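(* If $E$ is a connected $f_{ms}$-BC and $\widetilde{E}$ is its universal cover, then $\Lambda_{\widetilde{E}}$ is simply connected. Especially, $\Lambda_E$ is standard.
   Context: $k$ is a fixed field; paths in quivers are written from right to left, with source $s$ and terminal $t$. Let $G=\langle g\rangle$ be a fixed infinite cyclic group. A fractional Brauer configuration (f-BC) is a quadruple $E=(E,P,L,d)$, where $E$ is a $G$-set, $P$ and $L$ are two partitions of $E$ (write $P(e)$, $L(e)$ for the classes containing $e\in E$), and $d:E\to\mathbb{Z}_{>0}$ is a function, such that: (f1) $L(e)\subseteq P(e)$ and $P(e)$ is a finite set for each $e\in E$; (f2) if $L(e_1)=L(e_2)$, then $P(g\cdot e_1)=P(g\cdot e_2)$; (f3) if $e_1,e_2$ belong to the same $G$-orbit, then $d(e_1)=d(e_2)$; (f4) $P(e_1)=P(e_2)$ if and only if $P(g^{d(e_1)}\cdot e_1)=P(g^{d(e_2)}\cdot e_2)$; (f5) $L(e_1)=L(e_2)$ if and only if $L(g^{d(e_1)}\cdot e_1)=L(g^{d(e_2)}\cdot e_2)$; (f6) the sequence $L(g^{d(e)-1}\cdot e)\cdots L(g\cdot e)L(e)$ is not a proper subsequence (block of consecutive terms) of $L(g^{d(h)-1}\cdot h)\cdots L(g\cdot h)L(h)$ for all $e,h\in E$. An f-BC is of type MS (an $f_{ms}$-BC) if $L(e)=\{e\}$ for all $e\in E$. Walks. A walk of $E$ is a sequence $w=(e_n|\delta_n|e_{n-1})\cdots(e_1|\delta_1|e_0)$ with $e_i\in E$, $\delta_i\in\{g,g^{-1},\tau\}$,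 such that $e_i=g\cdot e_{i-1}$ if $\delta_i=g$, $e_i=g^{-1}\cdot e_{i-1}$ if $\delta_i=g^{-1}$, $P(e_i)=P(e_{i-1})$ if $\delta_i=\tau$; abbreviated $(e_n|\delta_n\cdots\delta_1|e_0)$; $s(w)=e_0$, $t(w)=e_n$; $(e||e)$ is the trivial walk. Composition $uv$ is concatenation when $t(v)=s(u)$. $E$ is connected if any two elements can be connected by a walk. Homotopy $\sim$ is the smallest equivalence relation on walks with: (h1) $(e|g^{-1}g|e)\sim(e|gg^{-1}|e)\sim(e|\tau|e)\sim(e||e)$; (h2) $(e_2|\tau|e_1)(e_1|\tau|e_0)\sim(e_2|\tau|e_0)$; (h3) $(g^{d(h)}\cdot h|\tau|g^{d(e)}\cdot e)(g^{d(e)}\cdot e|g^{d(e)}|e)\sim(g^{d(h)}\cdot h|g^{d(h)}|h)(h|\tau|e)$ whenever $P(e)=P(h)$; (h4) $(g\cdot h|\tau|g\cdot e)(g\cdot e|g|e)\sim(g\cdot h|g|h)(h|\tau|e)$ whenever $L(e)=L(h)$; (h5) compatibility with composition on both sides. $\overline{w}$ is the homotopy class of $w$. The universal cover of $E$ at $e\in E$ is the f-BC $\widetilde{E}=(\widetilde{E},\widetilde{P},\widetilde{L},\widetilde{d})$ with $\widetilde{E}=\{\overline{w}\mid s(w)=e\}$, $g^n\cdot\overline{w}=\overline{(g^n\cdot t(w)|g^n|t(w))w}$, $\widetilde{P}(\overline{w})=\{\overline{(h|\tau|t(w))w}\mid h\in P(t(w))\}$, $\widetilde{L}(\overline{w})=\{\overline{(h|\tau|t(w))w}\mid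 h\in L(t(w))\}$, $\widetilde{d}(\overline{w})=d(t(w))$; for connected $E$ it is independent of $e$ up to isomorphism. The category $\Lambda_E=kQ_E/I_E$: $(Q_E)_0=\{P(e)\mid e\in E\}$, $(Q_E)_1=\{L(e)\mid e\in E\}$ with $s(L(e))=P(e)$, $t(L(e))=P(g\cdot e)$. $I_E$ is the ideal of the path category $kQ_E$ generated by: (fR1) $L(g^{d(e)-1-j}\cdot e)\cdots L(g\cdot e)L(e)-L(g^{d(h)-1-j}\cdot h)\cdots L(g\cdot h)L(h)$, where $j\ge 0$ (both expressions being paths), $P(e)=P(h)$ and $L(g^{d(e)-i}\cdot e)=L(g^{d(h)-i}\cdot h)$ for $1\le i\le j$; (fR2) paths $L(e_n)\cdots L(e_2)L(e_1)$ with $n>1$ and $\bigcap_{i=1}^n g^{n-i}\cdot L(e_i)=\emptyset$; (fR3) paths $L(g^{n-1}\cdot e)\cdots L(g\cdot e)L(e)$ with $n>d(e)$. $\Lambda_E$ is a locally bounded $k$-category. Fundamental group of a quiver with relations. Let $Q$ be a connected locally finite quiver and $I$ an ideal of $kQ$. A minimal relation of $I$ is $\rho=\sum_{i=1}^n\lambda_iu_i\in I(x,y)$ with $n\ge2$, $\lambda_i\in k^*$, $u_i$ pairwise distinct paths from $x$ to $y$, such that $\sum_{i\in K}\lambda_iu_i\notin I(x,y)$ for every non-empty proper subset $K\subset\{1,\ldots,n\}$; $m(I)$ is the set of these. A walk of $Q$ is a composable sequence of arrows and formal inverses; $\Pi(Q,x)$ is the group of closed walks at $x$ modulo the congruence generated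 by $\alpha^{-1}\alpha\sim1_{s(\alpha)}$, $\alpha\alpha^{-1}\sim1_{t(\alpha)}$. $\Pi(Q,I):=\Pi(Q,x)/N$, where $N$ is the normal subgroup generated by all classes $[\gamma^{-1}u^{-1}v\gamma]$ with $\gamma$ a walk from $x$ to $y$ and $u,v$ paths from $y$ to $z$ such that some $\rho=\sum_i\lambda_ip_i\in m(I)$ has $u=p_1$, $v=p_2$. Let $\Lambda$ be a connected locally bounded category with Gabriel quiver $Q$. $\Lambda$ is simply connected if $Q$ contains no oriented cycles and for every admissible ideal $I$ of $kQ$ with $\Lambda\cong kQ/I$ one has $\Pi(Q,I)=\{1\}$. $\Lambda$ is standard if there is a simply connected locally bounded category $\widetilde{\Lambda}$ and a Galois covering $\widetilde{\Lambda}\to\Lambda$. Here a $k$-linear functor $F:M\to N$ is a covering functor if for all objects $a,b$ of $N$ and $x,y$ of $M$ it induces isomorphisms $\bigoplus_{z:F(z)=a}M(z,y)\to N(a,F(y))$ and $\bigoplus_{z:F(z)=b}M(x,z)\to N(F(x),b)$; a covering functor of locally bounded categories is a Galois covering if it is surjective on objects and there is a group $H$ of $k$-linear automorphisms of $M$ acting freely on (the objects of) $M$ such that $F\circ h=F$ for all $h\in H$ and $H$ acts transitively on $F^{-1}(a)$ for each object $a$ of $N$. *)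

theory Defs
  imports
    "Jordan_Normal_Form.VS_Connect"
    "Graph_Theory.Arc_Walk"
    "HOL-Algebra.AbelCoset"
    "HOL-Algebra.Group_Action"
    "HOL-Algebra.Elementary_Groups"
    "HOL-Library.Poly_Mapping"
    "HOL-Library.Sublist"
    "HOL-Library.Disjoint_Sets"
begin

section \<open>Linear categories over a field\<close>

text \<open>
  The ground field is the type \<open>'k::field\<close>, seen as the ring record \<open>class_ring\<close>.
  Hom-spaces carry their own vector space structure and need not be disjoint; composition is
  therefore indexed by the objects: \<open>cmp C x y z v u\<close> is \<open>v u\<close> for \<open>u : x \<rightarrow> y\<close>, \<open>v : y \<rightarrow> z\<close>.
\<close>

record ('k, 'o, 'm) kcat =
  Ob :: "'o set"
  Hom :: "'o \<Rightarrow> 'o \<Rightarrow> ('k, 'm) module"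
  cmp :: "'o \<Rightarrow> 'o \<Rightarrow> 'o \<Rightarrow> 'm \<Rightarrow> 'm \<Rightarrow> 'm"
  idt :: "'o \<Rightarrow> 'm"

abbreviation mor :: "('k, 'o, 'm) kcat \<Rightarrow> 'o \<Rightarrow> 'o \<Rightarrow> 'm set" where
  "mor C x y \<equiv> carrier (Hom C x y)"

locale k_category =
  fixes C :: "('k::field, 'o, 'm) kcat"
  assumes hom_vectorspace:
      "\<lbrakk>x \<in> Ob C; y \<in> Ob C\<rbrakk> \<Longrightarrow> vectorspace class_ring (Hom C x y)"
    and cmp_linear_left:
      "\<lbrakk>x \<in> Ob C; y \<in> Ob C; z \<in> Ob C; u \<in> mor C x y\<rbrakk> \<Longrightarrow>
        (\<lambda>v. cmp C x y z v u) \<in> LinearCombinations.module_hom class_ring (Hom C y z) (Hom C x z)"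
    and cmp_linear_right:
      "\<lbrakk>x \<in> Ob C; y \<in> Ob C; z \<in> Ob C; v \<in> mor C y z\<rbrakk> \<Longrightarrow>
        (\<lambda>u. cmp C x y z v u) \<in> LinearCombinations.module_hom class_ring (Hom C x y) (Hom C x z)"
    and cmp_assoc:
      "\<lbrakk>x \<in> Ob C; y \<in> Ob C; z \<in> Ob C; t \<in> Ob C;
        u \<in> mor C x y; v \<in> mor C y z; w \<in> mor C z t\<rbrakk> \<Longrightarrow>
        cmp C x y t (cmp C y z t w v) u = cmp C x z t w (cmp C x y z v u)"
    and idt_closed: "x \<in> Ob C \<Longrightarrow> idt C x \<in> mor C x x"
    and cmp_idt_left:
      "\<lbrakk>x \<in> Ob C; y \<in> Ob C; u \<in> mor C x y\<rbrakk> \<Longrightarrow> cmp C x y y (idt C y) u = u"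
    and cmp_idt_right:
      "\<lbrakk>x \<in> Ob C; y \<in> Ob C; u \<in> mor C x y\<rbrakk> \<Longrightarrow> cmp C x x y u (idt C x) = u"

definition iso_mor :: "('k::field, 'o, 'm) kcat \<Rightarrow> 'o \<Rightarrow> 'o \<Rightarrow> 'm \<Rightarrow> bool" where
  "iso_mor C x y u \<longleftrightarrow> u \<in> mor C x y \<and>
    (\<exists>v \<in> mor C y x. cmp C x y x v u = idt C x \<and> cmp C y x y u v = idt C y)"

definition local_end :: "('k::field, 'o, 'm) kcat \<Rightarrow> 'o \<Rightarrow> bool" where
  "local_end C x \<longleftrightarrow> idt C x \<noteq> \<zero>\<^bsub>Hom C x x\<^esub> \<and>
    (\<forall>u \<in> mor C x x. \<forall>v \<in> mor C x x.
      \<not> iso_mor C x x u \<longrightarrow> \<not> iso_mor C x x v \<longrightarrow> \<not> iso_mor C x x (u \<oplus>\<^bsub>Hom C x x\<^esub> v))"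

text \<open>
  Locally bounded in the sense of Bongartz and Gabriel; the last three conjuncts say that
  \<open>\<Sum>\<^sub>y dim C(x,y)\<close> and \<open>\<Sum>\<^sub>y dim C(y,x)\<close> are finite for every \<open>x\<close>.
\<close>

definition locally_bounded :: "('k::field, 'o, 'm) kcat \<Rightarrow> bool" where
  "locally_bounded C \<longleftrightarrow> k_category C \<and>
    (\<forall>x \<in> Ob C. local_end C x) \<and>
    (\<forall>x \<in> Ob C. \<forall>y \<in> Ob C. x \<noteq> y \<longrightarrow> \<not> (\<exists>u. iso_mor C x y u)) \<and>
    (\<forall>x \<in> Ob C. \<forall>y \<in> Ob C. vectorspace.fin_dim class_ring (Hom C x y)) \<and>
    (\<forall>x \<in> Ob C. finite {y \<in> Ob C. mor C x y \<noteq> {\<zero>\<^bsub>Hom C x y\<^esub>}}) \<and>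
    (\<forall>x \<in> Ob C. finite {y \<in> Ob C. mor C y x \<noteq> {\<zero>\<^bsub>Hom C y x\<^esub>}})"

definition connected_kcat :: "('k::field, 'o, 'm) kcat \<Rightarrow> bool" where
  "connected_kcat C \<longleftrightarrow> Ob C \<noteq> {} \<and>
    (\<forall>x \<in> Ob C. \<forall>y \<in> Ob C. (x, y) \<in>
      {(a, b). a \<in> Ob C \<and> b \<in> Ob C \<and>
        (mor C a b \<noteq> {\<zero>\<^bsub>Hom C a b\<^esub>} \<or> mor C b a \<noteq> {\<zero>\<^bsub>Hom C b a\<^esub>})}\<^sup>*)"

subsection \<open>Functors, automorphisms and Galois coverings\<close>

record ('o, 'm, 'p, 'n) kfunc =
  fob :: "'o \<Rightarrow> 'p"
  fmor :: "'o \<Rightarrow> 'o \<Rightarrow> 'm \<Rightarrow> 'n"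

definition k_functor ::
  "('k::field, 'o, 'm) kcat \<Rightarrow> ('k, 'p, 'n) kcat \<Rightarrow> ('o, 'm, 'p, 'n) kfunc \<Rightarrow> bool" where
  "k_functor C D F \<longleftrightarrow>
    (\<forall>x \<in> Ob C. fob F x \<in> Ob D) \<and>
    (\<forall>x \<in> Ob C. \<forall>y \<in> Ob C.
      fmor F x y \<in> LinearCombinations.module_hom class_ring (Hom C x y) (Hom D (fob F x) (fob F y))) \<and>
    (\<forall>x \<in> Ob C. \<forall>y \<in> Ob C. \<forall>z \<in> Ob C. \<forall>u \<in> mor C x y. \<forall>v \<in> mor C y z.
      fmor F x z (cmp C x y z v u) =
        cmp D (fob F x) (fob F y) (fob F z) (fmor F y z v) (fmor F x y u)) \<and>
    (\<forall>x \<in> Ob C. fmor F x x (idt C x) = idt D (fob F x))"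

definition k_isomorphism ::
  "('k::field, 'o, 'm) kcat \<Rightarrow> ('k, 'p, 'n) kcat \<Rightarrow> ('o, 'm, 'p, 'n) kfunc \<Rightarrow> bool" where
  "k_isomorphism C D F \<longleftrightarrow> k_functor C D F \<and> bij_betw (fob F) (Ob C) (Ob D) \<and>
    (\<forall>x \<in> Ob C. \<forall>y \<in> Ob C. bij_betw (fmor F x y) (mor C x y) (mor D (fob F x) (fob F y)))"

definition k_isomorphic :: "('k::field, 'o, 'm) kcat \<Rightarrow> ('k, 'p, 'n) kcat \<Rightarrow> bool" where
  "k_isomorphic C D \<longleftrightarrow> (\<exists>F. k_isomorphism C D F)"

text \<open>
  As in \<open>BijGroup\<close>, automorphisms are normalised to be undefined outside their domain, so that
  equality of functors is equality of records.
\<close>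

definition restrict_func ::
  "('k::field, 'o, 'm) kcat \<Rightarrow> ('o, 'm, 'p, 'n) kfunc \<Rightarrow> ('o, 'm, 'p, 'n) kfunc" where
  "restrict_func C F =
    \<lparr>fob = restrict (fob F) (Ob C),
     fmor = (\<lambda>x y. if x \<in> Ob C \<and> y \<in> Ob C then restrict (fmor F x y) (mor C x y) else undefined)\<rparr>"

definition Aut_kcat :: "('k::field, 'o, 'm) kcat \<Rightarrow> ('o, 'm, 'o, 'm) kfunc monoid" where
  "Aut_kcat C =
    \<lparr>carrier = {F. k_isomorphism C C F \<and> restrict_func C F = F},
     mult = (\<lambda>G F. restrict_func C
       \<lparr>fob = fob G \<circ> fob F, fmor = (\<lambda>x y. fmor G (fob F x) (fob F y) \<circ> fmor F x y)\<rparr>),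
     one = restrict_func C \<lparr>fob = (\<lambda>x. x), fmor = (\<lambda>x y u. u)\<rparr>\<rparr>"

definition direct_sum_families :: "'i set \<Rightarrow> ('i \<Rightarrow> ('k, 'm) module) \<Rightarrow> ('i \<Rightarrow> 'm) set" where
  "direct_sum_families J V =
    {\<phi> \<in> (\<Pi>\<^sub>E i\<in>J. carrier (V i)). finite {i \<in> J. \<phi> i \<noteq> \<zero>\<^bsub>V i\<^esub>}}"

abbreviation fibre ::
  "('k, 'o, 'm) kcat \<Rightarrow> ('o, 'm, 'p, 'n) kfunc \<Rightarrow> 'p \<Rightarrow> 'o set" where
  "fibre M F a \<equiv> {z \<in> Ob M. fob F z = a}"

definition covering_functor ::
  "('k::field, 'o, 'm) kcat \<Rightarrow> ('k, 'p, 'n) kcat \<Rightarrow> ('o, 'm, 'p, 'n) kfunc \<Rightarrow> bool" where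
  "covering_functor M N F \<longleftrightarrow> k_functor M N F \<and>
    (\<forall>a \<in> Ob N. \<forall>y \<in> Ob M. bij_betw
      (\<lambda>\<phi>. \<Oplus>\<^bsub>Hom N a (fob F y)\<^esub> z \<in> {z \<in> fibre M F a. \<phi> z \<noteq> \<zero>\<^bsub>Hom M z y\<^esub>}. fmor F z y (\<phi> z))
      (direct_sum_families (fibre M F a) (\<lambda>z. Hom M z y))
      (mor N a (fob F y))) \<and>
    (\<forall>b \<in> Ob N. \<forall>x \<in> Ob M. bij_betw
      (\<lambda>\<phi>. \<Oplus>\<^bsub>Hom N (fob F x) b\<^esub> z \<in> {z \<in> fibre M F b. \<phi> z \<noteq> \<zero>\<^bsub>Hom M x z\<^esub>}. fmor F x z (\<phi> z))
      (direct_sum_families (fibre M F b) (\<lambda>z. Hom M x z))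
      (mor N (fob F x) b))"

definition galois_covering ::
  "('k::field, 'o, 'm) kcat \<Rightarrow> ('k, 'p, 'n) kcat \<Rightarrow> ('o, 'm, 'p, 'n) kfunc \<Rightarrow> bool" where
  "galois_covering M N F \<longleftrightarrow>
    locally_bounded M \<and> locally_bounded N \<and> covering_functor M N F \<and> fob F ` Ob M = Ob N \<and>
    (\<exists>H. subgroup H (Aut_kcat M) \<and>
      (\<forall>h \<in> H. \<forall>x \<in> Ob M. fob h x = x \<longrightarrow> h = \<one>\<^bsub>Aut_kcat M\<^esub>) \<and>
      (\<forall>h \<in> H. \<forall>x \<in> Ob M. fob F (fob h x) = fob F x) \<and>
      (\<forall>h \<in> H. \<forall>x \<in> Ob M. \<forall>y \<in> Ob M. \<forall>u \<in> mor M x y.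
        fmor F (fob h x) (fob h y) (fmor h x y u) = fmor F x y u) \<and>
      (\<forall>a \<in> Ob N. \<forall>x \<in> fibre M F a. \<forall>y \<in> fibre M F a. \<exists>h \<in> H. fob h x = y))"

subsection \<open>Ideals and quotients\<close>

definition quot_module :: "('k, 'm) module \<Rightarrow> 'm set \<Rightarrow> ('k, 'm set) module" where
  "quot_module V W =
    \<lparr>carrier = a_rcosets\<^bsub>V\<^esub> W, mult = (\<lambda>X Y. W), one = W,
     zero = W, add = (\<lambda>X Y. X <+>\<^bsub>V\<^esub> Y), smult = (\<lambda>c X. \<Union>v\<in>X. W +>\<^bsub>V\<^esub> (c \<odot>\<^bsub>V\<^esub> v))\<rparr>"

definition k_ideal :: "('k::field, 'o, 'm) kcat \<Rightarrow> ('o \<Rightarrow> 'o \<Rightarrow> 'm set) \<Rightarrow> bool" where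
  "k_ideal C I \<longleftrightarrow>
    (\<forall>x \<in> Ob C. \<forall>y \<in> Ob C. VectorSpace.subspace class_ring (I x y) (Hom C x y)) \<and>
    (\<forall>x \<in> Ob C. \<forall>y \<in> Ob C. \<forall>z \<in> Ob C. \<forall>u \<in> mor C x y. \<forall>v \<in> mor C y z.
      u \<in> I x y \<or> v \<in> I y z \<longrightarrow> cmp C x y z v u \<in> I x z)"

definition ideal_generated ::
  "('k::field, 'o, 'm) kcat \<Rightarrow> ('o \<Rightarrow> 'o \<Rightarrow> 'm set) \<Rightarrow> 'o \<Rightarrow> 'o \<Rightarrow> 'm set" where
  "ideal_generated C R x y =
    \<Inter>{I x y | I. k_ideal C I \<and> (\<forall>a \<in> Ob C. \<forall>b \<in> Ob C. R a b \<subseteq> I a b)}"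

definition quot_kcat ::
  "('k::field, 'o, 'm) kcat \<Rightarrow> ('o \<Rightarrow> 'o \<Rightarrow> 'm set) \<Rightarrow> ('k, 'o, 'm set) kcat" where
  "quot_kcat C I =
    \<lparr>Ob = Ob C,
     Hom = (\<lambda>x y. quot_module (Hom C x y) (I x y)),
     cmp = (\<lambda>x y z Y X. \<Union>v\<in>Y. \<Union>u\<in>X. I x z +>\<^bsub>Hom C x z\<^esub> cmp C x y z v u),
     idt = (\<lambda>x. I x x +>\<^bsub>Hom C x x\<^esub> idt C x)\<rparr>"

subsection \<open>Radical and Gabriel quiver\<close>

definition rad :: "('k::field, 'o, 'm) kcat \<Rightarrow> 'o \<Rightarrow> 'o \<Rightarrow> 'm set" where
  "rad C x y = {u \<in> mor C x y. \<forall>v \<in> mor C y x.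
    iso_mor C x x (idt C x \<ominus>\<^bsub>Hom C x x\<^esub> cmp C x y x v u)}"

definition rad_square :: "('k::field, 'o, 'm) kcat \<Rightarrow> 'o \<Rightarrow> 'o \<Rightarrow> 'm set" where
  "rad_square C x y = LinearCombinations.module.span class_ring (Hom C x y)
    {cmp C x z y v u | z u v. z \<in> Ob C \<and> u \<in> rad C x z \<and> v \<in> rad C z y}"

text \<open>A quiver is a \<open>pre_digraph\<close>; \<open>(x, y, i)\<close> is the \<open>i\<close>-th arrow from \<open>x\<close> to \<open>y\<close>.\<close>

definition gabriel_quiver :: "('k::field, 'o, 'm) kcat \<Rightarrow> ('o, 'o \<times> 'o \<times> nat) pre_digraph" where
  "gabriel_quiver C =
    \<lparr>verts = Ob C,
     arcs = {(x, y, i). x \<in> Ob C \<and> y \<in> Ob C \<and>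
       i < vectorspace.dim class_ring
             (quot_module ((Hom C x y)\<lparr>carrier := rad C x y\<rparr>) (rad_square C x y))},
     tail = (\<lambda>(x, y, i). x),
     head = (\<lambda>(x, y, i). y)\<rparr>"

section \<open>Path categories of quivers\<close>

text \<open>
  A path from \<open>x\<close> to \<open>y\<close> is a list \<open>p\<close> with \<open>awalk x p y\<close>. All lists of arrows, signed arrows and
  walk steps below are in the order of traversal: the path written \<open>a\<^sub>n \<cdots> a\<^sub>1\<close> from right to left
  is \<open>[a\<^sub>1, \<dots>, a\<^sub>n]\<close>. The empty list is the trivial path at every vertex; the vertex
  is recovered from the indices of the hom-space.
\<close>

abbreviation qpath :: "('v, 'a) pre_digraph \<Rightarrow> 'v \<Rightarrow> 'a list \<Rightarrow> 'v \<Rightarrow> bool" where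
  "qpath \<equiv> pre_digraph.awalk"

definition path_category :: "('v, 'a) pre_digraph \<Rightarrow> ('k::field, 'v, 'a list \<Rightarrow>\<^sub>0 'k) kcat" where
  "path_category Q =
    \<lparr>Ob = verts Q,
     Hom = (\<lambda>x y. \<lparr>carrier = {f. \<forall>p \<in> Poly_Mapping.keys f. qpath Q x p y},
       mult = (\<lambda>f h. 0), one = 0, zero = 0, add = (+),
       smult = (\<lambda>c. Poly_Mapping.map (\<lambda>a. c * a))\<rparr>),
     cmp = (\<lambda>x y z v u. \<Sum>p \<in> Poly_Mapping.keys u. \<Sum>q \<in> Poly_Mapping.keys v.
       Poly_Mapping.single (p @ q) (Poly_Mapping.lookup v q * Poly_Mapping.lookup u p)),
     idt = (\<lambda>x. Poly_Mapping.single [] 1)\<rparr>"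

text \<open>Meant for locally finite quivers, such as Gabriel quivers of locally bounded categories.\<close>

definition admissible_ideal ::
  "('v, 'a) pre_digraph \<Rightarrow> ('v \<Rightarrow> 'v \<Rightarrow> ('a list \<Rightarrow>\<^sub>0 'k::field) set) \<Rightarrow> bool" where
  "admissible_ideal Q I \<longleftrightarrow> k_ideal (path_category Q) I \<and>
    (\<forall>x \<in> verts Q. \<forall>y \<in> verts Q. \<forall>f \<in> I x y. \<forall>p \<in> Poly_Mapping.keys f. 2 \<le> length p) \<and>
    (\<forall>x \<in> verts Q. \<exists>n. \<forall>y \<in> verts Q. \<forall>p. n \<le> length p \<longrightarrow>
      (qpath Q x p y \<longrightarrow> Poly_Mapping.single p 1 \<in> I x y) \<and>
      (qpath Q y p x \<longrightarrow> Poly_Mapping.single p 1 \<in> I y x))"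

section \<open>Fundamental group of a quiver with relations\<close>

text \<open>
  A combination \<open>\<Sum>\<^sub>i \<lambda>\<^sub>i u\<^sub>i\<close> with nonzero coefficients and pairwise distinct paths is an element
  \<open>\<rho>\<close> of the path category; the \<open>u\<^sub>i\<close> are its \<open>keys\<close>.
\<close>

definition minimal_relation ::
  "('v \<Rightarrow> 'v \<Rightarrow> ('a list \<Rightarrow>\<^sub>0 'k::field) set) \<Rightarrow> 'v \<Rightarrow> 'v \<Rightarrow> ('a list \<Rightarrow>\<^sub>0 'k) \<Rightarrow> bool" where
  "minimal_relation I x y \<rho> \<longleftrightarrow> \<rho> \<in> I x y \<and> 2 \<le> card (Poly_Mapping.keys \<rho>) \<and>
    (\<forall>K. K \<noteq> {} \<and> K \<subset> Poly_Mapping.keys \<rho> \<longrightarrow>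
      (\<Sum>u\<in>K. Poly_Mapping.single u (Poly_Mapping.lookup \<rho> u)) \<notin> I x y)"

datatype 'a signed = Pos 'a | Neg 'a

primrec flip_sign :: "'a signed \<Rightarrow> 'a signed" where
  "flip_sign (Pos a) = Neg a"
| "flip_sign (Neg a) = Pos a"

text \<open>Walks in \<open>Q\<close> are the paths of its double quiver.\<close>

definition double_quiver :: "('v, 'a) pre_digraph \<Rightarrow> ('v, 'a signed) pre_digraph" where
  "double_quiver Q =
    \<lparr>verts = verts Q, arcs = Pos ` arcs Q \<union> Neg ` arcs Q,
     tail = case_signed (tail Q) (head Q), head = case_signed (head Q) (tail Q)\<rparr>"

abbreviation qwalk :: "('v, 'a) pre_digraph \<Rightarrow> 'v \<Rightarrow> 'a signed list \<Rightarrow> 'v \<Rightarrow> bool" where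
  "qwalk Q \<equiv> pre_digraph.awalk (double_quiver Q)"

definition inv_walk :: "'a signed list \<Rightarrow> 'a signed list" where
  "inv_walk w = rev (map flip_sign w)"

inductive walk_cong ::
  "('v, 'a) pre_digraph \<Rightarrow> 'v \<Rightarrow> 'v \<Rightarrow> 'a signed list \<Rightarrow> 'a signed list \<Rightarrow> bool" for Q where
  wc_refl: "qwalk Q x w y \<Longrightarrow> walk_cong Q x y w w"
| wc_sym: "walk_cong Q x y v w \<Longrightarrow> walk_cong Q x y w v"
| wc_trans: "walk_cong Q x y u v \<Longrightarrow> walk_cong Q x y v w \<Longrightarrow> walk_cong Q x y u w"
| wc_inv_left: "a \<in> arcs Q \<Longrightarrow> walk_cong Q (tail Q a) (tail Q a) [Pos a, Neg a] []"
| wc_inv_right: "a \<in> arcs Q \<Longrightarrow> walk_cong Q (head Q a) (head Q a) [Neg a, Pos a] []"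
| wc_comp: "walk_cong Q x y v v' \<Longrightarrow> walk_cong Q y z w w' \<Longrightarrow> walk_cong Q x z (v @ w) (v' @ w')"

definition walk_class :: "('v, 'a) pre_digraph \<Rightarrow> 'v \<Rightarrow> 'a signed list \<Rightarrow> 'a signed list set" where
  "walk_class Q x w = {w'. walk_cong Q x x w w'}"

definition quiver_pi1 :: "('v, 'a) pre_digraph \<Rightarrow> 'v \<Rightarrow> 'a signed list set monoid" where
  "quiver_pi1 Q x =
    \<lparr>carrier = walk_class Q x ` {w. qwalk Q x w x},
     mult = (\<lambda>W V. \<Union>w\<in>W. \<Union>v\<in>V. walk_class Q x (v @ w)),
     one = walk_class Q x []\<rparr>"

definition pi1_relators ::
  "('v, 'a) pre_digraph \<Rightarrow> ('v \<Rightarrow> 'v \<Rightarrow> ('a list \<Rightarrow>\<^sub>0 'k::field) set) \<Rightarrow> 'v \<Rightarrow> 'a signed list set set" where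
  "pi1_relators Q I x =
    {walk_class Q x (\<gamma> @ map Pos v @ inv_walk (map Pos u) @ inv_walk \<gamma>) | \<gamma> u v.
      \<exists>y z \<rho>. qwalk Q x \<gamma> y \<and> y \<in> verts Q \<and> z \<in> verts Q \<and> minimal_relation I y z \<rho> \<and>
        u \<in> Poly_Mapping.keys \<rho> \<and> v \<in> Poly_Mapping.keys \<rho> \<and> u \<noteq> v}"

definition pi1 ::
  "('v, 'a) pre_digraph \<Rightarrow> ('v \<Rightarrow> 'v \<Rightarrow> ('a list \<Rightarrow>\<^sub>0 'k::field) set) \<Rightarrow> 'v \<Rightarrow>
    'a signed list set set monoid" where
  "pi1 Q I x = quiver_pi1 Q x Mod ((\<lambda>N. normal N (quiver_pi1 Q x)) hull pi1_relators Q I x)"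

section \<open>Simply connected and standard categories\<close>

definition simply_connected :: "('k::field, 'o, 'm) kcat \<Rightarrow> bool" where
  "simply_connected C \<longleftrightarrow> locally_bounded C \<and> connected_kcat C \<and>
    \<not> (\<exists>x p. p \<noteq> [] \<and> qpath (gabriel_quiver C) x p x) \<and>
    (\<forall>I :: 'o \<Rightarrow> 'o \<Rightarrow> (('o \<times> 'o \<times> nat) list \<Rightarrow>\<^sub>0 'k) set.
      admissible_ideal (gabriel_quiver C) I \<and>
      k_isomorphic C (quot_kcat (path_category (gabriel_quiver C)) I) \<longrightarrow>
      (\<forall>x \<in> Ob C. trivial_group (pi1 (gabriel_quiver C) I x)))"

text \<open>
  HOL cannot quantify over types inside a formula, so the types of objects and morphisms of the
  covering category are parameters.
\<close>

definition standard :: "'p itself \<Rightarrow> 'n itself \<Rightarrow> ('k::field, 'o, 'm) kcat \<Rightarrow> bool" where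
  "standard TP TN C \<longleftrightarrow> locally_bounded C \<and> connected_kcat C \<and>
    (\<exists>(D :: ('k, 'p, 'n) kcat) F. simply_connected D \<and> galois_covering D C F)"

section \<open>Fractional Brauer configurations\<close>

text \<open>
  \<open>G = \<langle>g\<rangle>\<close> is \<open>integer_group\<close> with \<open>g\<close> the integer \<open>1\<close>: \<open>act E n e\<close> is \<open>g\<^sup>n \<cdot> e\<close>.
\<close>

record 'e fbc =
  elts :: "'e set"
  act :: "int \<Rightarrow> 'e \<Rightarrow> 'e"
  Ppart :: "'e set set"
  Lpart :: "'e set set"
  deg :: "'e \<Rightarrow> nat"

definition class_in :: "'e set set \<Rightarrow> 'e \<Rightarrow> 'e set" where
  "class_in \<P> e = (THE X. X \<in> \<P> \<and> e \<in> X)"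

abbreviation Pcl :: "'e fbc \<Rightarrow> 'e \<Rightarrow> 'e set" where
  "Pcl E \<equiv> class_in (Ppart E)"

abbreviation Lcl :: "'e fbc \<Rightarrow> 'e \<Rightarrow> 'e set" where
  "Lcl E \<equiv> class_in (Lpart E)"

definition Lseq :: "'e fbc \<Rightarrow> 'e \<Rightarrow> nat \<Rightarrow> 'e set list" where
  "Lseq E e n = map (\<lambda>i. Lcl E (act E (int i) e)) [0..<n]"

locale f_BC =
  fixes E :: "'e fbc"
  assumes G_set: "group_action integer_group (elts E) (act E)"
    and P_partition: "partition_on (elts E) (Ppart E)"
    and L_partition: "partition_on (elts E) (Lpart E)"
    and deg_pos: "e \<in> elts E \<Longrightarrow> 0 < deg E e"
    and f1: "e \<in> elts E \<Longrightarrow> Lcl E e \<subseteq> Pcl E e \<and> finite (Pcl E e)"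
    and f2: "\<lbrakk>e1 \<in> elts E; e2 \<in> elts E; Lcl E e1 = Lcl E e2\<rbrakk> \<Longrightarrow>
      Pcl E (act E 1 e1) = Pcl E (act E 1 e2)"
    and f3: "\<lbrakk>e1 \<in> elts E; e2 \<in> orbit integer_group (act E) e1\<rbrakk> \<Longrightarrow> deg E e1 = deg E e2"
    and f4: "\<lbrakk>e1 \<in> elts E; e2 \<in> elts E\<rbrakk> \<Longrightarrow> Pcl E e1 = Pcl E e2 \<longleftrightarrow>
      Pcl E (act E (int (deg E e1)) e1) = Pcl E (act E (int (deg E e2)) e2)"
    and f5: "\<lbrakk>e1 \<in> elts E; e2 \<in> elts E\<rbrakk> \<Longrightarrow> Lcl E e1 = Lcl E e2 \<longleftrightarrow>
      Lcl E (act E (int (deg E e1)) e1) = Lcl E (act E (int (deg E e2)) e2)"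
    and f6: "\<lbrakk>e \<in> elts E; h \<in> elts E\<rbrakk> \<Longrightarrow>
      \<not> strict_sublist (Lseq E e (deg E e)) (Lseq E h (deg E h))"

locale fms_BC = f_BC +
  assumes type_MS: "e \<in> elts E \<Longrightarrow> Lcl E e = {e}"

subsection \<open>Walks and homotopy\<close>

datatype dir = Gpos | Gneg | Tau

text \<open>
  The walk \<open>(e\<^sub>n|\<delta>\<^sub>n|e\<^sub>n\<^sub>-\<^sub>1)\<cdots>(e\<^sub>1|\<delta>\<^sub>1|e\<^sub>0)\<close> is given by its source \<open>e\<^sub>0\<close>
  and the list of steps \<open>[(\<delta>\<^sub>1, e\<^sub>1), \<dots>, (\<delta>\<^sub>n, e\<^sub>n)]\<close>.
\<close>

type_synonym 'e steps = "(dir \<times> 'e) list"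

definition is_step :: "'e fbc \<Rightarrow> 'e \<Rightarrow> dir \<Rightarrow> 'e \<Rightarrow> bool" where
  "is_step E e \<delta> h \<longleftrightarrow> e \<in> elts E \<and> h \<in> elts E \<and>
    (case \<delta> of Gpos \<Rightarrow> h = act E 1 e | Gneg \<Rightarrow> h = act E (- 1) e | Tau \<Rightarrow> Pcl E h = Pcl E e)"

primrec walk_target :: "'e \<Rightarrow> 'e steps \<Rightarrow> 'e" where
  "walk_target e [] = e"
| "walk_target e (s # w) = walk_target (snd s) w"

primrec is_walk :: "'e fbc \<Rightarrow> 'e \<Rightarrow> 'e steps \<Rightarrow> bool" where
  "is_walk E e [] \<longleftrightarrow> e \<in> elts E"
| "is_walk E e (s # w) \<longleftrightarrow> is_step E e (fst s) (snd s) \<and> is_walk E (snd s) w"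

definition connected_fbc :: "'e fbc \<Rightarrow> bool" where
  "connected_fbc E \<longleftrightarrow>
    (\<forall>e \<in> elts E. \<forall>h \<in> elts E. \<exists>w. is_walk E e w \<and> walk_target e w = h)"

text \<open>The walk \<open>(g\<^sup>n \<cdot> e|g\<^sup>n|e)\<close>.\<close>

definition gwalk :: "'e fbc \<Rightarrow> int \<Rightarrow> 'e \<Rightarrow> 'e steps" where
  "gwalk E n e =
    (if 0 \<le> n then map (\<lambda>i. (Gpos, act E (int (Suc i)) e)) [0..<nat n]
     else map (\<lambda>i. (Gneg, act E (- int (Suc i)) e)) [0..<nat (- n)])"

text \<open>\<open>homotopic E e h v w\<close>: \<open>v\<close> and \<open>w\<close> are homotopic walks from \<open>e\<close> to \<open>h\<close>.\<close>

inductive homotopic :: "'e fbc \<Rightarrow> 'e \<Rightarrow> 'e \<Rightarrow> 'e steps \<Rightarrow> 'e steps \<Rightarrow> bool" for E where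
  h_refl: "is_walk E e w \<Longrightarrow> walk_target e w = h \<Longrightarrow> homotopic E e h w w"
| h_sym: "homotopic E e h v w \<Longrightarrow> homotopic E e h w v"
| h_trans: "homotopic E e h u v \<Longrightarrow> homotopic E e h v w \<Longrightarrow> homotopic E e h u w"
| h1_neg_pos: "e \<in> elts E \<Longrightarrow> homotopic E e e [(Gpos, act E 1 e), (Gneg, e)] []"
| h1_pos_neg: "e \<in> elts E \<Longrightarrow> homotopic E e e [(Gneg, act E (- 1) e), (Gpos, e)] []"
| h1_tau: "e \<in> elts E \<Longrightarrow> homotopic E e e [(Tau, e)] []"
| h2: "\<lbrakk>e0 \<in> elts E; e1 \<in> elts E; e2 \<in> elts E; Pcl E e1 = Pcl E e0; Pcl E e2 = Pcl E e1\<rbrakk> \<Longrightarrow>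
    homotopic E e0 e2 [(Tau, e1), (Tau, e2)] [(Tau, e2)]"
| h3: "\<lbrakk>e \<in> elts E; h \<in> elts E; Pcl E e = Pcl E h\<rbrakk> \<Longrightarrow>
    homotopic E e (act E (int (deg E h)) h)
      (gwalk E (int (deg E e)) e @ [(Tau, act E (int (deg E h)) h)])
      ([(Tau, h)] @ gwalk E (int (deg E h)) h)"
| h4: "\<lbrakk>e \<in> elts E; h \<in> elts E; Lcl E e = Lcl E h\<rbrakk> \<Longrightarrow>
    homotopic E e (act E 1 h)
      [(Gpos, act E 1 e), (Tau, act E 1 h)] [(Tau, h), (Gpos, act E 1 h)]"
| h5: "homotopic E e0 e1 v v' \<Longrightarrow> homotopic E e1 e2 w w' \<Longrightarrow>
    homotopic E e0 e2 (v @ w) (v' @ w')"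

definition homotopy_class :: "'e fbc \<Rightarrow> 'e \<Rightarrow> 'e steps \<Rightarrow> 'e steps set" where
  "homotopy_class E e w = {w'. homotopic E e (walk_target e w) w w'}"

subsection \<open>The universal cover\<close>

text \<open>
  Each component is the value at any representative \<open>w\<close> of the class \<open>X\<close>, written as a union over
  (or as the unique value on) all representatives.
\<close>

definition cover_elts :: "'e fbc \<Rightarrow> 'e \<Rightarrow> 'e steps set set" where
  "cover_elts E e = homotopy_class E e ` {w. is_walk E e w}"

definition universal_cover :: "'e fbc \<Rightarrow> 'e \<Rightarrow> 'e steps set fbc" where
  "universal_cover E e =
    \<lparr>elts = cover_elts E e,
     act = (\<lambda>n. \<lambda>X \<in> cover_elts E e. \<Union>w\<in>X. homotopy_class E e (w @ gwalk E n (walk_target e w))),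
     Ppart = (\<lambda>X. {homotopy_class E e (w @ [(Tau, h)]) | w h. w \<in> X \<and> h \<in> Pcl E (walk_target e w)})
       ` cover_elts E e,
     Lpart = (\<lambda>X. {homotopy_class E e (w @ [(Tau, h)]) | w h. w \<in> X \<and> h \<in> Lcl E (walk_target e w)})
       ` cover_elts E e,
     deg = (\<lambda>X. the_elem ((\<lambda>w. deg E (walk_target e w)) ` X))\<rparr>"

subsection \<open>The category of a fractional Brauer configuration\<close>

text \<open>By (f1) and (f2) the images below are singletons.\<close>

definition fbc_quiver :: "'e fbc \<Rightarrow> ('e set, 'e set) pre_digraph" where
  "fbc_quiver E =
    \<lparr>verts = Ppart E, arcs = Lpart E,
     tail = (\<lambda>A. the_elem (Pcl E ` A)),
     head = (\<lambda>A. the_elem ((\<lambda>e. Pcl E (act E 1 e)) ` A))\<rparr>"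

definition fR1 :: "'e fbc \<Rightarrow> ('e set list \<Rightarrow>\<^sub>0 'k::field) set" where
  "fR1 E = {Poly_Mapping.single (Lseq E e (deg E e - j)) 1 - Poly_Mapping.single (Lseq E h (deg E h - j)) 1 | e h j.
    e \<in> elts E \<and> h \<in> elts E \<and> j < deg E e \<and> j < deg E h \<and> Pcl E e = Pcl E h \<and>
    (\<forall>i \<in> {1..j}. Lcl E (act E (int (deg E e) - int i) e) = Lcl E (act E (int (deg E h) - int i) h))}"

definition fR2 :: "'e fbc \<Rightarrow> ('e set list \<Rightarrow>\<^sub>0 'k::field) set" where
  "fR2 E = {Poly_Mapping.single p 1 | p. (\<exists>x y. qpath (fbc_quiver E) x p y) \<and> 1 < length p \<and>
    (\<Inter>i \<in> {1..length p}. act E (int (length p) - int i) ` (p ! (i - 1))) = {}}"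

definition fR3 :: "'e fbc \<Rightarrow> ('e set list \<Rightarrow>\<^sub>0 'k::field) set" where
  "fR3 E = {Poly_Mapping.single (Lseq E e n) 1 | e n. e \<in> elts E \<and> deg E e < n}"

definition fbc_ideal :: "'e fbc \<Rightarrow> 'e set \<Rightarrow> 'e set \<Rightarrow> ('e set list \<Rightarrow>\<^sub>0 'k::field) set" where
  "fbc_ideal E = ideal_generated (path_category (fbc_quiver E))
    (\<lambda>x y. (fR1 E \<union> fR2 E \<union> fR3 E) \<inter> mor (path_category (fbc_quiver E)) x y)"

text \<open>Objects of \<open>\<Lambda>\<^sub>E\<close> are classes \<open>P(e)\<close>, morphisms are cosets of combinations of paths.\<close>

type_synonym 'e lam_ob = "'e set"
type_synonym ('k, 'e) lam_mor = "('e set list \<Rightarrow>\<^sub>0 'k) set"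

definition Lambda :: "'e fbc \<Rightarrow> ('k::field, 'e lam_ob, ('k, 'e) lam_mor) kcat" where
  "Lambda E = quot_kcat (path_category (fbc_quiver E)) (fbc_ideal E)"

end

(*
  In type MS the category Lambda_E has a basis consisting of the identities, the paths
  g^n e <- e with 0 < n < d(e), and one full path for every polygon at which such paths start;
  the relations identify parallel full paths and kill everything else.  The target map from the
  universal cover U to E is a covering of configurations, hence induces a covering functor, and
  it is Galois because the deck transformations act freely and transitively on its fibres.

  Two invariants of the homotopy class of a walk show that all morphism spaces of Lambda_U have
  dimension at most one.  The first is the total degree, the sum of 1/d(e) over the g-steps at e
  counted with sign; it separates paths of different relative length, and as it increases along
  nonzero paths the Gabriel quiver has no oriented cycle.  The second is a representation of the
  homotopy groupoid by affine maps of the complex plane, which separates the short paths of the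
  same degree.

  Finally let Lambda_U = kQ/I.  Every arrow of Q is nonzero modulo I, so it is parallel to a
  nonzero composition of g-steps and by one-dimensionality connected with it through a minimal
  relation.  Hence every closed walk of Q is congruent modulo minimal relations to the lift of a
  walk of E.  Homotopic walks have congruent lifts: for (h3) both sides lift to nonzero parallel
  paths.  A closed lift comes from a walk that is homotopic to a tau-step, so it is trivial.
*)
theory Submission
  imports Defs
begin


section \<open>Path algebras and their quotients\<close>

text \<open>Homotopy of walks has no normal form here, so two walks are told apart only by
  invariants. In type MS the one serious constraint on an invariant is (h3): full paths starting at
  one polygon must get the same value. The affine representation meets it by a geometric sum: for a
  primitive d-th root of unity \<open>w\<close> the sum of \<open>w^i\<close> over
  \<open>i < k\<close> vanishes for \<open>k = d\<close> but not for \<open>0 < k < d\<close>. So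
  full paths act without translation, while shorter paths on the chosen orbit keep one; a further
  constant, a root detecting the stabiliser of \<open>e\<close>, records the position on that orbit.

  The ideal and the isomorphism in the last step are arbitrary, so arrows of Q need not be classes
  L(e). In fact an arrow of degree one is itself a full path and may equal a longer one. This is why
  a g-step is lifted to a chosen nonzero path of Q, which is unique only up to scalars and minimal
  relations.

  All categories of configurations are handled as path categories modulo a congruence with zero. Its
  nonzero classes, called tokens, are bases of the morphism spaces, so that coverings of categories
  reduce to unique lifting of tokens.\<close>

instantiation list :: (type) monoid_add
begin

definition zero_list :: "'a list" where "zero_list = []"

definition plus_list :: "'a list \<Rightarrow> 'a list \<Rightarrow> 'a list" where "plus_list = (@)"

instance
  by standard (auto simp: zero_list_def plus_list_def)

end

text \<open>
  With concatenation as addition of lists, composition in the path category is the convolution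
  product \<open>u * v\<close> (first \<open>u\<close>, then \<open>v\<close>), and the scalar \<open>c\<close> acts as \<open>single [] c\<close>.
\<close>

abbreviation single :: "'a \<Rightarrow> 'b \<Rightarrow> 'a \<Rightarrow>\<^sub>0 'b::zero" where
  "single \<equiv> Poly_Mapping.single"

abbreviation keys :: "('a \<Rightarrow>\<^sub>0 'b::zero) \<Rightarrow> 'a set" where
  "keys \<equiv> Poly_Mapping.keys"

abbreviation lookup :: "('a \<Rightarrow>\<^sub>0 'b::zero) \<Rightarrow> 'a \<Rightarrow> 'b" where
  "lookup \<equiv> Poly_Mapping.lookup"

lemma single_Nil_one: "single ([] :: 'a list) (1::'k::field) = 1"
  by (metis single_one zero_list_def)

lemma single_mult_single:
  "single p (a::'k::field) * single q b = single (p @ q) (a * b)"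
  by (simp add: mult_single plus_list_def)

lemma poly_mapping_sum_singles:
  fixes f :: "'a \<Rightarrow>\<^sub>0 'k::comm_monoid_add"
  shows "f = (\<Sum>p\<in>keys f. single p (lookup f p))"
proof (rule poly_mapping_eqI)
  fix q
  have "(\<Sum>p\<in>keys f. lookup (single p (lookup f p)) q) = (\<Sum>p\<in>keys f. if p = q then lookup f q else 0)"
    by (intro sum.cong) (auto simp: lookup_single when_def)
  also have "\<dots> = lookup f q"
    by (simp add: in_keys_iff)
  finally show "lookup f q = lookup (\<Sum>p\<in>keys f. single p (lookup f p)) q"
    by (simp add: lookup_sum)
qed

text \<open>The right-hand side is the double sum by which \<open>path_category\<close> defines
  composition; hence \<open>cmp\<close> becomes the product of the convolution ring and its laws
  come for free.\<close>

lemma poly_mapping_mult_sum: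
  fixes u v :: "'a list \<Rightarrow>\<^sub>0 'k::field"
  shows "u * v = (\<Sum>p\<in>keys u. \<Sum>q\<in>keys v. single (p @ q) (lookup v q * lookup u p))"
proof -
  have "u * v = (\<Sum>p\<in>keys u. single p (lookup u p)) * (\<Sum>q\<in>keys v. single q (lookup v q))"
    by (simp flip: poly_mapping_sum_singles)
  then show ?thesis
    by (simp add: sum_product single_mult_single mult.commute)
qed

lemma single_Nil_commute:
  fixes f :: "'a list \<Rightarrow>\<^sub>0 'k::field"
  shows "single [] c * f = f * single [] c"
proof (cases "c = 0")
  case False
  have "single [] c * f = (\<Sum>q\<in>keys f. single q (lookup f q * c))"
    using False by (subst poly_mapping_mult_sum) simp
  moreover have "f * single [] c = (\<Sum>q\<in>keys f. single q (c * lookup f q))"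
    using False by (subst poly_mapping_mult_sum) simp
  ultimately show ?thesis
    by (simp add: mult.commute)
qed simp

lemma mult_scale_right:
  fixes u v :: "'a list \<Rightarrow>\<^sub>0 'k::field"
  shows "u * (single [] c * v) = single [] c * (u * v)"
  by (metis mult.assoc single_Nil_commute)

lemma map_scale_eq: "Poly_Mapping.map (\<lambda>a. c * a) f = single [] (c::'k::field) * f"
  by (metis mult_map_scale_conv_mult zero_list_def)

lemma lookup_scale [simp]: "lookup (single [] c * f) p = (c::'k::field) * lookup f p"
  by (simp flip: map_scale_eq) (simp add: Poly_Mapping.map.rep_eq when_def)

section \<open>Morphism spaces of the path category\<close>

definition path_span :: "('v, 'a) pre_digraph \<Rightarrow> 'v \<Rightarrow> 'v \<Rightarrow> ('a list \<Rightarrow>\<^sub>0 'k::field) set" where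
  "path_span Q x y = {f. \<forall>p\<in>keys f. qpath Q x p y}"

lemma path_category_simps [simp]:
  "Ob (path_category Q) = verts Q"
  "carrier (Hom (path_category Q) x y) = path_span Q x y"
  "\<zero>\<^bsub>Hom (path_category Q) x y\<^esub> = 0"
  "f \<oplus>\<^bsub>Hom (path_category Q) x y\<^esub> h = f + h"
  "c \<odot>\<^bsub>Hom (path_category Q) x y\<^esub> f = single [] c * f"
  "cmp (path_category Q) x y z v u = u * v"
  "idt (path_category Q) x = 1"
  by (simp_all add: path_category_def map_scale_eq poly_mapping_mult_sum path_span_def single_Nil_one)

lemma path_span_zero [simp]: "0 \<in> path_span Q x y"
  by (simp add: path_span_def)

lemma path_span_single: "qpath Q x p y \<Longrightarrow> single p c \<in> path_span Q x y"
  by (simp add: path_span_def)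

lemma path_span_add: "f \<in> path_span Q x y \<Longrightarrow> h \<in> path_span Q x y \<Longrightarrow> f + h \<in> path_span Q x y"
  using keys_add[of f h] by (auto simp: path_span_def)

lemma path_span_uminus: "f \<in> path_span Q x y \<Longrightarrow> - f \<in> path_span Q x y"
  by (simp add: path_span_def)

lemma path_span_diff: "f \<in> path_span Q x y \<Longrightarrow> h \<in> path_span Q x y \<Longrightarrow> f - h \<in> path_span Q x y"
  using path_span_add[of f Q x y "- h"] path_span_uminus[of h Q x y] by simp

lemma path_span_scale: "f \<in> path_span Q x y \<Longrightarrow> single [] c * f \<in> path_span Q x y"
  by (simp add: path_span_def in_keys_iff)

lemma path_span_sum: "(\<And>i. i \<in> A \<Longrightarrow> f i \<in> path_span Q x y) \<Longrightarrow> sum f A \<in> path_span Q x y"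
  by (induction A rule: infinite_finite_induct) (auto intro: path_span_add)

lemma path_span_one: "x \<in> verts Q \<Longrightarrow> 1 \<in> path_span Q x x"
  by (metis path_span_single single_Nil_one pre_digraph.awalk_def pre_digraph.cas.simps(1)
      empty_subsetI list.set(1))

lemma (in wf_digraph) path_span_mult:
  "u \<in> path_span G x y \<Longrightarrow> v \<in> path_span G y z \<Longrightarrow> u * v \<in> path_span G x z"
  unfolding poly_mapping_mult_sum
  by (intro path_span_sum path_span_single) (auto simp: path_span_def)

lemma smult_diff_one: "- f = single [] (- 1) * (f :: 'a list \<Rightarrow>\<^sub>0 'k::field)"
  by (rule poly_mapping_eqI) simp

section \<open>The quotient of the path category by an ideal\<close>

definition pcoset :: "('v \<Rightarrow> 'v \<Rightarrow> ('a list \<Rightarrow>\<^sub>0 'k::field) set) \<Rightarrow> 'v \<Rightarrow> 'v \<Rightarrow>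
    ('a list \<Rightarrow>\<^sub>0 'k) \<Rightarrow> ('a list \<Rightarrow>\<^sub>0 'k) set" where
  "pcoset I x y f = (\<lambda>h. h + f) ` I x y"

abbreviation quot_path_category ::
  "('v, 'a) pre_digraph \<Rightarrow> ('v \<Rightarrow> 'v \<Rightarrow> ('a list \<Rightarrow>\<^sub>0 'k::field) set) \<Rightarrow>
    ('k, 'v, ('a list \<Rightarrow>\<^sub>0 'k) set) kcat" where
  "quot_path_category Q I \<equiv> quot_kcat (path_category Q) I"

text \<open>The indices \<open>a\<close> and \<open>b\<close> are free because the addition of the
  path category is the same on all morphism spaces.\<close>

lemma a_r_coset_path:
  "I x y +>\<^bsub>Hom (path_category Q) a b\<^esub> f = pcoset I x y f"
  by (auto simp: a_r_coset_def' pcoset_def)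

lemma quot_path_category_simps [simp]:
  "Ob (quot_path_category Q I) = verts Q"
  "carrier (Hom (quot_path_category Q I) x y) = pcoset I x y ` path_span Q x y"
  "\<zero>\<^bsub>Hom (quot_path_category Q I) x y\<^esub> = I x y"
  "idt (quot_path_category Q I) x = pcoset I x x 1"
  by (auto simp: quot_kcat_def quot_module_def A_RCOSETS_def' a_r_coset_path)

locale path_ideal = wf_digraph G for G :: "('v, 'a) pre_digraph" +
  fixes I :: "'v \<Rightarrow> 'v \<Rightarrow> ('a list \<Rightarrow>\<^sub>0 'k::field) set"
  assumes ideal: "k_ideal (path_category G) I"
begin

abbreviation "C \<equiv> quot_path_category G I"

context
  fixes x y assumes xy: "x \<in> verts G" "y \<in> verts G"
begin

lemma ideal_submodule: "submodule class_ring (I x y) (Hom (path_category G) x y)"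
  using ideal xy by (auto simp: k_ideal_def intro: subspace.submod)

lemma ideal_subset: "I x y \<subseteq> path_span G x y"
  using submodule.subset[OF ideal_submodule] by simp

lemma ideal_zero [simp]: "0 \<in> I x y"
  using submodule.zero_closed[OF ideal_submodule] by simp

lemma ideal_add: "f \<in> I x y \<Longrightarrow> h \<in> I x y \<Longrightarrow> f + h \<in> I x y"
  using submodule.m_closed[OF ideal_submodule] by simp

lemma ideal_scale: "f \<in> I x y \<Longrightarrow> single [] c * f \<in> I x y"
  using submodule.smult_closed[OF ideal_submodule, of c f] by simp

lemma ideal_uminus: "f \<in> I x y \<Longrightarrow> - f \<in> I x y"
  using ideal_scale[of f "- 1"] by (simp flip: smult_diff_one)

lemma ideal_diff: "f \<in> I x y \<Longrightarrow> h \<in> I x y \<Longrightarrow> f - h \<in> I x y"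
  using ideal_add[OF _ ideal_uminus] by fastforce

lemma ideal_sum: "(\<And>i. i \<in> A \<Longrightarrow> f i \<in> I x y) \<Longrightarrow> sum f A \<in> I x y"
  by (induction A rule: infinite_finite_induct) (auto intro: ideal_add)

lemma pcoset_eq_iff: "pcoset I x y f = pcoset I x y h \<longleftrightarrow> f - h \<in> I x y"
proof
  assume "pcoset I x y f = pcoset I x y h"
  moreover have "f \<in> pcoset I x y f"
    unfolding pcoset_def by (rule image_eqI[of _ _ 0]) auto
  ultimately have "f \<in> pcoset I x y h" by simp
  then show "f - h \<in> I x y"
    by (auto simp: pcoset_def)
next
  assume *: "f - h \<in> I x y"
  have "r + f \<in> pcoset I x y h" "r + h \<in> pcoset I x y f" if "r \<in> I x y" for r
    using ideal_add[OF that *] ideal_diff[OF that *] unfolding pcoset_def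
    by (auto intro: image_eqI[of _ _ "r + (f - h)"] image_eqI[of _ _ "r - (f - h)"])
  then show "pcoset I x y f = pcoset I x y h"
    by (auto simp: pcoset_def[of I x y f] pcoset_def[of I x y h])
qed

lemma pcoset_cong: "f - h \<in> I x y \<Longrightarrow> pcoset I x y f = pcoset I x y h"
  by (simp add: pcoset_eq_iff)

lemma pcoset_memI: "f \<in> pcoset I x y f"
  unfolding pcoset_def by (rule image_eqI[of _ _ 0]) auto

lemma pcoset_memD: "h \<in> pcoset I x y f \<Longrightarrow> h - f \<in> I x y"
  by (auto simp: pcoset_def)

lemma pcoset_mem_span: "h \<in> pcoset I x y f \<Longrightarrow> f \<in> path_span G x y \<Longrightarrow> h \<in> path_span G x y"
  using ideal_subset path_span_add by (fastforce simp: pcoset_def)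

text \<open>The quotient record defines scalar multiplication and composition as unions over
  representatives; such a union collapses to one value as soon as the summand is constant on the
  coset.\<close>

lemma pcoset_UN:
  assumes "\<And>h. h \<in> pcoset I x y f \<Longrightarrow> F h = F f"
  shows "(\<Union>h\<in>pcoset I x y f. F h) = F f"
  using assms pcoset_memI by blast

lemma quot_zero: "\<zero>\<^bsub>Hom C x y\<^esub> = pcoset I x y 0"
  by (simp add: pcoset_def)

lemma pcoset_eq_zero_iff: "pcoset I x y f = I x y \<longleftrightarrow> f \<in> I x y"
  using pcoset_eq_iff[of f 0] by (simp add: pcoset_def[of I x y 0])

lemma quot_add:
  "pcoset I x y f \<oplus>\<^bsub>Hom C x y\<^esub> pcoset I x y h = pcoset I x y (f + h)"
proof -
  have "(r + f) + (s + h) \<in> pcoset I x y (f + h)" if "r \<in> I x y" "s \<in> I x y" for r s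
    using ideal_add[OF that] unfolding pcoset_def
    by (auto intro!: image_eqI[of _ _ "r + s"])
  moreover have "\<exists>a\<in>pcoset I x y f. \<exists>b\<in>pcoset I x y h. r + (f + h) = a + b" if "r \<in> I x y" for r
    by (rule bexI[of _ "r + f"], rule bexI[of _ h])
       (use that pcoset_memI in \<open>auto simp: pcoset_def add.assoc\<close>)
  ultimately show ?thesis
    by (auto simp: quot_kcat_def quot_module_def set_add_def' pcoset_def[of I x y "f + h"])
       (auto simp: pcoset_def)
qed

lemma quot_smult: "c \<odot>\<^bsub>Hom C x y\<^esub> pcoset I x y f = pcoset I x y (single [] c * f)"
proof -
  have "(\<Union>v\<in>pcoset I x y f. pcoset I x y (single [] c * v)) = pcoset I x y (single [] c * f)"
  proof (rule pcoset_UN)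
    fix h assume "h \<in> pcoset I x y f"
    then have "single [] c * (h - f) \<in> I x y"
      by (intro ideal_scale pcoset_memD)
    then show "pcoset I x y (single [] c * h) = pcoset I x y (single [] c * f)"
      by (intro pcoset_cong) (simp add: right_diff_distrib)
  qed
  then show ?thesis
    by (simp add: quot_kcat_def quot_module_def a_r_coset_path)
qed

lemma quot_hom_cases:
  assumes "U \<in> carrier (Hom C x y)"
  obtains f where "f \<in> path_span G x y" "U = pcoset I x y f"
  using assms by auto

lemma vectorspace_quot: "vectorspace class_ring (Hom C x y)"
proof (rule vs_criteria)
  show "field (class_ring :: 'k ring)" by (rule class_field)
  have span_ball: "(\<forall>U. U \<in> carrier (Hom C x y) \<longrightarrow> P U) \<longleftrightarrow> (\<forall>f\<in>path_span G x y. P (pcoset I x y f))" for P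
    by auto
  show "\<zero>\<^bsub>Hom C x y\<^esub> \<in> carrier (Hom C x y)"
    unfolding quot_zero by simp
  show "\<forall>v w. v \<in> carrier (Hom C x y) \<and> w \<in> carrier (Hom C x y) \<longrightarrow> v \<oplus>\<^bsub>Hom C x y\<^esub> w \<in> carrier (Hom C x y)"
    by (auto simp: quot_add path_span_add)
  show "\<forall>v\<in>carrier (Hom C x y). \<exists>neg_v\<in>carrier (Hom C x y). v \<oplus>\<^bsub>Hom C x y\<^esub> neg_v = \<zero>\<^bsub>Hom C x y\<^esub>"
  proof
    fix U assume "U \<in> carrier (Hom C x y)"
    then obtain f where f: "f \<in> path_span G x y" "U = pcoset I x y f" by auto
    show "\<exists>neg_v\<in>carrier (Hom C x y). U \<oplus>\<^bsub>Hom C x y\<^esub> neg_v = \<zero>\<^bsub>Hom C x y\<^esub>"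
      unfolding quot_zero
      by (rule bexI[of _ "pcoset I x y (- f)"]) (use f in \<open>auto simp: quot_add path_span_uminus\<close>)
  qed
  show "\<forall>c v. c \<in> carrier class_ring \<and> v \<in> carrier (Hom C x y) \<longrightarrow> c \<odot>\<^bsub>Hom C x y\<^esub> v \<in> carrier (Hom C x y)"
    by (auto simp: quot_smult path_span_scale)
  show "\<forall>v w. v \<in> carrier (Hom C x y) \<and> w \<in> carrier (Hom C x y) \<longrightarrow>
      v \<oplus>\<^bsub>Hom C x y\<^esub> w = w \<oplus>\<^bsub>Hom C x y\<^esub> v"
    by (auto simp: quot_add add.commute)
  show "\<forall>v w x'. v \<in> carrier (Hom C x y) \<and> w \<in> carrier (Hom C x y) \<and> x' \<in> carrier (Hom C x y) \<longrightarrow>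
      v \<oplus>\<^bsub>Hom C x y\<^esub> w \<oplus>\<^bsub>Hom C x y\<^esub> x' = v \<oplus>\<^bsub>Hom C x y\<^esub> (w \<oplus>\<^bsub>Hom C x y\<^esub> x')"
    by (auto simp: quot_add add.assoc)
  show "\<forall>v\<in>carrier (Hom C x y). v \<oplus>\<^bsub>Hom C x y\<^esub> \<zero>\<^bsub>Hom C x y\<^esub> = v"
    unfolding quot_zero by (auto simp: quot_add)
  show "\<forall>a b v. a \<in> carrier class_ring \<and> b \<in> carrier class_ring \<and> v \<in> carrier (Hom C x y) \<longrightarrow>
      (a \<otimes>\<^bsub>class_ring\<^esub> b) \<odot>\<^bsub>Hom C x y\<^esub> v = a \<odot>\<^bsub>Hom C x y\<^esub> (b \<odot>\<^bsub>Hom C x y\<^esub> v)"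
    by (auto simp: quot_smult single_mult_single simp flip: mult.assoc)
  show "\<forall>v\<in>carrier (Hom C x y). \<one>\<^bsub>class_ring\<^esub> \<odot>\<^bsub>Hom C x y\<^esub> v = v"
    by (auto simp: quot_smult single_Nil_one)
  show "\<forall>a b v. a \<in> carrier class_ring \<and> b \<in> carrier class_ring \<and> v \<in> carrier (Hom C x y) \<longrightarrow>
      (a \<oplus>\<^bsub>class_ring\<^esub> b) \<odot>\<^bsub>Hom C x y\<^esub> v = a \<odot>\<^bsub>Hom C x y\<^esub> v \<oplus>\<^bsub>Hom C x y\<^esub> b \<odot>\<^bsub>Hom C x y\<^esub> v"
    by (auto simp: quot_smult quot_add single_add distrib_right)
  show "\<forall>a v w. a \<in> carrier class_ring \<and> v \<in> carrier (Hom C x y) \<and> w \<in> carrier (Hom C x y) \<longrightarrow>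
      a \<odot>\<^bsub>Hom C x y\<^esub> (v \<oplus>\<^bsub>Hom C x y\<^esub> w) = a \<odot>\<^bsub>Hom C x y\<^esub> v \<oplus>\<^bsub>Hom C x y\<^esub> a \<odot>\<^bsub>Hom C x y\<^esub> w"
    by (auto simp: quot_smult quot_add distrib_left)
qed

lemma quot_finsum:
  assumes "finite A" "\<And>i. i \<in> A \<Longrightarrow> f i \<in> path_span G x y"
  shows "(\<Oplus>\<^bsub>Hom C x y\<^esub> i\<in>A. pcoset I x y (f i)) = pcoset I x y (sum f A)"
proof -
  interpret V: vectorspace class_ring "Hom C x y" by (rule vectorspace_quot)
  show ?thesis
    using assms
  proof (induction A)
    case empty
    then show ?case by (simp add: V.M.finsum_empty pcoset_def)
  next
    case (insert i A)
    then have "(\<Oplus>\<^bsub>Hom C x y\<^esub> i\<in>insert i A. pcoset I x y (f i)) =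
        pcoset I x y (f i) \<oplus>\<^bsub>Hom C x y\<^esub> (\<Oplus>\<^bsub>Hom C x y\<^esub> i\<in>A. pcoset I x y (f i))"
      by (intro V.M.finsum_insert) auto
    then show ?case
      using insert by (simp add: quot_add)
  qed
qed

lemma quot_minus:
  assumes "f \<in> path_span G x y" "h \<in> path_span G x y"
  shows "pcoset I x y f \<ominus>\<^bsub>Hom C x y\<^esub> pcoset I x y h = pcoset I x y (f - h)"
proof -
  interpret V: vectorspace class_ring "Hom C x y" by (rule vectorspace_quot)
  have "\<ominus>\<^bsub>Hom C x y\<^esub> pcoset I x y h = pcoset I x y (- h)"
    by (rule V.minus_equality)
       (use assms in \<open>auto simp: quot_add quot_zero path_span_uminus simp del: quot_path_category_simps(3)\<close>)
  then show ?thesis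
    by (simp add: a_minus_def quot_add)
qed

end

lemma ideal_mult_left:
  "\<lbrakk>x \<in> verts G; y \<in> verts G; z \<in> verts G; u \<in> I x y; v \<in> path_span G y z\<rbrakk> \<Longrightarrow> u * v \<in> I x z"
  using ideal ideal_subset[of x y] unfolding k_ideal_def by fastforce

lemma ideal_mult_right:
  "\<lbrakk>x \<in> verts G; y \<in> verts G; z \<in> verts G; u \<in> path_span G x y; v \<in> I y z\<rbrakk> \<Longrightarrow> u * v \<in> I x z"
  using ideal ideal_subset[of y z] unfolding k_ideal_def by fastforce

text \<open>Independence of the representatives is the identity
  \<open>a * b - u * v = (a - u) * b + u * (b - v)\<close>, whose two summands lie in the ideal by
  closure on either side.\<close>

lemma quot_cmp:
  assumes "x \<in> verts G" "y \<in> verts G" "z \<in> verts G" "u \<in> path_span G x y" "v \<in> path_span G y z"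
  shows "cmp C x y z (pcoset I y z v) (pcoset I x y u) = pcoset I x z (u * v)"
proof -
  have "pcoset I x z (a * b) = pcoset I x z (u * v)"
    if "a \<in> pcoset I x y u" "b \<in> pcoset I y z v" for a b
  proof (rule pcoset_cong[OF assms(1,3)])
    have "b \<in> path_span G y z"
      by (rule pcoset_mem_span[OF assms(2,3) that(2) assms(5)])
    then have "(a - u) * b \<in> I x z"
      by (rule ideal_mult_left[OF assms(1-3) pcoset_memD[OF assms(1,2) that(1)]])
    moreover have "u * (b - v) \<in> I x z"
      by (rule ideal_mult_right[OF assms(1-3,4) pcoset_memD[OF assms(2,3) that(2)]])
    ultimately have "(a - u) * b + u * (b - v) \<in> I x z"
      using assms by (intro ideal_add)
    then show "a * b - u * v \<in> I x z"
      by (simp add: algebra_simps)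
  qed
  then have "(\<Union>a\<in>pcoset I x y u. pcoset I x z (a * b)) = pcoset I x z (u * v)"
    if "b \<in> pcoset I y z v" for b
    using pcoset_memI[OF assms(1,2), of u] that by blast
  then have "(\<Union>b\<in>pcoset I y z v. \<Union>a\<in>pcoset I x y u. pcoset I x z (a * b)) = pcoset I x z (u * v)"
    if "v \<in> pcoset I y z v"
    using that by (simp cong: SUP_cong_simp) blast
  then show ?thesis
    using pcoset_memI[OF assms(2,3), of v] by (simp add: quot_kcat_def a_r_coset_path)
qed

lemma k_category_quot: "k_category C"
proof (rule k_category.intro)
  fix x y assume "x \<in> Ob C" "y \<in> Ob C"
  then show "vectorspace class_ring (Hom C x y)"
    by (simp add: vectorspace_quot)
next
  fix x y z u
  assume "x \<in> Ob C" "y \<in> Ob C" "z \<in> Ob C" "u \<in> carrier (Hom C x y)"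
  then show "(\<lambda>v. cmp C x y z v u) \<in> LinearCombinations.module_hom class_ring (Hom C y z) (Hom C x z)"
    by (auto simp: LinearCombinations.module_hom_def quot_cmp quot_add quot_smult path_span_mult
        path_span_add path_span_scale distrib_left mult_scale_right)
next
  fix x y z v
  assume "x \<in> Ob C" "y \<in> Ob C" "z \<in> Ob C" "v \<in> carrier (Hom C y z)"
  then show "(\<lambda>u. cmp C x y z v u) \<in> LinearCombinations.module_hom class_ring (Hom C x y) (Hom C x z)"
    by (auto simp: LinearCombinations.module_hom_def quot_cmp quot_add quot_smult path_span_mult
        path_span_add path_span_scale distrib_right mult.assoc)
next
  fix x y z t u v w
  assume "x \<in> Ob C" "y \<in> Ob C" "z \<in> Ob C" "t \<in> Ob C"
    "u \<in> carrier (Hom C x y)" "v \<in> carrier (Hom C y z)" "w \<in> carrier (Hom C z t)"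
  then show "cmp C x y t (cmp C y z t w v) u = cmp C x z t w (cmp C x y z v u)"
    by (auto simp: quot_cmp path_span_mult mult.assoc)
next
  fix x assume "x \<in> Ob C"
  then show "idt C x \<in> carrier (Hom C x x)"
    by (simp add: path_span_one)
next
  fix x y u assume "x \<in> Ob C" "y \<in> Ob C" "u \<in> carrier (Hom C x y)"
  then show "cmp C x y y (idt C y) u = u"
    by (auto simp: quot_cmp path_span_one)
next
  fix x y u assume "x \<in> Ob C" "y \<in> Ob C" "u \<in> carrier (Hom C x y)"
  then show "cmp C x x y u (idt C x) = u"
    by (auto simp: quot_cmp path_span_one)
qed

end

section \<open>Path categories modulo a congruence with zero\<close>

text \<open>Linear extension of a partial map of basis elements, with \<open>None\<close> standing
  for the zero vector. Total maps are the special case \<open>push\<close>.\<close>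

definition pmap :: "('a \<Rightarrow> 'b option) \<Rightarrow> ('a \<Rightarrow>\<^sub>0 'k::field) \<Rightarrow> ('b \<Rightarrow>\<^sub>0 'k)" where
  "pmap \<tau> f = (\<Sum>p\<in>keys f. case \<tau> p of None \<Rightarrow> 0 | Some t \<Rightarrow> single t (lookup f p))"

lemma pmap_zero [simp]: "pmap \<tau> 0 = 0"
  by (simp add: pmap_def)

lemma pmap_add: "pmap \<tau> (f + h) = pmap \<tau> f + pmap \<tau> h"
  unfolding pmap_def
  by (rule setsum_keys_plus_distrib) (auto split: option.split simp: single_add)

lemma single_eq_0: "single p c = 0 \<longleftrightarrow> c = 0"
  by (metis lookup_single_eq lookup_zero single_zero)

lemma pmap_single: "pmap \<tau> (single p c) = (case \<tau> p of None \<Rightarrow> 0 | Some t \<Rightarrow> single t c)"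
  by (cases "c = 0") (auto simp: pmap_def split: option.split)

lemma pmap_uminus: "pmap \<tau> (- f) = - pmap \<tau> f"
  using pmap_add[of \<tau> f "- f"] by (simp add: eq_neg_iff_add_eq_0 add.commute)

lemma pmap_diff: "pmap \<tau> (f - h) = pmap \<tau> f - pmap \<tau> h"
  using pmap_add[of \<tau> f "- h"] by (simp add: pmap_uminus)

lemma pmap_sum: "pmap \<tau> (sum f A) = (\<Sum>i\<in>A. pmap \<tau> (f i))"
  by (induction A rule: infinite_finite_induct) (auto simp: pmap_add)

lemma pmap_cong: "(\<And>p. p \<in> keys f \<Longrightarrow> \<tau> p = \<sigma> p) \<Longrightarrow> pmap \<tau> f = pmap \<sigma> f"
  by (simp add: pmap_def)

lemma pmap_Some [simp]: "pmap Some f = f"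
  by (simp add: pmap_def flip: poly_mapping_sum_singles)

lemma pmap_pmap: "pmap \<sigma> (pmap \<tau> f) = pmap (\<lambda>p. Option.bind (\<tau> p) \<sigma>) f"
proof -
  have "pmap \<sigma> (pmap \<tau> f) = (\<Sum>p\<in>keys f. pmap \<sigma> (case \<tau> p of None \<Rightarrow> 0 | Some t \<Rightarrow> single t (lookup f p)))"
    by (simp add: pmap_def[of \<tau>] pmap_sum)
  also have "\<dots> = pmap (\<lambda>p. Option.bind (\<tau> p) \<sigma>) f"
    unfolding pmap_def[of "\<lambda>p. Option.bind (\<tau> p) \<sigma>"]
    by (intro sum.cong) (auto simp: pmap_single split: option.split)
  finally show ?thesis .
qed

lemma lookup_pmap: "lookup (pmap \<tau> f) t = (\<Sum>p\<in>{p \<in> keys f. \<tau> p = Some t}. lookup f p)"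
proof -
  have "lookup (pmap \<tau> f) t = (\<Sum>p\<in>keys f. if \<tau> p = Some t then lookup f p else 0)"
    unfolding pmap_def lookup_sum
    by (intro sum.cong) (auto split: option.split simp: lookup_single when_def)
  then show ?thesis
    by (simp add: sum.If_cases Int_def)
qed

lemma keys_pmap: "t \<in> keys (pmap \<tau> f) \<Longrightarrow> \<exists>p\<in>keys f. \<tau> p = Some t"
  by (rule ccontr) (auto simp: in_keys_iff lookup_pmap intro!: sum.neutral)

lemma lookup_pmap_scale: "lookup (pmap \<tau> (single [] c * f)) t = c * lookup (pmap \<tau> f) t"
proof (cases "c = 0")
  case False
  then have "keys (single [] c * f) = keys f"
    by (auto simp: in_keys_iff)
  then show ?thesis
    by (simp add: lookup_pmap sum_distrib_left)
qed simp

lemma pmap_scale_eq_0: "pmap \<tau> f = 0 \<Longrightarrow> pmap \<tau> (single [] c * f) = 0"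
  by (rule poly_mapping_eqI) (simp add: lookup_pmap_scale)

lemma pmap_mult_single:
  fixes f :: "'a list \<Rightarrow>\<^sub>0 'k::field"
  shows "f * single q 1 = pmap (\<lambda>p. Some (p @ q)) f" "single q 1 * f = pmap (\<lambda>p. Some (q @ p)) f"
  by (subst poly_mapping_mult_sum, simp add: pmap_def)+

lemma single_scale: "single p c = single [] c * single p (1::'k::field)"
  by (simp add: single_mult_single)

abbreviation push :: "('a \<Rightarrow> 'b) \<Rightarrow> ('a \<Rightarrow>\<^sub>0 'k::field) \<Rightarrow> ('b \<Rightarrow>\<^sub>0 'k)" where
  "push \<phi> \<equiv> pmap (\<lambda>p. Some (\<phi> p))"

lemma pmap_push: "pmap \<tau> (push \<phi> f) = pmap (\<lambda>p. \<tau> (\<phi> p)) f"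
  by (simp add: pmap_pmap)

lemma push_map_scale: "push (map \<phi>) (single [] c * f) = single [] c * push (map \<phi>) f"
  by (rule poly_mapping_eqI) (simp add: lookup_pmap_scale)

lemma push_map_one: "push (map \<phi>) 1 = (1 :: _ \<Rightarrow>\<^sub>0 'k::field)"
  by (simp add: pmap_single flip: single_Nil_one)

lemma push_map_mult:
  fixes u v :: "'a list \<Rightarrow>\<^sub>0 'k::field"
  shows "push (map \<phi>) (u * v) = push (map \<phi>) u * push (map \<phi>) v"
proof -
  have *: "push (map \<phi>) u = (\<Sum>p\<in>keys u. single (map \<phi> p) (lookup u p))" for u :: "'a list \<Rightarrow>\<^sub>0 'k"
    by (simp add: pmap_def)
  show ?thesis
    by (simp add: poly_mapping_mult_sum[of u v] pmap_sum pmap_single *[of u] *[of v] sum_product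
        single_mult_single mult.commute)
qed

text \<open>The kernel of the linear extension of \<open>tok\<close>. It is spanned by the paths
  with value \<open>None\<close> and the differences of parallel paths with equal value, see
  \<open>tok_ideal_minimal\<close>.\<close>

definition tok_ideal ::
  "('v, 'a) pre_digraph \<Rightarrow> ('a list \<Rightarrow> 't option) \<Rightarrow> 'v \<Rightarrow> 'v \<Rightarrow> ('a list \<Rightarrow>\<^sub>0 'k::field) set" where
  "tok_ideal Q tok x y = {f \<in> path_span Q x y. pmap tok f = 0}"

text \<open>
  \<open>tok\<close> encodes a congruence with zero on the paths: \<open>tok p = None\<close> if \<open>p\<close> is sent to \<open>0\<close>, and
  two nonzero parallel paths are identified iff they have the same value.
\<close>

locale token_quiver = wf_digraph G for G :: "('v, 'a) pre_digraph" +
  fixes tok :: "'a list \<Rightarrow> 't option"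
  assumes tok_append_cong:
      "\<lbrakk>qpath G x p y; qpath G x p' y; qpath G y q z; qpath G y q' z; tok p = tok p'; tok q = tok q'\<rbrakk>
        \<Longrightarrow> tok (p @ q) = tok (p' @ q')"
    and tok_append_None:
      "\<lbrakk>qpath G x p y; qpath G y q z; tok p = None \<or> tok q = None\<rbrakk> \<Longrightarrow> tok (p @ q) = None"
begin

definition tokens :: "'v \<Rightarrow> 'v \<Rightarrow> 't set" where
  "tokens x y = {t. \<exists>p. qpath G x p y \<and> tok p = Some t}"

definition tok_rep :: "'v \<Rightarrow> 'v \<Rightarrow> 't \<Rightarrow> 'a list" where
  "tok_rep x y t = (SOME p. qpath G x p y \<and> tok p = Some t)"

lemma tok_rep: "t \<in> tokens x y \<Longrightarrow> qpath G x (tok_rep x y t) y \<and> tok (tok_rep x y t) = Some t"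
  unfolding tokens_def tok_rep_def by (rule someI_ex) auto

lemma tokensI: "qpath G x p y \<Longrightarrow> tok p = Some t \<Longrightarrow> t \<in> tokens x y"
  by (auto simp: tokens_def)

lemma keys_pmap_tok: "f \<in> path_span G x y \<Longrightarrow> keys (pmap tok f) \<subseteq> tokens x y"
  using keys_pmap[of _ tok f] by (fastforce simp: path_span_def tokens_def)

text \<open>Choosing one path for every token gives a linear section of \<open>pmap tok\<close>;
  this is the surjectivity half of the description of the quotient by coordinates.\<close>

lemma pmap_tok_section:
  assumes "keys g \<subseteq> tokens x y"
  shows "push (tok_rep x y) g \<in> path_span G x y" "pmap tok (push (tok_rep x y) g) = g"
proof -
  show "push (tok_rep x y) g \<in> path_span G x y"
    using assms tok_rep unfolding path_span_def by (auto dest!: keys_pmap)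
  have "pmap tok (push (tok_rep x y) g) = pmap Some g"
    unfolding pmap_push by (rule pmap_cong) (use assms tok_rep in auto)
  then show "pmap tok (push (tok_rep x y) g) = g" by simp
qed

text \<open>For a fixed path \<open>q\<close> the token of \<open>p @ q\<close> is a function of the
  token of \<open>p\<close>. So right multiplication by \<open>q\<close> followed by
  \<open>pmap tok\<close> factors through \<open>pmap tok\<close>, and sends its kernel to 0. The
  general case follows by linearity in \<open>v\<close>.\<close>

lemma tok_ideal_mult_right:
  assumes "u \<in> path_span G x y" "pmap tok u = 0" "v \<in> path_span G y z"
  shows "pmap tok (u * v) = 0"
proof -
  have "pmap tok (u * single q 1) = 0" if "q \<in> keys v" for q
  proof -
    have q: "qpath G y q z" using assms(3) that by (auto simp: path_span_def)
    have "pmap (\<lambda>p. tok (p @ q)) u = pmap (\<lambda>p. Option.bind (tok p) (\<lambda>t. tok (tok_rep x y t @ q))) u"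
    proof (rule pmap_cong)
      fix p assume "p \<in> keys u"
      then have p: "qpath G x p y" using assms(1) by (auto simp: path_span_def)
      show "tok (p @ q) = Option.bind (tok p) (\<lambda>t. tok (tok_rep x y t @ q))"
      proof (cases "tok p")
        case None
        then show ?thesis using tok_append_None[OF p q] by simp
      next
        case (Some t)
        then show ?thesis
          using tok_append_cong[OF p _ q q, of "tok_rep x y t"] tok_rep[OF tokensI[OF p Some]] by simp
      qed
    qed
    then show ?thesis
      by (simp add: pmap_mult_single pmap_push flip: pmap_pmap) (simp add: assms(2))
  qed
  then have "pmap tok (single [] c * (u * single q 1)) = 0" if "q \<in> keys v" for q c
    using that by (intro pmap_scale_eq_0)
  then have "pmap tok (u * single q (lookup v q)) = 0" if "q \<in> keys v" for q
    using that by (subst single_scale) (simp add: mult_scale_right)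
  moreover have "u * v = (\<Sum>q\<in>keys v. u * single q (lookup v q))"
    by (subst poly_mapping_sum_singles[of v]) (simp add: sum_distrib_left)
  ultimately show ?thesis
    by (simp add: pmap_sum)
qed

lemma tok_ideal_mult_left:
  assumes "u \<in> path_span G x y" "v \<in> path_span G y z" "pmap tok v = 0"
  shows "pmap tok (u * v) = 0"
proof -
  have "pmap tok (single q 1 * v) = 0" if "q \<in> keys u" for q
  proof -
    have q: "qpath G x q y" using assms(1) that by (auto simp: path_span_def)
    have "pmap (\<lambda>p. tok (q @ p)) v = pmap (\<lambda>p. Option.bind (tok p) (\<lambda>t. tok (q @ tok_rep y z t))) v"
    proof (rule pmap_cong)
      fix p assume "p \<in> keys v"
      then have p: "qpath G y p z" using assms(2) by (auto simp: path_span_def)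
      show "tok (q @ p) = Option.bind (tok p) (\<lambda>t. tok (q @ tok_rep y z t))"
      proof (cases "tok p")
        case None
        then show ?thesis using tok_append_None[OF q p] by simp
      next
        case (Some t)
        then show ?thesis
          using tok_append_cong[OF q q p, of "tok_rep y z t"] tok_rep[OF tokensI[OF p Some]] by simp
      qed
    qed
    then show ?thesis
      by (simp add: pmap_mult_single pmap_push flip: pmap_pmap) (simp add: assms(3))
  qed
  then have "pmap tok (single [] c * (single q 1 * v)) = 0" if "q \<in> keys u" for q c
    using that by (intro pmap_scale_eq_0)
  then have "pmap tok (single q (lookup u q) * v) = 0" if "q \<in> keys u" for q
    using that by (subst single_scale) (simp add: mult.assoc)
  moreover have "u * v = (\<Sum>q\<in>keys u. single q (lookup u q) * v)"
    by (subst poly_mapping_sum_singles[of u]) (simp add: sum_distrib_right)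
  ultimately show ?thesis
    by (simp add: pmap_sum)
qed

text \<open>Modulo \<open>J\<close> every term of \<open>f\<close> may be replaced by the chosen
  path of its token, or dropped if it has none. What remains is the section applied to
  \<open>pmap tok f\<close>, which is 0.\<close>

lemma tok_ideal_minimal:
  assumes f: "f \<in> tok_ideal G tok x y"
    and zero: "0 \<in> J" and add: "\<And>u v. u \<in> J \<Longrightarrow> v \<in> J \<Longrightarrow> u + v \<in> J"
    and scale: "\<And>c u. u \<in> J \<Longrightarrow> single [] c * u \<in> J"
    and None: "\<And>p. qpath G x p y \<Longrightarrow> tok p = None \<Longrightarrow> single p 1 \<in> J"
    and Some: "\<And>p q. qpath G x p y \<Longrightarrow> qpath G x q y \<Longrightarrow> tok p = tok q \<Longrightarrow> tok p \<noteq> None \<Longrightarrow>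
      single p 1 - single q 1 \<in> J"
  shows "f \<in> J"
proof -
  have sum: "sum h A \<in> J" if "\<And>i. i \<in> A \<Longrightarrow> h i \<in> J" for h :: "'a list \<Rightarrow> _" and A
    using that by (induction A rule: infinite_finite_induct) (auto intro: zero add)
  define r where "r p = (case tok p of None \<Rightarrow> 0 | Some t \<Rightarrow> single (tok_rep x y t) (lookup f p))" for p
  have "single p (lookup f p) - r p \<in> J" if "p \<in> keys f" for p
  proof -
    have p: "qpath G x p y" using that f by (auto simp: tok_ideal_def path_span_def)
    show ?thesis
    proof (cases "tok p")
      case None
      then show ?thesis
        using scale[OF assms(5)[OF p None], of "lookup f p"] by (simp add: r_def single_mult_single)
    next
      case (Some t)
      have "single p 1 - single (tok_rep x y t) 1 \<in> J"
        using tok_rep[OF tokensI[OF p Some]] Some by (intro assms(6) p) auto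
      from scale[OF this, of "lookup f p"] show ?thesis
        using Some by (simp add: r_def single_mult_single right_diff_distrib)
    qed
  qed
  then have "(\<Sum>p\<in>keys f. single p (lookup f p) - r p) \<in> J"
    by (rule sum)
  moreover have "(\<Sum>p\<in>keys f. r p) = push (tok_rep x y) (pmap tok f)"
    unfolding pmap_pmap unfolding pmap_def
    by (intro sum.cong) (auto simp: r_def split: option.split)
  ultimately show ?thesis
    using f by (simp add: sum_subtractf tok_ideal_def flip: poly_mapping_sum_singles)
qed

end

lemma vectorspace_path_category:
  "vectorspace (class_ring :: 'k::field ring) (Hom (path_category Q) x y)"
proof (rule vs_criteria)
  show "field (class_ring :: 'k ring)" by (rule class_field)
  show "\<forall>v\<in>carrier (Hom (path_category Q) x y). \<exists>neg_v\<in>carrier (Hom (path_category Q) x y).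
      v \<oplus>\<^bsub>Hom (path_category Q) x y\<^esub> neg_v = \<zero>\<^bsub>Hom (path_category Q) x y\<^esub>"
    using path_span_uminus add.right_inverse by (metis path_category_simps(2-4))
qed (auto simp: path_span_add path_span_scale add.commute add.assoc single_mult_single single_Nil_one
    single_add distrib_left distrib_right simp flip: mult.assoc)

text \<open>An ideal is a function on all pairs of elements of the vertex type, and its values off
  the quiver are junk; the equation is therefore asked for vertices only.\<close>

locale token_cat = token_quiver G tok for G :: "('v, 'a) pre_digraph" and tok :: "'a list \<Rightarrow> 't option" +
  fixes I :: "'v \<Rightarrow> 'v \<Rightarrow> ('a list \<Rightarrow>\<^sub>0 'k::field) set"
  assumes I_eq: "x \<in> verts G \<Longrightarrow> y \<in> verts G \<Longrightarrow> I x y = tok_ideal G tok x y"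
begin

lemma tok_ideal_subspace:
  "VectorSpace.subspace class_ring (tok_ideal G tok x y :: (_ \<Rightarrow>\<^sub>0 'k) set) (Hom (path_category G) x y)"
proof -
  interpret V: vectorspace "class_ring :: 'k ring" "Hom (path_category G) x y"
    by (rule vectorspace_path_category)
  show ?thesis
    by (intro subspace.intro submodule.intro V.module_axioms V.vectorspace_axioms)
       (auto simp: tok_ideal_def path_span_add path_span_scale pmap_add pmap_scale_eq_0)
qed

lemma k_ideal_I: "k_ideal (path_category G) I"
  unfolding k_ideal_def
proof (intro conjI ballI impI)
  fix x y assume "x \<in> Ob (path_category G)" "y \<in> Ob (path_category G)"
  then show "VectorSpace.subspace class_ring (I x y) (Hom (path_category G) x y)"
    using tok_ideal_subspace[of x y] by (simp add: I_eq)
next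
  fix x y z u v
  assume "x \<in> Ob (path_category G)" "y \<in> Ob (path_category G)" "z \<in> Ob (path_category G)"
    "u \<in> mor (path_category G) x y" "v \<in> mor (path_category G) y z" "u \<in> I x y \<or> v \<in> I y z"
  then show "cmp (path_category G) x y z v u \<in> I x z"
    using tok_ideal_mult_left[of u x y v z] tok_ideal_mult_right[of u x y v z] path_span_mult[of u x y v z]
    by (auto simp: I_eq tok_ideal_def)
qed

sublocale path_ideal G I
  by unfold_locales (rule k_ideal_I)

lemma pcoset_eq_iff_tok:
  assumes "x \<in> verts G" "y \<in> verts G" "f \<in> path_span G x y" "h \<in> path_span G x y"
  shows "pcoset I x y f = pcoset I x y h \<longleftrightarrow> pmap tok f = pmap tok h"
  using assms by (auto simp: pcoset_eq_iff I_eq tok_ideal_def pmap_diff path_span_diff)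

lemma pcoset_zero_iff_tok:
  assumes "x \<in> verts G" "y \<in> verts G" "f \<in> path_span G x y"
  shows "pcoset I x y f = I x y \<longleftrightarrow> pmap tok f = 0"
  using assms by (subst pcoset_eq_zero_iff) (auto simp: I_eq tok_ideal_def)

text \<open>The coordinates of a coset with respect to the tokens; by \<open>coord_pcoset\<close>
  the choice of the representative does not matter.\<close>

definition coord :: "('a list \<Rightarrow>\<^sub>0 'k) set \<Rightarrow> 't \<Rightarrow>\<^sub>0 'k" where
  "coord U = pmap tok (SOME f. f \<in> U)"

lemma coord_pcoset:
  assumes "x \<in> verts G" "y \<in> verts G" "f \<in> path_span G x y"
  shows "coord (pcoset I x y f) = pmap tok f"
proof -
  have "(SOME h. h \<in> pcoset I x y f) \<in> pcoset I x y f"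
    using pcoset_memI[OF assms(1,2)] by (rule someI)
  from pcoset_memD[OF assms(1,2) this] show ?thesis
    using assms(1,2) by (auto simp: coord_def I_eq tok_ideal_def pmap_diff)
qed

text \<open>In other words, the tokens from \<open>x\<close> to \<open>y\<close> index a basis of
  the morphism space: distinct tokens are independent since the ideal is exactly the kernel of
  \<open>pmap tok\<close>.\<close>

lemma coord_bij:
  assumes xy: "x \<in> verts G" "y \<in> verts G"
  shows "bij_betw coord (mor C x y) {g. keys g \<subseteq> tokens x y}"
proof (rule bij_betwI')
  fix U V assume "U \<in> mor C x y" "V \<in> mor C x y"
  then show "coord U = coord V \<longleftrightarrow> U = V"
    by (elim quot_hom_cases[OF xy]) (simp add: xy coord_pcoset pcoset_eq_iff_tok)
next
  fix U assume "U \<in> mor C x y"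
  then show "coord U \<in> {g. keys g \<subseteq> tokens x y}"
    by (elim quot_hom_cases[OF xy]) (simp add: xy coord_pcoset keys_pmap_tok)
next
  fix g :: "'t \<Rightarrow>\<^sub>0 'k" assume "g \<in> {g. keys g \<subseteq> tokens x y}"
  then show "\<exists>U\<in>mor C x y. g = coord U"
    using pmap_tok_section[of g x y] xy
    by (intro bexI[of _ "pcoset I x y (push (tok_rep x y) g)"]) (auto simp: coord_pcoset)
qed

end

section \<open>Local endomorphism rings and finiteness conditions\<close>

lemma lookup_mult_Nil:
  fixes u v :: "'a list \<Rightarrow>\<^sub>0 'k::field"
  shows "lookup (u * v) [] = lookup u [] * lookup v []"
proof -
  have "lookup (u * v) [] = (\<Sum>p\<in>keys u. \<Sum>q\<in>keys v. if p = [] \<and> q = [] then lookup v [] * lookup u [] else 0)"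
    by (simp only: poly_mapping_mult_sum lookup_sum) (intro sum.cong, auto simp: lookup_single when_def)
  also have "\<dots> = (\<Sum>p\<in>keys u. if p = [] then (\<Sum>q\<in>keys v. if q = [] then lookup v [] * lookup u [] else 0) else 0)"
    by (intro sum.cong) auto
  also have "\<dots> = lookup u [] * lookup v []"
    by (simp add: in_keys_iff)
  finally show ?thesis .
qed

lemma lookup_one_Nil: "lookup (1 :: 'a list \<Rightarrow>\<^sub>0 'k::field) p = (if p = [] then 1 else 0)"
  by (simp add: lookup_single when_def flip: single_Nil_one)

lemma keys_power_length:
  fixes f :: "'a list \<Rightarrow>\<^sub>0 'k::field"
  assumes "[] \<notin> keys f"
  shows "p \<in> keys (f ^ n) \<Longrightarrow> n \<le> length p"
proof (induction n arbitrary: p)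
  case (Suc n)
  then obtain a b where "a \<in> keys f" "b \<in> keys (f ^ n)" "p = a @ b"
    using keys_mult[of f "f ^ n"] by (auto simp: plus_list_def)
  then show ?case
    using Suc.IH[of b] assms by (cases a) auto
qed simp

lemma telescope_power:
  fixes s :: "'a::ring_1"
  shows "(1 - s) * (\<Sum>i<n. s ^ i) = 1 - s ^ n" "(\<Sum>i<n. s ^ i) * (1 - s) = 1 - s ^ n"
proof -
  show *: "(1 - s) * (\<Sum>i<n. s ^ i) = 1 - s ^ n"
    by (induction n) (simp_all add: distrib_left left_diff_distrib)
  have "(\<Sum>i<n. s ^ i) * s = s * (\<Sum>i<n. s ^ i)"
    by (simp add: sum_distrib_left sum_distrib_right power_commutes)
  then show "(\<Sum>i<n. s ^ i) * (1 - s) = 1 - s ^ n"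
    using * by (simp add: left_diff_distrib right_diff_distrib)
qed

text \<open>The trivial path is nonzero and alone in its class, so its coefficient is an invariant
  of a coset, and a multiplicative one. Finiteness bounds the length of nonzero paths at a vertex,
  which makes combinations of nontrivial cycles nilpotent.\<close>

locale bounded_token_cat = token_cat G tok I
  for G :: "('v, 'a) pre_digraph" and tok :: "'a list \<Rightarrow> 't option"
    and I :: "'v \<Rightarrow> 'v \<Rightarrow> ('a list \<Rightarrow>\<^sub>0 'k::field) set" +
  assumes tok_Nil: "tok [] \<noteq> None"
    and tok_eq_Nil: "tok p = tok [] \<Longrightarrow> p = []"
    and finite_out: "x \<in> verts G \<Longrightarrow> finite {p. \<exists>y. qpath G x p y \<and> tok p \<noteq> None}"
    and finite_in: "x \<in> verts G \<Longrightarrow> finite {p. \<exists>y. qpath G y p x \<and> tok p \<noteq> None}"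
begin

lemma lookup_Nil_cong:
  fixes f h :: "'a list \<Rightarrow>\<^sub>0 'k"
  assumes "pmap tok f = pmap tok h"
  shows "lookup f [] = lookup h []"
proof -
  obtain t where t: "tok [] = Some t" using tok_Nil by auto
  have "lookup (pmap tok f) t = lookup f []" for f :: "'a list \<Rightarrow>\<^sub>0 'k"
  proof -
    have "{p \<in> keys f. tok p = Some t} = {p \<in> keys f. p = []}"
      using t tok_eq_Nil by auto
    also have "\<dots> = (if [] \<in> keys f then {[]} else {})" by auto
    finally show ?thesis by (simp add: lookup_pmap in_keys_iff)
  qed
  then show ?thesis using assms by metis
qed

text \<open>The \<open>N\<close>-th power of a combination of nontrivial paths involves only paths
  of length at least \<open>N\<close>, while the nonzero paths starting at \<open>x\<close> have
  bounded length.\<close>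

lemma power_in_ideal:
  fixes f :: "'a list \<Rightarrow>\<^sub>0 'k"
  assumes x: "x \<in> verts G" and f: "f \<in> path_span G x x" "lookup f [] = 0"
  obtains N where "pmap tok (f ^ N) = 0"
proof -
  obtain N where N: "\<And>p y. qpath G x p y \<Longrightarrow> tok p \<noteq> None \<Longrightarrow> length p < N"
    using finite_nat_set_iff_bounded[of "length ` {p. \<exists>y. qpath G x p y \<and> tok p \<noteq> None}"] finite_out[OF x]
    by auto
  have "f ^ N \<in> path_span G x x"
    by (induction N) (auto intro: path_span_one x path_span_mult f)
  then have "tok p = None" if "p \<in> keys (f ^ N)" for p
    using N[of p x] that keys_power_length[of f p N] f(2) by (force simp: in_keys_iff path_span_def)
  then have "pmap tok (f ^ N) = pmap (\<lambda>p. None) (f ^ N)"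
    by (intro pmap_cong) auto
  then show thesis
    by (intro that[of N]) (simp add: pmap_def)
qed

text \<open>If the constant term is nonzero, a scalar multiple of \<open>f\<close> has the form
  \<open>1 - s\<close> with \<open>s\<close> nilpotent modulo the ideal, and the inverse is a finite
  geometric series. Conversely the constant term is multiplicative and equals 1 on the
  identity.\<close>

lemma iso_mor_iff:
  fixes f :: "'a list \<Rightarrow>\<^sub>0 'k"
  assumes x: "x \<in> verts G" and f: "f \<in> path_span G x x"
  shows "iso_mor C x x (pcoset I x x f) \<longleftrightarrow> lookup f [] \<noteq> 0"
proof
  assume "iso_mor C x x (pcoset I x x f)"
  then obtain h where "h \<in> path_span G x x" "pcoset I x x (f * h) = pcoset I x x 1"
    using x f by (auto simp: iso_mor_def quot_cmp)
  then have "pmap tok (f * h) = pmap tok 1"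
    using x f by (subst (asm) pcoset_eq_iff_tok) (auto intro: path_span_mult path_span_one)
  then have "lookup (f * h) [] = lookup (1 :: 'a list \<Rightarrow>\<^sub>0 'k) []"
    by (rule lookup_Nil_cong)
  then show "lookup f [] \<noteq> 0"
    by (auto simp: lookup_mult_Nil lookup_one_Nil)
next
  assume c: "lookup f [] \<noteq> 0"
  define a where "a = single ([] :: 'a list) (inverse (lookup f []))"
  define s where "s = 1 - a * f"
  have s: "s \<in> path_span G x x"
    unfolding s_def a_def by (intro path_span_diff path_span_one path_span_scale x f)
  have "lookup s [] = 0"
    using c by (simp add: s_def a_def lookup_minus lookup_one_Nil)
  then obtain N where N: "pmap tok (s ^ N) = 0"
    using power_in_ideal[OF x s] by blast
  define h where "h = a * (\<Sum>i<N. s ^ i)"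
  have pow: "s ^ i \<in> path_span G x x" for i
    by (induction i) (auto intro: path_span_one x path_span_mult s)
  have h: "h \<in> path_span G x x"
    unfolding h_def a_def by (intro path_span_scale path_span_sum pow)
  have af: "a * f = 1 - s" "f * a = 1 - s"
    by (simp_all add: s_def a_def single_Nil_commute)
  have "h * f = (\<Sum>i<N. s ^ i) * (a * f)"
    by (simp add: h_def a_def single_Nil_commute[of _ "sum _ _"] mult.assoc)
  then have 1: "h * f = 1 - s ^ N"
    by (simp add: af telescope_power)
  have "f * h = (f * a) * (\<Sum>i<N. s ^ i)"
    by (simp add: h_def mult.assoc)
  then have 2: "f * h = 1 - s ^ N"
    by (simp add: af telescope_power)
  have "pcoset I x x (1 - s ^ N) = pcoset I x x 1"
    using pcoset_eq_iff_tok[OF x x, of "1 - s ^ N" 1] N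
    by (simp add: pmap_diff path_span_one x path_span_diff pow)
  then show "iso_mor C x x (pcoset I x x f)"
    unfolding iso_mor_def using x f h 1 2
    by (intro conjI bexI[of _ "pcoset I x x h"]) (simp_all add: quot_cmp)
qed

text \<open>The non-invertible endomorphisms are those with constant term 0, and these are closed
  under addition.\<close>

lemma local_end_C: "x \<in> verts G \<Longrightarrow> local_end C x"
proof -
  assume x: "x \<in> verts G"
  have "idt C x \<noteq> \<zero>\<^bsub>Hom C x x\<^esub>"
    using x tok_Nil pcoset_zero_iff_tok[OF x x path_span_one[OF x]]
    by (auto simp: pmap_single single_eq_0 simp flip: single_Nil_one)
  then show ?thesis
    using x by (auto simp: local_end_def quot_add iso_mor_iff path_span_add lookup_add)
qed

lemma not_iso_distinct:
  assumes "x \<in> verts G" "y \<in> verts G" "x \<noteq> y"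
  shows "\<not> iso_mor C x y U"
proof
  assume "iso_mor C x y U"
  then obtain f h where fh: "f \<in> path_span G x y" "h \<in> path_span G y x" "pcoset I x x (f * h) = pcoset I x x 1"
    using assms by (auto simp: iso_mor_def quot_cmp)
  then have "pmap tok (f * h) = pmap tok 1"
    using assms by (subst (asm) pcoset_eq_iff_tok) (auto intro: path_span_mult path_span_one)
  then have "lookup (f * h) [] = lookup (1 :: 'a list \<Rightarrow>\<^sub>0 'k) []"
    by (rule lookup_Nil_cong)
  moreover have "lookup f [] = 0"
    using fh(1) assms by (metis (lifting) awalk_Nil_iff in_keys_iff mem_Collect_eq path_span_def)
  ultimately show False
    by (simp add: lookup_mult_Nil lookup_one_Nil)
qed

text \<open>The cosets of the nonzero paths span, and there are finitely many of these by
  \<open>finite_out\<close>.\<close>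

lemma fin_dim_C:
  assumes xy: "x \<in> verts G" "y \<in> verts G"
  shows "vectorspace.fin_dim class_ring (Hom C x y)"
proof -
  interpret V: vectorspace "class_ring :: 'k ring" "Hom C x y"
    by (rule vectorspace_quot[OF xy])
  define B where "B = {p. qpath G x p y \<and> tok p \<noteq> None}"
  define A where "A = (\<lambda>p. pcoset I x y (single p 1)) ` B"
  have "finite B"
    by (rule finite_subset[OF _ finite_out[OF xy(1)]]) (auto simp: B_def)
  then have fin: "finite A" by (simp add: A_def)
  have A: "A \<subseteq> mor C x y"
    by (auto simp: A_def B_def path_span_single)
  interpret S: submodule "class_ring :: 'k ring" "V.span A" "Hom C x y"
    by (rule V.span_is_submodule[OF A])
  have single: "pcoset I x y (single p c) \<in> V.span A" if "p \<in> B" for p c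
  proof -
    have "pcoset I x y (single p 1) \<in> V.span A"
      using V.in_own_span[OF A] that by (auto simp: A_def)
    from S.smult_closed[OF _ this, of c] show ?thesis
      using xy by (simp add: quot_smult single_mult_single)
  qed
  have "pcoset I x y f \<in> V.span A" if "f \<in> path_span G x y" for f
  proof -
    have sum: "pcoset I x y (\<Sum>p\<in>K. single p (lookup f p)) \<in> V.span A" if "finite K" "K \<subseteq> B" for K
      using that
    proof (induction K)
      case empty
      then show ?case using S.zero_closed by (simp add: pcoset_def)
    next
      case (insert p K)
      then show ?case
        using S.m_closed[OF single[of p "lookup f p"], of "pcoset I x y (\<Sum>p\<in>K. single p (lookup f p))"] xy
        by (simp add: quot_add[OF xy])
    qed
    \<comment> \<open>Terms with token \<open>None\<close> contribute nothing to
      \<open>pmap tok f\<close>, so deleting them leaves the coset unchanged and only paths of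
      \<open>B\<close> remain.\<close>
    let ?h = "\<Sum>p\<in>keys f \<inter> B. single p (lookup f p)"
    have "pmap tok f = pmap tok ?h"
      unfolding pmap_def[of tok f] pmap_sum
      by (rule sum.mono_neutral_cong_right)
         (use that in \<open>auto simp: B_def pmap_single path_span_def split: option.split\<close>)
    then have "pcoset I x y f = pcoset I x y ?h"
      using xy that by (subst pcoset_eq_iff_tok) (auto intro!: path_span_sum path_span_single simp: B_def)
    then show ?thesis
      using sum[of "keys f \<inter> B"] by simp
  qed
  then have "V.span A = mor C x y"
    using S.subset by auto
  then show ?thesis
    unfolding V.fin_dim_def using fin A by auto
qed

lemma nonzero_hom_iff:
  assumes xy: "x \<in> verts G" "y \<in> verts G"
  shows "mor C x y \<noteq> {\<zero>\<^bsub>Hom C x y\<^esub>} \<longleftrightarrow> (\<exists>p. qpath G x p y \<and> tok p \<noteq> None)"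
proof
  assume *: "mor C x y \<noteq> {\<zero>\<^bsub>Hom C x y\<^esub>}"
  have "I x y = pcoset I x y 0"
    by (simp add: pcoset_def)
  then have "I x y \<in> mor C x y"
    by simp
  then obtain f where f: "f \<in> path_span G x y" "pcoset I x y f \<noteq> I x y"
    using * by auto
  then have "pmap tok f \<noteq> 0"
    using xy by (simp add: pcoset_zero_iff_tok)
  then obtain p where "p \<in> keys f" "tok p \<noteq> None"
    by (force simp: pmap_def intro!: sum.neutral split: option.splits)
  then show "\<exists>p. qpath G x p y \<and> tok p \<noteq> None"
    using f(1) by (auto simp: path_span_def)
next
  assume "\<exists>p. qpath G x p y \<and> tok p \<noteq> None"
  then obtain p where p: "qpath G x p y" "tok p \<noteq> None" by blast
  have "pcoset I x y (single p 1) \<noteq> I x y"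
    using p xy by (subst pcoset_zero_iff_tok) (auto simp: pmap_single path_span_single single_eq_0)
  then show "mor C x y \<noteq> {\<zero>\<^bsub>Hom C x y\<^esub>}"
    using path_span_single[OF p(1), of 1] by auto
qed

lemma locally_bounded_C: "locally_bounded C"
  unfolding locally_bounded_def
proof (intro conjI ballI impI)
  fix x assume "x \<in> Ob C"
  then have x: "x \<in> verts G" by simp
  show "finite {y \<in> Ob C. mor C x y \<noteq> {\<zero>\<^bsub>Hom C x y\<^esub>}}"
  proof (rule finite_subset[OF _ finite_imageI[OF finite_out[OF x], of "awlast x"]], rule subsetI)
    fix y assume "y \<in> {y \<in> Ob C. mor C x y \<noteq> {\<zero>\<^bsub>Hom C x y\<^esub>}}"
    then obtain p where p: "qpath G x p y" "tok p \<noteq> None"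
      using nonzero_hom_iff[OF x, of y] by (simp del: quot_path_category_simps(2,3)) blast
    then have "awlast x p = y" by blast
    then show "y \<in> awlast x ` {p. \<exists>y. qpath G x p y \<and> tok p \<noteq> None}"
      using p by blast
  qed
  show "finite {y \<in> Ob C. mor C y x \<noteq> {\<zero>\<^bsub>Hom C y x\<^esub>}}"
  proof (rule finite_subset[OF _ finite_imageI[OF finite_in[OF x], of "awhd x"]], rule subsetI)
    fix y assume "y \<in> {y \<in> Ob C. mor C y x \<noteq> {\<zero>\<^bsub>Hom C y x\<^esub>}}"
    then obtain p where p: "qpath G y p x" "tok p \<noteq> None"
      using nonzero_hom_iff[OF _ x, of y] by (simp del: quot_path_category_simps(2,3)) blast
    then have "awhd x p = y"
      by (cases p) (auto simp: awalk_Nil_iff awalk_Cons_iff)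
    then show "y \<in> awhd x ` {p. \<exists>y. qpath G y p x \<and> tok p \<noteq> None}"
      using p by blast
  qed
qed (auto simp: k_category_quot local_end_C not_iso_distinct fin_dim_C
    simp del: quot_path_category_simps(2,3))

end

section \<open>Functors induced by quiver maps\<close>

text \<open>All spaces are given by coordinates, \<open>V i\<close> on \<open>T i\<close> and
  \<open>W\<close> on \<open>S\<close>, and \<open>L i\<close> sends basis vectors to basis vectors
  along \<open>ft\<close>. A bijection from the disjoint union of the \<open>T i\<close> to
  \<open>S\<close> therefore makes the sum map bijective. This reduces the covering condition to a
  statement about bases.\<close>

lemma direct_sum_families_bij:
  fixes \<chi> :: "'i \<Rightarrow> 'm \<Rightarrow> 't \<Rightarrow>\<^sub>0 'k::field" and \<psi> :: "'n \<Rightarrow> 's \<Rightarrow>\<^sub>0 'k"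
  assumes \<chi>: "\<And>i. i \<in> J \<Longrightarrow> bij_betw (\<chi> i) (carrier (V i)) {g. keys g \<subseteq> T i}"
    and \<chi>0: "\<And>i. i \<in> J \<Longrightarrow> \<zero>\<^bsub>V i\<^esub> \<in> carrier (V i) \<and> \<chi> i \<zero>\<^bsub>V i\<^esub> = 0"
    and \<psi>: "bij_betw \<psi> (carrier W) {g. keys g \<subseteq> S}"
    and \<psi>_finsum: "\<And>(A :: 'i set) h. finite A \<Longrightarrow> h \<in> A \<rightarrow> carrier W \<Longrightarrow>
      (\<Oplus>\<^bsub>W\<^esub> i\<in>A. h i) \<in> carrier W \<and> \<psi> (\<Oplus>\<^bsub>W\<^esub> i\<in>A. h i) = (\<Sum>i\<in>A. \<psi> (h i))"
    and L: "\<And>i u. i \<in> J \<Longrightarrow> u \<in> carrier (V i) \<Longrightarrow> L i u \<in> carrier W \<and> \<psi> (L i u) = push ft (\<chi> i u)"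
    and ft: "bij_betw (\<lambda>(i, t). ft t) (Sigma J T) S"
  shows "bij_betw (\<lambda>\<phi>. \<Oplus>\<^bsub>W\<^esub> i\<in>{i \<in> J. \<phi> i \<noteq> \<zero>\<^bsub>V i\<^esub>}. L i (\<phi> i)) (direct_sum_families J V) (carrier W)"
proof -
  define D where "D = direct_sum_families J V"
  define supp where "supp \<phi> = {i \<in> J. \<phi> i \<noteq> \<zero>\<^bsub>V i\<^esub>}" for \<phi>
  define F where "F \<phi> = (\<Oplus>\<^bsub>W\<^esub> i\<in>supp \<phi>. L i (\<phi> i))" for \<phi>
  have D: "\<phi> i \<in> carrier (V i)" "finite (supp \<phi>)" if "\<phi> \<in> D" "i \<in> J" for \<phi> i
    using that by (auto simp: D_def direct_sum_families_def supp_def)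
  have fin: "finite (supp \<phi>)" if "\<phi> \<in> D" for \<phi>
    using that by (auto simp: D_def direct_sum_families_def supp_def)
  have F: "F \<phi> \<in> carrier W" "\<psi> (F \<phi>) = (\<Sum>i\<in>supp \<phi>. push ft (\<chi> i (\<phi> i)))" if "\<phi> \<in> D" for \<phi>
  proof -
    have "(\<lambda>i. L i (\<phi> i)) \<in> supp \<phi> \<rightarrow> carrier W"
      using L D[OF that] by (auto simp: supp_def)
    from \<psi>_finsum[OF fin[OF that] this]
    show "F \<phi> \<in> carrier W" "\<psi> (F \<phi>) = (\<Sum>i\<in>supp \<phi>. push ft (\<chi> i (\<phi> i)))"
      using L D[OF that] by (auto simp: F_def supp_def intro!: sum.cong)
  qed
  have inj: "i = j \<and> t = t'" if "i \<in> J" "j \<in> J" "t \<in> T i" "t' \<in> T j" "ft t = ft t'" for i j t t'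
    using bij_betw_imp_inj_on[OF ft] that by (auto simp: inj_on_def)
  have keys: "keys (\<chi> i u) \<subseteq> T i" if "i \<in> J" "u \<in> carrier (V i)" for i u
    using bij_betwE[OF \<chi>[OF that(1)]] that(2) by auto
  \<comment> \<open>Injectivity of \<open>ft\<close> on the disjoint union separates the summands:
    the coordinate of the sum at \<open>ft t\<close> comes from the component \<open>i\<close>
    alone.\<close>
  have lookup: "lookup (\<psi> (F \<phi>)) (ft t) = lookup (\<chi> i (\<phi> i)) t"
    if \<phi>: "\<phi> \<in> D" and i: "i \<in> J" "t \<in> T i" for \<phi> i t
  proof -
    have "lookup (push ft (\<chi> j (\<phi> j))) (ft t) = (if j = i then lookup (\<chi> i (\<phi> i)) t else 0)" if "j \<in> J" for j
    proof -
      have "{p \<in> keys (\<chi> j (\<phi> j)). Some (ft p) = Some (ft t)} = (if j = i then keys (\<chi> i (\<phi> i)) \<inter> {t} else {})"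
        using keys[OF that D(1)[OF \<phi> that]] inj[OF that i(1) _ i(2)] by auto
      then show ?thesis
        by (simp add: lookup_pmap Int_insert_right not_in_keys_iff_lookup_eq_zero)
    qed
    then have "lookup (\<psi> (F \<phi>)) (ft t) = (\<Sum>j\<in>supp \<phi>. if j = i then lookup (\<chi> i (\<phi> i)) t else 0)"
      unfolding F(2)[OF \<phi>] lookup_sum by (intro sum.cong) (auto simp: supp_def)
    also have "\<dots> = lookup (\<chi> i (\<phi> i)) t"
      using fin[OF \<phi>] \<chi>0[OF i(1)] i by (auto simp: supp_def)
    finally show ?thesis .
  qed
  have "bij_betw F D (carrier W)"
  proof (rule bij_betwI')
    fix \<phi> \<phi>' assume \<phi>: "\<phi> \<in> D" "\<phi>' \<in> D"
    show "F \<phi> = F \<phi>' \<longleftrightarrow> \<phi> = \<phi>'"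
    proof
      assume eq: "F \<phi> = F \<phi>'"
      have "\<phi> i = \<phi>' i" if "i \<in> J" for i
      proof -
        have "\<chi> i (\<phi> i) = \<chi> i (\<phi>' i)"
        proof (rule poly_mapping_eqI)
          fix t
          have "t \<notin> keys (\<chi> i (\<phi> i))" "t \<notin> keys (\<chi> i (\<phi>' i))" if "t \<notin> T i"
            using that keys[OF \<open>i \<in> J\<close> D(1)[OF \<phi>(1) \<open>i \<in> J\<close>]] keys[OF \<open>i \<in> J\<close> D(1)[OF \<phi>(2) \<open>i \<in> J\<close>]]
            by auto
          then show "lookup (\<chi> i (\<phi> i)) t = lookup (\<chi> i (\<phi>' i)) t"
            using lookup[OF \<phi>(1) that, of t] lookup[OF \<phi>(2) that, of t] eq
            by (cases "t \<in> T i") (auto simp: not_in_keys_iff_lookup_eq_zero)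
        qed
        then show ?thesis
          using bij_betw_imp_inj_on[OF \<chi>[OF that]] D(1)[OF \<phi>(1) that] D(1)[OF \<phi>(2) that]
          by (auto dest: inj_onD)
      qed
      then show "\<phi> = \<phi>'"
        using \<phi> by (intro PiE_ext[of \<phi> J "\<lambda>i. carrier (V i)"]) (auto simp: D_def direct_sum_families_def)
    qed simp
  next
    fix \<phi> assume "\<phi> \<in> D"
    then show "F \<phi> \<in> carrier W" by (rule F)
  next
    fix w assume w: "w \<in> carrier W"
    define g where "g = \<psi> w"
    have g: "keys g \<subseteq> S" using bij_betwE[OF \<psi>] w by (auto simp: g_def)
    \<comment> \<open>For surjectivity the support of \<open>g\<close> is split according to the
      index over which each of its elements lies; \<open>h i\<close> collects the part over
      \<open>i\<close>.\<close>
    define K where "K i = {t \<in> T i. ft t \<in> keys g}" for i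
    have finK: "finite (K i)" if "i \<in> J" for i
      by (rule finite_imageD[of ft])
         (auto simp: K_def inj_on_def dest: inj[OF that that] intro: finite_subset[of _ "keys g"])
    define h where "h i = (\<Sum>t\<in>K i. single t (lookup g (ft t)))" for i
    have h_lookup: "lookup (h i) t = (if t \<in> T i then lookup g (ft t) else 0)" if "i \<in> J" for i t
    proof -
      have "lookup (h i) t = (\<Sum>s\<in>K i. if s = t then lookup g (ft t) else 0)"
        unfolding h_def lookup_sum by (intro sum.cong) (auto simp: lookup_single when_def)
      then show ?thesis
        using finK[OF that] by (auto simp: K_def in_keys_iff)
    qed
    have "\<exists>u\<in>carrier (V i). \<chi> i u = h i" if "i \<in> J" for i
    proof -
      have "keys (h i) \<subseteq> T i" using h_lookup[OF that] by (auto simp: in_keys_iff split: if_splits)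
      then show ?thesis using \<chi>[OF that] by (force simp: bij_betw_def image_iff)
    qed
    then obtain u where u: "\<And>i. i \<in> J \<Longrightarrow> u i \<in> carrier (V i) \<and> \<chi> i (u i) = h i" by metis
    define \<phi> where "\<phi> = restrict u J"
    have sub: "supp \<phi> \<subseteq> {i \<in> J. K i \<noteq> {}}"
    proof
      fix i assume "i \<in> supp \<phi>"
      then have i: "i \<in> J" "u i \<noteq> \<zero>\<^bsub>V i\<^esub>" by (auto simp: supp_def \<phi>_def)
      then have "h i \<noteq> 0"
        using u[OF i(1)] \<chi>0[OF i(1)] bij_betw_imp_inj_on[OF \<chi>[OF i(1)]] by (metis inj_onD)
      then show "i \<in> {i \<in> J. K i \<noteq> {}}" using i by (auto simp: h_def)
    qed
    \<comment> \<open>Each such index is recovered from an element of the finite support of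
      \<open>g\<close>, namely from its unique preimage in the disjoint union.\<close>
    have "finite {i \<in> J. K i \<noteq> {}}"
    proof (rule finite_surj[of "keys g" _ "\<lambda>s. fst (SOME it. it \<in> Sigma J T \<and> ft (snd it) = s)"])
      show "{i \<in> J. K i \<noteq> {}} \<subseteq> (\<lambda>s. fst (SOME it. it \<in> Sigma J T \<and> ft (snd it) = s)) ` keys g"
      proof
        fix i assume "i \<in> {i \<in> J. K i \<noteq> {}}"
        then obtain t where t: "i \<in> J" "t \<in> T i" "ft t \<in> keys g" by (auto simp: K_def)
        have "(SOME it. it \<in> Sigma J T \<and> ft (snd it) = ft t) = (i, t)"
          by (rule some_equality) (use t inj in auto)
        then show "i \<in> (\<lambda>s. fst (SOME it. it \<in> Sigma J T \<and> ft (snd it) = s)) ` keys g"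
          using t by (intro image_eqI[of _ _ "ft t"]) auto
      qed
    qed simp
    then have \<phi>D: "\<phi> \<in> D"
      using finite_subset[OF sub] u by (auto simp: D_def direct_sum_families_def supp_def \<phi>_def)
    have "\<psi> (F \<phi>) = g"
    proof (rule poly_mapping_eqI)
      fix s
      show "lookup (\<psi> (F \<phi>)) s = lookup g s"
      proof (cases "s \<in> S")
        case True
        then obtain i t where "i \<in> J" "t \<in> T i" "s = ft t"
          using ft by (auto simp: bij_betw_def)
        then show ?thesis
          using lookup[OF \<phi>D, of i t] u h_lookup by (simp add: \<phi>_def)
      next
        case False
        moreover have "keys (\<psi> (F \<phi>)) \<subseteq> S"
          using bij_betwE[OF \<psi>] F(1)[OF \<phi>D] by auto
        ultimately show ?thesis using g by (metis in_keys_iff subsetD)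
      qed
    qed
    then have "F \<phi> = w"
      using bij_betw_imp_inj_on[OF \<psi>] F(1)[OF \<phi>D] w by (auto simp: g_def dest: inj_onD)
    then show "\<exists>\<phi>\<in>D. w = F \<phi>" using \<phi>D by auto
  qed
  then show ?thesis
    unfolding F_def D_def supp_def .
qed

lemma (in token_cat) coord_zero: "x \<in> verts G \<Longrightarrow> y \<in> verts G \<Longrightarrow> coord (I x y) = 0"
  using coord_pcoset[of x y 0] by (simp add: pcoset_def)

lemma (in token_cat) coord_finsum:
  assumes xy: "x \<in> verts G" "y \<in> verts G" and A: "finite A" "h \<in> A \<rightarrow> mor C x y"
  shows "(\<Oplus>\<^bsub>Hom C x y\<^esub> i\<in>A. h i) \<in> mor C x y" "coord (\<Oplus>\<^bsub>Hom C x y\<^esub> i\<in>A. h i) = (\<Sum>i\<in>A. coord (h i))"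
proof -
  have "\<forall>i\<in>A. \<exists>f. f \<in> path_span G x y \<and> h i = pcoset I x y f" using A(2) by auto
  then obtain f where f: "\<And>i. i \<in> A \<Longrightarrow> f i \<in> path_span G x y \<and> h i = pcoset I x y (f i)"
    by metis
  interpret V: vectorspace "class_ring :: 'k ring" "Hom C x y"
    by (rule vectorspace_quot[OF xy])
  have "(\<Oplus>\<^bsub>Hom C x y\<^esub> i\<in>A. h i) = (\<Oplus>\<^bsub>Hom C x y\<^esub> i\<in>A. pcoset I x y (f i))"
    by (rule V.M.finsum_cong') (use f A in auto)
  then have *: "(\<Oplus>\<^bsub>Hom C x y\<^esub> i\<in>A. h i) = pcoset I x y (sum f A)"
    using quot_finsum[OF xy A(1), of f] f by simp
  show "(\<Oplus>\<^bsub>Hom C x y\<^esub> i\<in>A. h i) \<in> mor C x y"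
    unfolding * using f by (auto intro: path_span_sum)
  show "coord (\<Oplus>\<^bsub>Hom C x y\<^esub> i\<in>A. h i) = (\<Sum>i\<in>A. coord (h i))"
    unfolding * using f xy by (simp add: coord_pcoset path_span_sum pmap_sum)
qed

definition path_functor ::
  "('w \<Rightarrow> 'w \<Rightarrow> ('b list \<Rightarrow>\<^sub>0 'k::field) set) \<Rightarrow> ('v \<Rightarrow> 'w) \<Rightarrow> ('a \<Rightarrow> 'b) \<Rightarrow>
    ('v, ('a list \<Rightarrow>\<^sub>0 'k) set, 'w, ('b list \<Rightarrow>\<^sub>0 'k) set) kfunc" where
  "path_functor I fv fa =
    \<lparr>fob = fv, fmor = (\<lambda>x y U. \<Union>f\<in>U. pcoset I (fv x) (fv y) (push (map fa) f))\<rparr>"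

text \<open>By \<open>tok_map\<close> a path is nonzero exactly if its image is, and parallel paths
  with equal tokens have images with equal tokens. Thus the quiver map induces a functor that acts
  on the bases of tokens by \<open>ft\<close>.\<close>

locale token_cat_map = S: token_cat G' tok' I' + T: token_cat G tok I
  for G' :: "('w, 'b) pre_digraph" and tok' :: "'b list \<Rightarrow> 's option"
    and I' :: "'w \<Rightarrow> 'w \<Rightarrow> ('b list \<Rightarrow>\<^sub>0 'k::field) set"
    and G :: "('v, 'a) pre_digraph" and tok :: "'a list \<Rightarrow> 't option"
    and I :: "'v \<Rightarrow> 'v \<Rightarrow> ('a list \<Rightarrow>\<^sub>0 'k) set" +
  fixes fv :: "'w \<Rightarrow> 'v" and fa :: "'b \<Rightarrow> 'a" and ft :: "'s \<Rightarrow> 't"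
  assumes fv_verts: "x \<in> verts G' \<Longrightarrow> fv x \<in> verts G"
    and map_path: "qpath G' x p y \<Longrightarrow> qpath G (fv x) (map fa p) (fv y)"
    and tok_map: "qpath G' x p y \<Longrightarrow> tok (map fa p) = map_option ft (tok' p)"
begin

abbreviation "F \<equiv> path_functor I fv fa"

lemma push_span: "f \<in> path_span G' x y \<Longrightarrow> push (map fa) f \<in> path_span G (fv x) (fv y)"
  using map_path by (fastforce simp: path_span_def dest!: keys_pmap)

lemma pmap_tok_push:
  assumes "f \<in> path_span G' x y"
  shows "pmap tok (push (map fa) f) = push ft (pmap tok' f)"
  unfolding pmap_push pmap_pmap
  by (rule pmap_cong) (use assms tok_map in \<open>auto simp: path_span_def map_option_case split: option.split\<close>)

lemma F_pcoset:
  assumes "x \<in> verts G'" "y \<in> verts G'" "f \<in> path_span G' x y"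
  shows "fmor F x y (pcoset I' x y f) = pcoset I (fv x) (fv y) (push (map fa) f)"
proof -
  have "(\<Union>f\<in>pcoset I' x y f. pcoset I (fv x) (fv y) (push (map fa) f)) =
      pcoset I (fv x) (fv y) (push (map fa) f)"
  proof (rule S.pcoset_UN[OF assms(1,2)])
    fix h assume h: "h \<in> pcoset I' x y f"
    then have "pcoset I' x y h = pcoset I' x y f"
      using assms by (simp add: S.pcoset_eq_iff S.pcoset_memD)
    moreover have hs: "h \<in> path_span G' x y"
      by (rule S.pcoset_mem_span[OF assms(1,2) h assms(3)])
    ultimately have "pmap tok' h = pmap tok' f"
      using assms by (simp add: S.pcoset_eq_iff_tok)
    then show "pcoset I (fv x) (fv y) (push (map fa) h) = pcoset I (fv x) (fv y) (push (map fa) f)"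
      using assms hs by (subst T.pcoset_eq_iff_tok) (auto simp: fv_verts push_span pmap_tok_push)
  qed
  then show ?thesis by (simp add: path_functor_def)
qed

lemma fob_F [simp]: "fob F = fv"
  by (simp add: path_functor_def)

lemma F_closed:
  assumes "x \<in> verts G'" "y \<in> verts G'" "U \<in> mor S.C x y"
  shows "fmor F x y U \<in> mor T.C (fv x) (fv y)"
  using assms by (elim S.quot_hom_cases[OF assms(1,2)]) (simp add: F_pcoset push_span)

lemma coord_F:
  assumes "x \<in> verts G'" "y \<in> verts G'" "U \<in> mor S.C x y"
  shows "T.coord (fmor F x y U) = push ft (S.coord U)"
  using assms by (elim S.quot_hom_cases[OF assms(1,2)])
    (simp add: F_pcoset push_span T.coord_pcoset fv_verts S.coord_pcoset pmap_tok_push)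

lemma k_functor_F: "k_functor S.C T.C F"
  unfolding k_functor_def
proof (intro conjI ballI)
  fix x assume "x \<in> Ob S.C"
  then show "fob F x \<in> Ob T.C" by (simp add: fv_verts)
  show "fmor F x x (idt S.C x) = idt T.C (fob F x)"
    using \<open>x \<in> Ob S.C\<close> by (simp add: F_pcoset path_span_one push_map_one)
next
  fix x y assume xy: "x \<in> Ob S.C" "y \<in> Ob S.C"
  then have xy': "x \<in> verts G'" "y \<in> verts G'" by auto
  show "fmor F x y \<in> LinearCombinations.module_hom class_ring (Hom S.C x y) (Hom T.C (fob F x) (fob F y))"
    unfolding LinearCombinations.module_hom_def using xy'
    by (auto simp: F_pcoset push_span S.quot_add T.quot_add S.quot_smult T.quot_smult fv_verts
        path_span_add path_span_scale pmap_add push_map_scale)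
next
  fix x y z u v
  assume "x \<in> Ob S.C" "y \<in> Ob S.C" "z \<in> Ob S.C" "u \<in> mor S.C x y" "v \<in> mor S.C y z"
  then show "fmor F x z (cmp S.C x y z v u) =
      cmp T.C (fob F x) (fob F y) (fob F z) (fmor F y z v) (fmor F x y u)"
    by (auto simp: F_pcoset S.quot_cmp T.quot_cmp push_span fv_verts S.path_span_mult push_map_mult)
qed

lemma tokens_map: "t \<in> S.tokens x y \<Longrightarrow> ft t \<in> T.tokens (fv x) (fv y)"
proof -
  assume "t \<in> S.tokens x y"
  then obtain p where "qpath G' x p y" "tok' p = Some t"
    by (auto simp: S.tokens_def)
  then show "ft t \<in> T.tokens (fv x) (fv y)"
    using map_path tok_map by (intro T.tokensI[of _ "map fa p"]) auto
qed

text \<open>Both covering conditions become unique lifting of a token, once its end and once its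
  start is prescribed upstairs; the lifted token and its other end are then determined
  together.\<close>

lemma covering_functor_F:
  assumes lift_in: "\<And>a y t. a \<in> verts G \<Longrightarrow> y \<in> verts G' \<Longrightarrow> t \<in> T.tokens a (fv y) \<Longrightarrow>
      \<exists>z t'. z \<in> verts G' \<and> fv z = a \<and> t' \<in> S.tokens z y \<and> ft t' = t"
    and lift_in_unique: "\<And>y z z' t t'. y \<in> verts G' \<Longrightarrow> z \<in> verts G' \<Longrightarrow> z' \<in> verts G' \<Longrightarrow> fv z = fv z' \<Longrightarrow>
      t \<in> S.tokens z y \<Longrightarrow> t' \<in> S.tokens z' y \<Longrightarrow> ft t = ft t' \<Longrightarrow> z = z' \<and> t = t'"
    and lift_out: "\<And>b x t. b \<in> verts G \<Longrightarrow> x \<in> verts G' \<Longrightarrow> t \<in> T.tokens (fv x) b \<Longrightarrow>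
      \<exists>z t'. z \<in> verts G' \<and> fv z = b \<and> t' \<in> S.tokens x z \<and> ft t' = t"
    and lift_out_unique: "\<And>x z z' t t'. x \<in> verts G' \<Longrightarrow> z \<in> verts G' \<Longrightarrow> z' \<in> verts G' \<Longrightarrow> fv z = fv z' \<Longrightarrow>
      t \<in> S.tokens x z \<Longrightarrow> t' \<in> S.tokens x z' \<Longrightarrow> ft t = ft t' \<Longrightarrow> z = z' \<and> t = t'"
  shows "covering_functor S.C T.C F"
  unfolding covering_functor_def
proof (intro conjI ballI k_functor_F)
  fix a y assume "a \<in> Ob T.C" "y \<in> Ob S.C"
  then have ay: "a \<in> verts G" "y \<in> verts G'" by auto
  show "bij_betw
      (\<lambda>\<phi>. \<Oplus>\<^bsub>Hom T.C a (fob F y)\<^esub> z \<in> {z \<in> fibre S.C F a. \<phi> z \<noteq> \<zero>\<^bsub>Hom S.C z y\<^esub>}. fmor F z y (\<phi> z))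
      (direct_sum_families (fibre S.C F a) (\<lambda>z. Hom S.C z y)) (mor T.C a (fob F y))"
  proof (rule direct_sum_families_bij[where T = "\<lambda>z. S.tokens z y" and S = "T.tokens a (fv y)"
        and \<chi> = "\<lambda>z. S.coord" and \<psi> = T.coord and ft = ft])
    show "bij_betw S.coord (mor S.C z y) {g. keys g \<subseteq> S.tokens z y}" if "z \<in> fibre S.C F a" for z
      using that ay by (intro S.coord_bij) auto
    show "\<zero>\<^bsub>Hom S.C z y\<^esub> \<in> mor S.C z y \<and> S.coord \<zero>\<^bsub>Hom S.C z y\<^esub> = 0" if "z \<in> fibre S.C F a" for z
      using that ay by (simp add: S.coord_zero) (metis S.quot_zero imageI path_span_zero quot_path_category_simps(3))
    show "bij_betw T.coord (mor T.C a (fob F y)) {g. keys g \<subseteq> T.tokens a (fv y)}"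
      using ay fv_verts by (simp del: quot_path_category_simps add: T.coord_bij)
    show "(\<Oplus>\<^bsub>Hom T.C a (fob F y)\<^esub> i\<in>A. h i) \<in> mor T.C a (fob F y) \<and>
        T.coord (\<Oplus>\<^bsub>Hom T.C a (fob F y)\<^esub> i\<in>A. h i) = (\<Sum>i\<in>A. T.coord (h i))"
      if "finite A" "h \<in> A \<rightarrow> mor T.C a (fob F y)" for A h
      using T.coord_finsum[OF ay(1) fv_verts[OF ay(2)] that(1), of h] that(2) by simp
    show "fmor F z y u \<in> mor T.C a (fob F y) \<and> T.coord (fmor F z y u) = push ft (S.coord u)"
      if "z \<in> fibre S.C F a" "u \<in> mor S.C z y" for z u
      using that ay F_closed[of z y u] coord_F[of z y u] by auto
    show "bij_betw (\<lambda>(z, t). ft t) (Sigma (fibre S.C F a) (\<lambda>z. S.tokens z y)) (T.tokens a (fv y))"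
      unfolding bij_betw_def inj_on_def
      using lift_in[OF ay] lift_in_unique[OF ay(2)] tokens_map by (fastforce simp: image_iff)
  qed
next
  fix b x assume "b \<in> Ob T.C" "x \<in> Ob S.C"
  then have ay: "b \<in> verts G" "x \<in> verts G'" by auto
  show "bij_betw
      (\<lambda>\<phi>. \<Oplus>\<^bsub>Hom T.C (fob F x) b\<^esub> z \<in> {z \<in> fibre S.C F b. \<phi> z \<noteq> \<zero>\<^bsub>Hom S.C x z\<^esub>}. fmor F x z (\<phi> z))
      (direct_sum_families (fibre S.C F b) (\<lambda>z. Hom S.C x z)) (mor T.C (fob F x) b)"
  proof (rule direct_sum_families_bij[where T = "\<lambda>z. S.tokens x z" and S = "T.tokens (fv x) b"
        and \<chi> = "\<lambda>z. S.coord" and \<psi> = T.coord and ft = ft])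
    show "bij_betw S.coord (mor S.C x z) {g. keys g \<subseteq> S.tokens x z}" if "z \<in> fibre S.C F b" for z
      using that ay by (intro S.coord_bij) auto
    show "\<zero>\<^bsub>Hom S.C x z\<^esub> \<in> mor S.C x z \<and> S.coord \<zero>\<^bsub>Hom S.C x z\<^esub> = 0" if "z \<in> fibre S.C F b" for z
      using that ay by (simp add: S.coord_zero) (metis S.quot_zero imageI path_span_zero quot_path_category_simps(3))
    show "bij_betw T.coord (mor T.C (fob F x) b) {g. keys g \<subseteq> T.tokens (fv x) b}"
      using ay fv_verts by (simp del: quot_path_category_simps add: T.coord_bij)
    show "(\<Oplus>\<^bsub>Hom T.C (fob F x) b\<^esub> i\<in>A. h i) \<in> mor T.C (fob F x) b \<and>
        T.coord (\<Oplus>\<^bsub>Hom T.C (fob F x) b\<^esub> i\<in>A. h i) = (\<Sum>i\<in>A. T.coord (h i))"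
      if "finite A" "h \<in> A \<rightarrow> mor T.C (fob F x) b" for A h
      using T.coord_finsum[OF fv_verts[OF ay(2)] ay(1) that(1), of h] that(2) by simp
    show "fmor F x z u \<in> mor T.C (fob F x) b \<and> T.coord (fmor F x z u) = push ft (S.coord u)"
      if "z \<in> fibre S.C F b" "u \<in> mor S.C x z" for z u
      using that ay F_closed[of x z u] coord_F[of x z u] by auto
    show "bij_betw (\<lambda>(z, t). ft t) (Sigma (fibre S.C F b) (\<lambda>z. S.tokens x z)) (T.tokens (fv x) b)"
      unfolding bij_betw_def inj_on_def
      using lift_out[OF ay] lift_out_unique[OF ay(2)] tokens_map by (fastforce simp: image_iff)
  qed
qed

end

text \<open>The composite maps are compared only at \<open>x\<close>, \<open>y\<close> and on
  arrows. This is essential in the applications, where identities such as \<open>tgt\<close> after a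
  deck transformation being \<open>tgt\<close> hold on the cover but not on the whole type.\<close>

lemma path_functor_comp:
  fixes I1 :: "'u \<Rightarrow> 'u \<Rightarrow> ('a list \<Rightarrow>\<^sub>0 'k::field) set"
  assumes "token_cat_map G1 tok1 I1 G2 tok2 I2 fv fa ft" "token_cat_map G2 tok2 I2 G3 tok3 I3 fv' fa' ft'"
    and xy: "x \<in> verts G1" "y \<in> verts G1" and U: "U \<in> mor (quot_path_category G1 I1) x y"
    and fv'': "fv'' x = fv' (fv x)" "fv'' y = fv' (fv y)" and fa'': "\<And>a. a \<in> arcs G1 \<Longrightarrow> fa'' a = fa' (fa a)"
  shows "fmor (path_functor I3 fv' fa') (fv x) (fv y) (fmor (path_functor I2 fv fa) x y U) =
    fmor (path_functor I3 fv'' fa'') x y U"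
proof -
  interpret M: token_cat_map G1 tok1 I1 G2 tok2 I2 fv fa ft by fact
  interpret N: token_cat_map G2 tok2 I2 G3 tok3 I3 fv' fa' ft' by fact
  from U obtain f where f: "f \<in> path_span G1 x y" "U = pcoset I1 x y f" by auto
  have push: "push (map fa') (push (map fa) h) = push (map fa'') h" if "h \<in> path_span G1 x y" for h :: "_ \<Rightarrow>\<^sub>0 'k"
    unfolding pmap_push
  proof (rule pmap_cong)
    fix p assume "p \<in> keys h"
    then have "set p \<subseteq> arcs G1"
      using that by (auto simp: path_span_def)
    then show "Some (map fa' (map fa p)) = Some (map fa'' p)"
      using fa'' by auto
  qed
  have "fmor (path_functor I3 fv' fa') (fv x) (fv y) (fmor (path_functor I2 fv fa) x y U) =
      pcoset I3 (fv' (fv x)) (fv' (fv y)) (push (map fa'') f)"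
    using f xy by (simp add: M.F_pcoset N.F_pcoset M.fv_verts M.push_span push)
  also have "\<dots> = fmor (path_functor I3 fv'' fa'') x y U"
  proof -
    have "(\<Union>h\<in>U. pcoset I3 (fv'' x) (fv'' y) (push (map fa'') h)) = pcoset I3 (fv'' x) (fv'' y) (push (map fa'') f)"
      unfolding f(2)
    proof (rule M.S.pcoset_UN[OF xy])
      fix h assume h: "h \<in> pcoset I1 x y f"
      then have hs: "h \<in> path_span G1 x y"
        using M.S.pcoset_mem_span[OF xy h f(1)] by simp
      have "pcoset I1 x y h = pcoset I1 x y f"
        using h xy by (simp add: M.S.pcoset_eq_iff M.S.pcoset_memD)
      from arg_cong[OF this, of "\<lambda>U. fmor (path_functor I3 fv' fa') (fv x) (fv y) (fmor (path_functor I2 fv fa) x y U)"]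
      show "pcoset I3 (fv'' x) (fv'' y) (push (map fa'') h) = pcoset I3 (fv'' x) (fv'' y) (push (map fa'') f)"
        using hs f xy by (simp add: M.F_pcoset N.F_pcoset M.fv_verts M.push_span push fv'')
    qed
    then show ?thesis by (simp add: path_functor_def fv'')
  qed
  finally show ?thesis .
qed

lemma path_functor_id:
  fixes I :: "'v \<Rightarrow> 'v \<Rightarrow> ('a list \<Rightarrow>\<^sub>0 'k::field) set"
  assumes "path_ideal G I" "x \<in> verts G" "y \<in> verts G" "U \<in> mor (quot_path_category G I) x y"
    and fv: "fv x = x" "fv y = y" and fa: "\<And>a. a \<in> arcs G \<Longrightarrow> fa a = a"
  shows "fmor (path_functor I fv fa) x y U = U"
proof -
  interpret path_ideal G I by fact
  from assms obtain f where f: "f \<in> path_span G x y" "U = pcoset I x y f" by auto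
  have push: "push (map fa) h = h" if "h \<in> path_span G x y" for h :: "_ \<Rightarrow>\<^sub>0 'k"
  proof -
    have "push (map fa) h = pmap Some h"
    proof (rule pmap_cong)
      fix p assume "p \<in> keys h"
      then have "set p \<subseteq> arcs G" using that by (auto simp: path_span_def)
      then show "Some (map fa p) = Some p" using fa by (auto intro!: map_idI)
    qed
    then show ?thesis by simp
  qed
  have "(\<Union>h\<in>U. pcoset I x y (push (map fa) h)) = pcoset I x y (push (map fa) f)"
    unfolding f(2)
  proof (rule pcoset_UN[OF assms(2,3)])
    fix h assume h: "h \<in> pcoset I x y f"
    then have "h \<in> path_span G x y" "pcoset I x y h = pcoset I x y f"
      using pcoset_mem_span[OF assms(2,3) h f(1)] assms(2,3) by (simp_all add: pcoset_eq_iff pcoset_memD)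
    then show "pcoset I x y (push (map fa) h) = pcoset I x y (push (map fa) f)"
      using f by (simp add: push)
  qed
  then show ?thesis
    using f by (simp add: path_functor_def fv push)
qed

section \<open>The automorphism group of a linear category\<close>

lemma restrict_func_fob: "x \<in> Ob C \<Longrightarrow> fob (restrict_func C F) x = fob F x"
  by (simp add: restrict_func_def)

lemma restrict_func_fmor:
  "x \<in> Ob C \<Longrightarrow> y \<in> Ob C \<Longrightarrow> u \<in> mor C x y \<Longrightarrow> fmor (restrict_func C F) x y u = fmor F x y u"
  by (simp add: restrict_func_def)

lemma restrict_func_cong:
  assumes "\<And>x. x \<in> Ob C \<Longrightarrow> fob F x = fob F' x"
    and "\<And>x y u. x \<in> Ob C \<Longrightarrow> y \<in> Ob C \<Longrightarrow> u \<in> mor C x y \<Longrightarrow> fmor F x y u = fmor F' x y u"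
  shows "restrict_func C F = restrict_func C F'"
  using assms by (auto simp: restrict_func_def restrict_def fun_eq_iff)

lemma restrict_func_idem [simp]: "restrict_func C (restrict_func C F) = restrict_func C F"
  by (rule restrict_func_cong) (simp_all add: restrict_func_fob restrict_func_fmor)

lemma k_functor_cong:
  assumes "k_category C" "k_functor C D F"
    and ob: "\<And>x. x \<in> Ob C \<Longrightarrow> fob F' x = fob F x"
    and mo: "\<And>x y u. x \<in> Ob C \<Longrightarrow> y \<in> Ob C \<Longrightarrow> u \<in> mor C x y \<Longrightarrow> fmor F' x y u = fmor F x y u"
  shows "k_functor C D F'"
proof -
  interpret k_category C by fact
  have closed: "cmp C x y z v u \<in> mor C x z"
    if "x \<in> Ob C" "y \<in> Ob C" "z \<in> Ob C" "u \<in> mor C x y" "v \<in> mor C y z" for x y z u v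
    using cmp_linear_left[OF that(1-4)] that(5) by (auto simp: LinearCombinations.module_hom_def)
  have hom: "fmor F' x y \<in> LinearCombinations.module_hom class_ring (Hom C x y) (Hom D (fob F' x) (fob F' y))"
    if xy: "x \<in> Ob C" "y \<in> Ob C" for x y
  proof -
    interpret V: vectorspace class_ring "Hom C x y" by (rule hom_vectorspace[OF xy])
    have "fmor F x y \<in> LinearCombinations.module_hom class_ring (Hom C x y) (Hom D (fob F x) (fob F y))"
      using assms(2) xy by (auto simp: k_functor_def)
    then show ?thesis
      using ob mo xy V.smult_closed V.M.add.m_closed by (auto simp: LinearCombinations.module_hom_def)
  qed
  show ?thesis
    unfolding k_functor_def
    using assms(2) hom by (auto simp: k_functor_def ob mo closed idt_closed)
qed

lemma k_isomorphism_cong: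
  assumes "k_category C" "k_isomorphism C D F"
    and ob: "\<And>x. x \<in> Ob C \<Longrightarrow> fob F' x = fob F x"
    and mo: "\<And>x y u. x \<in> Ob C \<Longrightarrow> y \<in> Ob C \<Longrightarrow> u \<in> mor C x y \<Longrightarrow> fmor F' x y u = fmor F x y u"
  shows "k_isomorphism C D F'"
  unfolding k_isomorphism_def
proof (intro conjI ballI)
  show "k_functor C D F'"
    by (rule k_functor_cong[of C D F]) (use assms in \<open>auto simp: k_isomorphism_def\<close>)
  show "bij_betw (fob F') (Ob C) (Ob D)"
    using assms(2) bij_betw_cong[of "Ob C" "fob F'" "fob F"] ob by (simp add: k_isomorphism_def)
  fix x y assume "x \<in> Ob C" "y \<in> Ob C"
  then show "bij_betw (fmor F' x y) (mor C x y) (mor D (fob F' x) (fob F' y))"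
    using assms(2) bij_betw_cong[of "mor C x y" "fmor F' x y" "fmor F x y"] ob mo
    by (simp add: k_isomorphism_def)
qed

lemma k_isomorphism_comp:
  assumes F: "k_isomorphism A B F" and H: "k_isomorphism B C H"
  shows "k_isomorphism A C \<lparr>fob = fob H \<circ> fob F, fmor = (\<lambda>x y. fmor H (fob F x) (fob F y) \<circ> fmor F x y)\<rparr>"
proof -
  have ob: "fob F x \<in> Ob B" if "x \<in> Ob A" for x
    using F that by (auto simp: k_isomorphism_def k_functor_def)
  have mo: "fmor F x y u \<in> mor B (fob F x) (fob F y)" if "x \<in> Ob A" "y \<in> Ob A" "u \<in> mor A x y" for x y u
    using F that by (auto simp: k_isomorphism_def dest: bij_betwE)
  have "bij_betw (fob H \<circ> fob F) (Ob A) (Ob C)"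
    using F H by (auto simp: k_isomorphism_def intro: bij_betw_trans)
  moreover have "bij_betw (fmor H (fob F x) (fob F y) \<circ> fmor F x y) (mor A x y)
      (mor C (fob H (fob F x)) (fob H (fob F y)))" if "x \<in> Ob A" "y \<in> Ob A" for x y
    using F H that ob by (intro bij_betw_trans) (auto simp: k_isomorphism_def)
  moreover have "k_functor A C \<lparr>fob = fob H \<circ> fob F, fmor = (\<lambda>x y. fmor H (fob F x) (fob F y) \<circ> fmor F x y)\<rparr>"
    using F H ob mo unfolding k_isomorphism_def k_functor_def LinearCombinations.module_hom_def
    by (simp add: Pi_iff)
  ultimately show ?thesis
    by (simp add: k_isomorphism_def)
qed

lemma k_isomorphism_id:
  assumes "k_category C"
  shows "k_isomorphism C C \<lparr>fob = (\<lambda>x. x), fmor = (\<lambda>x y u. u)\<rparr>"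
  by (auto simp: k_isomorphism_def k_functor_def LinearCombinations.module_hom_def
      bij_betw_id[unfolded id_def])

text \<open>Compatibility of the inverse with sums, scalars and composition is verified after
  applying \<open>F\<close>, which is injective on every morphism space.\<close>

lemma k_isomorphism_inverse:
  assumes C: "k_category C" and F: "k_isomorphism C C F"
  obtains H where "k_isomorphism C C H"
    "\<And>x. x \<in> Ob C \<Longrightarrow> fob H (fob F x) = x"
    "\<And>x y u. x \<in> Ob C \<Longrightarrow> y \<in> Ob C \<Longrightarrow> u \<in> mor C x y \<Longrightarrow> fmor H (fob F x) (fob F y) (fmor F x y u) = u"
proof -
  interpret k_category C by fact
  define g where "g = inv_into (Ob C) (fob F)"
  \<comment> \<open>Morphism spaces may overlap as sets, so the inverse is formed separately for
    each pair: at \<open>(x, y)\<close> it inverts \<open>F\<close> between \<open>g x\<close> and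
    \<open>g y\<close>.\<close>
  define H where "H = \<lparr>fob = g, fmor = (\<lambda>x y. inv_into (mor C (g x) (g y)) (fmor F (g x) (g y)))\<rparr>"
  have obF: "bij_betw (fob F) (Ob C) (Ob C)"
    and moF: "\<And>x y. x \<in> Ob C \<Longrightarrow> y \<in> Ob C \<Longrightarrow> bij_betw (fmor F x y) (mor C x y) (mor C (fob F x) (fob F y))"
    and kF: "k_functor C C F"
    using F by (auto simp: k_isomorphism_def)
  have g: "bij_betw g (Ob C) (Ob C)"
    unfolding g_def by (rule bij_betw_inv_into[OF obF])
  have gF: "g (fob F x) = x" if "x \<in> Ob C" for x
    using that obF by (simp add: g_def bij_betw_inv_into_left)
  have Fg: "fob F (g x) = x" if "x \<in> Ob C" for x
    using that obF by (simp add: g_def bij_betw_inv_into_right)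
  have gO: "g x \<in> Ob C" if "x \<in> Ob C" for x
    using g that by (auto dest: bij_betwE)
  have HF: "fmor H (fob F x) (fob F y) (fmor F x y u) = u" if "x \<in> Ob C" "y \<in> Ob C" "u \<in> mor C x y" for x y u
    using that by (simp add: H_def gF bij_betw_inv_into_left[OF moF])
  have FH: "fmor F (g x) (g y) (fmor H x y u) = u" "fmor H x y u \<in> mor C (g x) (g y)"
    if "x \<in> Ob C" "y \<in> Ob C" "u \<in> mor C x y" for x y u
  proof -
    have *: "bij_betw (fmor F (g x) (g y)) (mor C (g x) (g y)) (mor C x y)"
      using moF[OF gO[OF that(1)] gO[OF that(2)]] that Fg by simp
    show "fmor F (g x) (g y) (fmor H x y u) = u" "fmor H x y u \<in> mor C (g x) (g y)"
      using that bij_betw_inv_into_right[OF *] bij_betwE[OF bij_betw_inv_into[OF *]]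
      by (simp_all add: H_def)
  qed
  have inj: "u = v" if "fmor F x y u = fmor F x y v" "x \<in> Ob C" "y \<in> Ob C" "u \<in> mor C x y" "v \<in> mor C x y" for x y u v
    using moF[OF that(2,3)] that by (auto simp: bij_betw_def dest: inj_onD)
  have closed: "cmp C x y z v u \<in> mor C x z"
    if "x \<in> Ob C" "y \<in> Ob C" "z \<in> Ob C" "u \<in> mor C x y" "v \<in> mor C y z" for x y z u v
    using cmp_linear_left[OF that(1-4)] that(5) by (auto simp: LinearCombinations.module_hom_def)
  have Fcmp: "fmor F x z (cmp C x y z v u) = cmp C (fob F x) (fob F y) (fob F z) (fmor F y z v) (fmor F x y u)"
    if "x \<in> Ob C" "y \<in> Ob C" "z \<in> Ob C" "u \<in> mor C x y" "v \<in> mor C y z" for x y z u v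
    using kF that by (auto simp: k_functor_def)
  have Fhom: "fmor F x y (u \<oplus>\<^bsub>Hom C x y\<^esub> v) = fmor F x y u \<oplus>\<^bsub>Hom C (fob F x) (fob F y)\<^esub> fmor F x y v"
    if "x \<in> Ob C" "y \<in> Ob C" "u \<in> mor C x y" "v \<in> mor C x y" for x y u v
    using kF that by (auto simp: k_functor_def LinearCombinations.module_hom_def)
  have Fsmult: "fmor F x y (c \<odot>\<^bsub>Hom C x y\<^esub> u) = c \<odot>\<^bsub>Hom C (fob F x) (fob F y)\<^esub> fmor F x y u"
    if "x \<in> Ob C" "y \<in> Ob C" "u \<in> mor C x y" for x y u c
    using kF that by (auto simp: k_functor_def LinearCombinations.module_hom_def)
  have "k_functor C C H"
    unfolding k_functor_def
  proof (intro conjI ballI)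
    fix x assume x: "x \<in> Ob C"
    show "fob H x \<in> Ob C" using gO x by (simp add: H_def)
    have "fmor F (g x) (g x) (idt C (g x)) = idt C x"
      using kF gO[OF x] Fg[OF x] by (auto simp: k_functor_def)
    then show "fmor H x x (idt C x) = idt C (fob H x)"
      using HF[OF gO[OF x] gO[OF x] idt_closed[OF gO[OF x]]] x Fg by (simp add: H_def)
  next
    fix x y assume xy: "x \<in> Ob C" "y \<in> Ob C"
    interpret V: vectorspace class_ring "Hom C x y" by (rule hom_vectorspace[OF xy])
    interpret W: vectorspace class_ring "Hom C (g x) (g y)" by (rule hom_vectorspace[OF gO[OF xy(1)] gO[OF xy(2)]])
    show "fmor H x y \<in> LinearCombinations.module_hom class_ring (Hom C x y) (Hom C (fob H x) (fob H y))"
      unfolding LinearCombinations.module_hom_def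
    proof (clarsimp, intro conjI allI impI funcsetI)
      have [simp]: "fob H = g" by (simp add: H_def)
      show "fmor H x y u \<in> mor C (fob H x) (fob H y)" if "u \<in> mor C x y" for u
        using FH xy that by simp
      show "fmor H x y (u \<oplus>\<^bsub>Hom C x y\<^esub> v) = fmor H x y u \<oplus>\<^bsub>Hom C (fob H x) (fob H y)\<^esub> fmor H x y v"
        if "u \<in> mor C x y \<and> v \<in> mor C x y" for u v
        by (rule inj[of "g x" "g y"]) (use that xy in \<open>simp_all add: FH Fhom gO Fg\<close>)
      show "fmor H x y (c \<odot>\<^bsub>Hom C x y\<^esub> u) = c \<odot>\<^bsub>Hom C (fob H x) (fob H y)\<^esub> fmor H x y u"
        if "u \<in> mor C x y" for c u
        by (rule inj[of "g x" "g y"])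
          (use that xy V.smult_closed[of c u] W.smult_closed[of c "fmor H x y u"] in
            \<open>simp_all add: FH Fsmult gO Fg\<close>)
    qed
  next
    fix x y z u v
    assume *: "x \<in> Ob C" "y \<in> Ob C" "z \<in> Ob C" "u \<in> mor C x y" "v \<in> mor C y z"
    have [simp]: "fob H = g" by (simp add: H_def)
    show "fmor H x z (cmp C x y z v u) = cmp C (fob H x) (fob H y) (fob H z) (fmor H y z v) (fmor H x y u)"
      by (rule inj[of "g x" "g z"]) (use * in \<open>simp_all add: FH Fcmp closed gO Fg\<close>)
  qed
  moreover have "bij_betw (fmor H x y) (mor C x y) (mor C (fob H x) (fob H y))" if "x \<in> Ob C" "y \<in> Ob C" for x y
    unfolding H_def using bij_betw_inv_into[OF moF[OF gO[OF that(1)] gO[OF that(2)]]] that by (simp add: Fg)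
  ultimately have "k_isomorphism C C H"
    using g by (auto simp: k_isomorphism_def H_def)
  then show thesis
    using that[of H] HF gF by (simp add: H_def)
qed

lemma Aut_kcat_simps:
  "F \<in> carrier (Aut_kcat C) \<longleftrightarrow> k_isomorphism C C F \<and> restrict_func C F = F"
  "H \<otimes>\<^bsub>Aut_kcat C\<^esub> F = restrict_func C
     \<lparr>fob = fob H \<circ> fob F, fmor = (\<lambda>x y. fmor H (fob F x) (fob F y) \<circ> fmor F x y)\<rparr>"
  "\<one>\<^bsub>Aut_kcat C\<^esub> = restrict_func C \<lparr>fob = (\<lambda>x. x), fmor = (\<lambda>x y u. u)\<rparr>"
  by (simp_all add: Aut_kcat_def)

lemma k_isomorphism_restrict:
  "k_category C \<Longrightarrow> k_isomorphism C D F \<Longrightarrow> k_isomorphism C D (restrict_func C F)"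
  by (rule k_isomorphism_cong[of C D F]) (simp_all add: restrict_func_fob restrict_func_fmor)

lemma k_isomorphism_closed:
  assumes "k_isomorphism C D F"
  shows "x \<in> Ob C \<Longrightarrow> fob F x \<in> Ob D"
    "x \<in> Ob C \<Longrightarrow> y \<in> Ob C \<Longrightarrow> u \<in> mor C x y \<Longrightarrow> fmor F x y u \<in> mor D (fob F x) (fob F y)"
  using assms by (auto simp: k_isomorphism_def dest: bij_betwE)

lemma group_Aut_kcat:
  assumes C: "k_category C"
  shows "group (Aut_kcat C)"
proof (rule groupI)
  fix F H assume "F \<in> carrier (Aut_kcat C)" "H \<in> carrier (Aut_kcat C)"
  then have "k_isomorphism C C H" "k_isomorphism C C F"
    by (simp_all add: Aut_kcat_simps)
  from k_isomorphism_restrict[OF C k_isomorphism_comp[OF this]]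
  show "F \<otimes>\<^bsub>Aut_kcat C\<^esub> H \<in> carrier (Aut_kcat C)"
    by (simp add: Aut_kcat_simps)
next
  show "\<one>\<^bsub>Aut_kcat C\<^esub> \<in> carrier (Aut_kcat C)"
    by (simp add: Aut_kcat_simps k_isomorphism_restrict[OF C k_isomorphism_id[OF C]])
next
  fix F H K
  assume "F \<in> carrier (Aut_kcat C)" "H \<in> carrier (Aut_kcat C)" "K \<in> carrier (Aut_kcat C)"
  then show "F \<otimes>\<^bsub>Aut_kcat C\<^esub> H \<otimes>\<^bsub>Aut_kcat C\<^esub> K = F \<otimes>\<^bsub>Aut_kcat C\<^esub> (H \<otimes>\<^bsub>Aut_kcat C\<^esub> K)"
    by (auto simp: Aut_kcat_simps restrict_func_fob restrict_func_fmor k_isomorphism_closed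
        intro!: restrict_func_cong)
next
  fix F assume "F \<in> carrier (Aut_kcat C)"
  then have F: "k_isomorphism C C F" "restrict_func C F = F" by (auto simp: Aut_kcat_simps)
  have "\<one>\<^bsub>Aut_kcat C\<^esub> \<otimes>\<^bsub>Aut_kcat C\<^esub> F = restrict_func C F"
    unfolding Aut_kcat_simps
    by (rule restrict_func_cong)
       (simp_all add: restrict_func_fob restrict_func_fmor k_isomorphism_closed[OF F(1)])
  then show "\<one>\<^bsub>Aut_kcat C\<^esub> \<otimes>\<^bsub>Aut_kcat C\<^esub> F = F"
    using F by simp
next
  fix F assume "F \<in> carrier (Aut_kcat C)"
  then have F: "k_isomorphism C C F" "restrict_func C F = F" by (auto simp: Aut_kcat_simps)
  obtain H where H: "k_isomorphism C C H" "\<And>x. x \<in> Ob C \<Longrightarrow> fob H (fob F x) = x"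
    "\<And>x y u. x \<in> Ob C \<Longrightarrow> y \<in> Ob C \<Longrightarrow> u \<in> mor C x y \<Longrightarrow> fmor H (fob F x) (fob F y) (fmor F x y u) = u"
    using k_isomorphism_inverse[OF C F(1)] by blast
  have "restrict_func C H \<otimes>\<^bsub>Aut_kcat C\<^esub> F = \<one>\<^bsub>Aut_kcat C\<^esub>"
    unfolding Aut_kcat_simps
    by (rule restrict_func_cong)
       (simp_all add: restrict_func_fob restrict_func_fmor k_isomorphism_closed[OF F(1)] H)
  then show "\<exists>H\<in>carrier (Aut_kcat C). H \<otimes>\<^bsub>Aut_kcat C\<^esub> F = \<one>\<^bsub>Aut_kcat C\<^esub>"
    using k_isomorphism_restrict[OF C H(1)] by (intro bexI[of _ "restrict_func C H"]) (auto simp: Aut_kcat_simps)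
qed

section \<open>The category of a configuration of type MS\<close>

lemma class_in_eq:
  assumes "partition_on A P" "X \<in> P" "x \<in> X"
  shows "class_in P x = X"
  unfolding class_in_def
proof (rule the_equality)
  show "X \<in> P \<and> x \<in> X" using assms by simp
  show "Y = X" if "Y \<in> P \<and> x \<in> Y" for Y
    using that assms partition_onD2[OF assms(1)] by (auto simp: disjoint_def)
qed

lemma class_in_props:
  assumes "partition_on A P" "x \<in> A"
  shows "class_in P x \<in> P" "x \<in> class_in P x" "class_in P x \<subseteq> A"
proof -
  obtain X where X: "X \<in> P" "x \<in> X" using assms by (auto simp: partition_on_def)
  then show "class_in P x \<in> P" "x \<in> class_in P x" "class_in P x \<subseteq> A"
    using class_in_eq[OF assms(1) X] assms by (auto simp: partition_on_def)
qed

lemma class_in_eq_iff: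
  assumes "partition_on A P" "x \<in> A" "y \<in> A"
  shows "class_in P x = class_in P y \<longleftrightarrow> x \<in> class_in P y"
  using class_in_props[OF assms(1,2)] class_in_props[OF assms(1,3)] class_in_eq[OF assms(1)] by metis

context fms_BC
begin

abbreviation "g \<equiv> act E 1"
abbreviation "P \<equiv> Pcl E"

interpretation GA: group_action integer_group "elts E" "act E"
  by (rule G_set)

lemma act_closed [simp]: "e \<in> elts E \<Longrightarrow> act E n e \<in> elts E"
  using GA.element_image[of n e] by (simp add: integer_group_def)

lemma act_0 [simp]: "e \<in> elts E \<Longrightarrow> act E 0 e = e"
  using GA.id_eq_one by (simp add: fun_eq_iff integer_group_def restrict_def) metis

lemma act_act [simp]: "e \<in> elts E \<Longrightarrow> act E m (act E n e) = act E (m + n) e"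
  using GA.composition_rule[of e m n] by (simp add: integer_group_def)

lemma act_inj: "e \<in> elts E \<Longrightarrow> h \<in> elts E \<Longrightarrow> act E n e = act E n h \<longleftrightarrow> e = h"
  by (metis act_act act_0 add.left_inverse)

lemma deg_act [simp]: "e \<in> elts E \<Longrightarrow> deg E (act E n e) = deg E e"
  using f3[of e "act E n e"] by (fastforce simp: orbit_def integer_group_def)

lemma Pcl_props:
  assumes "e \<in> elts E"
  shows "P e \<in> Ppart E" "e \<in> P e" "P e \<subseteq> elts E" "finite (P e)"
  using class_in_props[OF P_partition assms] f1[OF assms] by auto

lemma Pcl_eq: "X \<in> Ppart E \<Longrightarrow> e \<in> X \<Longrightarrow> P e = X"
  by (rule class_in_eq[OF P_partition])

lemma Ppart_subset: "X \<in> Ppart E \<Longrightarrow> X \<subseteq> elts E"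
  using P_partition by (auto simp: partition_on_def)

lemma Ppart_cases:
  assumes "X \<in> Ppart E"
  obtains e where "e \<in> X" "e \<in> elts E" "X = P e"
proof -
  have "X \<noteq> {}" using assms P_partition by (auto simp: partition_on_def)
  then show thesis using that Pcl_eq[OF assms] Ppart_subset[OF assms] by blast
qed

lemma finite_Ppart: "X \<in> Ppart E \<Longrightarrow> finite X"
  by (elim Ppart_cases) (simp add: Pcl_props)

lemma Lpart_eq: "Lpart E = (\<lambda>e. {e}) ` elts E"
proof -
  have "X \<in> (\<lambda>e. {e}) ` elts E" if "X \<in> Lpart E" for X
  proof -
    have "X \<noteq> {}" "X \<subseteq> elts E" using that L_partition by (auto simp: partition_on_def)
    then obtain e where e: "e \<in> X" "e \<in> elts E" by blast
    then show ?thesis using class_in_eq[OF L_partition that e(1)] type_MS[OF e(2)] by blast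
  qed
  moreover have "{e} \<in> Lpart E" if "e \<in> elts E" for e
    using class_in_props[OF L_partition that] type_MS[OF that] by simp
  ultimately show ?thesis by blast
qed

abbreviation "Q \<equiv> fbc_quiver E"

lemma quiver_simps [simp]:
  "verts Q = Ppart E" "arcs Q = (\<lambda>e. {e}) ` elts E"
  "tail Q {e} = P e" "head Q {e} = P (g e)"
  by (simp_all add: fbc_quiver_def Lpart_eq)

sublocale Q: wf_digraph Q
  by unfold_locales (auto simp: Pcl_props)

section \<open>Paths along an orbit and their tokens\<close>

definition opath :: "'a \<Rightarrow> nat \<Rightarrow> 'a set list" where
  "opath e n = map (\<lambda>i. {act E (int i) e}) [0..<n]"

lemma Lseq_eq: "e \<in> elts E \<Longrightarrow> Lseq E e n = opath e n"
  by (simp add: Lseq_def opath_def type_MS)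

lemma length_opath [simp]: "length (opath e n) = n"
  by (simp add: opath_def)

lemma opath_0 [simp]: "opath e 0 = []"
  by (simp add: opath_def)

lemma opath_eq_Nil [simp]: "opath e n = [] \<longleftrightarrow> n = 0"
  by (simp add: opath_def)

lemma opath_add: "e \<in> elts E \<Longrightarrow> opath e (m + n) = opath e m @ opath (act E (int m) e) n"
  by (rule nth_equalityI) (auto simp: opath_def nth_append algebra_simps of_nat_diff)

lemma opath_Suc: "e \<in> elts E \<Longrightarrow> opath e (Suc n) = {e} # opath (g e) n"
  using opath_add[of e 1 n] by (simp add: opath_def)

text \<open>A nonempty path along an orbit remembers its starting element because arrows are
  singletons; the empty path remembers nothing.\<close>

lemma opath_eq_iff:
  assumes "e \<in> elts E" "h \<in> elts E"
  shows "opath e m = opath h n \<longleftrightarrow> m = n \<and> (n = 0 \<or> e = h)"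
proof
  assume *: "opath e m = opath h n"
  then have "m = n" by (metis length_opath)
  moreover have "e = h" if "n \<noteq> 0"
    using * that assms opath_Suc by (cases m; cases n) auto
  ultimately show "m = n \<and> (n = 0 \<or> e = h)" by auto
qed auto

lemma opath_awalk_iff:
  assumes "e \<in> elts E"
  shows "qpath Q x (opath e n) y \<longleftrightarrow>
    (if n = 0 then x = y \<and> x \<in> Ppart E else x = P e \<and> y = P (act E (int n) e))"
proof (cases n)
  case (Suc m)
  have "qpath Q (P e) (opath e n) (P (act E (int n) e))" for n
    using assms
  proof (induction n arbitrary: e)
    case 0
    then show ?case by (simp add: Q.awalk_Nil_iff Pcl_props)
  next
    case (Suc n)
    then show ?case
      using Suc.IH[of "g e"] by (simp add: opath_Suc Q.awalk_Cons_iff add.commute)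
  qed
  from this[of n] show ?thesis
    using Suc Q.awalk_ends[of "P e" "opath e n" "P (act E (int n) e)" x y] by auto
qed (auto simp: Q.awalk_Nil_iff)

lemma opath_awalk: "e \<in> elts E \<Longrightarrow> qpath Q (P e) (opath e n) (P (act E (int n) e))"
  by (simp add: opath_awalk_iff Pcl_props)

lemma opath_append_cases:
  assumes "e \<in> elts E" "p @ q = opath e n"
  shows "p = opath e (length p)" "q = opath (act E (int (length p)) e) (n - length p)" "length p \<le> n"
proof -
  show le: "length p \<le> n"
    using arg_cong[OF assms(2), of length] by simp
  have "p @ q = opath e (length p) @ opath (act E (int (length p)) e) (n - length p)"
    using opath_add[OF assms(1), of "length p" "n - length p"] assms(2) le by simp
  then show "p = opath e (length p)" "q = opath (act E (int (length p)) e) (n - length p)"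
    by (simp_all add: append_eq_append_conv)
qed

text \<open>
  The value \<open>Some None\<close> is shared by all full paths; parallel full paths are identified by (fR1).
\<close>

definition tok :: "'a set list \<Rightarrow> 'a set list option option" where
  "tok p = (if \<exists>e\<in>elts E. \<exists>n<deg E e. p = opath e n then Some (Some p)
    else if \<exists>e\<in>elts E. p = opath e (deg E e) then Some None else None)"

lemma tok_opath:
  assumes e: "e \<in> elts E"
  shows "tok (opath e n) = (if n < deg E e then Some (Some (opath e n)) else if n = deg E e then Some None else None)"
proof -
  have 1: "(\<exists>h\<in>elts E. \<exists>m<deg E h. opath e n = opath h m) \<longleftrightarrow> n < deg E e"
    using e deg_pos[OF e] by (auto simp: opath_eq_iff)
  have 2: "(\<exists>h\<in>elts E. opath e n = opath h (deg E h)) \<longleftrightarrow> n = deg E e"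
    using e deg_pos by (auto simp: opath_eq_iff) (metis less_irrefl)
  show ?thesis
    unfolding tok_def 1 2 by auto
qed

lemma tok_not_None_iff: "tok p \<noteq> None \<longleftrightarrow> (\<exists>e\<in>elts E. \<exists>n\<le>deg E e. p = opath e n)"
proof
  assume "tok p \<noteq> None"
  then show "\<exists>e\<in>elts E. \<exists>n\<le>deg E e. p = opath e n"
    by (auto simp: tok_def split: if_splits) (metis less_imp_le)
qed (auto simp: tok_opath)

lemma tok_cases:
  assumes "tok p \<noteq> None"
  obtains e n where "e \<in> elts E" "n < deg E e" "p = opath e n" "tok p = Some (Some p)"
  | e where "e \<in> elts E" "p = opath e (deg E e)" "tok p = Some None"
proof -
  obtain e n where e: "e \<in> elts E" "n \<le> deg E e" "p = opath e n"
    using assms unfolding tok_not_None_iff by blast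
  then show thesis
    using that(1)[of e n] that(2)[of e] by (cases "n < deg E e") (auto simp: tok_opath)
qed

lemma tok_append_None:
  assumes "tok p = None \<or> tok q = None"
  shows "tok (p @ q) = None"
proof (rule ccontr)
  assume "tok (p @ q) \<noteq> None"
  then obtain e n where e: "e \<in> elts E" "n \<le> deg E e" "p @ q = opath e n"
    unfolding tok_not_None_iff by blast
  from opath_append_cases[OF e(1,3)] have "tok p \<noteq> None" "tok q \<noteq> None"
    using e unfolding tok_not_None_iff
    by (metis order_trans, metis act_closed deg_act diff_le_self order_trans)
  then show False using assms by auto
qed

text \<open>The degree is constant on orbits and bounds the length of a nonzero path, so a full path
  leaves no room for another arrow on either side.\<close>

lemma tok_append_full:
  assumes "tok p = Some None \<and> q \<noteq> [] \<or> p \<noteq> [] \<and> tok q = Some None"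
  shows "tok (p @ q) = None"
proof (rule ccontr)
  assume "tok (p @ q) \<noteq> None"
  then obtain e n where e: "e \<in> elts E" "n \<le> deg E e" "p @ q = opath e n"
    unfolding tok_not_None_iff by blast
  define m where "m = length p"
  note * = opath_append_cases[OF e(1,3), folded m_def]
  have "m \<noteq> deg E e" if "q \<noteq> []"
    using * that e by (metis diff_self_eq_0 le_antisym opath_0)
  then have "tok p \<noteq> Some None" if "q \<noteq> []"
    using that e tok_opath[OF e(1), of m] *(1) by auto
  moreover have "n - m < deg E e" if "p \<noteq> []"
    using that e deg_pos[OF e(1)] unfolding m_def by (cases p) auto
  then have "tok q \<noteq> Some None" if "p \<noteq> []"
    using that e tok_opath[of "act E (int m) e" "n - m"] *(2) by auto
  ultimately show False using assms by auto
qed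

lemma tok_Nil: "tok [] \<noteq> None \<and> tok [] \<noteq> Some None" if "e \<in> elts E"
  using tok_opath[OF that, of 0] deg_pos[OF that] by simp

lemma tok_Some_Some: "tok p = Some (Some q) \<Longrightarrow> p = q"
  by (auto simp: tok_def split: if_splits)

text \<open>Two different paths with the same token that is not \<open>None\<close> are both full,
  and a nonempty extension of a full path is zero. So the identification of parallel full paths is
  compatible with composition.\<close>

sublocale Q: token_quiver Q tok
proof
  fix x y z p p' q q'
  assume *: "qpath Q x p y" "qpath Q x p' y" "qpath Q y q z" "qpath Q y q' z" "tok p = tok p'" "tok q = tok q'"
  from * obtain e where e: "e \<in> elts E" by (metis Ppart_cases Q.awalk_hd_in_verts quiver_simps(1))
  show "tok (p @ q) = tok (p' @ q')"
  proof (cases "tok p = None \<or> tok q = None")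
    case True
    then show ?thesis using * by (simp add: tok_append_None)
  next
    case False
    show ?thesis
    proof (cases "tok p = Some None")
      case True
      note p = this
      then have "p \<noteq> []" "p' \<noteq> []" using tok_Nil[OF e] * by auto
      show ?thesis
      proof (cases "q = []")
        case True
        then have "q' = []" using *(6) tok_Nil[OF e] tok_Some_Some by (metis not_None_eq option.exhaust)
        then show ?thesis using True * by simp
      next
        case q: False
        then have "q' \<noteq> []" using *(6) tok_Nil[OF e] tok_Some_Some by (metis not_None_eq option.exhaust)
        then show ?thesis using p q * by (simp add: tok_append_full)
      qed
    next
      case p: False
      then have pp: "p = p'"
        using False *(5) tok_Some_Some by (metis not_None_eq option.exhaust)
      show ?thesis
      proof (cases "tok q = Some None")
        case True
        then show ?thesis using pp * by (cases "p = []") (simp_all add: tok_append_full)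
      next
        case q: False
        then have "q = q'"
          using False *(6) tok_Some_Some by (metis not_None_eq option.exhaust)
        then show ?thesis using pp by simp
      qed
    qed
  qed
next
  fix x y z p q
  assume "tok p = None \<or> tok q = None"
  then show "tok (p @ q) = None" by (rule tok_append_None)
qed

text \<open>A common element of the translated arrows forces the arrows to be consecutive elements
  of one orbit. A zero path of this form is longer than the degree and belongs to (fR3); every other
  zero path belongs to (fR2).\<close>

lemma tok_None_fR:
  assumes p: "qpath Q x p y" and None: "tok p = None"
  shows "(single p 1 :: _ \<Rightarrow>\<^sub>0 'k::field) \<in> fR2 E \<union> fR3 E"
proof -
  let ?S = "\<Inter>i \<in> {1..length p}. act E (int (length p) - int i) ` (p ! (i - 1))"
  obtain e0 where e0: "e0 \<in> elts E" using p by (metis Ppart_cases Q.awalk_hd_in_verts quiver_simps(1))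
  have p_arcs: "\<exists>e\<in>elts E. p ! i = {e}" if "i < length p" for i
  proof -
    have "p ! i \<in> arcs Q" using p that nth_mem[of i p] by blast
    then show ?thesis by auto
  qed
  have "p \<noteq> []" using None tok_Nil[OF e0] by auto
  show ?thesis
  proof (cases "?S = {}")
    case False
    then obtain a where a: "a \<in> ?S" by blast
    define n where "n = length p"
    have n: "0 < n" using \<open>p \<noteq> []\<close> by (simp add: n_def)
    \<comment> \<open>The last arrow is translated by \<open>g^0\<close>, so \<open>a\<close> is its
      element; counted from 0, the arrow at position \<open>i\<close> lies \<open>n - 1 - i\<close>
      steps before \<open>a\<close>.\<close>
    have nth: "p ! i = {act E (int i) (act E (1 - int n) a)}" if i: "i < n" for i
    proof -
      obtain h where h: "h \<in> elts E" "p ! i = {h}" using p_arcs i by (auto simp: n_def)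
      have "a \<in> act E (int n - int (Suc i)) ` (p ! (Suc i - 1))"
        by (rule INT_D[OF a, of "Suc i", folded n_def]) (use i in auto)
      then have "a = act E (int n - int (Suc i)) h" using h by simp
      then show ?thesis using h by (simp add: algebra_simps)
    qed
    have "a \<in> elts E"
    proof -
      obtain h where h: "h \<in> elts E" "p ! 0 = {h}" using p_arcs n by (auto simp: n_def)
      have "a \<in> act E (int n - int 1) ` (p ! (1 - 1))"
        by (rule INT_D[OF a, of 1, folded n_def]) (use n in auto)
      then show ?thesis using h by auto
    qed
    then have e: "act E (1 - int n) a \<in> elts E" by simp
    have "p = opath (act E (1 - int n) a) n"
      by (rule nth_equalityI) (auto simp: n_def opath_def nth[unfolded n_def] simp del: act_act)
    then have "p = Lseq E (act E (1 - int n) a) n" "deg E (act E (1 - int n) a) < n"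
      using None tok_opath[OF e] Lseq_eq[OF e] by (auto split: if_splits)
    then have "(single p 1 :: _ \<Rightarrow>\<^sub>0 'k) \<in> fR3 E"
      unfolding fR3_def using e by blast
    then show ?thesis by blast
  next
    case True
    \<comment> \<open>Relation (fR2) asks for length greater than 1, and a single arrow has itself
      as intersection.\<close>
    have "length p \<noteq> 1"
    proof
      assume "length p = 1"
      moreover obtain h where h: "h \<in> elts E" "p ! 0 = {h}" using p_arcs \<open>p \<noteq> []\<close> by auto
      ultimately show False using True by simp
    qed
    then have "1 < length p" using \<open>p \<noteq> []\<close> by (metis One_nat_def length_0_conv linorder_neqE_nat less_one)
    then have "(single p 1 :: _ \<Rightarrow>\<^sub>0 'k) \<in> fR2 E"
      unfolding fR2_def using p True by blast
    then show ?thesis by blast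
  qed
qed

text \<open>For \<open>j = 0\<close> relation (fR1) identifies two full paths. For
  \<open>j > 0\<close> the two full paths end in the same arrow, so \<open>e\<close> and
  \<open>h\<close> share an orbit and hence a degree; stepping back gives \<open>e = h\<close> and
  the relation is 0.\<close>

lemma fR_tok:
  assumes "(f :: _ \<Rightarrow>\<^sub>0 'k::field) \<in> fR1 E \<union> fR2 E \<union> fR3 E"
  shows "pmap tok f = 0"
proof -
  consider "f \<in> fR1 E" | "f \<in> fR2 E" | "f \<in> fR3 E" using assms by blast
  then show ?thesis
  proof cases
    case 1
    then obtain e h j where f: "f = single (Lseq E e (deg E e - j)) 1 - single (Lseq E h (deg E h - j)) 1"
      and eh: "e \<in> elts E" "h \<in> elts E" "j < deg E e" "j < deg E h"
      and j: "\<forall>i \<in> {1..j}. Lcl E (act E (int (deg E e) - int i) e) = Lcl E (act E (int (deg E h) - int i) h)"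
      unfolding fR1_def by blast
    show ?thesis
    proof (cases "j = 0")
      case True
      then show ?thesis using eh f by (simp add: Lseq_eq pmap_diff pmap_single tok_opath)
    next
      case False
      then have *: "act E (int (deg E e) - 1) e = act E (int (deg E h) - 1) h"
        using j[rule_format, of 1] eh by (simp add: type_MS)
      then have "deg E e = deg E h"
        using eh deg_act by metis
      then have "e = h" using * eh act_inj by simp
      then show ?thesis by (simp add: f)
    qed
  next
    case 2
    then obtain p where f: "f = single p 1" "1 < length p"
      "(\<Inter>i \<in> {1..length p}. act E (int (length p) - int i) ` (p ! (i - 1))) = {}"
      unfolding fR2_def by blast
    have "tok p = None"
    proof (rule ccontr)
      assume "tok p \<noteq> None"
      then obtain e n where e: "e \<in> elts E" "p = opath e n" unfolding tok_not_None_iff by blast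
      \<comment> \<open>The element of the last arrow of the path: every arrow is moved onto it by
        its translation.\<close>
      have "act E (int n - 1) e \<in> (\<Inter>i \<in> {1..length p}. act E (int (length p) - int i) ` (p ! (i - 1)))"
        using e by (auto simp: opath_def of_nat_diff)
      then show False unfolding f(3) by blast
    qed
    then show ?thesis by (simp add: f pmap_single)
  next
    case 3
    then show ?thesis by (auto simp: fR3_def Lseq_eq pmap_single tok_opath)
  qed
qed

lemma tok_token_cat: "token_cat Q tok (tok_ideal Q tok :: _ \<Rightarrow> _ \<Rightarrow> (_ \<Rightarrow>\<^sub>0 'k::field) set)"
  by unfold_locales simp

text \<open>The kernel of the token map is an ideal containing all relations. Conversely an ideal
  containing the relations contains every zero path, and (fR1) with \<open>j = 0\<close> gives the
  differences of parallel full paths, so minimality of the kernel applies.\<close>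

lemma fbc_ideal_eq:
  assumes xy: "x \<in> Ppart E" "y \<in> Ppart E"
  shows "(fbc_ideal E x y :: (_ \<Rightarrow>\<^sub>0 'k::field) set) = tok_ideal Q tok x y"
proof (intro equalityI subsetI)
  let ?J = "tok_ideal Q tok :: _ \<Rightarrow> _ \<Rightarrow> (_ \<Rightarrow>\<^sub>0 'k) set"
  fix f :: "_ \<Rightarrow>\<^sub>0 'k" assume f: "f \<in> fbc_ideal E x y"
  have "k_ideal (path_category Q) ?J"
    by (rule token_cat.k_ideal_I[OF tok_token_cat])
  moreover have "\<forall>a \<in> Ob (path_category Q). \<forall>b \<in> Ob (path_category Q).
      (fR1 E \<union> fR2 E \<union> fR3 E) \<inter> mor (path_category Q) a b \<subseteq> ?J a b"
    using fR_tok by (auto simp: tok_ideal_def)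
  ultimately show "f \<in> ?J x y"
    using f unfolding fbc_ideal_def ideal_generated_def by blast
next
  fix f :: "_ \<Rightarrow>\<^sub>0 'k" assume f: "f \<in> tok_ideal Q tok x y"
  have "f \<in> J x y" if J: "k_ideal (path_category Q) J"
      "\<forall>a \<in> Ob (path_category Q). \<forall>b \<in> Ob (path_category Q).
        (fR1 E \<union> fR2 E \<union> fR3 E) \<inter> mor (path_category Q) a b \<subseteq> J a b" for J
  proof -
    interpret J: path_ideal Q J by unfold_locales (rule J)
    have R: "h \<in> J x y" if "h \<in> fR1 E \<union> fR2 E \<union> fR3 E" "h \<in> path_span Q x y" for h
      using J(2) that xy by auto
    show ?thesis
    proof (rule Q.tok_ideal_minimal[OF f])
      show "single p 1 \<in> J x y" if "qpath Q x p y" "tok p = None" for p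
        using tok_None_fR[OF that] that by (intro R) (auto simp: path_span_single)
      show "single p 1 - single q 1 \<in> J x y"
        if pq: "qpath Q x p y" "qpath Q x q y" "tok p = tok q" "tok p \<noteq> None" for p q
      proof (cases "tok p = Some None")
        case False
        then have "p = q" using pq tok_Some_Some by (metis not_None_eq option.exhaust)
        then show ?thesis using xy by (simp add: J.ideal_zero)
      next
        case True
        then obtain e h where eh: "e \<in> elts E" "p = opath e (deg E e)" "h \<in> elts E" "q = opath h (deg E h)"
          using pq by (metis option.distinct(1) option.inject tok_cases)
        then have "P e = P h"
          using pq deg_pos[of e] deg_pos[of h] by (auto simp: opath_awalk_iff)
        then have "(single p 1 - single q 1 :: _ \<Rightarrow>\<^sub>0 'k) \<in> fR1 E"
          unfolding fR1_def using eh deg_pos[of e] deg_pos[of h]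
          by (intro CollectI exI[of _ e] exI[of _ h] exI[of _ "0::nat"]) (simp add: Lseq_eq)
        then show ?thesis
          using pq by (intro R) (auto simp: path_span_single path_span_diff)
      qed
    qed (use xy in \<open>auto simp: J.ideal_zero J.ideal_add J.ideal_scale\<close>)
  qed
  then show "f \<in> fbc_ideal E x y"
    unfolding fbc_ideal_def ideal_generated_def by blast
qed

lemma finite_nonzero_out: "x \<in> Ppart E \<Longrightarrow> finite {p. \<exists>y. qpath Q x p y \<and> tok p \<noteq> None}"
proof -
  assume x: "x \<in> Ppart E"
  have "{p. \<exists>y. qpath Q x p y \<and> tok p \<noteq> None} \<subseteq> insert [] (\<Union>e\<in>x. opath e ` {..deg E e})"
  proof
    fix p assume "p \<in> {p. \<exists>y. qpath Q x p y \<and> tok p \<noteq> None}"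
    then obtain y e n where "qpath Q x p y" "e \<in> elts E" "n \<le> deg E e" "p = opath e n"
      unfolding tok_not_None_iff by blast
    then show "p \<in> insert [] (\<Union>e\<in>x. opath e ` {..deg E e})"
      using Pcl_props(2)[of e] by (auto simp: opath_awalk_iff split: if_splits)
  qed
  then show ?thesis
    by (rule finite_subset) (use finite_Ppart[OF x] in auto)
qed

lemma finite_nonzero_in: "x \<in> Ppart E \<Longrightarrow> finite {p. \<exists>y. qpath Q y p x \<and> tok p \<noteq> None}"
proof -
  assume x: "x \<in> Ppart E"
  have "{p. \<exists>y. qpath Q y p x \<and> tok p \<noteq> None} \<subseteq>
      insert [] (\<Union>h\<in>x. (\<lambda>n. opath (act E (- int n) h) n) ` {..deg E h})"
  proof
    fix p assume "p \<in> {p. \<exists>y. qpath Q y p x \<and> tok p \<noteq> None}"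
    then obtain y e n where p: "qpath Q y p x" "e \<in> elts E" "n \<le> deg E e" "p = opath e n"
      unfolding tok_not_None_iff by blast
    show "p \<in> insert [] (\<Union>h\<in>x. (\<lambda>n. opath (act E (- int n) h) n) ` {..deg E h})"
    proof (cases "n = 0")
      case False
      then have "act E (int n) e \<in> x"
        using p Pcl_props(2)[of "act E (int n) e"] by (simp add: opath_awalk_iff)
      then show ?thesis
        using p by (auto intro!: bexI[of _ "act E (int n) e"] image_eqI[of _ _ n])
    qed (use p in simp)
  qed
  then show ?thesis
    by (rule finite_subset) (use finite_Ppart[OF x] in auto)
qed

text \<open>The element \<open>e\<close> ensures that the trivial path is a path along an orbit of
  length less than a degree, hence nonzero.\<close>

lemma bounded_token_cat_E: "bounded_token_cat Q tok (fbc_ideal E :: _ \<Rightarrow> _ \<Rightarrow> (_ \<Rightarrow>\<^sub>0 'k::field) set)"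
  if "e \<in> elts E"
proof unfold_locales
  show "tok [] \<noteq> None" using tok_Nil[OF that] by simp
  show "p = []" if "tok p = tok []" for p
    using that tok_Nil[OF \<open>e \<in> elts E\<close>] tok_Some_Some by (metis not_None_eq option.exhaust)
  show "finite {p. \<exists>y. qpath Q x p y \<and> tok p \<noteq> None}" if "x \<in> verts Q" for x
    using finite_nonzero_out that unfolding quiver_simps .
  show "finite {p. \<exists>y. qpath Q y p x \<and> tok p \<noteq> None}" if "x \<in> verts Q" for x
    using finite_nonzero_in that unfolding quiver_simps .
qed (simp add: fbc_ideal_eq)

lemma token_cat_E: "token_cat Q tok (fbc_ideal E :: _ \<Rightarrow> _ \<Rightarrow> (_ \<Rightarrow>\<^sub>0 'k::field) set)"
  by unfold_locales (simp add: fbc_ideal_eq)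

end

section \<open>Homotopy of walks and the universal cover\<close>

lemma walk_target_append [simp]: "walk_target e (v @ w) = walk_target (walk_target e v) w"
  by (induction v arbitrary: e) auto

lemma is_walk_target: "is_walk E e w \<Longrightarrow> e \<in> elts E \<and> walk_target e w \<in> elts E"
  by (induction w arbitrary: e) (auto simp: is_step_def)

lemma is_walk_append [simp]:
  "is_walk E e (v @ w) \<longleftrightarrow> is_walk E e v \<and> is_walk E (walk_target e v) w"
  by (induction v arbitrary: e) (auto dest: is_walk_target)

text \<open>The starting point \<open>e\<close> is an argument because steps record only their
  targets, and the reversed first step has to return to \<open>e\<close>.\<close>

primrec inv_steps :: "'e \<Rightarrow> 'e steps \<Rightarrow> 'e steps" where
  "inv_steps e [] = []"
| "inv_steps e (s # w) = inv_steps (snd s) w @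
    [(case fst s of Gpos \<Rightarrow> Gneg | Gneg \<Rightarrow> Gpos | Tau \<Rightarrow> Tau, e)]"

context fms_BC
begin

lemma gwalk_0 [simp]: "gwalk E 0 e = []"
  by (simp add: gwalk_def)

lemma gwalk_pos: "0 \<le> n \<Longrightarrow> gwalk E (n + 1) e = gwalk E n e @ [(Gpos, act E (n + 1) e)]"
proof -
  assume n: "0 \<le> n"
  then have "nat (n + 1) = Suc (nat n)" by simp
  then show ?thesis using n by (simp add: gwalk_def add.commute)
qed

lemma gwalk_neg: "n \<le> 0 \<Longrightarrow> gwalk E (n - 1) e = gwalk E n e @ [(Gneg, act E (n - 1) e)]"
proof -
  assume n: "n \<le> 0"
  then have "nat (- (n - 1)) = Suc (nat (- n))" by simp
  then show ?thesis using n by (cases "n = 0") (simp_all add: gwalk_def)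
qed

lemma gwalk_1: "gwalk E 1 e = [(Gpos, g e)]"
  using gwalk_pos[of 0 e] by simp

lemma gwalk_is_walk:
  assumes "e \<in> elts E"
  shows "is_walk E e (gwalk E n e) \<and> walk_target e (gwalk E n e) = act E n e"
  using assms
proof (induction n rule: int_induct[where k = 0])
  case (step1 i)
  have "act E 1 (act E i e) = act E (i + 1) e" using assms by (simp add: add.commute)
  then show ?case using step1 by (simp add: gwalk_pos is_step_def)
next
  case (step2 i)
  then show ?case by (simp add: gwalk_neg is_step_def)
qed simp

text \<open>For (h3) the closing tau-step is legitimate by (f4): full paths starting at one polygon
  end at one polygon.\<close>

lemma homotopic_walks:
  "homotopic E e h v w \<Longrightarrow> is_walk E e v \<and> is_walk E e w \<and> walk_target e v = h \<and> walk_target e w = h"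
proof (induction rule: homotopic.induct)
  case (h3 e h)
  then show ?case
    using f4[of e h] by (auto simp: gwalk_is_walk is_step_def)
next
  case (h4 e h)
  then show ?case by (auto simp: is_step_def type_MS)
qed (auto simp: is_step_def)

lemma homotopic_append_left:
  "is_walk E e v \<Longrightarrow> homotopic E (walk_target e v) h w w' \<Longrightarrow> homotopic E e h (v @ w) (v @ w')"
  by (rule h5[OF h_refl]) auto

lemma homotopic_append_right:
  "homotopic E e h w w' \<Longrightarrow> is_walk E h v \<Longrightarrow> homotopic E e (walk_target h v) (w @ v) (w' @ v)"
  by (rule h5[OF _ h_refl]) auto

lemma step_inverse:
  assumes "is_step E e \<delta> h"
  shows "homotopic E e e [(\<delta>, h), (case \<delta> of Gpos \<Rightarrow> Gneg | Gneg \<Rightarrow> Gpos | Tau \<Rightarrow> Tau, e)] []"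
proof (cases \<delta>)
  case Tau
  then have "homotopic E e e [(Tau, h), (Tau, e)] [(Tau, e)]"
    using assms by (intro h2) (auto simp: is_step_def)
  then show ?thesis
    using Tau assms by (auto simp: is_step_def intro: h_trans[OF _ h1_tau])
qed (use assms in \<open>auto simp: is_step_def intro: h1_neg_pos h1_pos_neg\<close>)

lemma inv_steps_walk:
  "is_walk E e w \<Longrightarrow> is_walk E (walk_target e w) (inv_steps e w) \<and> walk_target (walk_target e w) (inv_steps e w) = e"
proof (induction w arbitrary: e)
  case (Cons s w)
  then have "is_step E (snd s) (case fst s of Gpos \<Rightarrow> Gneg | Gneg \<Rightarrow> Gpos | Tau \<Rightarrow> Tau) e"
    by (auto simp: is_step_def split: dir.splits)
  then show ?case
    using Cons by (auto simp: is_step_def)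
qed simp

lemma inv_steps_right: "is_walk E e w \<Longrightarrow> homotopic E e e (w @ inv_steps e w) []"
proof (induction w arbitrary: e)
  case Nil
  then show ?case by (auto intro: h_refl)
next
  case (Cons s w)
  let ?i = "(case fst s of Gpos \<Rightarrow> Gneg | Gneg \<Rightarrow> Gpos | Tau \<Rightarrow> Tau, e)"
  have step: "is_step E e (fst s) (snd s)" using Cons by simp
  have "homotopic E (snd s) (snd s) (w @ inv_steps (snd s) w) []"
    using Cons by simp
  then have "homotopic E e (snd s) ([s] @ (w @ inv_steps (snd s) w)) ([s] @ [])"
    using step by (intro homotopic_append_left) (auto simp: is_step_def)
  moreover have "is_walk E (snd s) [?i]"
    using step by (auto simp: is_step_def split: dir.splits)
  ultimately have "homotopic E e e (([s] @ (w @ inv_steps (snd s) w)) @ [?i]) (([s] @ []) @ [?i])"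
    using homotopic_append_right by fastforce
  moreover have "homotopic E e e (([s] @ []) @ [?i]) []"
    using step_inverse[OF step] by simp
  ultimately show ?case
    using h_trans by fastforce
qed

lemma inv_steps_inv_steps:
  "is_walk E e w \<Longrightarrow> inv_steps (walk_target e w) (inv_steps e w) = w"
proof -
  have app: "inv_steps e (v @ w) = inv_steps (walk_target e v) w @ inv_steps e v" for e :: 'a and v w
    by (induction v arbitrary: e) auto
  show "is_walk E e w \<Longrightarrow> inv_steps (walk_target e w) (inv_steps e w) = w"
  proof (induction w arbitrary: e)
    case (Cons s w)
    then show ?case
      using inv_steps_walk[of "snd s" w] by (cases s) (auto simp: app split: dir.splits)
  qed simp
qed

lemma inv_steps_left: "is_walk E e w \<Longrightarrow> homotopic E (walk_target e w) (walk_target e w) (inv_steps e w @ w) []"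
  using inv_steps_right[of "walk_target e w" "inv_steps e w"] inv_steps_walk[of e w] inv_steps_inv_steps[of e w]
  by simp

text \<open>Prepending the inverse of \<open>u\<close> undoes prepending \<open>u\<close> up to
  homotopy. Equality in the universal cover thereby becomes a condition on the continuing walks
  only.\<close>

lemma homotopic_cancel_left:
  assumes "is_walk E e u" "homotopic E e h (u @ v) (u @ w)"
  shows "homotopic E (walk_target e u) h v w"
proof -
  let ?a = "walk_target e u" and ?i = "inv_steps e u"
  note i = inv_steps_walk[OF assms(1)]
  have w: "is_walk E ?a v" "is_walk E ?a w" "walk_target ?a v = h" "walk_target ?a w = h"
    using homotopic_walks[OF assms(2)] by auto
  have *: "homotopic E ?a h ((?i @ u) @ x) x" if "is_walk E ?a x" "walk_target ?a x = h" for x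
    using homotopic_append_right[OF inv_steps_left[OF assms(1)] that(1)] that(2) by simp
  have "homotopic E ?a h (?i @ (u @ v)) (?i @ (u @ w))"
    using i assms(2) homotopic_append_left[of "?a" ?i h "u @ v" "u @ w"] by simp
  then show ?thesis
    using *[OF w(1,3)] *[OF w(2,4)] by (metis append.assoc h_sym h_trans)
qed

text \<open>For negative \<open>n\<close> the walk ends with an inverse step, which cancels against
  the appended one by (h1).\<close>

lemma gwalk_Gpos:
  assumes e: "e \<in> elts E"
  shows "homotopic E e (act E (n + 1) e) (gwalk E n e @ [(Gpos, act E (n + 1) e)]) (gwalk E (n + 1) e)"
proof (cases "0 \<le> n")
  case True
  then have "gwalk E (n + 1) e = gwalk E n e @ [(Gpos, act E (n + 1) e)]"
    by (rule gwalk_pos)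
  then show ?thesis
    using gwalk_is_walk[OF e, of "n + 1"] by (auto intro: h_refl)
next
  case False
  have "homotopic E e (act E (n + 1) e) (gwalk E (n + 1) e @ [(Gneg, act E n e), (Gpos, act E (n + 1) e)])
      (gwalk E (n + 1) e @ [])"
    using h1_pos_neg[of "act E (n + 1) e" E] e gwalk_is_walk[OF e, of "n + 1"]
    by (intro homotopic_append_left) auto
  moreover have "gwalk E n e = gwalk E (n + 1) e @ [(Gneg, act E n e)]"
    using gwalk_neg[of "n + 1" e] False by simp
  ultimately show ?thesis by simp
qed

lemma gwalk_Gneg:
  assumes e: "e \<in> elts E"
  shows "homotopic E e (act E (n - 1) e) (gwalk E n e @ [(Gneg, act E (n - 1) e)]) (gwalk E (n - 1) e)"
proof (cases "n \<le> 0")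
  case True
  then have "gwalk E (n - 1) e = gwalk E n e @ [(Gneg, act E (n - 1) e)]"
    by (rule gwalk_neg)
  then show ?thesis
    using gwalk_is_walk[OF e, of "n - 1"] by (auto intro: h_refl)
next
  case False
  have "homotopic E e (act E (n - 1) e) (gwalk E (n - 1) e @ [(Gpos, act E n e), (Gneg, act E (n - 1) e)])
      (gwalk E (n - 1) e @ [])"
    using h1_neg_pos[of "act E (n - 1) e" E] e gwalk_is_walk[OF e, of "n - 1"]
    by (intro homotopic_append_left) auto
  moreover have "gwalk E n e = gwalk E (n - 1) e @ [(Gpos, act E n e)]"
    using gwalk_pos[of "n - 1" e] False by simp
  ultimately show ?thesis by simp
qed

lemma gwalk_add:
  assumes e: "e \<in> elts E"
  shows "homotopic E e (act E (n + m) e) (gwalk E n e @ gwalk E m (act E n e)) (gwalk E (n + m) e)"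
proof (induction m rule: int_induct[where k = 0])
  case base
  then show ?case using gwalk_is_walk[OF e] by (auto intro: h_refl)
next
  case (step1 i)
  then have "gwalk E (i + 1) (act E n e) = gwalk E i (act E n e) @ [(Gpos, act E (n + i + 1) e)]"
    using gwalk_pos[of i "act E n e"] e by (simp add: algebra_simps)
  then have "homotopic E e (act E (n + i + 1) e) (gwalk E n e @ gwalk E (i + 1) (act E n e))
      (gwalk E (n + i) e @ [(Gpos, act E (n + i + 1) e)])"
    using homotopic_append_right[OF step1(2), of "[(Gpos, act E (n + i + 1) e)]"] e
    by (simp add: is_step_def add.commute)
  from h_trans[OF this gwalk_Gpos[OF e, of "n + i"]] show ?case
    by (simp add: add.assoc)
next
  case (step2 i)
  then have "gwalk E (i - 1) (act E n e) = gwalk E i (act E n e) @ [(Gneg, act E (n + i - 1) e)]"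
    using gwalk_neg[of i "act E n e"] e by (simp add: algebra_simps)
  then have "homotopic E e (act E (n + i - 1) e) (gwalk E n e @ gwalk E (i - 1) (act E n e))
      (gwalk E (n + i) e @ [(Gneg, act E (n + i - 1) e)])"
    using homotopic_append_right[OF step2(2), of "[(Gneg, act E (n + i - 1) e)]"] e
    by (simp add: is_step_def add.commute)
  from h_trans[OF this gwalk_Gneg[OF e, of "n + i"]] show ?case
    by (simp add: add_diff_eq)
qed

end

section \<open>The universal cover as a configuration of type MS\<close>

locale based_fms_BC = fms_BC E for E :: "'a fbc" +
  fixes b :: 'a
  assumes base: "b \<in> elts E"
begin

abbreviation "U \<equiv> universal_cover E b"
abbreviation "cls \<equiv> homotopy_class E b"

lemma elts_U [simp]: "elts U = cover_elts E b"
  by (simp add: universal_cover_def)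

lemma cls_eq_iff:
  assumes "is_walk E b v"
  shows "cls v = cls w \<longleftrightarrow> homotopic E b (walk_target b v) v w"
proof
  assume *: "cls v = cls w"
  have "v \<in> cls v"
    unfolding homotopy_class_def using assms by (auto intro: h_refl)
  then have "homotopic E b (walk_target b w) w v"
    unfolding * by (simp add: homotopy_class_def)
  from h_sym[OF this] homotopic_walks[OF this] show "homotopic E b (walk_target b v) v w"
    by simp
next
  assume *: "homotopic E b (walk_target b v) v w"
  then have "walk_target b w = walk_target b v" using homotopic_walks by blast
  then show "cls v = cls w"
    using * unfolding homotopy_class_def by (auto intro: h_trans h_sym)
qed

definition rep :: "'a steps set \<Rightarrow> 'a steps" where
  "rep X = (SOME w. is_walk E b w \<and> cls w = X)"

definition tgt :: "'a steps set \<Rightarrow> 'a" where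
  "tgt X = walk_target b (rep X)"

text \<open>Endpoint of the lift of the walk \<open>v\<close> starting at \<open>X\<close>. The
  whole structure of the cover is expressed by it: the action extends by \<open>gwalk\<close> and
  the polygon of \<open>X\<close> consists of its extensions by one tau-step.\<close>

definition ext :: "'a steps set \<Rightarrow> 'a steps \<Rightarrow> 'a steps set" where
  "ext X v = cls (rep X @ v)"

lemma rep:
  assumes "X \<in> cover_elts E b"
  shows "is_walk E b (rep X)" "cls (rep X) = X"
proof -
  have "\<exists>w. is_walk E b w \<and> cls w = X" using assms by (auto simp: cover_elts_def)
  then have "is_walk E b (rep X) \<and> cls (rep X) = X" unfolding rep_def by (rule someI_ex)
  then show "is_walk E b (rep X)" "cls (rep X) = X" by auto
qed

lemma mem_cover:
  assumes "X \<in> cover_elts E b" "w \<in> X"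
  shows "is_walk E b w" "walk_target b w = tgt X" "cls w = X"
proof -
  have "homotopic E b (tgt X) (rep X) w"
    using assms(2) rep(2)[OF assms(1)] by (auto simp: homotopy_class_def tgt_def)
  then show "is_walk E b w" "walk_target b w = tgt X" "cls w = X"
    using homotopic_walks[of b "tgt X" "rep X" w] cls_eq_iff[OF rep(1)[OF assms(1)], of w] rep[OF assms(1)]
    by (auto simp: tgt_def)
qed

lemma rep_mem: "X \<in> cover_elts E b \<Longrightarrow> rep X \<in> X"
  using rep[of X] h_refl[of E b "rep X"] by (auto simp: homotopy_class_def)

lemma cls_cover [simp]: "is_walk E b w \<Longrightarrow> cls w \<in> cover_elts E b"
  by (auto simp: cover_elts_def)

lemma cls_mem: "is_walk E b w \<Longrightarrow> w \<in> cls w"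
  by (auto simp: homotopy_class_def intro: h_refl)

lemma tgt_cls [simp]: "is_walk E b w \<Longrightarrow> tgt (cls w) = walk_target b w"
  using mem_cover[OF cls_cover cls_mem] by auto

lemma tgt_elts [simp]: "X \<in> cover_elts E b \<Longrightarrow> tgt X \<in> elts E"
  using is_walk_target[OF rep(1)] by (simp add: tgt_def)

lemma ext_cls:
  assumes "is_walk E b w" "is_walk E (walk_target b w) v"
  shows "ext (cls w) v = cls (w @ v)"
proof -
  have "homotopic E b (tgt (cls w)) (rep (cls w)) w"
    using rep[OF cls_cover[OF assms(1)]] cls_eq_iff[of "rep (cls w)" w] by (simp add: tgt_def)
  then have "homotopic E b (walk_target b (w @ v)) (rep (cls w) @ v) (w @ v)"
    using homotopic_append_right[of b _ "rep (cls w)" w v] assms by simp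
  then show ?thesis
    unfolding ext_def using homotopic_walks by (subst cls_eq_iff) fastforce+
qed

lemma ext_mem:
  assumes "X \<in> cover_elts E b" "w \<in> X" "is_walk E (tgt X) v"
  shows "cls (w @ v) = ext X v"
  using ext_cls[of w v] mem_cover[OF assms(1,2)] assms(3) by simp

lemma ext_cover [simp]:
  "X \<in> cover_elts E b \<Longrightarrow> is_walk E (tgt X) v \<Longrightarrow> ext X v \<in> cover_elts E b"
  unfolding ext_def using rep by (simp add: tgt_def)

lemma tgt_ext [simp]:
  "X \<in> cover_elts E b \<Longrightarrow> is_walk E (tgt X) v \<Longrightarrow> tgt (ext X v) = walk_target (tgt X) v"
  unfolding ext_def using rep by (simp add: tgt_def[of X])

lemma ext_Nil [simp]: "X \<in> cover_elts E b \<Longrightarrow> ext X [] = X"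
  by (simp add: ext_def rep)

lemma ext_ext [simp]:
  assumes "X \<in> cover_elts E b" "is_walk E (tgt X) v" "is_walk E (walk_target (tgt X) v) w"
  shows "ext (ext X v) w = ext X (v @ w)"
  using ext_cls[of "rep X @ v" w] rep[OF assms(1)] assms(2,3) by (simp add: ext_def[of X] tgt_def)

text \<open>The criterion for equality of lifted endpoints. It depends on \<open>X\<close> only
  through \<open>tgt X\<close>, which is what makes deck transformations well defined.\<close>

lemma ext_eq_iff:
  assumes X: "X \<in> cover_elts E b" and v: "is_walk E (tgt X) v" "is_walk E (tgt X) w"
  shows "ext X v = ext X w \<longleftrightarrow> homotopic E (tgt X) (walk_target (tgt X) v) v w"
proof
  assume "ext X v = ext X w"
  then have "homotopic E b (walk_target (tgt X) v) (rep X @ v) (rep X @ w)"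
    unfolding ext_def using rep[OF X] v by (subst (asm) cls_eq_iff) (auto simp: tgt_def)
  then show "homotopic E (tgt X) (walk_target (tgt X) v) v w"
    unfolding tgt_def using rep[OF X] by (intro homotopic_cancel_left)
next
  assume "homotopic E (tgt X) (walk_target (tgt X) v) v w"
  then have "homotopic E b (walk_target (tgt X) v) (rep X @ v) (rep X @ w)"
    unfolding tgt_def using rep[OF X] by (intro homotopic_append_left)
  then show "ext X v = ext X w"
    unfolding ext_def using rep[OF X] v by (subst cls_eq_iff) (auto simp: tgt_def)
qed

lemma ext_cong:
  assumes "X \<in> cover_elts E b" "homotopic E (tgt X) h v w"
  shows "ext X v = ext X w"
  using ext_eq_iff[OF assms(1), of v w] homotopic_walks[OF assms(2)] assms(2) by auto

lemma act_U: "X \<in> cover_elts E b \<Longrightarrow> act U n X = ext X (gwalk E n (tgt X))"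
proof -
  assume X: "X \<in> cover_elts E b"
  have "homotopy_class E b (w @ gwalk E n (walk_target b w)) = ext X (gwalk E n (tgt X))" if "w \<in> X" for w
    using ext_mem[OF X that, of "gwalk E n (tgt X)"] mem_cover[OF X that] gwalk_is_walk tgt_elts[OF X] by simp
  then have "(\<Union>w\<in>X. homotopy_class E b (w @ gwalk E n (walk_target b w))) = ext X (gwalk E n (tgt X))"
    using rep_mem[OF X] by blast
  then show ?thesis
    using X by (simp add: universal_cover_def)
qed

lemma act_U_outside: "X \<notin> cover_elts E b \<Longrightarrow> act U n X = undefined"
  by (simp add: universal_cover_def)

lemma act_U_closed: "X \<in> cover_elts E b \<Longrightarrow> act U n X \<in> cover_elts E b"
  by (simp add: act_U gwalk_is_walk)

lemma tgt_act [simp]: "X \<in> cover_elts E b \<Longrightarrow> tgt (act U n X) = act E n (tgt X)"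
  by (simp add: act_U gwalk_is_walk)

lemma act_U_act_U: "X \<in> cover_elts E b \<Longrightarrow> act U m (act U n X) = act U (m + n) X"
  using ext_cong[OF _ gwalk_add[of "tgt X" n m]]
  by (simp add: act_U gwalk_is_walk add.commute)

lemma act_U_0: "X \<in> cover_elts E b \<Longrightarrow> act U 0 X = X"
  by (simp add: act_U)

text \<open>Permutations in the sense of \<open>Bij\<close> are undefined off the carrier, so the
  restriction built into the action of the cover matters for the homomorphism law as well.\<close>

lemma group_action_U: "group_action integer_group (elts U) (act U)"
proof -
  have bij: "act U n \<in> Bij (elts U)" for n
  proof -
    have "bij_betw (act U n) (elts U) (elts U)"
      by (rule bij_betwI[where g = "act U (- n)"])
         (auto simp: act_U_closed act_U_act_U act_U_0)
    then show ?thesis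
      by (auto simp: Bij_def extensional_def act_U_outside)
  qed
  have "act U (m + n) = compose (elts U) (act U m) (act U n)" for m n
    by (auto simp: fun_eq_iff compose_def restrict_def act_U_act_U act_U_outside)
  then show ?thesis
    using bij unfolding group_action_def
    by (intro group_hom.intro group_hom_axioms.intro group_BijGroup group_integer_group homI)
       (auto simp: BijGroup_def integer_group_def)
qed

definition Pc :: "'a steps set \<Rightarrow> 'a steps set set" where
  "Pc X = (\<lambda>h. ext X [(Tau, h)]) ` P (tgt X)"

lemma tau_walk [simp]: "e \<in> elts E \<Longrightarrow> is_walk E e [(Tau, h)] \<longleftrightarrow> h \<in> P e"
  using class_in_eq_iff[OF P_partition, of h e] Pcl_props[of e] by (auto simp: is_step_def)

lemma P_mem_eq: "e \<in> elts E \<Longrightarrow> h \<in> P e \<Longrightarrow> P h = P e"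
  using Pcl_eq[OF Pcl_props(1)] .

lemma Pc_cover:
  assumes "X \<in> cover_elts E b" "Y \<in> Pc X"
  shows "Y \<in> cover_elts E b \<and> P (tgt Y) = P (tgt X)"
proof -
  obtain h where h: "h \<in> P (tgt X)" "Y = ext X [(Tau, h)]"
    using assms(2) by (auto simp: Pc_def)
  then show ?thesis
    using assms(1) P_mem_eq[OF tgt_elts h(1)] by (simp del: is_walk.simps)
qed

lemma ext_tau_tgt: "X \<in> cover_elts E b \<Longrightarrow> ext X [(Tau, tgt X)] = X"
  using ext_cong[OF _ h1_tau[OF tgt_elts]] by simp

lemma Pc_refl: "X \<in> cover_elts E b \<Longrightarrow> X \<in> Pc X"
  unfolding Pc_def
  by (rule image_eqI[of _ _ "tgt X"]) (simp_all add: ext_tau_tgt Pcl_props)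

lemma ext_tau_tau:
  assumes "X \<in> cover_elts E b" "h \<in> P (tgt X)" "h' \<in> P (tgt X)"
  shows "ext (ext X [(Tau, h)]) [(Tau, h')] = ext X [(Tau, h')]"
proof -
  have h: "h \<in> elts E" "h' \<in> elts E" "P h = P (tgt X)" "P h' = P (tgt X)"
    using assms Pcl_props(3)[OF tgt_elts[OF assms(1)]] Pcl_eq[OF Pcl_props(1)[OF tgt_elts[OF assms(1)]]] by auto
  have "homotopic E (tgt X) h' ([(Tau, h)] @ [(Tau, h')]) [(Tau, h')]"
    using h2[of "tgt X" E h h'] h assms by simp
  from ext_cong[OF assms(1) this] show ?thesis
    using assms h by (subst ext_ext) (auto simp del: is_walk.simps)
qed

lemma Pc_eq:
  assumes "X \<in> cover_elts E b" "Y \<in> Pc X"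
  shows "Pc Y = Pc X"
proof -
  obtain h where h: "h \<in> P (tgt X)" "Y = ext X [(Tau, h)]"
    using assms(2) by (auto simp: Pc_def)
  have "P (tgt Y) = P (tgt X)" using Pc_cover[OF assms] by simp
  then show ?thesis
    unfolding Pc_def using ext_tau_tau[OF assms(1) h(1)] h(2) by simp
qed

lemma Pc_eq_iff:
  "X \<in> cover_elts E b \<Longrightarrow> Y \<in> cover_elts E b \<Longrightarrow> Pc X = Pc Y \<longleftrightarrow> Y \<in> Pc X"
  using Pc_eq Pc_refl by blast

lemma Ppart_U: "Ppart U = Pc ` cover_elts E b"
proof -
  have "{homotopy_class E b (w @ [(Tau, h)]) | w h. w \<in> X \<and> h \<in> P (walk_target b w)} = Pc X"
    if X: "X \<in> cover_elts E b" for X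
  proof -
    have "homotopy_class E b (w @ [(Tau, h)]) = ext X [(Tau, h)]" if "w \<in> X" "h \<in> P (tgt X)" for w h
      using ext_mem[OF X that(1), of "[(Tau, h)]"] that X by (simp del: is_walk.simps)
    then show ?thesis
      using rep_mem[OF X] mem_cover(2)[OF X] unfolding Pc_def by fastforce
  qed
  then show ?thesis
    by (simp add: universal_cover_def)
qed

lemma Lpart_U: "Lpart U = (\<lambda>X. {X}) ` cover_elts E b"
proof -
  have "{homotopy_class E b (w @ [(Tau, h)]) | w h. w \<in> X \<and> h \<in> Lcl E (walk_target b w)} = {X}"
    if X: "X \<in> cover_elts E b" for X
  proof -
    have "homotopy_class E b (w @ [(Tau, tgt X)]) = X" if "w \<in> X" for w
      using ext_mem[OF X that(1), of "[(Tau, tgt X)]"] that X ext_tau_tgt[OF X] Pcl_props(2)[OF tgt_elts[OF X]]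
      by (simp del: is_walk.simps)
    then show ?thesis
      using rep_mem[OF X] mem_cover(2)[OF X] type_MS[OF tgt_elts[OF X]] by fastforce
  qed
  then show ?thesis
    by (simp add: universal_cover_def)
qed

lemma partition_Ppart_U: "partition_on (elts U) (Ppart U)"
proof (rule partition_onI)
  show "\<Union> (Ppart U) = elts U"
    unfolding Ppart_U using Pc_refl Pc_cover by fastforce
  show "{} \<notin> Ppart U"
    unfolding Ppart_U using Pc_refl by blast
  show "disjnt p q" if "p \<in> Ppart U" "q \<in> Ppart U" "p \<noteq> q" for p q
  proof -
    obtain X Y where XY: "X \<in> cover_elts E b" "p = Pc X" "Y \<in> cover_elts E b" "q = Pc Y"
      using \<open>p \<in> Ppart U\<close> \<open>q \<in> Ppart U\<close> unfolding Ppart_U by auto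
    have "Z \<notin> Pc X \<inter> Pc Y" for Z
      using Pc_eq[of X Z] Pc_eq[of Y Z] XY that(3) by auto
    then show ?thesis using XY by (auto simp: disjnt_def)
  qed
qed

lemma partition_Lpart_U: "partition_on (elts U) (Lpart U)"
  unfolding Lpart_U by (rule partition_onI) (auto simp: disjnt_def)

lemma Pcl_U: "X \<in> cover_elts E b \<Longrightarrow> Pcl U X = Pc X"
  by (rule class_in_eq[OF partition_Ppart_U]) (auto simp: Ppart_U Pc_refl)

lemma Lcl_U: "X \<in> cover_elts E b \<Longrightarrow> Lcl U X = {X}"
  by (rule class_in_eq[OF partition_Lpart_U]) (auto simp: Lpart_U)

lemma deg_U: "X \<in> cover_elts E b \<Longrightarrow> deg U X = deg E (tgt X)"
proof -
  assume X: "X \<in> cover_elts E b"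
  have "(\<lambda>w. deg E (walk_target b w)) ` X = {deg E (tgt X)}"
    using rep_mem[OF X] mem_cover(2)[OF X] by auto
  then show ?thesis by (simp add: universal_cover_def)
qed

lemma deg_act_U: "X \<in> cover_elts E b \<Longrightarrow> deg U (act U n X) = deg U X"
  by (simp add: deg_U act_U_closed)

text \<open>This is (h3), read as a property of the Nakayama shift \<open>X \<mapsto> g\<^sup>d X\<close>.\<close>

lemma shift_tau:
  assumes X: "X \<in> cover_elts E b" and h: "h \<in> P (tgt X)"
  shows "act U (int (deg E h)) (ext X [(Tau, h)]) =
    ext (act U (int (deg E (tgt X))) X) [(Tau, act E (int (deg E h)) h)]"
proof -
  have hE: "h \<in> elts E" "P h = P (tgt X)"
    using h Pcl_props(3)[OF tgt_elts[OF X]] Pcl_eq[OF Pcl_props(1)[OF tgt_elts[OF X]]] by auto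
  have sh: "act E (int (deg E h)) h \<in> P (act E (int (deg E (tgt X))) (tgt X))"
    using f4[of "tgt X" h] hE X Pcl_props(2)[of "act E (int (deg E h)) h"] by simp
  have "homotopic E (tgt X) (act E (int (deg E h)) h)
      (gwalk E (int (deg E (tgt X))) (tgt X) @ [(Tau, act E (int (deg E h)) h)])
      ([(Tau, h)] @ gwalk E (int (deg E h)) h)"
    using hE X by (intro h3) auto
  from ext_cong[OF X this] show ?thesis
    using X h hE sh by (simp add: act_U gwalk_is_walk del: is_walk.simps)
qed

text \<open>The substantial axiom is (f4). Its forward direction is \<open>shift_tau\<close>, its
  backward direction follows since the shift by the degree is injective once the targets are known
  to agree. For (f6) a sequence contained in another lies on the same orbit, so both have the same
  length.\<close>

lemma fms_BC_U: "fms_BC U"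
proof (intro fms_BC.intro f_BC.intro fms_BC_axioms.intro)
  show "group_action integer_group (elts U) (act U)" by (rule group_action_U)
  show "partition_on (elts U) (Ppart U)" by (rule partition_Ppart_U)
  show "partition_on (elts U) (Lpart U)" by (rule partition_Lpart_U)
  show "0 < deg U X" if "X \<in> elts U" for X
    using that deg_pos by (simp add: deg_U)
  show "Lcl U X \<subseteq> Pcl U X \<and> finite (Pcl U X)" if "X \<in> elts U" for X
    using that Pc_refl Pcl_props(4)[of "tgt X"] by (simp add: Lcl_U Pcl_U) (simp add: Pc_def)
  show "Pcl U (act U 1 X) = Pcl U (act U 1 Y)" if "X \<in> elts U" "Y \<in> elts U" "Lcl U X = Lcl U Y" for X Y
    using that by (simp add: Lcl_U)
  show "Lcl U X = {X}" if "X \<in> elts U" for X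
    using that by (simp add: Lcl_U)
  show deg: "deg U X = deg U Y" if "X \<in> elts U" "Y \<in> orbit integer_group (act U) X" for X Y
    using that by (auto simp: orbit_def deg_act_U)
  show "Pcl U X = Pcl U Y \<longleftrightarrow>
      Pcl U (act U (int (deg U X)) X) = Pcl U (act U (int (deg U Y)) Y)" if "X \<in> elts U" "Y \<in> elts U" for X Y
  proof -
    have XY: "X \<in> cover_elts E b" "Y \<in> cover_elts E b" using that by auto
    have "Y \<in> Pc X \<longleftrightarrow> act U (int (deg E (tgt Y))) Y \<in> Pc (act U (int (deg E (tgt X))) X)"
    proof
      assume "Y \<in> Pc X"
      then obtain h where h: "h \<in> P (tgt X)" "Y = ext X [(Tau, h)]" by (auto simp: Pc_def)
      then have "act U (int (deg E h)) Y = ext (act U (int (deg E (tgt X))) X) [(Tau, act E (int (deg E h)) h)]"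
        using shift_tau[OF XY(1) h(1)] by simp
      moreover have "act E (int (deg E h)) h \<in> P (act E (int (deg E (tgt X))) (tgt X))"
        using h(1) XY f4[of "tgt X" h] Pcl_props(2)[of "act E (int (deg E h)) h"] Pcl_props(3)[OF tgt_elts[OF XY(1)]]
          Pcl_eq[OF Pcl_props(1)[OF tgt_elts[OF XY(1)]]]
        by (metis act_closed subsetD tgt_elts)
      moreover have "tgt Y = h" using h XY by (simp del: is_walk.simps)
      ultimately show "act U (int (deg E (tgt Y))) Y \<in> Pc (act U (int (deg E (tgt X))) X)"
        using XY by (simp add: Pc_def)
    next
      assume *: "act U (int (deg E (tgt Y))) Y \<in> Pc (act U (int (deg E (tgt X))) X)"
      let ?sX = "act U (int (deg E (tgt X))) X" and ?sY = "act U (int (deg E (tgt Y))) Y"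
      from * obtain k where k: "k \<in> P (tgt ?sX)" "?sY = ext ?sX [(Tau, k)]" by (auto simp: Pc_def)
      have k2: "k = act E (int (deg E (tgt Y))) (tgt Y)"
        using arg_cong[OF k(2), of tgt] k(1) XY act_U_closed by (simp del: is_walk.simps)
      have "P (tgt X) = P (tgt Y)"
        using f4[of "tgt X" "tgt Y"] k(1) k2 XY P_mem_eq[of "act E (int (deg E (tgt X))) (tgt X)" k] by simp
      then have tY: "tgt Y \<in> P (tgt X)" using Pcl_props(2) XY by simp
      \<comment> \<open>The candidate for \<open>Y\<close> in the polygon of \<open>X\<close>: it
        has the same target, and by the forward direction its shift is that of \<open>Y\<close>, so
        translating back gives \<open>Y' = Y\<close>.\<close>
      define Y' where "Y' = ext X [(Tau, tgt Y)]"
      have Y': "Y' \<in> cover_elts E b" using XY tY by (simp add: Y'_def del: is_walk.simps)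
      have "act U (int (deg E (tgt Y))) Y' = ?sY"
        using shift_tau[OF XY(1) tY] k k2 by (simp add: Y'_def)
      then have "Y' = Y"
        using XY Y' act_U_act_U[of _ "- int (deg E (tgt Y))" "int (deg E (tgt Y))"] act_U_0
        by (metis add.left_inverse)
      then show "Y \<in> Pc X" using tY by (auto simp: Y'_def Pc_def)
    qed
    then show ?thesis
      using XY by (simp add: Pcl_U deg_U act_U_closed Pc_eq_iff)
  qed
  show "Lcl U X = Lcl U Y \<longleftrightarrow>
      Lcl U (act U (int (deg U X)) X) = Lcl U (act U (int (deg U Y)) Y)" if "X \<in> elts U" "Y \<in> elts U" for X Y
  proof -
    have "X = Y" if eq: "act U (int (deg U X)) X = act U (int (deg U Y)) Y"
    proof -
      have "deg U X = deg U Y"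
        using arg_cong[OF eq, of "deg U"] \<open>X \<in> elts U\<close> \<open>Y \<in> elts U\<close> by (simp add: deg_act_U)
      then show ?thesis
        using eq \<open>X \<in> elts U\<close> \<open>Y \<in> elts U\<close> act_U_act_U[of _ "- int (deg U X)" "int (deg U X)"] act_U_0
        by (metis add.left_inverse elts_U)
    qed
    then show ?thesis
      using that by (auto simp: Lcl_U act_U_closed)
  qed
  show "\<not> strict_sublist (Lseq U X (deg U X)) (Lseq U Y (deg U Y))" if XY: "X \<in> elts U" "Y \<in> elts U" for X Y
  proof
    assume *: "strict_sublist (Lseq U X (deg U X)) (Lseq U Y (deg U Y))"
    have L: "Lseq U X n = map (\<lambda>i. {act U (int i) X}) [0..<n]" if "X \<in> elts U" for X n
      using that by (simp add: Lseq_def Lcl_U act_U_closed)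
    from * obtain ps ss where s: "Lseq U Y (deg U Y) = ps @ Lseq U X (deg U X) @ ss"
      "Lseq U X (deg U X) \<noteq> Lseq U Y (deg U Y)"
      by (auto simp: strict_sublist_def sublist_def)
    have "0 < deg U X" using XY deg_pos by (simp add: deg_U)
    then have "{act U (int 0) X} \<in> set (Lseq U X (deg U X))"
      using XY by (auto simp: L intro!: image_eqI[of _ _ 0])
    \<comment> \<open>The first term of the inner sequence puts \<open>X\<close> on the orbit of
      \<open>Y\<close>; then the degrees agree and nothing is left for \<open>ps\<close> and
      \<open>ss\<close>.\<close>
    then have "{X} \<in> set (Lseq U Y (deg U Y))"
      using s(1) XY by (simp add: act_U_0)
    then obtain i where "X = act U (int i) Y" using XY by (auto simp: L)
    then have "deg U X = deg U Y" using XY by (simp add: deg_act_U)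
    then have "ps = []" "ss = []"
      using arg_cong[OF s(1), of length] XY by (auto simp: L)
    then show False using s by simp
  qed
qed

end

section \<open>Coverings of configurations\<close>

text \<open>Equivariance together with bijectivity on polygons is the lifting property of a
  covering, forwards and backwards along arrows. The notion serves both the projection of the
  universal cover and its deck transformations.\<close>

locale fms_covering = D: fms_BC E' + B: fms_BC E for E' :: "'b fbc" and E :: "'a fbc" +
  fixes \<phi> :: "'b \<Rightarrow> 'a"
  assumes \<phi>_elts: "X \<in> elts E' \<Longrightarrow> \<phi> X \<in> elts E"
    and \<phi>_act: "X \<in> elts E' \<Longrightarrow> \<phi> (act E' n X) = act E n (\<phi> X)"
    and \<phi>_deg: "X \<in> elts E' \<Longrightarrow> deg E (\<phi> X) = deg E' X"
    and \<phi>_P: "X \<in> elts E' \<Longrightarrow> bij_betw \<phi> (Pcl E' X) (Pcl E (\<phi> X))"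
begin

lemma \<phi>_P_image: "X \<in> elts E' \<Longrightarrow> \<phi> ` Pcl E' X = Pcl E (\<phi> X)"
  using \<phi>_P by (simp add: bij_betw_def)

lemma \<phi>_inj:
  assumes "x \<in> Ppart E'" "X \<in> x" "Y \<in> x" "\<phi> X = \<phi> Y"
  shows "X = Y"
proof -
  obtain Z where "Z \<in> elts E'" "x = Pcl E' Z" using assms(1) by (elim D.Ppart_cases) auto
  then show ?thesis
    using \<phi>_P[of Z] assms by (auto simp: bij_betw_def dest: inj_onD)
qed

lemma map_opath: "X \<in> elts E' \<Longrightarrow> map ((`) \<phi>) (D.opath X n) = B.opath (\<phi> X) n"
  by (auto simp: D.opath_def B.opath_def \<phi>_act)

lemma map_path: "qpath D.Q x p y \<Longrightarrow> qpath B.Q (\<phi> ` x) (map ((`) \<phi>) p) (\<phi> ` y)"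
proof (induction p arbitrary: x)
  case Nil
  then show ?case
    by (auto simp: D.Q.awalk_Nil_iff B.Q.awalk_Nil_iff \<phi>_P_image B.Pcl_props \<phi>_elts elim!: D.Ppart_cases)
next
  case (Cons a p)
  then obtain X where X: "X \<in> elts E'" "a = {X}" "x = Pcl E' X" "qpath D.Q (Pcl E' (act E' 1 X)) p y"
    by (auto simp: D.Q.awalk_Cons_iff)
  then show ?case
    using Cons.IH[OF X(4)] by (auto simp: B.Q.awalk_Cons_iff \<phi>_P_image \<phi>_elts \<phi>_act)
qed

text \<open>Consecutive arrows of \<open>p\<close> meet in a polygon, and there
  \<open>\<phi>\<close> is injective. So if the images follow one orbit, each arrow must be the
  translate of the preceding one.\<close>

lemma lift_opath:
  assumes "qpath D.Q x p y" "map ((`) \<phi>) p = B.opath e n" "e \<in> elts E" "n \<noteq> 0"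
  shows "\<exists>X\<in>elts E'. X \<in> x \<and> \<phi> X = e \<and> p = D.opath X n"
  using assms
proof (induction n arbitrary: x p e)
  case (Suc n)
  from Suc.prems obtain a p' where p: "p = a # p'" "\<phi> ` a = {e}" "map ((`) \<phi>) p' = B.opath (act E 1 e) n"
    by (cases p) (auto simp: B.opath_Suc)
  then obtain X where X: "X \<in> elts E'" "a = {X}" "x = Pcl E' X" "qpath D.Q (Pcl E' (act E' 1 X)) p' y" "\<phi> X = e"
    using Suc.prems(1) by (auto simp: D.Q.awalk_Cons_iff)
  show ?case
  proof (cases "n = 0")
    case True
    then show ?thesis
      using p X by (intro bexI[of _ X]) (auto simp: D.opath_Suc D.Pcl_props)
  next
    case False
    obtain Y where Y: "Y \<in> elts E'" "Y \<in> Pcl E' (act E' 1 X)" "\<phi> Y = act E 1 e" "p' = D.opath Y n"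
      using Suc.IH[OF X(4) p(3) _ False] Suc.prems(3) by auto
    have "Y = act E' 1 X"
      by (rule \<phi>_inj[of "Pcl E' (act E' 1 X)"]) (use X Y in \<open>auto simp: D.Pcl_props \<phi>_act\<close>)
    then show ?thesis
      using p X Y by (intro bexI[of _ X]) (auto simp: D.opath_Suc D.Pcl_props)
  qed
qed simp

abbreviation "ft \<equiv> map_option (map ((`) \<phi>))"

lemma tok_opath_map: "X \<in> elts E' \<Longrightarrow> B.tok (B.opath (\<phi> X) n) = map_option ft (D.tok (D.opath X n))"
  by (simp add: B.tok_opath D.tok_opath \<phi>_elts \<phi>_deg map_opath)

text \<open>A path whose image runs along an orbit runs along an orbit itself, and degrees are
  preserved; hence no zero path acquires a nonzero image.\<close>

lemma tok_map:
  assumes p: "qpath D.Q x p y"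
  shows "B.tok (map ((`) \<phi>) p) = map_option ft (D.tok p)"
proof (cases "D.tok p = None")
  case False
  then obtain X n where "X \<in> elts E'" "p = D.opath X n"
    unfolding D.tok_not_None_iff by blast
  then show ?thesis by (simp add: tok_opath_map map_opath)
next
  case True
  have "B.tok (map ((`) \<phi>) p) = None"
  proof (rule ccontr)
    assume "B.tok (map ((`) \<phi>) p) \<noteq> None"
    then obtain e n where e: "e \<in> elts E" "n \<le> deg E e" "map ((`) \<phi>) p = B.opath e n"
      unfolding B.tok_not_None_iff by blast
    show False
    proof (cases "n = 0")
      case True
      obtain X where "X \<in> elts E'"
        using p by (metis D.Ppart_cases D.Q.awalk_hd_in_verts D.quiver_simps(1))
      then show False
        using True e D.tok_Nil \<open>D.tok p = None\<close> by auto
    next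
      case n: False
      then obtain X where "X \<in> elts E'" "\<phi> X = e" "p = D.opath X n"
        using lift_opath[OF p e(3,1)] by blast
      then show False
        using True e by (auto simp: D.tok_opath \<phi>_deg split: if_splits)
    qed
  qed
  then show ?thesis using True by simp
qed

lemma token_cat_map_\<phi>:
  "token_cat_map D.Q D.tok (fbc_ideal E' :: _ \<Rightarrow> _ \<Rightarrow> (_ \<Rightarrow>\<^sub>0 'k::field) set) B.Q B.tok (fbc_ideal E)
    ((`) \<phi>) ((`) \<phi>) ft"
proof (intro token_cat_map.intro token_cat_map_axioms.intro D.token_cat_E B.token_cat_E)
  fix x assume "x \<in> verts D.Q"
  then show "\<phi> ` x \<in> verts B.Q"
    by (auto simp: \<phi>_P_image B.Pcl_props \<phi>_elts elim!: D.Ppart_cases)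
qed (simp_all add: map_path tok_map)

abbreviation Lambda_map ::
  "('b set, ('b set list \<Rightarrow>\<^sub>0 'k::field) set, 'a set, ('a set list \<Rightarrow>\<^sub>0 'k) set) kfunc" where
  "Lambda_map \<equiv> path_functor (fbc_ideal E) ((`) \<phi>) ((`) \<phi>)"

lemma token_cases:
  assumes "t \<in> D.Q.tokens x y"
  obtains "t = Some []" "x = y" "x \<in> Ppart E'"
  | X n where "X \<in> elts E'" "0 < n" "n < deg E' X" "t = Some (D.opath X n)" "x = Pcl E' X" "y = Pcl E' (act E' (int n) X)"
  | X where "X \<in> elts E'" "t = None" "x = Pcl E' X" "y = Pcl E' (act E' (int (deg E' X)) X)"
proof -
  from assms obtain p where p: "qpath D.Q x p y" "D.tok p = Some t"
    by (auto simp: D.Q.tokens_def)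
  then obtain X n where X: "X \<in> elts E'" "n \<le> deg E' X" "p = D.opath X n"
    using D.tok_not_None_iff[of p] by auto
  show thesis
  proof (cases "n = 0")
    case True
    then show thesis
      using that(1) p X D.deg_pos[OF X(1)] D.tok_opath[OF X(1), of 0] by (auto simp: D.Q.awalk_Nil_iff)
  next
    case False
    then have xy: "x = Pcl E' X" "y = Pcl E' (act E' (int n) X)"
      using p X by (auto simp: D.opath_awalk_iff)
    show thesis
    proof (cases "n = deg E' X")
      case True
      then show thesis using that(3)[of X] p X xy by (simp add: D.tok_opath)
    next
      case False
      then show thesis using that(2)[of X n] p X xy \<open>n \<noteq> 0\<close> by (simp add: D.tok_opath)
    qed
  qed
qed

lemma tokens_opath:
  assumes "X \<in> elts E'" "n \<le> deg E' X" "n \<noteq> 0"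
  shows "(if n < deg E' X then Some (D.opath X n) else None) \<in> D.Q.tokens (Pcl E' X) (Pcl E' (act E' (int n) X))"
  using D.opath_awalk[OF assms(1), of n] D.tok_opath[OF assms(1), of n] assms(2)
  by (intro D.Q.tokensI) auto

lemma tokens_Nil:
  assumes "x \<in> Ppart E'"
  shows "Some [] \<in> D.Q.tokens x x"
proof -
  obtain X where X: "X \<in> elts E'" using assms by (elim D.Ppart_cases)
  show ?thesis
    using D.tok_opath[OF X, of 0] D.deg_pos[OF X] assms
    by (intro D.Q.tokensI[of _ "[]"]) (simp_all add: D.Q.awalk_Nil_iff)
qed

lemma base_token_cases:
  assumes "t \<in> B.Q.tokens x y"
  obtains "t = Some []" "x = y"
  | e n where "e \<in> elts E" "0 < n" "n \<le> deg E e" "t = (if n < deg E e then Some (B.opath e n) else None)"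
      "x = Pcl E e" "y = Pcl E (act E (int n) e)"
proof -
  from assms obtain p where p: "qpath B.Q x p y" "B.tok p = Some t"
    by (auto simp: B.Q.tokens_def)
  then obtain e n where e: "e \<in> elts E" "n \<le> deg E e" "p = B.opath e n"
    using B.tok_not_None_iff[of p] by auto
  show thesis
  proof (cases "n = 0")
    case True
    then show thesis
      using that(1) p e B.deg_pos[OF e(1)] B.tok_opath[OF e(1), of 0] by (auto simp: B.Q.awalk_Nil_iff)
  next
    case False
    then show thesis
      using that(2)[of e n] p e by (auto simp: B.opath_awalk_iff B.tok_opath split: if_splits)
  qed
qed

lemma lift_token_out:
  assumes x: "x \<in> Ppart E'" and t: "t \<in> B.Q.tokens (\<phi> ` x) b"
  shows "\<exists>z t'. z \<in> Ppart E' \<and> \<phi> ` z = b \<and> t' \<in> D.Q.tokens x z \<and> ft t' = t"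
  using t
proof (cases rule: base_token_cases)
  case 1
  then show ?thesis using x tokens_Nil by (intro exI[of _ x] exI[of _ "Some []"]) simp
next
  case (2 e n)
  then have "e \<in> \<phi> ` x" using B.Pcl_props by auto
  then obtain X where X: "X \<in> x" "\<phi> X = e" "X \<in> elts E'" "x = Pcl E' X"
    using D.Ppart_subset[OF x] D.Pcl_eq[OF x] by auto
  show ?thesis
    using 2 X tokens_opath[of X n]
    by (intro exI[of _ "Pcl E' (act E' (int n) X)"] exI[of _ "if n < deg E' X then Some (D.opath X n) else None"])
       (auto simp: D.Pcl_props \<phi>_P_image \<phi>_act \<phi>_deg map_opath)
qed

lemma lift_token_in:
  assumes y: "y \<in> Ppart E'" and t: "t \<in> B.Q.tokens a (\<phi> ` y)"
  shows "\<exists>z t'. z \<in> Ppart E' \<and> \<phi> ` z = a \<and> t' \<in> D.Q.tokens z y \<and> ft t' = t"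
  using t
proof (cases rule: base_token_cases)
  case 1
  then show ?thesis using y tokens_Nil by (intro exI[of _ y] exI[of _ "Some []"]) simp
next
  case (2 e n)
  then have "act E (int n) e \<in> \<phi> ` y" using B.Pcl_props by auto
  then obtain Y where "Y \<in> y" "\<phi> Y = act E (int n) e" by auto
  with D.Ppart_subset[OF y] D.Pcl_eq[OF y] have Y: "Y \<in> y" "\<phi> Y = act E (int n) e" "Y \<in> elts E'" "y = Pcl E' Y"
    by auto
  define X where "X = act E' (- int n) Y"
  have X: "X \<in> elts E'" "act E' (int n) X = Y" "\<phi> X = e"
    using Y 2 by (auto simp: X_def \<phi>_act)
  show ?thesis
    using 2 X Y tokens_opath[of X n]
    by (intro exI[of _ "Pcl E' X"] exI[of _ "if n < deg E' X then Some (D.opath X n) else None"])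
       (auto simp: D.Pcl_props \<phi>_P_image \<phi>_deg map_opath)
qed

text \<open>The token of a full path forgets the starting element, but (f4) shows that the polygon
  at its end depends only on the polygon \<open>x\<close>. For shorter paths the starting element is
  determined by injectivity on \<open>x\<close>.\<close>

lemma lift_token_out_unique:
  assumes x: "x \<in> Ppart E'" and z: "z \<in> Ppart E'" "z' \<in> Ppart E'"
    and t: "t \<in> D.Q.tokens x z" "t' \<in> D.Q.tokens x z'" "ft t = ft t'"
  shows "z = z' \<and> t = t'"
  using t(1)
proof (cases rule: token_cases)
  case 1
  with t(2) show ?thesis
    by (cases rule: token_cases) (use t(3) in \<open>auto simp: D.opath_eq_iff\<close>)
next
  case (2 X n)
  note X = this
  from t(2) show ?thesis
  proof (cases rule: token_cases)
    case (2 Y m)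
    then have "B.opath (\<phi> X) n = B.opath (\<phi> Y) m" using t(3) X by (simp add: map_opath)
    then have "n = m" "\<phi> X = \<phi> Y" using X 2 by (auto simp: B.opath_eq_iff \<phi>_elts)
    moreover have "X \<in> x" "Y \<in> x" using X 2 D.Pcl_props by auto
    ultimately show ?thesis using \<phi>_inj[OF x] X 2 by auto
  qed (use t(3) X in auto)
next
  case (3 X)
  note X = this
  from t(2) show ?thesis
  proof (cases rule: token_cases)
    case (3 Y)
    then show ?thesis using D.f4[of X Y] X by simp
  qed (use t(3) X in auto)
qed

text \<open>For full paths this is the converse direction of (f4); for shorter ones injectivity is
  applied to the end element in \<open>y\<close>, and the action is then reversed.\<close>

lemma lift_token_in_unique:
  assumes y: "y \<in> Ppart E'" and z: "z \<in> Ppart E'" "z' \<in> Ppart E'"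
    and t: "t \<in> D.Q.tokens z y" "t' \<in> D.Q.tokens z' y" "ft t = ft t'"
  shows "z = z' \<and> t = t'"
  using t(1)
proof (cases rule: token_cases)
  case 1
  with t(2) show ?thesis
    by (cases rule: token_cases) (use t(3) in \<open>auto simp: D.opath_eq_iff\<close>)
next
  case (2 X n)
  note X = this
  from t(2) show ?thesis
  proof (cases rule: token_cases)
    case (2 Y m)
    then have "B.opath (\<phi> X) n = B.opath (\<phi> Y) m" using t(3) X by (simp add: map_opath)
    then have *: "n = m" "\<phi> X = \<phi> Y" using X 2 by (auto simp: B.opath_eq_iff \<phi>_elts)
    have "act E' (int n) X \<in> y" "act E' (int n) Y \<in> y" using X 2 * D.Pcl_props(2) by (metis D.act_closed)+
    then have "act E' (int n) X = act E' (int n) Y"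
      by (rule \<phi>_inj[OF y]) (use X 2 * in \<open>simp add: \<phi>_act\<close>)
    then show ?thesis using X 2 * by (simp add: D.act_inj)
  qed (use t(3) X in auto)
next
  case (3 X)
  note X = this
  from t(2) show ?thesis
  proof (cases rule: token_cases)
    case (3 Y)
    then show ?thesis using D.f4[of X Y] X by simp
  qed (use t(3) X in auto)
qed

lemma covering_functor_Lambda_map: "covering_functor (Lambda E') (Lambda E) (Lambda_map :: (_, (_ \<Rightarrow>\<^sub>0 'k::field) set, _, _) kfunc)"
proof -
  interpret token_cat_map D.Q D.tok "fbc_ideal E' :: _ \<Rightarrow> _ \<Rightarrow> (_ \<Rightarrow>\<^sub>0 'k) set" B.Q B.tok "fbc_ideal E"
    "(`) \<phi>" "(`) \<phi>" ft
    by (rule token_cat_map_\<phi>)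
  show ?thesis
    unfolding Lambda_def
  proof (rule covering_functor_F)
    show "\<exists>z t'. z \<in> verts D.Q \<and> \<phi> ` z = a \<and> t' \<in> D.Q.tokens z y \<and> ft t' = t"
      if "y \<in> verts D.Q" "t \<in> B.Q.tokens a (\<phi> ` y)" for a y t
      using lift_token_in[of y t a] that by simp
    show "\<exists>z t'. z \<in> verts D.Q \<and> \<phi> ` z = b \<and> t' \<in> D.Q.tokens x z \<and> ft t' = t"
      if "x \<in> verts D.Q" "t \<in> B.Q.tokens (\<phi> ` x) b" for b x t
      using lift_token_out[of x t b] that by simp
    show "z = z' \<and> t = t'" if "y \<in> verts D.Q" "z \<in> verts D.Q" "z' \<in> verts D.Q" "\<phi> ` z = \<phi> ` z'"
      "t \<in> D.Q.tokens z y" "t' \<in> D.Q.tokens z' y" "ft t = ft t'" for y z z' t t'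
      using lift_token_in_unique[of y z z' t t'] that by simp
    show "z = z' \<and> t = t'" if "x \<in> verts D.Q" "z \<in> verts D.Q" "z' \<in> verts D.Q" "\<phi> ` z = \<phi> ` z'"
      "t \<in> D.Q.tokens x z" "t' \<in> D.Q.tokens x z'" "ft t = ft t'" for x z z' t t'
      using lift_token_out_unique[of x z z' t t'] that by simp
  qed
qed

end

section \<open>Deck transformations\<close>

definition hom_adj :: "('k::field, 'o, 'm) kcat \<Rightarrow> ('o \<times> 'o) set" where
  "hom_adj C = {(a, b). a \<in> Ob C \<and> b \<in> Ob C \<and>
    (mor C a b \<noteq> {\<zero>\<^bsub>Hom C a b\<^esub>} \<or> mor C b a \<noteq> {\<zero>\<^bsub>Hom C b a\<^esub>})}"

context fms_BC
begin

lemma hom_adj_arrow: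
  assumes e: "e \<in> elts E"
  shows "(P e, P (g e)) \<in> hom_adj (Lambda E :: ('k::field, _, _) kcat)"
    "(P (g e), P e) \<in> hom_adj (Lambda E :: ('k, _, _) kcat)"
proof -
  interpret bounded_token_cat Q tok "fbc_ideal E :: _ \<Rightarrow> _ \<Rightarrow> (_ \<Rightarrow>\<^sub>0 'k) set"
    by (rule bounded_token_cat_E[OF e])
  have "\<exists>p. qpath Q (P e) p (P (g e)) \<and> tok p \<noteq> None"
    using e opath_awalk[OF e, of 1] deg_pos[OF e] unfolding tok_not_None_iff
    by (intro exI[of _ "opath e 1"]) (auto intro!: bexI[of _ e] exI[of _ "Suc 0"])
  then have "mor C (P e) (P (g e)) \<noteq> {\<zero>\<^bsub>Hom C (P e) (P (g e))\<^esub>}"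
    using e by (subst nonzero_hom_iff) (auto simp: Pcl_props)
  then show "(P e, P (g e)) \<in> hom_adj (Lambda E :: ('k, _, _) kcat)"
    "(P (g e), P e) \<in> hom_adj (Lambda E :: ('k, _, _) kcat)"
    unfolding hom_adj_def Lambda_def using e Pcl_props(1)[of e] Pcl_props(1)[of "g e"]
    by (auto simp del: quot_path_category_simps(2,3))
qed

lemma walk_hom_adj:
  "is_walk E e w \<Longrightarrow> (P e, P (walk_target e w)) \<in> (hom_adj (Lambda E :: ('k::field, _, _) kcat))\<^sup>*"
proof (induction w arbitrary: e)
  case (Cons s w)
  have e: "e \<in> elts E" using Cons.prems by (auto simp: is_step_def)
  have "(P e, P (snd s)) \<in> (hom_adj (Lambda E :: ('k, _, _) kcat))\<^sup>*"
    using Cons.prems hom_adj_arrow(1)[OF e, where 'k = 'k] hom_adj_arrow(2)[of "act E (- 1) e", where 'k = 'k] e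
    by (auto simp: is_step_def split: dir.splits)
  then show ?case
    using Cons.IH[of "snd s"] Cons.prems by (auto intro: rtrancl_trans)
qed simp

lemma connected_Lambda:
  assumes "connected_fbc E" "e \<in> elts E"
  shows "connected_kcat (Lambda E :: ('k::field, _, _) kcat)"
  unfolding connected_kcat_def hom_adj_def[symmetric]
proof (intro conjI ballI)
  show "Ob (Lambda E :: ('k, _, _) kcat) \<noteq> {}"
    using Pcl_props(1)[OF assms(2)] by (auto simp: Lambda_def)
  fix x y assume "x \<in> Ob (Lambda E :: ('k, _, _) kcat)" "y \<in> Ob (Lambda E :: ('k, _, _) kcat)"
  then have "x \<in> Ppart E" "y \<in> Ppart E" by (simp_all add: Lambda_def)
  then obtain e h where "e \<in> elts E" "x = P e" "h \<in> elts E" "y = P h"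
    by (metis Ppart_cases)
  then show "(x, y) \<in> (hom_adj (Lambda E :: ('k, _, _) kcat))\<^sup>*"
    using assms(1) walk_hom_adj unfolding connected_fbc_def by metis
qed

lemma locally_bounded_Lambda:
  assumes "e \<in> elts E"
  shows "locally_bounded (Lambda E :: ('k::field, _, _) kcat)"
  unfolding Lambda_def by (rule bounded_token_cat.locally_bounded_C[OF bounded_token_cat_E[OF assms]])

end

section \<open>Deck transformations of the universal cover\<close>

context based_fms_BC
begin

sublocale U: fms_BC U
  by (rule fms_BC_U)

lemma tgt_inj_Pc: "X \<in> cover_elts E b \<Longrightarrow> inj_on tgt (Pc X)"
  by (auto simp: inj_on_def Pc_def simp del: is_walk.simps)

lemma tgt_Pc: "X \<in> cover_elts E b \<Longrightarrow> tgt ` Pc X = P (tgt X)"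
  by (auto simp: Pc_def image_image simp del: is_walk.simps)

lemma covering_tgt: "fms_covering U E tgt"
proof unfold_locales
  show "bij_betw tgt (Pcl U X) (P (tgt X))" if "X \<in> elts U" for X
    using that by (simp add: Pcl_U bij_betw_def tgt_inj_Pc tgt_Pc)
qed (simp_all add: deg_U)

primrec lift_steps :: "'a steps set \<Rightarrow> 'a steps \<Rightarrow> 'a steps set steps" where
  "lift_steps X [] = []"
| "lift_steps X (s # v) = (fst s, ext X [s]) # lift_steps (ext X [s]) v"

lemma ext_Gpos: "X \<in> cover_elts E b \<Longrightarrow> ext X [(Gpos, g (tgt X))] = act U 1 X"
  by (simp add: act_U gwalk_1)

lemma gwalk_minus_1: "gwalk E (- 1) e = [(Gneg, act E (- 1) e)]"
  using gwalk_neg[of 0 e] by simp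

lemma ext_Gneg: "X \<in> cover_elts E b \<Longrightarrow> ext X [(Gneg, act E (- 1) (tgt X))] = act U (- 1) X"
  by (simp add: act_U gwalk_minus_1)

lemma lift_steps_walk:
  "X \<in> cover_elts E b \<Longrightarrow> is_walk E (tgt X) v \<Longrightarrow>
    is_walk U X (lift_steps X v) \<and> walk_target X (lift_steps X v) = ext X v"
proof (induction v arbitrary: X)
  case (Cons s v)
  obtain \<delta> h where s: "s = (\<delta>, h)" by (cases s)
  have step: "is_step E (tgt X) \<delta> h" "is_walk E h v" using Cons.prems s by auto
  have w: "is_walk E (tgt X) [s]" using step s by (auto simp: is_step_def)
  define Y where "Y = ext X [s]"
  have Y: "Y \<in> cover_elts E b" "tgt Y = h" using Cons.prems(1) w s by (auto simp: Y_def simp del: is_walk.simps)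
  have "is_step U X \<delta> Y"
  proof (cases \<delta>)
    case Gpos
    then have "Y = act U 1 X" using step s ext_Gpos[OF Cons.prems(1)] by (simp add: Y_def is_step_def)
    then show ?thesis using Gpos Cons.prems(1) Y by (simp add: is_step_def)
  next
    case Gneg
    then have "Y = act U (- 1) X" using step s ext_Gneg[OF Cons.prems(1)] by (simp add: Y_def is_step_def)
    then show ?thesis using Gneg Cons.prems(1) Y by (simp add: is_step_def)
  next
    case Tau
    then have "Y \<in> Pc X" using w s Cons.prems(1) by (simp add: Y_def Pc_def del: is_walk.simps)
    from Pc_eq[OF Cons.prems(1) this] show ?thesis
      using Tau Cons.prems(1) Y by (simp add: is_step_def Pcl_U)
  qed
  moreover have "is_walk U Y (lift_steps Y v) \<and> walk_target Y (lift_steps Y v) = ext Y v"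
    using Cons.IH[of Y] Y step by simp
  moreover have "ext Y v = ext X (s # v)"
    unfolding Y_def using Cons.prems w s step by (subst ext_ext) auto
  ultimately show ?case
    using s by (simp add: Y_def)
qed simp

text \<open>A walk below whose lift at \<open>X\<close> ends at \<open>Z\<close>: back to the base
  point along \<open>X\<close>, then out along \<open>Z\<close>.\<close>

definition pth :: "'a steps set \<Rightarrow> 'a steps set \<Rightarrow> 'a steps" where
  "pth X Z = inv_steps b (rep X) @ rep Z"

lemma pth:
  assumes "X \<in> cover_elts E b" "Z \<in> cover_elts E b"
  shows "is_walk E (tgt X) (pth X Z)" "walk_target (tgt X) (pth X Z) = tgt Z" "ext X (pth X Z) = Z"
proof -
  note X = rep[OF assms(1)] and Z = rep[OF assms(2)]
  show *: "is_walk E (tgt X) (pth X Z)" "walk_target (tgt X) (pth X Z) = tgt Z"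
    using inv_steps_walk[OF X(1)] Z by (simp_all add: pth_def tgt_def)
  have "homotopic E b (tgt Z) ((rep X @ inv_steps b (rep X)) @ rep Z) ([] @ rep Z)"
    using homotopic_append_right[OF inv_steps_right[OF X(1)] Z(1)] by (simp add: tgt_def)
  then have "cls (rep X @ pth X Z) = cls (rep Z)"
    using * X by (subst cls_eq_iff) (auto simp: pth_def tgt_def)
  then show "ext X (pth X Z) = Z"
    using Z by (simp add: ext_def)
qed

lemma connected_U: "connected_fbc U"
  unfolding connected_fbc_def
proof (intro ballI)
  fix X Z assume "X \<in> elts U" "Z \<in> elts U"
  then show "\<exists>w. is_walk U X w \<and> walk_target X w = Z"
    using lift_steps_walk[of X "pth X Z"] pth[of X Z] by auto
qed

text \<open>The functions are constrained on the cover only, so they do not form a group under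
  composition as they stand; the automorphisms they induce are normalised later by
  \<open>restrict_func\<close>.\<close>

definition deck :: "('a steps set \<Rightarrow> 'a steps set) set" where
  "deck = {\<phi>. bij_betw \<phi> (cover_elts E b) (cover_elts E b) \<and>
    (\<forall>X\<in>cover_elts E b. \<forall>n. \<phi> (act U n X) = act U n (\<phi> X)) \<and>
    (\<forall>X\<in>cover_elts E b. Pc (\<phi> X) = \<phi> ` Pc X) \<and>
    (\<forall>X\<in>cover_elts E b. tgt (\<phi> X) = tgt X)}"

lemma deckD:
  assumes "\<phi> \<in> deck"
  shows "bij_betw \<phi> (cover_elts E b) (cover_elts E b)"
    "X \<in> cover_elts E b \<Longrightarrow> \<phi> X \<in> cover_elts E b"
    "X \<in> cover_elts E b \<Longrightarrow> \<phi> (act U n X) = act U n (\<phi> X)"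
    "X \<in> cover_elts E b \<Longrightarrow> Pc (\<phi> X) = \<phi> ` Pc X"
    "X \<in> cover_elts E b \<Longrightarrow> tgt (\<phi> X) = tgt X"
  using assms by (auto simp: deck_def dest: bij_betwE)

lemma Pc_subset: "X \<in> cover_elts E b \<Longrightarrow> Pc X \<subseteq> cover_elts E b"
  using Pc_cover by blast

lemma deck_id: "id \<in> deck"
  by (auto simp: deck_def)

lemma deck_comp:
  assumes "\<psi> \<in> deck" "\<phi> \<in> deck"
  shows "\<psi> \<circ> \<phi> \<in> deck"
proof -
  have "bij_betw (\<psi> \<circ> \<phi>) (cover_elts E b) (cover_elts E b)"
    by (rule bij_betw_trans[OF deckD(1)[OF assms(2)] deckD(1)[OF assms(1)]])
  then show ?thesis
    using deckD(2-5)[OF assms(1)] deckD(2-5)[OF assms(2)] unfolding deck_def by (simp add: image_comp)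
qed

lemma deck_inv:
  assumes "\<phi> \<in> deck"
  defines "\<psi> \<equiv> inv_into (cover_elts E b) \<phi>"
  shows "\<psi> \<in> deck" "\<And>X. X \<in> cover_elts E b \<Longrightarrow> \<psi> (\<phi> X) = X" "\<And>X. X \<in> cover_elts E b \<Longrightarrow> \<phi> (\<psi> X) = X"
proof -
  note d = deckD[OF assms(1)]
  show 1: "\<psi> (\<phi> X) = X" and 2: "\<phi> (\<psi> X) = X" if "X \<in> cover_elts E b" for X
    using that d(1) by (simp_all add: \<psi>_def bij_betw_inv_into_left bij_betw_inv_into_right)
  have bij: "bij_betw \<psi> (cover_elts E b) (cover_elts E b)"
    unfolding \<psi>_def by (rule bij_betw_inv_into[OF d(1)])
  have c: "\<psi> X \<in> cover_elts E b" if "X \<in> cover_elts E b" for X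
    using bij that by (auto dest: bij_betwE)
  have "\<psi> (act U n X) = act U n (\<psi> X)" if "X \<in> cover_elts E b" for n X
    using d(3)[OF c[OF that], of n] 1[of "act U n (\<psi> X)"] 2[OF that] c[OF that] by (simp add: act_U_closed)
  moreover have "Pc (\<psi> X) = \<psi> ` Pc X" if "X \<in> cover_elts E b" for X
  proof -
    have "Pc X = \<phi> ` Pc (\<psi> X)" using d(4)[OF c[OF that]] 2[OF that] by simp
    moreover have "\<psi> ` \<phi> ` Pc (\<psi> X) = Pc (\<psi> X)"
      using 1 Pc_subset[OF c[OF that]] by (force simp: image_image)
    ultimately show ?thesis by simp
  qed
  moreover have "tgt (\<psi> X) = tgt X" if "X \<in> cover_elts E b" for X
    using d(5)[OF c[OF that]] 2[OF that] by simp
  ultimately show "\<psi> \<in> deck"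
    using bij unfolding deck_def by simp
qed

lemma deck_covering:
  assumes "\<phi> \<in> deck"
  shows "fms_covering U U \<phi>"
proof unfold_locales
  note d = deckD[OF assms]
  fix X assume X: "X \<in> elts U"
  show "\<phi> X \<in> elts U" using X d by simp
  show "\<phi> (act U n X) = act U n (\<phi> X)" for n using X d by simp
  show "deg U (\<phi> X) = deg U X" using X d by (simp add: deg_U)
  show "bij_betw \<phi> (Pcl U X) (Pcl U (\<phi> X))"
    using X d bij_betw_subset[OF d(1) Pc_subset, of X "Pc (\<phi> X)"] by (simp add: Pcl_U)
qed

text \<open>For tau-steps both sides lie in the polygon of \<open>\<phi> X\<close> and have the same
  target, and targets are injective on a polygon. The other steps are equivariance.\<close>

lemma deck_ext:
  assumes \<phi>: "\<phi> \<in> deck" and "X \<in> cover_elts E b" "is_walk E (tgt X) v"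
  shows "\<phi> (ext X v) = ext (\<phi> X) v"
  using assms(2,3)
proof (induction v arbitrary: X)
  case Nil
  then show ?case using deckD[OF \<phi>] by simp
next
  case (Cons s v)
  note d = deckD[OF \<phi>]
  obtain \<delta> h where s: "s = (\<delta>, h)" by (cases s)
  have w: "is_walk E (tgt X) [s]" "is_walk E h v" using Cons.prems s by (auto simp: is_step_def)
  have "\<phi> (ext X [s]) = ext (\<phi> X) [s]"
  proof (cases \<delta>)
    case Gpos
    then show ?thesis using w s Cons.prems d ext_Gpos[of X] ext_Gpos[of "\<phi> X"] by (simp add: is_step_def)
  next
    case Gneg
    then show ?thesis using w s Cons.prems d ext_Gneg[of X] ext_Gneg[of "\<phi> X"] by (simp add: is_step_def)
  next
    case Tau
    have h: "h \<in> P (tgt X)" using Tau w s Cons.prems by (simp del: is_walk.simps)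
    have "ext X [s] \<in> Pc X" using h Tau s by (auto simp: Pc_def)
    then have "\<phi> (ext X [s]) \<in> Pc (\<phi> X)" using d(4)[OF Cons.prems(1)] by blast
    moreover have "ext (\<phi> X) [s] \<in> Pc (\<phi> X)"
      using h Tau s d(5)[OF Cons.prems(1)] by (auto simp: Pc_def)
    moreover have "tgt (\<phi> (ext X [s])) = tgt (ext (\<phi> X) [s])"
      using w Cons.prems(1) d by (simp del: is_walk.simps)
    ultimately show ?thesis
      using tgt_inj_Pc[of "\<phi> X"] d Cons.prems(1) by (auto dest: inj_onD)
  qed
  moreover have "ext X (s # v) = ext (ext X [s]) v" "ext (\<phi> X) (s # v) = ext (ext (\<phi> X) [s]) v"
    using w s Cons.prems d by (subst ext_ext; simp)+
  ultimately show ?case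
    using Cons.IH[of "ext X [s]"] w s Cons.prems(1) by (simp del: is_walk.simps)
qed

text \<open>The transformation sends the extension of \<open>X\<close> by a walk \<open>v\<close> to
  the extension of \<open>Y\<close> by \<open>v\<close>. This is well defined because
  \<open>ext_eq_iff\<close> only refers to the common target of \<open>X\<close> and
  \<open>Y\<close>, and exchanging \<open>X\<close> and \<open>Y\<close> gives the inverse.\<close>

lemma deck_transitive:
  assumes X: "X \<in> cover_elts E b" and Y: "Y \<in> cover_elts E b" and tgt: "tgt X = tgt Y"
  obtains \<phi> where "\<phi> \<in> deck" "\<phi> X = Y"
proof -
  define \<phi> where "\<phi> X Y Z = ext Y (pth X Z)" for X Y Z
  have \<phi>_ext: "\<phi> X Y (ext X v) = ext Y v"
    if "X \<in> cover_elts E b" "Y \<in> cover_elts E b" "tgt X = tgt Y" "is_walk E (tgt X) v" for X Y v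
  proof -
    have "ext X (pth X (ext X v)) = ext X v" using that by (intro pth) auto
    then have "homotopic E (tgt X) (tgt (ext X v)) (pth X (ext X v)) v"
      using that pth[of X "ext X v"] by (subst (asm) ext_eq_iff) auto
    then show ?thesis
      unfolding \<phi>_def using ext_cong[of Y] that by auto
  qed
  have closed: "\<phi> X Y Z \<in> cover_elts E b" "tgt (\<phi> X Y Z) = tgt Z"
    if "X \<in> cover_elts E b" "Y \<in> cover_elts E b" "tgt X = tgt Y" "Z \<in> cover_elts E b" for X Y Z
    using that pth[of X Z] by (simp_all add: \<phi>_def)
  have inv: "\<phi> Y X (\<phi> X Y Z) = Z"
    if "X \<in> cover_elts E b" "Y \<in> cover_elts E b" "tgt X = tgt Y" "Z \<in> cover_elts E b" for X Y Z
    using that \<phi>_ext[of Y X "pth X Z"] pth[of X Z] by (simp add: \<phi>_def[of X])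
  have ext: "\<phi> X Y (ext Z v) = ext (\<phi> X Y Z) v" if "Z \<in> cover_elts E b" "is_walk E (tgt Z) v" for Z v
    using \<phi>_ext[OF X Y tgt, of "pth X Z @ v"] pth[OF X that(1)] that X Y tgt
      ext_ext[of X "pth X Z" v] ext_ext[of Y "pth X Z" v]
    by (simp add: \<phi>_def)
  have "\<phi> X Y \<in> deck"
    unfolding deck_def
  proof (intro CollectI conjI ballI allI)
    show "bij_betw (\<phi> X Y) (cover_elts E b) (cover_elts E b)"
      by (rule bij_betwI[where g = "\<phi> Y X"]) (use X Y tgt closed inv in auto)
    fix Z assume Z: "Z \<in> cover_elts E b"
    show "\<phi> X Y (act U n Z) = act U n (\<phi> X Y Z)" for n
      using Z X Y tgt closed[OF X Y tgt Z] ext[OF Z, of "gwalk E n (tgt Z)"]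
      by (simp add: act_U gwalk_is_walk)
    show "Pc (\<phi> X Y Z) = \<phi> X Y ` Pc Z"
      using closed[OF X Y tgt Z] ext[OF Z] Z
      by (auto simp: Pc_def image_image simp del: is_walk.simps)
    show "tgt (\<phi> X Y Z) = tgt Z" using closed[OF X Y tgt Z] by simp
  qed
  moreover have "\<phi> X Y X = Y"
    using \<phi>_ext[OF X Y tgt, of "[]"] X Y by simp
  ultimately show thesis by (rule that)
qed

end

section \<open>The deck group and the Galois covering\<close>

locale based_fms_BC_field = based_fms_BC E b for E :: "'a fbc" and b :: 'a +
  fixes K :: "'k::field itself"
begin

abbreviation Lam_U :: "('k, 'a steps set lam_ob, ('k, 'a steps set) lam_mor) kcat" where
  "Lam_U \<equiv> Lambda U"

abbreviation Lam :: "('k, 'a lam_ob, ('k, 'a) lam_mor) kcat" where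
  "Lam \<equiv> Lambda E"

abbreviation deck_map ::
  "('a steps set \<Rightarrow> 'a steps set) \<Rightarrow>
    ('a steps set lam_ob, ('k, 'a steps set) lam_mor, 'a steps set lam_ob, ('k, 'a steps set) lam_mor) kfunc" where
  "deck_map \<phi> \<equiv> path_functor (fbc_ideal U) ((`) \<phi>) ((`) \<phi>)"

abbreviation cover_map ::
  "('a steps set lam_ob, ('k, 'a steps set) lam_mor, 'a lam_ob, ('k, 'a) lam_mor) kfunc" where
  "cover_map \<equiv> path_functor (fbc_ideal E) ((`) tgt) ((`) tgt)"

lemma Ob_Lam_U: "Ob Lam_U = Pc ` cover_elts E b"
  by (simp add: Lambda_def Ppart_U)

lemma k_category_Lam_U: "k_category Lam_U"
  using U.locally_bounded_Lambda[of "cls []"] base unfolding locally_bounded_def by auto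

lemma deck_map_mult:
  assumes \<phi>: "\<phi> \<in> deck" and \<psi>: "\<psi> \<in> deck"
    and "x \<in> Ob Lam_U" "y \<in> Ob Lam_U" "u \<in> mor Lam_U x y"
  shows "fmor (deck_map \<psi>) (\<phi> ` x) (\<phi> ` y) (fmor (deck_map \<phi>) x y u) = fmor (deck_map (\<psi> \<circ> \<phi>)) x y u"
  by (rule path_functor_comp[OF fms_covering.token_cat_map_\<phi>[OF deck_covering[OF \<phi>]]
        fms_covering.token_cat_map_\<phi>[OF deck_covering[OF \<psi>]]])
     (use assms(3-5) in \<open>auto simp: Lambda_def image_comp\<close>)

lemma cover_map_deck:
  assumes \<phi>: "\<phi> \<in> deck"
    and "x \<in> Ob Lam_U" "y \<in> Ob Lam_U" "u \<in> mor Lam_U x y"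
  shows "fmor cover_map (\<phi> ` x) (\<phi> ` y) (fmor (deck_map \<phi>) x y u) = fmor cover_map x y u"
proof (rule path_functor_comp[OF fms_covering.token_cat_map_\<phi>[OF deck_covering[OF \<phi>]]
        fms_covering.token_cat_map_\<phi>[OF covering_tgt]])
  have "tgt ` x = tgt ` \<phi> ` x" if "x \<subseteq> cover_elts E b" for x
    using that deckD(5)[OF \<phi>] by (force simp: image_image)
  moreover have "x \<subseteq> cover_elts E b" "y \<subseteq> cover_elts E b"
    using assms(2,3) Pc_subset by (auto simp: Ob_Lam_U)
  ultimately show "tgt ` x = tgt ` \<phi> ` x" "tgt ` y = tgt ` \<phi> ` y" by blast+
qed (use assms(2-4) deckD(5)[OF \<phi>] in \<open>auto simp: Lambda_def\<close>)

lemma deck_map_eq_id: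
  assumes "\<And>X. X \<in> cover_elts E b \<Longrightarrow> \<phi> X = X"
    and "x \<in> Ob Lam_U" "y \<in> Ob Lam_U" "u \<in> mor Lam_U x y"
  shows "fmor (deck_map \<phi>) x y u = u"
proof (rule path_functor_id)
  show "path_ideal U.Q (fbc_ideal U :: _ \<Rightarrow> _ \<Rightarrow> (_ \<Rightarrow>\<^sub>0 'k) set)"
    using token_cat.k_ideal_I[OF U.token_cat_E] by unfold_locales
  have "\<phi> ` x = x" if "x \<subseteq> cover_elts E b" for x
    using that assms(1) by force
  moreover have "x \<subseteq> cover_elts E b" "y \<subseteq> cover_elts E b"
    using assms(2,3) Pc_subset by (auto simp: Ob_Lam_U)
  ultimately show "\<phi> ` x = x" "\<phi> ` y = y" by blast+
qed (use assms in \<open>auto simp: Lambda_def\<close>)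

lemma deck_map_iso:
  assumes \<phi>: "\<phi> \<in> deck"
  shows "k_isomorphism Lam_U Lam_U (deck_map \<phi>)"
proof -
  let ?\<psi> = "inv_into (cover_elts E b) \<phi>"
  note \<psi> = deck_inv[OF \<phi>]
  have map: "token_cat_map U.Q U.tok (fbc_ideal U :: _ \<Rightarrow> _ \<Rightarrow> (_ \<Rightarrow>\<^sub>0 'k) set) U.Q U.tok (fbc_ideal U)
      ((`) \<chi>) ((`) \<chi>) (map_option (map ((`) \<chi>)))" if "\<chi> \<in> deck" for \<chi>
    by (rule fms_covering.token_cat_map_\<phi>[OF deck_covering[OF that]])
  have funct: "k_functor Lam_U Lam_U (deck_map \<phi>)"
    unfolding Lambda_def by (rule token_cat_map.k_functor_F[OF map[OF \<phi>]])
  have img: "\<chi> ` x \<in> Ob Lam_U" if "\<chi> \<in> deck" "x \<in> Ob Lam_U" for \<chi> x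
  proof -
    from that(2) obtain X where "X \<in> cover_elts E b" "x = Pc X" by (auto simp: Ob_Lam_U)
    then have "\<chi> ` x = Pc (\<chi> X)" "\<chi> X \<in> cover_elts E b" using deckD(2,4)[OF that(1)] by auto
    then show ?thesis by (auto simp: Ob_Lam_U)
  qed
  have sub: "x \<subseteq> cover_elts E b" if "x \<in> Ob Lam_U" for x
    using that Pc_subset by (auto simp: Ob_Lam_U)
  have inv: "?\<psi> ` \<phi> ` x = x" "\<phi> ` ?\<psi> ` x = x" if "x \<in> Ob Lam_U" for x
  proof -
    have "(\<lambda>X. ?\<psi> (\<phi> X)) ` x = (\<lambda>X. X) ` x" "(\<lambda>X. \<phi> (?\<psi> X)) ` x = (\<lambda>X. X) ` x"
      using sub[OF that] by (intro image_cong refl \<psi>(2,3); blast)+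
    then show "?\<psi> ` \<phi> ` x = x" "\<phi> ` ?\<psi> ` x = x" by (simp_all add: image_image)
  qed
  have closed: "fmor (deck_map \<chi>) x y u \<in> mor Lam_U (\<chi> ` x) (\<chi> ` y)"
    if "\<chi> \<in> deck" "x \<in> Ob Lam_U" "y \<in> Ob Lam_U"
      "u \<in> mor Lam_U x y" for \<chi> x y u
    using token_cat_map.F_closed[OF map[OF that(1)], of x y u] that(2-4) unfolding Lambda_def by simp
  have "bij_betw (fmor (deck_map \<phi>) x y) (mor Lam_U x y) (mor Lam_U (\<phi> ` x) (\<phi> ` y))"
    if xy: "x \<in> Ob Lam_U" "y \<in> Ob Lam_U" for x y
  proof (rule bij_betwI[where g = "fmor (deck_map ?\<psi>) (\<phi> ` x) (\<phi> ` y)"])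
    show "fmor (deck_map \<phi>) x y \<in> mor Lam_U x y \<rightarrow> mor Lam_U (\<phi> ` x) (\<phi> ` y)"
      using closed[OF \<phi>] xy by blast
    show "fmor (deck_map ?\<psi>) (\<phi> ` x) (\<phi> ` y) \<in> mor Lam_U (\<phi> ` x) (\<phi> ` y) \<rightarrow> mor Lam_U x y"
      using closed[OF \<psi>(1) img[OF \<phi>] img[OF \<phi>]] xy inv by fastforce
    show "fmor (deck_map ?\<psi>) (\<phi> ` x) (\<phi> ` y) (fmor (deck_map \<phi>) x y u) = u"
      if "u \<in> mor Lam_U x y" for u
      using deck_map_mult[OF \<phi> \<psi>(1) xy that] deck_map_eq_id[OF _ xy that, of "?\<psi> \<circ> \<phi>"] \<psi>(2) by simp
    show "fmor (deck_map \<phi>) x y (fmor (deck_map ?\<psi>) (\<phi> ` x) (\<phi> ` y) u) = u"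
      if u: "u \<in> mor Lam_U (\<phi> ` x) (\<phi> ` y)" for u
      using deck_map_mult[OF \<psi>(1) \<phi> img[OF \<phi> xy(1)] img[OF \<phi> xy(2)] u]
        deck_map_eq_id[OF _ img[OF \<phi> xy(1)] img[OF \<phi> xy(2)] u, of "\<phi> \<circ> ?\<psi>"] \<psi>(3) inv[OF xy(1)] inv[OF xy(2)]
      by simp
  qed
  moreover have "bij_betw ((`) \<phi>) (Ob Lam_U) (Ob Lam_U)"
    by (rule bij_betwI[where g = "(`) ?\<psi>"]) (use img[OF \<phi>] img[OF \<psi>(1)] inv in auto)
  ultimately show ?thesis
    using funct by (simp add: k_isomorphism_def path_functor_def)
qed

definition deck_group ::
  "('a steps set lam_ob, ('k, 'a steps set) lam_mor, 'a steps set lam_ob, ('k, 'a steps set) lam_mor) kfunc set" where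
  "deck_group = (\<lambda>\<phi>. restrict_func Lam_U (deck_map \<phi>)) ` deck"

lemma deck_group_one:
  assumes "\<And>X. X \<in> cover_elts E b \<Longrightarrow> \<phi> X = X"
  shows "restrict_func Lam_U (deck_map \<phi>) = \<one>\<^bsub>Aut_kcat Lam_U\<^esub>"
  unfolding Aut_kcat_simps
proof (rule restrict_func_cong)
  fix x assume "x \<in> Ob Lam_U"
  then have "x \<subseteq> cover_elts E b" using Pc_subset by (auto simp: Ob_Lam_U)
  then have "\<phi> ` x = x" using assms by force
  then show "fob (deck_map \<phi>) x = fob \<lparr>fob = \<lambda>x. x, fmor = \<lambda>x y u. u\<rparr> x"
    by (simp add: path_functor_def)
qed (simp add: deck_map_eq_id[OF assms])

lemma deck_group_mult:
  assumes "\<phi> \<in> deck" "\<psi> \<in> deck"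
  shows "restrict_func Lam_U (deck_map \<psi>) \<otimes>\<^bsub>Aut_kcat Lam_U\<^esub> restrict_func Lam_U (deck_map \<phi>) =
    restrict_func Lam_U (deck_map (\<psi> \<circ> \<phi>))"
  unfolding Aut_kcat_simps
proof (rule restrict_func_cong)
  have ob: "fob (deck_map \<chi>) = (`) \<chi>" for \<chi>
    by (simp add: path_functor_def)
  note closed = k_isomorphism_closed[OF deck_map_iso[OF assms(1)], unfolded ob]
  fix x assume x: "x \<in> Ob Lam_U"
  then show "fob \<lparr>fob = fob (restrict_func Lam_U (deck_map \<psi>)) \<circ> fob (restrict_func Lam_U (deck_map \<phi>)),
      fmor = \<lambda>x y. fmor (restrict_func Lam_U (deck_map \<psi>)) (fob (restrict_func Lam_U (deck_map \<phi>)) x)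
         (fob (restrict_func Lam_U (deck_map \<phi>)) y) \<circ> fmor (restrict_func Lam_U (deck_map \<phi>)) x y\<rparr> x =
      fob (deck_map (\<psi> \<circ> \<phi>)) x"
    using closed(1) by (simp add: restrict_func_fob ob) (simp add: image_comp)
  fix y u assume "y \<in> Ob Lam_U" "u \<in> mor Lam_U x y"
  then show "fmor \<lparr>fob = fob (restrict_func Lam_U (deck_map \<psi>)) \<circ> fob (restrict_func Lam_U (deck_map \<phi>)),
      fmor = \<lambda>x y. fmor (restrict_func Lam_U (deck_map \<psi>)) (fob (restrict_func Lam_U (deck_map \<phi>)) x)
         (fob (restrict_func Lam_U (deck_map \<phi>)) y) \<circ> fmor (restrict_func Lam_U (deck_map \<phi>)) x y\<rparr> x y u =
      fmor (deck_map (\<psi> \<circ> \<phi>)) x y u"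
    using closed x deck_map_mult[OF assms x, of y u]
    by (simp add: restrict_func_fob restrict_func_fmor ob)
qed

lemma subgroup_deck_group: "subgroup deck_group (Aut_kcat Lam_U)"
proof -
  interpret A: group "Aut_kcat Lam_U"
    by (rule group_Aut_kcat[OF k_category_Lam_U])
  have carrier: "restrict_func Lam_U (deck_map \<phi>) \<in> carrier (Aut_kcat Lam_U)" if "\<phi> \<in> deck" for \<phi>
    using k_isomorphism_restrict[OF k_category_Lam_U deck_map_iso[OF that]] by (simp add: Aut_kcat_simps)
  show ?thesis
  proof (rule A.subgroupI)
    show "deck_group \<subseteq> carrier (Aut_kcat Lam_U)"
      using carrier by (auto simp: deck_group_def)
    show "deck_group \<noteq> {}"
      using deck_id by (auto simp: deck_group_def)
    fix F assume "F \<in> deck_group"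
    then obtain \<phi> where \<phi>: "\<phi> \<in> deck" "F = restrict_func Lam_U (deck_map \<phi>)"
      by (auto simp: deck_group_def)
    let ?\<psi> = "inv_into (cover_elts E b) \<phi>"
    have "restrict_func Lam_U (deck_map ?\<psi>) \<otimes>\<^bsub>Aut_kcat Lam_U\<^esub> F = \<one>\<^bsub>Aut_kcat Lam_U\<^esub>"
      using deck_group_mult[OF \<phi>(1) deck_inv(1)[OF \<phi>(1)]]
        deck_group_one[of "?\<psi> \<circ> \<phi>"] deck_inv(2)[OF \<phi>(1)] \<phi>(2) by simp
    then have "inv\<^bsub>Aut_kcat Lam_U\<^esub> F = restrict_func Lam_U (deck_map ?\<psi>)"
      using carrier \<phi> deck_inv(1)[OF \<phi>(1)] by (intro A.inv_equality) auto
    then show "inv\<^bsub>Aut_kcat Lam_U\<^esub> F \<in> deck_group"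
      using deck_inv(1)[OF \<phi>(1)] by (auto simp: deck_group_def)
    fix H assume "H \<in> deck_group"
    then obtain \<psi> where \<psi>: "\<psi> \<in> deck" "H = restrict_func Lam_U (deck_map \<psi>)"
      by (auto simp: deck_group_def)
    show "F \<otimes>\<^bsub>Aut_kcat Lam_U\<^esub> H \<in> deck_group"
      using deck_group_mult[OF \<psi>(1) \<phi>(1)] deck_comp[OF \<phi>(1) \<psi>(1)] \<phi>(2) \<psi>(2)
      by (auto simp: deck_group_def)
  qed
qed

text \<open>A preserved polygon is fixed pointwise, since targets are preserved and injective on it.
  One fixed element suffices because every \<open>Z\<close> is an extension of \<open>X\<close>.
  This is freeness on objects, which are polygons and not elements.\<close>

lemma deck_fixed_point:
  assumes "\<phi> \<in> deck" "X \<in> cover_elts E b" "\<phi> ` Pc X = Pc X" "Z \<in> cover_elts E b"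
  shows "\<phi> Z = Z"
proof -
  note d = deckD[OF assms(1)]
  have "\<phi> X \<in> Pc X" using assms(2,3) Pc_refl by blast
  then have "\<phi> X = X"
    using tgt_inj_Pc[OF assms(2)] Pc_refl[OF assms(2)] d(5)[OF assms(2)] by (auto dest: inj_onD)
  then show ?thesis
    using deck_ext[OF assms(1,2), of "pth X Z"] pth[OF assms(2,4)] by simp
qed

theorem galois_covering_cover_map:
  assumes conn: "connected_fbc E"
  shows "galois_covering Lam_U Lam cover_map"
  unfolding galois_covering_def
proof (intro conjI exI[of _ deck_group])
  have ob: "fob cover_map = (`) tgt"
    "fob (deck_map \<phi>) = (`) \<phi>" for \<phi>
    by (simp_all add: path_functor_def)
  let ?Ob = "Ob Lam_U"
  show "locally_bounded Lam_U"
    using U.locally_bounded_Lambda[of "cls []"] base by simp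
  show "locally_bounded Lam"
    by (rule locally_bounded_Lambda[OF base])
  show "covering_functor Lam_U Lam cover_map"
    by (rule fms_covering.covering_functor_Lambda_map[OF covering_tgt])
  show "fob cover_map ` ?Ob = Ob Lam"
  proof -
    have "tgt ` cover_elts E b = elts E"
    proof
      show "elts E \<subseteq> tgt ` cover_elts E b"
      proof
        fix e assume "e \<in> elts E"
        then obtain w where "is_walk E b w" "walk_target b w = e"
          using conn base unfolding connected_fbc_def by blast
        then show "e \<in> tgt ` cover_elts E b" by (intro image_eqI[of _ _ "cls w"]) auto
      qed
    qed auto
    moreover have "Ppart E = P ` elts E"
      using Pcl_props(1) by (auto elim!: Ppart_cases)
    moreover have "(`) tgt ` Pc ` cover_elts E b = P ` tgt ` cover_elts E b"
      unfolding image_image using tgt_Pc by (intro image_cong) auto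
    ultimately show ?thesis
      unfolding ob Ob_Lam_U by (simp add: Lambda_def)
  qed
  show "subgroup deck_group (Aut_kcat Lam_U)"
    by (rule subgroup_deck_group)
  show "\<forall>h\<in>deck_group. \<forall>x\<in>?Ob. fob h x = x \<longrightarrow> h = \<one>\<^bsub>Aut_kcat Lam_U\<^esub>"
  proof (intro ballI impI)
    fix h x assume h: "h \<in> deck_group" and x: "x \<in> ?Ob" "fob h x = x"
    from h obtain \<phi> where \<phi>: "\<phi> \<in> deck" "h = restrict_func Lam_U (deck_map \<phi>)"
      by (auto simp: deck_group_def)
    from x obtain X where X: "X \<in> cover_elts E b" "x = Pc X" by (auto simp: Ob_Lam_U)
    have "\<phi> ` Pc X = Pc X"
      using x \<phi> X by (simp add: restrict_func_fob ob)
    then show "h = \<one>\<^bsub>Aut_kcat Lam_U\<^esub>"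
      unfolding \<phi>(2) using deck_fixed_point[OF \<phi>(1) X(1)] by (intro deck_group_one)
  qed
  show "\<forall>h\<in>deck_group. \<forall>x\<in>?Ob. fob cover_map (fob h x) = fob cover_map x"
  proof (intro ballI)
    fix h x assume h: "h \<in> deck_group" and x: "x \<in> ?Ob"
    from h obtain \<phi> where \<phi>: "\<phi> \<in> deck" "h = restrict_func Lam_U (deck_map \<phi>)"
      by (auto simp: deck_group_def)
    have "x \<subseteq> cover_elts E b" using x Pc_subset by (auto simp: Ob_Lam_U)
    then have "tgt ` \<phi> ` x = tgt ` x" using deckD(5)[OF \<phi>(1)] by (force simp: image_image)
    then show "fob cover_map (fob h x) = fob cover_map x"
      using \<phi> x by (simp add: restrict_func_fob ob)
  qed
  show "\<forall>h\<in>deck_group. \<forall>x\<in>?Ob. \<forall>y\<in>?Ob. \<forall>u\<in>mor Lam_U x y.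
      fmor cover_map (fob h x) (fob h y) (fmor h x y u) = fmor cover_map x y u"
  proof (intro ballI)
    fix h x y u assume h: "h \<in> deck_group"
      and x: "x \<in> ?Ob" "y \<in> ?Ob" "u \<in> mor Lam_U x y"
    from h obtain \<phi> where \<phi>: "\<phi> \<in> deck" "h = restrict_func Lam_U (deck_map \<phi>)"
      by (auto simp: deck_group_def)
    show "fmor cover_map (fob h x) (fob h y) (fmor h x y u) = fmor cover_map x y u"
      using cover_map_deck[OF \<phi>(1) x] \<phi> x by (simp add: restrict_func_fob restrict_func_fmor ob)
  qed
  show "\<forall>a\<in>Ob Lam. \<forall>x\<in>fibre Lam_U cover_map a.
      \<forall>y\<in>fibre Lam_U cover_map a. \<exists>h\<in>deck_group. fob h x = y"
  proof (intro ballI)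
    fix a x y
    assume "x \<in> fibre Lam_U cover_map a" "y \<in> fibre Lam_U cover_map a"
    then obtain X Y' where X: "X \<in> cover_elts E b" "x = Pc X" "Y' \<in> cover_elts E b" "y = Pc Y'"
      and eq: "tgt ` x = tgt ` y" and x: "x \<in> ?Ob"
      by (auto simp: Ob_Lam_U ob)
    \<comment> \<open>Polygons with the same image contain elements with the same target; the deck
      transformation is chosen for such a pair.\<close>
    have "tgt X \<in> tgt ` Pc Y'" using eq X Pc_refl by blast
    then obtain Y where Y: "Y \<in> Pc Y'" "tgt X = tgt Y" by auto
    have "Y \<in> cover_elts E b" "y = Pc Y"
      using Pc_cover[OF X(3) Y(1)] Pc_eq[OF X(3) Y(1)] X(4) by auto
    from this(1) obtain \<phi> where \<phi>: "\<phi> \<in> deck" "\<phi> X = Y" using deck_transitive[OF X(1) _ Y(2)] by blast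
    have "\<phi> ` x = y" using deckD(4)[OF \<phi>(1) X(1)] \<phi> X \<open>y = Pc Y\<close> by simp
    then show "\<exists>h\<in>deck_group. fob h x = y"
      using \<phi> x by (intro bexI[of _ "restrict_func Lam_U (deck_map \<phi>)"])
        (auto simp: deck_group_def restrict_func_fob ob)
  qed
qed

end

section \<open>Invariants of homotopy classes\<close>

context fms_BC
begin

primrec wsum :: "('a \<Rightarrow> 'r::ab_group_add) \<Rightarrow> 'a \<Rightarrow> 'a steps \<Rightarrow> 'r" where
  "wsum c e [] = 0"
| "wsum c e (s # w) = (case fst s of Gpos \<Rightarrow> c e | Gneg \<Rightarrow> - c (snd s) | Tau \<Rightarrow> 0) + wsum c (snd s) w"

text \<open>A walk acts on the affine line, first step first. A backward step acts by the inverse of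
  the forward step at its endpoint, hence the parameters are those of \<open>snd s\<close>.\<close>

primrec waff :: "('a \<Rightarrow> 'r::field) \<Rightarrow> ('a \<Rightarrow> 'r) \<Rightarrow> 'a \<Rightarrow> 'a steps \<Rightarrow> 'r \<Rightarrow> 'r" where
  "waff q c e [] = (\<lambda>z. z)"
| "waff q c e (s # w) = (\<lambda>z. waff q c (snd s) w
    (case fst s of Gpos \<Rightarrow> q e * z + c e | Gneg \<Rightarrow> (z - c (snd s)) / q (snd s) | Tau \<Rightarrow> z))"

lemma wsum_append: "wsum c e (v @ w) = wsum c e v + wsum c (walk_target e v) w"
  by (induction v arbitrary: e) (auto simp: add.assoc)

lemma waff_append: "waff q c e (v @ w) z = waff q c (walk_target e v) w (waff q c e v z)"
  by (induction v arbitrary: e z) auto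

lemma gwalk_Suc: "gwalk E (int (Suc n)) e = gwalk E (int n) e @ [(Gpos, act E (int (Suc n)) e)]"
  using gwalk_pos[of "int n" e] by (simp add: add.commute)

lemma wsum_gwalk:
  "e \<in> elts E \<Longrightarrow> wsum c e (gwalk E (int n) e) = (\<Sum>i<n. c (act E (int i) e))"
  by (induction n) (simp_all add: gwalk_Suc wsum_append gwalk_is_walk del: of_nat_Suc)

lemma waff_gwalk:
  "e \<in> elts E \<Longrightarrow> waff q c e (gwalk E (int n) e) z =
    (\<Prod>i<n. q (act E (int i) e)) * z + (\<Sum>i<n. (\<Prod>j\<in>{i<..<n}. q (act E (int j) e)) * c (act E (int i) e))"
proof (induction n)
  case (Suc n)
  have "(\<Prod>j\<in>{i<..<Suc n}. q (act E (int j) e)) = q (act E (int n) e) * (\<Prod>j\<in>{i<..<n}. q (act E (int j) e))"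
    if "i < n" for i
  proof -
    have "{i<..<Suc n} = insert n {i<..<n}" using that by auto
    then show ?thesis by simp
  qed
  moreover have "{n<..<Suc n} = {}" by auto
  ultimately show ?case
    using Suc by (simp add: gwalk_Suc waff_append gwalk_is_walk sum_distrib_left algebra_simps del: of_nat_Suc)
qed simp

text \<open>Only (h3) imposes a condition: (h1) cancels, tau-steps have weight 0, and (h4) is
  trivial because the L-classes are singletons.\<close>

lemma wsum_homotopic:
  assumes "\<And>e h. e \<in> elts E \<Longrightarrow> h \<in> elts E \<Longrightarrow> P e = P h \<Longrightarrow>
    (\<Sum>i<deg E e. c (act E (int i) e)) = (\<Sum>i<deg E h. c (act E (int i) h))"
  shows "homotopic E e h v w \<Longrightarrow> wsum c e v = wsum c e w"
proof (induction rule: homotopic.induct)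
  case (h3 e h)
  then show ?case using assms[of e h] by (simp add: wsum_append wsum_gwalk)
next
  case (h4 e h)
  then show ?case by (simp add: type_MS)
next
  case (h5 e0 e1 v v' e2 w w')
  then show ?case using homotopic_walks by (fastforce simp: wsum_append)
qed (auto)

text \<open>As for sums, the one condition is that full paths starting at a common polygon act by
  the same map; nonzero slopes make the forward steps invertible for (h1).\<close>

lemma waff_homotopic:
  assumes q: "\<And>e. e \<in> elts E \<Longrightarrow> q e \<noteq> 0"
    and "\<And>e h z. e \<in> elts E \<Longrightarrow> h \<in> elts E \<Longrightarrow> P e = P h \<Longrightarrow>
      waff q c e (gwalk E (int (deg E e)) e) z = waff q c h (gwalk E (int (deg E h)) h) z"
  shows "homotopic E e h v w \<Longrightarrow> waff q c e v z = waff q c e w z"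
proof (induction arbitrary: z rule: homotopic.induct)
  case (h3 e h)
  then show ?case using assms(2)[of e h z] by (simp add: waff_append)
next
  case (h4 e h)
  then show ?case by (simp add: type_MS)
next
  case (h5 e0 e1 v v' e2 w w')
  have "walk_target e0 v = e1" "walk_target e0 v' = e1" using homotopic_walks[OF h5.hyps(1)] by auto
  then show ?case using h5.IH by (simp add: waff_append)
qed (auto simp: q)

abbreviation wdeg :: "'a \<Rightarrow> 'a steps \<Rightarrow> real" where
  "wdeg \<equiv> wsum (\<lambda>e. 1 / real (deg E e))"

lemma wdeg_gwalk: "e \<in> elts E \<Longrightarrow> wdeg e (gwalk E (int n) e) = real n / real (deg E e)"
  by (simp add: wsum_gwalk)

text \<open>The weight \<open>1 / d\<close> is chosen so that every full path has total weight 1, as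
  (h3) requires.\<close>

lemma wdeg_homotopic: "homotopic E e h v w \<Longrightarrow> wdeg e v = wdeg e w"
proof (rule wsum_homotopic)
  show "(\<Sum>i<deg E e. 1 / real (deg E (act E (int i) e))) = (\<Sum>i<deg E h. 1 / real (deg E (act E (int i) h)))"
    if "e \<in> elts E" "h \<in> elts E" for e h
    using that deg_pos[of e] deg_pos[of h] by simp
qed

text \<open>The stabiliser of \<open>e\<close> in the infinite cyclic group is trivial or generated
  by some \<open>N > 0\<close>. In the first case any number that is not a root of unity will do,
  here 2; in the second a primitive \<open>N\<close>-th root of unity.\<close>

lemma ex_stabilizer_root:
  assumes e: "e \<in> elts E"
  shows "\<exists>\<zeta>::complex. \<zeta> \<noteq> 0 \<and> (\<forall>i. \<zeta> powi i = 1 \<longleftrightarrow> act E i e = e)"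
proof (cases "\<exists>i>0. act E i e = e")
  case False
  have *: "i = 0" if "act E i e = e" for i
  proof (rule ccontr)
    assume "i \<noteq> 0"
    moreover have "act E (- i) e = e"
      using that e act_act[of e "- i" i] by simp
    ultimately show False using False that by (metis neg_0_less_iff_less not_less_iff_gr_or_eq)
  qed
  have "(2::complex) powi i = 1 \<longleftrightarrow> i = 0" for i
  proof
    assume "(2::complex) powi i = 1"
    then have "norm ((2::complex) powi i) = 1" by simp
    then have "(2::real) powi i = 1" by (simp add: norm_power_int)
    then show "i = 0"
      using power_int_strict_increasing[of 0 i "2::real"] power_int_strict_increasing[of i 0 "2::real"]
      by (cases i "0::int" rule: linorder_cases) auto
  qed simp
  then have "2 \<noteq> (0::complex) \<and> (\<forall>i. (2::complex) powi i = 1 \<longleftrightarrow> act E i e = e)"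
    using * e by auto
  then show ?thesis by blast
next
  case True
  define N where "N = (LEAST n::nat. 0 < n \<and> act E (int n) e = e)"
  have "\<exists>n::nat. 0 < n \<and> act E (int n) e = e"
    using True by (metis zero_less_imp_eq_int)
  then have N: "0 < N" "act E (int N) e = e"
    unfolding N_def by (metis (mono_tags, lifting) LeastI_ex)+
  have minimal: "N \<le> n" if "0 < n" "act E (int n) e = e" for n
    unfolding N_def using that by (intro Least_le) auto
  have mult: "act E (int N * k) e = e" for k
  proof (induction k rule: int_induct[where k = 0])
    case (step1 i)
    then show ?case using act_act[OF e, of "int N" "int N * i"] N(2) by (simp add: algebra_simps)
  next
    case (step2 i)
    have "act E (- int N) e = e" using act_act[OF e, of "- int N" "int N"] N(2) e by simp
    then show ?case using step2 act_act[OF e, of "- int N" "int N * i"] by (simp add: algebra_simps)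
  qed (use e in simp)
  have stab: "act E i e = e \<longleftrightarrow> int N dvd i" for i
  proof
    assume i: "act E i e = e"
    have "act E (i mod int N) e = e"
      using act_act[OF e, of "i mod int N" "int N * (i div int N)"] mult[of "i div int N"] i
      by (simp add: algebra_simps)
    moreover have "i mod int N \<ge> 0" "i mod int N < int N" using N(1) by auto
    ultimately have "i mod int N = 0"
      using minimal[of "nat (i mod int N)"] by (cases "i mod int N = 0") auto
    then show "int N dvd i" by auto
  next
    assume "int N dvd i"
    then show "act E i e = e" using mult by auto
  qed
  define \<zeta> where "\<zeta> = cis (2 * pi / real N)"
  have "\<zeta> powi i = 1 \<longleftrightarrow> int N dvd i" for i
  proof -
    have "\<zeta> powi i = cis (of_int i * (2 * pi / real N))"
      by (simp add: \<zeta>_def cis_power_int)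
    also have "\<dots> = 1 \<longleftrightarrow> (\<exists>m. of_int i * (2 * pi / real N) = of_int m * (2 * pi))"
      using cos_one_2pi_int[of "of_int i * (2 * pi / real N)"] cos_one_sin_zero[of "of_int i * (2 * pi / real N)"]
      by (auto simp: complex_eq_iff mult.assoc)
    also have "\<dots> \<longleftrightarrow> (\<exists>m. of_int i = (of_int m * real N))"
      using N(1) by (simp add: field_simps)
    also have "\<dots> \<longleftrightarrow> int N dvd i"
      by (auto simp: dvd_def mult.commute) (metis of_int_eq_iff of_int_mult of_int_of_nat_eq)+
    finally show ?thesis .
  qed
  then have "\<zeta> \<noteq> 0 \<and> (\<forall>i. \<zeta> powi i = 1 \<longleftrightarrow> act E i e = e)"
    using stab by (simp add: \<zeta>_def)
  then show ?thesis by blast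
qed

lemma ex_complex_root: "(z::complex) \<noteq> 0 \<Longrightarrow> 0 < n \<Longrightarrow> \<exists>w. w \<noteq> 0 \<and> w ^ n = z"
  by (intro exI[of _ "cis (Arg z / n) * of_real (root n (norm z))"])
     (auto simp: power_mult_distrib Complex.DeMoivre cis_Arg sgn_eq simp flip: of_real_power)

text \<open>
  On the orbit of \<open>e\<close> the step at \<open>g\<^sup>i e\<close> acts by \<open>z \<mapsto> q z + \<zeta>\<^sup>i\<close>, and at any other \<open>h\<close> by a
  \<open>deg h\<close>-th root of \<open>q\<^sup>d\<close>. If \<open>\<zeta> / q\<close> is a \<open>d\<close>-th root of unity different from \<open>1\<close>, every full
  path acts by \<open>z \<mapsto> q\<^sup>d z\<close>, so this is a representation of the homotopy groupoid.
\<close>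

lemma parallel_gwalks:
  assumes e: "e \<in> elts E" and h: "h \<in> elts E" "P h = P e"
    and n: "0 < n" "n < deg E e" and m: "m \<le> deg E h" and t: "P (act E (int n) e) = P (act E (int m) h)"
    and hom: "homotopic E e (act E (int m) h)
      (gwalk E (int n) e @ [(Tau, act E (int m) h)]) ([(Tau, h)] @ gwalk E (int m) h)"
  shows "e = h"
proof -
  define d where "d = deg E e"
  obtain \<zeta> :: complex where \<zeta>: "\<zeta> \<noteq> 0" "\<And>i. \<zeta> powi i = 1 \<longleftrightarrow> act E i e = e"
    using ex_stabilizer_root[OF e] by blast
  \<comment> \<open>A primitive \<open>d\<close>-th root of unity; it differs from 1 because
    \<open>0 < n < d\<close> forces \<open>d > 1\<close>.\<close>
  define \<omega> where "\<omega> = cis (2 * pi / real d)"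
  have d: "1 < d" using n by (simp add: d_def)
  have \<omega>0: "\<omega> \<noteq> 0" by (simp add: \<omega>_def)
  have \<omega>n: "\<omega> ^ k \<noteq> 1" if "0 < k" "k < d" for k
  proof
    assume "\<omega> ^ k = 1"
    then have "cos (real k * (2 * pi / real d)) = 1"
      by (simp add: \<omega>_def Complex.DeMoivre complex_eq_iff)
    then obtain j :: int where "real k * (2 * pi / real d) = of_int j * 2 * pi"
      by (auto simp: cos_one_2pi_int)
    then have "real k = of_int j * real d" using d by (simp add: field_simps)
    then have "int k = j * int d" by (metis of_int_eq_iff of_int_mult of_int_of_nat_eq)
    then show False using that by (metis dvd_triv_right int_dvd_int_iff nat_dvd_not_less)
  qed
  have \<omega>d: "\<omega> ^ d = 1" using d by (simp add: \<omega>_def Complex.DeMoivre)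
  \<comment> \<open>With \<open>\<zeta> = r * \<omega>\<close> the translation contributed by the
    step \<open>i\<close> of \<open>k\<close>, transported through the remaining ones, is
    \<open>r^(k-1) * \<omega>^i\<close> up to a common factor. This is what produces the geometric
    sum.\<close>
  define r where "r = \<zeta> / \<omega>"
  have r0: "r \<noteq> 0" using \<zeta> \<omega>0 by (simp add: r_def)
  have root: "\<exists>w. w \<noteq> 0 \<and> w ^ deg E x = r ^ d" if "x \<in> elts E" for x
    using ex_complex_root[of "r ^ d" "deg E x"] r0 deg_pos[OF that] by auto
  define Orb where "Orb = (\<lambda>i. act E i e) ` UNIV"
  \<comment> \<open>On the orbit the slope is \<open>r\<close>; elsewhere it is a root chosen so
    that a full path, whatever its degree, has slope \<open>r^d\<close>.\<close>
  define q where "q x = (if x \<in> Orb then r else SOME w. w \<noteq> 0 \<and> w ^ deg E x = r ^ d)" for x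
  \<comment> \<open>The exponent is only determined modulo the stabiliser of \<open>e\<close>, but
    \<open>\<zeta>\<close> was chosen so that its power is well defined, see
    \<open>c_act\<close>.\<close>
  define c where "c x = (if x \<in> Orb then \<zeta> powi (SOME i. x = act E i e) else 0)" for x
  have q: "q x \<noteq> 0 \<and> q x ^ deg E x = r ^ d" if "x \<in> elts E" for x
  proof (cases "x \<in> Orb")
    case True
    then show ?thesis using r0 e by (auto simp: q_def Orb_def d_def)
  next
    case False
    then show ?thesis unfolding q_def using someI_ex[OF root[OF that]] by simp
  qed
  have Orb_act: "act E i x \<in> Orb \<longleftrightarrow> x \<in> Orb" if "x \<in> elts E" for i x
  proof -
    have "act E i y \<in> Orb" if "y \<in> Orb" for i y
      using that e by (auto simp: Orb_def)
    from this[of x i] this[of "act E i x" "- i"] show ?thesis using that by auto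
  qed
  have c_act: "c (act E i e) = \<zeta> powi i" for i
  proof -
    define j where "j = (SOME j. act E i e = act E j e)"
    have j: "act E i e = act E j e" unfolding j_def by (rule someI[of _ i]) simp
    then have "act E (i - j) e = e"
      using e act_act[OF e, of "- j" i] act_act[OF e, of "- j" j] by (simp add: algebra_simps)
    then have "\<zeta> powi (i - j) = 1" using \<zeta> by simp
    then have "\<zeta> powi i = \<zeta> powi j" using \<zeta>(1) by (simp add: power_int_diff)
    then show ?thesis by (simp add: c_def Orb_def j_def)
  qed
  have q_act: "q (act E i x) = q x" if "x \<in> elts E" for i x
    using that Orb_act[OF that] by (simp add: q_def)
  have sum_c: "(\<Sum>i<k. (\<Prod>j\<in>{i<..<k}. q (act E (int j) x)) * c (act E (int i) x)) =
      (if x \<in> Orb then c x * r ^ (k - 1) * (\<Sum>i<k. \<omega> ^ i) else 0)" if x: "x \<in> elts E" for x k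
  proof (cases "x \<in> Orb")
    case False
    then show ?thesis using Orb_act[OF x] by (simp add: c_def)
  next
    case True
    then obtain l where l: "x = act E l e" by (auto simp: Orb_def)
    have "(\<Prod>j\<in>{i<..<k}. q (act E (int j) x)) * c (act E (int i) x) = c x * r ^ (k - 1) * \<omega> ^ i"
      if "i < k" for i
    proof -
      have "(\<Prod>j\<in>{i<..<k}. q (act E (int j) x)) = r ^ (k - 1 - i)"
        using True x by (simp add: q_act) (simp add: q_def)
      moreover have "c (act E (int i) x) = c x * \<zeta> ^ i"
        using e \<zeta>(1) by (simp add: l c_act power_int_add add.commute)
      moreover have "r ^ (k - 1) = r ^ (k - 1 - i) * r ^ i"
        using that by (simp flip: power_add)
      moreover have "\<zeta> ^ i = r ^ i * \<omega> ^ i"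
        using \<omega>0 by (simp add: r_def power_divide)
      ultimately show ?thesis by simp
    qed
    then show ?thesis using True by (simp add: sum_distrib_left)
  qed
  have geo: "(\<Sum>i<k. \<omega> ^ i) = (1 - \<omega> ^ k) / (1 - \<omega>)" for k
    using \<omega>n[of 1] d by (simp add: sum_gp_strict)
  have aff: "waff q c x (gwalk E (int k) x) z = q x ^ k * z + (if x \<in> Orb then c x * r ^ (k - 1) * ((1 - \<omega> ^ k) / (1 - \<omega>)) else 0)"
    if "x \<in> elts E" for x k z
    unfolding waff_gwalk[OF that] sum_c[OF that] geo by (simp add: q_act that)
  have deg_Orb: "deg E x = d" if "x \<in> Orb" for x
    using that e by (auto simp: Orb_def d_def)
  \<comment> \<open>The translation part vanishes off the orbit because \<open>c\<close> does, and
    on the orbit because \<open>\<omega>^d = 1\<close>.\<close>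
  have full: "waff q c x (gwalk E (int (deg E x)) x) z = r ^ d * z" if "x \<in> elts E" for x z
    using that q[OF that] deg_Orb \<omega>d by (simp add: aff)
  have "waff q c e (gwalk E (int n) e @ [(Tau, act E (int m) h)]) z = waff q c e ([(Tau, h)] @ gwalk E (int m) h) z" for z
    using waff_homotopic[of q c, OF _ _ hom] q full by simp
  then have eq: "waff q c e (gwalk E (int n) e) z = waff q c h (gwalk E (int m) h) z" for z
    by (simp add: waff_append)
  have eOrb: "e \<in> Orb" "c e = 1"
    using e c_act[of 0] by (auto simp: Orb_def intro!: image_eqI[of _ _ 0])
  have "(1 - \<omega> ^ n) / (1 - \<omega>) \<noteq> 0" using \<omega>n[of n] \<omega>n[of 1] n d by (simp add: d_def)
  \<comment> \<open>The walk from \<open>e\<close> moves the point 0. Off the orbit of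
    \<open>e\<close> all walks along \<open>g\<close> fix 0, so \<open>h\<close> must lie on the
    orbit.\<close>
  then have nz: "r ^ (n - 1) * ((1 - \<omega> ^ n) / (1 - \<omega>)) \<noteq> 0" using r0 by simp
  then have hOrb: "h \<in> Orb"
    using eq[of 0] aff[OF e, of n 0] aff[OF h(1), of m 0] eOrb by (auto split: if_splits)
  then obtain l where l: "h = act E l e" by (auto simp: Orb_def)
  \<comment> \<open>On one orbit the degrees coincide, so the total degree gives
    \<open>n = m\<close>; then equality of the images of 0 leaves
    \<open>c h = c e = 1\<close>.\<close>
  have "wdeg e (gwalk E (int n) e @ [(Tau, act E (int m) h)]) = wdeg e ([(Tau, h)] @ gwalk E (int m) h)"
    by (rule wdeg_homotopic[OF hom])
  then have "real n / real d = real m / real d"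
    using e h(1) deg_Orb[OF hOrb] by (simp add: wsum_append wdeg_gwalk d_def del: wsum.simps) (simp add: wdeg_gwalk)
  then have "n = m" using d by simp
  then have "c h = 1"
    using eq[of 0] aff[OF e, of n 0] aff[OF h(1), of m 0] eOrb hOrb nz by auto
  then have "\<zeta> powi l = 1" using c_act[of l] l by simp
  then show "e = h" using \<zeta>(2) l by simp
qed

end

section \<open>Morphism spaces over the universal cover\<close>

context based_fms_BC
begin

definition pdeg :: "'a steps set \<Rightarrow> real" where
  "pdeg X = wdeg b (rep X)"

lemma pdeg_ext:
  assumes "X \<in> cover_elts E b" "is_walk E (tgt X) v"
  shows "pdeg (ext X v) = pdeg X + wdeg (tgt X) v"
proof -
  have w: "is_walk E b (rep X @ v)" using rep[OF assms(1)] assms(2) by (simp add: tgt_def)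
  then have "homotopic E b (walk_target b (rep X @ v)) (rep X @ v) (rep (ext X v))"
    unfolding ext_def using cls_eq_iff[OF w, of "rep (cls (rep X @ v))"] rep[OF cls_cover[OF w]] by simp
  from wdeg_homotopic[OF this] show ?thesis
    by (simp add: pdeg_def wsum_append tgt_def)
qed

lemma pdeg_Pc: "X \<in> cover_elts E b \<Longrightarrow> Y \<in> Pc X \<Longrightarrow> pdeg Y = pdeg X"
  by (auto simp: Pc_def pdeg_ext simp del: is_walk.simps)

lemma pdeg_act: "X \<in> cover_elts E b \<Longrightarrow> pdeg (act U (int n) X) = pdeg X + real n / real (deg U X)"
  by (simp add: act_U pdeg_ext gwalk_is_walk wdeg_gwalk deg_U)

definition vdeg :: "'a steps set set \<Rightarrow> real" where
  "vdeg x = pdeg (SOME X. X \<in> x)"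

lemma vdeg_Pc: "X \<in> cover_elts E b \<Longrightarrow> vdeg (Pc X) = pdeg X"
  unfolding vdeg_def using pdeg_Pc[of X "SOME Y. Y \<in> Pc X"] someI[of "\<lambda>Y. Y \<in> Pc X", OF Pc_refl[of X]] by simp

text \<open>The total degree forces equal relative lengths, so both paths are trivial, both are
  full, or both are proper. In the proper case equality of the endpoints in the cover is a homotopy
  below, and \<open>parallel_gwalks\<close> shows that the two paths start at the same
  element.\<close>

lemma parallel_paths:
  assumes X: "X \<in> cover_elts E b" "n \<le> deg U X" and Y: "Y \<in> Pc X" "m \<le> deg U Y"
    and t: "act U (int m) Y \<in> Pc (act U (int n) X)"
  shows "U.tok (U.opath X n) = U.tok (U.opath Y m)"
proof -
  have YC: "Y \<in> cover_elts E b" "P (tgt Y) = P (tgt X)" using Pc_cover[OF X(1) Y(1)] by auto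
  have pos: "0 < deg U X" "0 < deg U Y" using U.deg_pos X YC by simp_all
  have "pdeg Y + real m / real (deg U Y) = pdeg X + real n / real (deg U X)"
    using pdeg_Pc[OF act_U_closed[OF X(1)] t] pdeg_act[OF X(1)] pdeg_act[OF YC(1)] by simp
  then have dd: "real m / real (deg U Y) = real n / real (deg U X)"
    using pdeg_Pc[OF X(1) Y(1)] by simp
  consider "n = 0" | "n = deg U X" | "0 < n" "n < deg U X" using X(2) by linarith
  then show ?thesis
  proof cases
    case 1
    then have "m = 0" using dd pos by simp
    then show ?thesis using 1 by simp
  next
    case 2
    then have "m = deg U Y" using dd pos by simp
    then show ?thesis using 2 X YC by (simp add: U.tok_opath)
  next
    case 3
    let ?e = "tgt X" and ?h = "tgt Y"
    have eh: "?e \<in> elts E" "?h \<in> elts E" "?h \<in> P ?e"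
      using X YC Pcl_props(2)[of ?h] by auto
    have tP: "P (act E (int n) ?e) = P (act E (int m) ?h)"
      using Pc_cover[OF act_U_closed[OF X(1)] t] X YC by simp
    have th: "act E (int m) ?h \<in> P (act E (int n) ?e)"
      using tP eh Pcl_props(2)[of "act E (int m) ?h"] by simp
    \<comment> \<open>Within a polygon of the cover an element is determined by its target; the same
      argument identifies the end of the second path below.\<close>
    have Y_eq: "ext X [(Tau, ?h)] = Y"
      by (rule inj_onD[OF tgt_inj_Pc[OF X(1)]]) (use X YC Y eh in \<open>auto simp: Pc_def simp del: is_walk.simps\<close>)
    have "ext (act U (int n) X) [(Tau, act E (int m) ?h)] = act U (int m) Y"
      by (rule inj_onD[OF tgt_inj_Pc[OF act_U_closed[OF X(1), of "int n"]]])
         (use X YC t th eh act_U_closed[OF X(1), of "int n"] in \<open>auto simp: Pc_def simp del: is_walk.simps\<close>)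
    then have "ext X (gwalk E (int n) ?e @ [(Tau, act E (int m) ?h)]) = ext X ([(Tau, ?h)] @ gwalk E (int m) ?h)"
      using X YC eh th Y_eq ext_ext[of X "[(Tau, ?h)]" "gwalk E (int m) ?h"]
        ext_ext[of X "gwalk E (int n) ?e" "[(Tau, act E (int m) ?h)]"]
      by (simp add: act_U gwalk_is_walk del: is_walk.simps)
    moreover have "is_walk E ?e (gwalk E (int n) ?e @ [(Tau, act E (int m) ?h)])"
      "is_walk E ?e ([(Tau, ?h)] @ gwalk E (int m) ?h)"
      unfolding is_walk_append using eh th by (simp_all add: gwalk_is_walk del: is_walk.simps)
    ultimately have "homotopic E ?e (act E (int m) ?h)
        (gwalk E (int n) ?e @ [(Tau, act E (int m) ?h)]) ([(Tau, ?h)] @ gwalk E (int m) ?h)"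
      using X ext_eq_iff by fastforce
    then have "?e = ?h"
      by (rule parallel_gwalks[rotated 7]) (use eh YC 3 X Y tP in \<open>simp_all add: deg_U\<close>)
    then have "X = Y"
      using inj_onD[OF tgt_inj_Pc[OF X(1)]] Pc_refl[OF X(1)] Y(1) by blast
    then show ?thesis using dd pos by simp
  qed
qed

lemma nonzero_path_U:
  assumes "qpath U.Q x p y" "U.tok p \<noteq> None"
  obtains X n where "X \<in> cover_elts E b" "n \<le> deg U X" "p = U.opath X n" "x = Pc X" "y = Pc (act U (int n) X)"
proof -
  from assms(2) obtain X n where X: "X \<in> elts U" "n \<le> deg U X" "p = U.opath X n"
    unfolding U.tok_not_None_iff by blast
  show thesis
  proof (cases "n = 0")
    case True
    then have "x = y" "x \<in> Ppart U" using assms(1) X by (auto simp: U.Q.awalk_Nil_iff)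
    \<comment> \<open>The empty path does not know its vertex, so \<open>X\<close> is exchanged for
      an element of the polygon \<open>x\<close>.\<close>
    then obtain Z where "Z \<in> cover_elts E b" "x = Pc Z" "y = Pc Z"
      unfolding Ppart_U by auto
    then show thesis using that[of Z 0] True X by (simp add: act_U_0)
  next
    case False
    then show thesis using that[of X n] assms(1) X by (simp add: U.opath_awalk_iff Pcl_U act_U_closed)
  qed
qed

text \<open>Since tokens index a basis, every morphism space over the cover has dimension at most
  one.\<close>

lemma tokens_U_unique:
  assumes "t \<in> U.Q.tokens x y" "t' \<in> U.Q.tokens x y"
  shows "t = t'"
proof -
  obtain p p' where p: "qpath U.Q x p y" "U.tok p = Some t" "qpath U.Q x p' y" "U.tok p' = Some t'"
    using assms by (auto simp: U.Q.tokens_def)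
  obtain X n where X: "X \<in> cover_elts E b" "n \<le> deg U X" "p = U.opath X n" "x = Pc X" "y = Pc (act U (int n) X)"
    using nonzero_path_U[OF p(1)] p(2) by (metis option.distinct(1))
  obtain Y m where Y: "Y \<in> cover_elts E b" "m \<le> deg U Y" "p' = U.opath Y m" "x = Pc Y" "y = Pc (act U (int m) Y)"
    using nonzero_path_U[OF p(3)] p(4) by (metis option.distinct(1))
  have "U.tok p = U.tok p'"
    unfolding X(3) Y(3)
    by (rule parallel_paths)
       (use X Y Pc_refl[OF Y(1)] Pc_refl[OF act_U_closed[OF Y(1), of "int m"]] in auto)
  then show ?thesis using p by simp
qed

lemma vdeg_less:
  assumes "qpath U.Q x p y" "U.tok p \<noteq> None" "p \<noteq> []"
  shows "vdeg x < vdeg y"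
proof -
  obtain X n where X: "X \<in> cover_elts E b" "n \<le> deg U X" "p = U.opath X n" "x = Pc X" "y = Pc (act U (int n) X)"
    using nonzero_path_U[OF assms(1,2)] .
  then show ?thesis
    using assms(3) U.deg_pos[of X] by (simp add: vdeg_Pc act_U_closed pdeg_act)
qed

end

section \<open>The fundamental group of a quiver\<close>

lemma flip_sign_flip_sign [simp]: "flip_sign (flip_sign a) = a"
  by (cases a) auto

lemma inv_walk_simps [simp]:
  "inv_walk [] = []" "inv_walk (v @ w) = inv_walk w @ inv_walk v" "inv_walk (inv_walk w) = w"
  by (simp_all add: inv_walk_def rev_map o_def)

context wf_digraph
begin

lemma wf_double_quiver: "wf_digraph (double_quiver G)"
  by unfold_locales (auto simp: double_quiver_def)

interpretation dq: wf_digraph "double_quiver G"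
  by (rule wf_double_quiver)

lemma dq_simps [simp]:
  "verts (double_quiver G) = verts G"
  "arcs (double_quiver G) = Pos ` arcs G \<union> Neg ` arcs G"
  "tail (double_quiver G) (Pos a) = tail G a" "tail (double_quiver G) (Neg a) = head G a"
  "head (double_quiver G) (Pos a) = head G a" "head (double_quiver G) (Neg a) = tail G a"
  by (simp_all add: double_quiver_def)

lemma qwalk_Pos: "qpath G x p y \<Longrightarrow> qwalk G x (map Pos p) y"
  by (induction p arbitrary: x) (auto simp: awalk_Nil_iff dq.awalk_Nil_iff awalk_Cons_iff dq.awalk_Cons_iff)

lemma qwalk_append: "qwalk G x v y \<Longrightarrow> qwalk G y w z \<Longrightarrow> qwalk G x (v @ w) z"
  by (rule dq.awalk_appendI)

lemma qwalk_inv: "qwalk G x w y \<Longrightarrow> qwalk G y (inv_walk w) x"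
proof (induction w arbitrary: x)
  case Nil
  then show ?case by (auto simp: dq.awalk_Nil_iff)
next
  case (Cons s w)
  let ?z = "head (double_quiver G) s"
  have s: "s \<in> arcs (double_quiver G)" "tail (double_quiver G) s = x" "qwalk G ?z w y"
    using Cons.prems by (auto simp: dq.awalk_Cons_iff)
  have "qwalk G ?z [flip_sign s] x"
    using s(1,2) by (cases s) (auto simp: dq.awalk_Cons_iff dq.awalk_Nil_iff)
  then have "qwalk G y (inv_walk w @ [flip_sign s]) x"
    using Cons.IH[OF s(3)] by (rule qwalk_append[rotated])
  then show ?case by (simp add: inv_walk_def)
qed

lemma walk_cong_qwalk: "walk_cong G x y v w \<Longrightarrow> qwalk G x v y \<and> qwalk G x w y"
proof (induction rule: walk_cong.induct)
  case (wc_inv_left a)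
  then show ?case by (auto simp: dq.awalk_Cons_iff dq.awalk_Nil_iff)
next
  case (wc_inv_right a)
  then show ?case by (auto simp: dq.awalk_Cons_iff dq.awalk_Nil_iff)
qed (auto intro: qwalk_append)

lemma walk_cong_inv: "qwalk G x w y \<Longrightarrow> walk_cong G x x (w @ inv_walk w) []"
proof (induction w arbitrary: x)
  case Nil
  then show ?case by (auto simp: dq.awalk_Nil_iff intro: wc_refl)
next
  case (Cons s w)
  let ?z = "head (double_quiver G) s"
  have s: "s \<in> arcs (double_quiver G)" "tail (double_quiver G) s = x" "qwalk G ?z w y"
    using Cons.prems by (auto simp: dq.awalk_Cons_iff)
  have w: "qwalk G x [s] ?z" "qwalk G ?z [flip_sign s] x"
    using s(1,2) by (cases s; auto simp: dq.awalk_Cons_iff dq.awalk_Nil_iff)+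
  have "walk_cong G ?z x ((w @ inv_walk w) @ [flip_sign s]) ([] @ [flip_sign s])"
    by (rule wc_comp[OF Cons.IH[OF s(3)] wc_refl[OF w(2)]])
  from wc_comp[OF wc_refl[OF w(1)] this]
  have "walk_cong G x x ((s # w) @ inv_walk (s # w)) [s, flip_sign s]"
    by (simp add: inv_walk_def)
  moreover have "walk_cong G x x [s, flip_sign s] []"
    using s(1,2) wc_inv_left[of _ G] wc_inv_right[of _ G] by (cases s) auto
  ultimately show ?case by (rule wc_trans)
qed

lemma walk_cong_inv': "qwalk G x w y \<Longrightarrow> walk_cong G y y (inv_walk w @ w) []"
  using walk_cong_inv[OF qwalk_inv, of x w y] by simp

lemma walk_class_eq_iff:
  "qwalk G x v x \<Longrightarrow> walk_class G x v = walk_class G x w \<longleftrightarrow> walk_cong G x x v w"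
proof
  assume v: "qwalk G x v x" and "walk_class G x v = walk_class G x w"
  then have "v \<in> walk_class G x w" using wc_refl[OF v] by (auto simp: walk_class_def)
  then show "walk_cong G x x v w" by (auto simp: walk_class_def intro: wc_sym)
next
  assume "walk_cong G x x v w"
  then show "walk_class G x v = walk_class G x w"
    unfolding walk_class_def by (auto intro: wc_trans wc_sym)
qed

lemma quiver_pi1_mult:
  assumes "qwalk G x v x" "qwalk G x w x"
  shows "walk_class G x w \<otimes>\<^bsub>quiver_pi1 G x\<^esub> walk_class G x v = walk_class G x (v @ w)"
proof -
  have eq: "walk_class G x (v' @ w') = walk_class G x (v @ w)"
    if "v' \<in> walk_class G x v" "w' \<in> walk_class G x w" for v' w'
  proof -
    have "walk_cong G x x (v @ w) (v' @ w')"
      using that by (intro wc_comp) (auto simp: walk_class_def)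
    then show ?thesis
      using walk_class_eq_iff[OF qwalk_append[OF assms]] by blast
  qed
  have ne: "walk_class G x v \<noteq> {}" "walk_class G x w \<noteq> {}"
    using assms by (auto simp: walk_class_def intro: wc_refl)
  have inner: "(\<Union>v'\<in>walk_class G x v. walk_class G x (v' @ w')) = walk_class G x (v @ w)"
    if "w' \<in> walk_class G x w" for w'
    by (rule SUP_eq_const[OF ne(1)]) (rule eq[OF _ that])
  have "(\<Union>w'\<in>walk_class G x w. \<Union>v'\<in>walk_class G x v. walk_class G x (v' @ w')) = walk_class G x (v @ w)"
    by (rule SUP_eq_const[OF ne(2)]) (rule inner)
  then show ?thesis
    by (simp add: quiver_pi1_def)
qed

lemma quiver_pi1_carrier: "W \<in> carrier (quiver_pi1 G x) \<longleftrightarrow> (\<exists>w. qwalk G x w x \<and> W = walk_class G x w)"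
  by (auto simp: quiver_pi1_def)

lemma quiver_pi1_carrierI: "qwalk G x w x \<Longrightarrow> walk_class G x w \<in> carrier (quiver_pi1 G x)"
  by (auto simp: quiver_pi1_def)

lemma quiver_pi1_one: "\<one>\<^bsub>quiver_pi1 G x\<^esub> = walk_class G x []"
  by (simp add: quiver_pi1_def)

lemma group_quiver_pi1:
  assumes x: "x \<in> verts G"
  shows "group (quiver_pi1 G x)"
proof (rule groupI)
  have e: "qwalk G x [] x" using x by (simp add: dq.awalk_Nil_iff)
  show "\<one>\<^bsub>quiver_pi1 G x\<^esub> \<in> carrier (quiver_pi1 G x)"
    using e by (auto simp: quiver_pi1_one quiver_pi1_carrier)
  fix U V assume U: "U \<in> carrier (quiver_pi1 G x)" and V: "V \<in> carrier (quiver_pi1 G x)"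
  obtain u v where uv: "qwalk G x u x" "U = walk_class G x u" "qwalk G x v x" "V = walk_class G x v"
    using U V by (auto simp: quiver_pi1_carrier)
  then show "U \<otimes>\<^bsub>quiver_pi1 G x\<^esub> V \<in> carrier (quiver_pi1 G x)"
    using quiver_pi1_carrierI[OF qwalk_append[OF uv(3,1)]] by (simp add: quiver_pi1_mult)
  show "\<one>\<^bsub>quiver_pi1 G x\<^esub> \<otimes>\<^bsub>quiver_pi1 G x\<^esub> U = U"
    using U e by (auto simp: quiver_pi1_carrier quiver_pi1_one quiver_pi1_mult)
  note u = uv(1,2)
  have "walk_class G x (inv_walk u) \<otimes>\<^bsub>quiver_pi1 G x\<^esub> U = \<one>\<^bsub>quiver_pi1 G x\<^esub>"
    unfolding u(2) quiver_pi1_one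
    using u(1) qwalk_inv[OF u(1)] walk_cong_inv[OF u(1)]
    by (simp add: quiver_pi1_mult walk_class_eq_iff qwalk_append)
  then show "\<exists>W\<in>carrier (quiver_pi1 G x). W \<otimes>\<^bsub>quiver_pi1 G x\<^esub> U = \<one>\<^bsub>quiver_pi1 G x\<^esub>"
    using qwalk_inv[OF u(1)] by (intro bexI[of _ "walk_class G x (inv_walk u)"]) (auto simp: quiver_pi1_carrier)
  fix W assume W: "W \<in> carrier (quiver_pi1 G x)"
  obtain v w where vw: "qwalk G x v x" "V = walk_class G x v" "qwalk G x w x" "W = walk_class G x w"
    using V W by (auto simp: quiver_pi1_carrier)
  show "U \<otimes>\<^bsub>quiver_pi1 G x\<^esub> V \<otimes>\<^bsub>quiver_pi1 G x\<^esub> W = U \<otimes>\<^bsub>quiver_pi1 G x\<^esub> (V \<otimes>\<^bsub>quiver_pi1 G x\<^esub> W)"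
    using u vw by (simp add: quiver_pi1_mult qwalk_append)
qed

text \<open>Congruence modulo \<open>N\<close> extended from closed walks to walks from
  \<open>x\<close> to any \<open>y\<close>. It is compatible with appending walks; changes behind a
  prefix are covered by the relators, which carry their connecting walk from
  \<open>x\<close>.\<close>

definition walk_rel :: "'a \<Rightarrow> 'b signed list set set \<Rightarrow> 'a \<Rightarrow> 'b signed list \<Rightarrow> 'b signed list \<Rightarrow> bool" where
  "walk_rel x N y v w \<longleftrightarrow> qwalk G x v y \<and> qwalk G x w y \<and> walk_class G x (v @ inv_walk w) \<in> N"

context
  fixes x N
  assumes x: "x \<in> verts G" and N: "subgroup N (quiver_pi1 G x)"
begin

lemma walk_rel_cong: "walk_cong G x y v w \<Longrightarrow> walk_rel x N y v w"
proof -
  assume *: "walk_cong G x y v w"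
  then have q: "qwalk G x v y" "qwalk G x w y" using walk_cong_qwalk by auto
  have "walk_cong G x x (v @ inv_walk w) []"
    using wc_comp[OF * wc_refl[OF qwalk_inv[OF q(2)]]] walk_cong_inv[OF q(2)] by (rule wc_trans)
  then have "walk_class G x (v @ inv_walk w) = \<one>\<^bsub>quiver_pi1 G x\<^esub>"
    using q by (simp add: walk_class_eq_iff quiver_pi1_one qwalk_append qwalk_inv)
  then show ?thesis
    using subgroup.one_closed[OF N] q by (simp add: walk_rel_def)
qed

lemma walk_rel_refl: "qwalk G x v y \<Longrightarrow> walk_rel x N y v v"
  by (intro walk_rel_cong wc_refl)

lemma walk_rel_sym: "walk_rel x N y v w \<Longrightarrow> walk_rel x N y w v"
proof -
  assume *: "walk_rel x N y v w"
  then have q: "qwalk G x v y" "qwalk G x w y" by (auto simp: walk_rel_def)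
  interpret group "quiver_pi1 G x" by (rule group_quiver_pi1[OF x])
  have c: "qwalk G x (v @ inv_walk w) x" "qwalk G x (w @ inv_walk v) x"
    using q by (auto intro: qwalk_append qwalk_inv)
  have "walk_class G x ((v @ inv_walk w) @ (w @ inv_walk v)) = walk_class G x []"
    using walk_cong_inv[OF c(1)] qwalk_append[OF c] by (subst walk_class_eq_iff) auto
  then have "walk_class G x (w @ inv_walk v) \<otimes>\<^bsub>quiver_pi1 G x\<^esub> walk_class G x (v @ inv_walk w) = \<one>\<^bsub>quiver_pi1 G x\<^esub>"
    unfolding quiver_pi1_mult[OF c] quiver_pi1_one .
  then have "inv\<^bsub>quiver_pi1 G x\<^esub> (walk_class G x (v @ inv_walk w)) = walk_class G x (w @ inv_walk v)"
    using c by (intro inv_equality quiver_pi1_carrierI)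
  then show ?thesis
    using subgroup.m_inv_closed[OF N, of "walk_class G x (v @ inv_walk w)"] * q by (simp add: walk_rel_def)
qed

lemma walk_rel_trans: "walk_rel x N y u v \<Longrightarrow> walk_rel x N y v w \<Longrightarrow> walk_rel x N y u w"
proof -
  assume *: "walk_rel x N y u v" "walk_rel x N y v w"
  then have q: "qwalk G x u y" "qwalk G x v y" "qwalk G x w y" by (auto simp: walk_rel_def)
  have c: "qwalk G x (u @ inv_walk v) x" "qwalk G x (v @ inv_walk w) x" "qwalk G x (u @ inv_walk w) x"
    using q by (auto intro: qwalk_append qwalk_inv)
  have "walk_cong G x x (u @ ((inv_walk v @ v) @ inv_walk w)) (u @ ([] @ inv_walk w))"
    by (rule wc_comp[OF wc_refl[OF q(1)] wc_comp[OF walk_cong_inv'[OF q(2)] wc_refl[OF qwalk_inv[OF q(3)]]]])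
  then have "walk_class G x ((u @ inv_walk v) @ (v @ inv_walk w)) = walk_class G x (u @ inv_walk w)"
    using qwalk_append[OF c(1,2)] by (subst walk_class_eq_iff) auto
  moreover have "walk_class G x ((u @ inv_walk v) @ (v @ inv_walk w)) \<in> N"
    using subgroup.m_closed[OF N, of "walk_class G x (v @ inv_walk w)" "walk_class G x (u @ inv_walk v)"] * c(1,2)
    by (simp add: walk_rel_def quiver_pi1_mult)
  ultimately show ?thesis
    using q by (simp add: walk_rel_def)
qed

lemma walk_rel_append: "walk_rel x N y v w \<Longrightarrow> qwalk G y s z \<Longrightarrow> walk_rel x N z (v @ s) (w @ s)"
proof -
  assume *: "walk_rel x N y v w" and s: "qwalk G y s z"
  then have q: "qwalk G x v y" "qwalk G x w y" by (auto simp: walk_rel_def)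
  have "walk_cong G x x (v @ ((s @ inv_walk s) @ inv_walk w)) (v @ ([] @ inv_walk w))"
    by (rule wc_comp[OF wc_refl[OF q(1)] wc_comp[OF walk_cong_inv[OF s] wc_refl[OF qwalk_inv[OF q(2)]]]])
  moreover from this have "qwalk G x (v @ ((s @ inv_walk s) @ inv_walk w)) x"
    using walk_cong_qwalk by blast
  ultimately have "walk_class G x (v @ ((s @ inv_walk s) @ inv_walk w)) = walk_class G x (v @ ([] @ inv_walk w))"
    using walk_class_eq_iff by blast
  then show ?thesis
    using * q s by (simp add: walk_rel_def qwalk_append)
qed

end

text \<open>Every normal subgroup containing the relators is the whole group, and the whole group is
  one of them because the relators lie in it. So their intersection is everything and the quotient
  has a single coset.\<close>

lemma trivial_pi1I:
  assumes x: "x \<in> verts G"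
    and "\<And>N w. subgroup N (quiver_pi1 G x) \<Longrightarrow> pi1_relators G I x \<subseteq> N \<Longrightarrow> qwalk G x w x \<Longrightarrow> walk_class G x w \<in> N"
    and rel: "pi1_relators G I x \<subseteq> carrier (quiver_pi1 G x)"
  shows "trivial_group (pi1 G I x)"
proof -
  interpret group "quiver_pi1 G x" by (rule group_quiver_pi1[OF x])
  let ?G = "quiver_pi1 G x"
  have "N = carrier ?G" if "normal N ?G" "pi1_relators G I x \<subseteq> N" for N
  proof -
    have s: "subgroup N ?G" using that(1) by (rule normal_imp_subgroup)
    show ?thesis
      using assms(2)[OF s that(2)] subgroup.subset[OF s] by (auto simp: quiver_pi1_carrier)
  qed
  moreover have n: "normal (carrier ?G) ?G"
    by (simp add: normal_inv_iff subgroup_self)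
  ultimately have hull: "(\<lambda>N. normal N ?G) hull pi1_relators G I x = carrier ?G"
    unfolding hull_def using rel by blast
  have "group (?G Mod carrier ?G)"
    by (rule normal.factorgroup_is_group[OF n])
  moreover have "carrier (?G Mod carrier ?G) = {\<one>\<^bsub>?G Mod carrier ?G\<^esub>}"
    using coset_join2[OF _ subgroup_self] one_closed by (auto simp: FactGroup_def RCOSETS_def)
  ultimately show ?thesis
    unfolding pi1_def hull by (simp add: trivial_group_def)
qed

end

section \<open>Presentations of the category of the universal cover\<close>

text \<open>An arbitrary presentation of the category of the cover by its Gabriel quiver. The
  isomorphism \<open>F\<close> may permute objects and send an arrow to any combination of paths, so
  everything is transported through one-dimensionality of the morphism spaces.\<close>

locale presentation = based_fms_BC_field E b K for E :: "'a fbc" and b :: 'a and K :: "'k::field itself" +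
  fixes GQ :: "('a steps set lam_ob, 'a steps set lam_ob \<times> 'a steps set lam_ob \<times> nat) pre_digraph"
    and I :: "'a steps set lam_ob \<Rightarrow> 'a steps set lam_ob \<Rightarrow>
      (('a steps set lam_ob \<times> 'a steps set lam_ob \<times> nat) list \<Rightarrow>\<^sub>0 'k) set"
    and F :: "('a steps set lam_ob, ('k, 'a steps set) lam_mor, 'a steps set lam_ob,
      (('a steps set lam_ob \<times> 'a steps set lam_ob \<times> nat) list \<Rightarrow>\<^sub>0 'k) set) kfunc"
  assumes GQ_eq: "GQ = gabriel_quiver Lam_U"
    and admissible: "admissible_ideal GQ I"
    and iso: "k_isomorphism Lam_U (quot_kcat (path_category GQ) I) F"
begin

sublocale GQ: wf_digraph GQ
  by unfold_locales (auto simp: GQ_eq gabriel_quiver_def)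

sublocale GQ: path_ideal GQ I
  by unfold_locales (use admissible in \<open>simp add: admissible_ideal_def\<close>)

sublocale L: bounded_token_cat U.Q U.tok "fbc_ideal U :: _ \<Rightarrow> _ \<Rightarrow> (_ \<Rightarrow>\<^sub>0 'k) set"
  by (rule U.bounded_token_cat_E[of "cls []"]) (use base in simp)

lemma L_C: "L.C = Lam_U"
  by (simp add: Lambda_def)

abbreviation "f \<equiv> fob F"

lemma f_verts [simp]: "X \<in> cover_elts E b \<Longrightarrow> f (Pc X) \<in> verts GQ"
  using k_isomorphism_closed(1)[OF iso, of "Pc X"] by (simp add: Ob_Lam_U)

lemma f_surj: "x \<in> verts GQ \<Longrightarrow> \<exists>X\<in>cover_elts E b. x = f (Pc X)"
proof -
  assume "x \<in> verts GQ"
  moreover have "f ` Ob Lam_U = verts GQ"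
    using iso by (simp add: k_isomorphism_def bij_betw_def)
  ultimately show ?thesis by (auto simp: Ob_Lam_U)
qed

lemma f_inj: "X \<in> cover_elts E b \<Longrightarrow> Y \<in> cover_elts E b \<Longrightarrow> f (Pc X) = f (Pc Y) \<longleftrightarrow> Pc X = Pc Y"
  using iso unfolding k_isomorphism_def bij_betw_def by (auto simp: Ob_Lam_U dest: inj_onD)

abbreviation qco :: "_ \<Rightarrow> _ \<Rightarrow> _ \<Rightarrow> ('a steps set set list \<Rightarrow>\<^sub>0 'k) set" where
  "qco x y h \<equiv> pcoset (fbc_ideal U) x y h"

context
  fixes X Y assumes XY: "X \<in> cover_elts E b" "Y \<in> cover_elts E b"
begin

lemma F_bij: "bij_betw (fmor F (Pc X) (Pc Y)) (mor L.C (Pc X) (Pc Y)) (mor GQ.C (f (Pc X)) (f (Pc Y)))"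
  using iso XY unfolding k_isomorphism_def L_C[symmetric] by (simp del: quot_path_category_simps(2) add: Ppart_U)

lemma F_scale:
  assumes "h \<in> path_span U.Q (Pc X) (Pc Y)" "fmor F (Pc X) (Pc Y) (qco (Pc X) (Pc Y) h) = pcoset I (f (Pc X)) (f (Pc Y)) u"
  shows "fmor F (Pc X) (Pc Y) (qco (Pc X) (Pc Y) (single [] c * h)) = pcoset I (f (Pc X)) (f (Pc Y)) (single [] c * u)"
proof -
  have "fmor F (Pc X) (Pc Y) \<in> LinearCombinations.module_hom class_ring (Hom L.C (Pc X) (Pc Y)) (Hom GQ.C (f (Pc X)) (f (Pc Y)))"
    using iso XY by (simp add: k_isomorphism_def k_functor_def L_C Ppart_U Ob_Lam_U)
  then have "fmor F (Pc X) (Pc Y) (c \<odot>\<^bsub>Hom L.C (Pc X) (Pc Y)\<^esub> qco (Pc X) (Pc Y) h) =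
      c \<odot>\<^bsub>Hom GQ.C (f (Pc X)) (f (Pc Y))\<^esub> fmor F (Pc X) (Pc Y) (qco (Pc X) (Pc Y) h)"
    using assms(1) by (simp add: LinearCombinations.module_hom_def)
  then show ?thesis
    using XY assms f_verts[OF XY(1)] f_verts[OF XY(2)]
    by (simp add: L.quot_smult GQ.quot_smult Ppart_U)
qed

lemma F_preimage:
  assumes "u \<in> path_span GQ (f (Pc X)) (f (Pc Y))"
  obtains h where "h \<in> path_span U.Q (Pc X) (Pc Y)"
    "fmor F (Pc X) (Pc Y) (qco (Pc X) (Pc Y) h) = pcoset I (f (Pc X)) (f (Pc Y)) u"
proof -
  have "pcoset I (f (Pc X)) (f (Pc Y)) u \<in> mor GQ.C (f (Pc X)) (f (Pc Y))"
    using assms by simp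
  then have "pcoset I (f (Pc X)) (f (Pc Y)) u \<in> fmor F (Pc X) (Pc Y) ` mor L.C (Pc X) (Pc Y)"
    using F_bij by (simp only: bij_betw_def)
  then obtain V where "pcoset I (f (Pc X)) (f (Pc Y)) u = fmor F (Pc X) (Pc Y) V" "V \<in> mor L.C (Pc X) (Pc Y)"
    by (rule imageE)
  then show thesis
    using that by auto
qed

lemma F_image:
  assumes "h \<in> path_span U.Q (Pc X) (Pc Y)"
  obtains u where "u \<in> path_span GQ (f (Pc X)) (f (Pc Y))"
    "fmor F (Pc X) (Pc Y) (qco (Pc X) (Pc Y) h) = pcoset I (f (Pc X)) (f (Pc Y)) u"
proof -
  have "fmor F (Pc X) (Pc Y) (qco (Pc X) (Pc Y) h) \<in> mor GQ.C (f (Pc X)) (f (Pc Y))"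
    using bij_betwE[OF F_bij] assms by (metis imageI quot_path_category_simps(2))
  then show thesis using that by auto
qed

lemma F_zero_iff:
  assumes "h \<in> path_span U.Q (Pc X) (Pc Y)" "fmor F (Pc X) (Pc Y) (qco (Pc X) (Pc Y) h) = pcoset I (f (Pc X)) (f (Pc Y)) u"
  shows "pmap U.tok h = 0 \<longleftrightarrow> u \<in> I (f (Pc X)) (f (Pc Y))"
proof -
  note v = f_verts[OF XY(1)] f_verts[OF XY(2)]
  have PX: "Pc X \<in> verts U.Q" "Pc Y \<in> verts U.Q" using XY by (simp_all add: Ppart_U)
  have z: "fmor F (Pc X) (Pc Y) (qco (Pc X) (Pc Y) 0) = pcoset I (f (Pc X)) (f (Pc Y)) 0"
    using F_scale[OF assms, of 0] by simp
  have "u \<in> I (f (Pc X)) (f (Pc Y)) \<longleftrightarrow> pcoset I (f (Pc X)) (f (Pc Y)) u = pcoset I (f (Pc X)) (f (Pc Y)) 0"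
    using GQ.pcoset_eq_iff[OF v, of u 0] by simp
  also have "\<dots> \<longleftrightarrow> fmor F (Pc X) (Pc Y) (qco (Pc X) (Pc Y) h) = fmor F (Pc X) (Pc Y) (qco (Pc X) (Pc Y) 0)"
    using assms(2) z by simp
  also have "\<dots> \<longleftrightarrow> qco (Pc X) (Pc Y) h = qco (Pc X) (Pc Y) 0"
    using F_bij assms(1) by (auto simp: bij_betw_def dest: inj_onD)
  also have "\<dots> \<longleftrightarrow> pmap U.tok h = 0"
    using L.pcoset_eq_iff_tok[OF PX assms(1), of 0] by simp
  finally show ?thesis by simp
qed

text \<open>Both coordinate vectors are supported on the only token from \<open>Pc X\<close> to
  \<open>Pc Y\<close>, and the quotient of their coefficients is the factor.\<close>

lemma hom_multiple:
  assumes "h \<in> path_span U.Q (Pc X) (Pc Y)" "h' \<in> path_span U.Q (Pc X) (Pc Y)" "pmap U.tok h' \<noteq> (0 :: _ \<Rightarrow>\<^sub>0 'k)"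
  obtains c where "qco (Pc X) (Pc Y) h = qco (Pc X) (Pc Y) (single [] c * h')"
proof -
  have PX: "Pc X \<in> verts U.Q" "Pc Y \<in> verts U.Q" using XY by (simp_all add: Ppart_U)
  obtain t where t: "t \<in> keys (pmap U.tok h')" using assms(3) by (metis ex_in_conv keys_eq_empty)
  have eq: "s = t" if "s \<in> keys (pmap U.tok h) \<union> keys (pmap U.tok h')" for s
    using that t U.Q.keys_pmap_tok[OF assms(1)] U.Q.keys_pmap_tok[OF assms(2)] tokens_U_unique by blast
  define c where "c = lookup (pmap U.tok h) t / lookup (pmap U.tok h') t"
  have "lookup (pmap U.tok h) s = c * lookup (pmap U.tok h') s" for s
  proof (cases "s = t")
    case True
    then show ?thesis using t by (simp add: c_def in_keys_iff)
  next
    case False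
    then have "s \<notin> keys (pmap U.tok h)" "s \<notin> keys (pmap U.tok h')" using eq by auto
    then show ?thesis by (simp add: in_keys_iff)
  qed
  then have "pmap U.tok h = pmap U.tok (single [] c * h')"
    by (intro poly_mapping_eqI) (simp add: lookup_pmap_scale)
  then show thesis
    using that[of c] L.pcoset_eq_iff_tok[OF PX assms(1) path_span_scale[OF assms(2)]] by simp
qed

text \<open>By one-dimensionality \<open>u\<close> equals a multiple \<open>c\<close> of
  \<open>v\<close> modulo the ideal, and \<open>c\<close> is nonzero since \<open>u\<close> is. The
  relation \<open>u - c v\<close> is minimal because its proper parts are nonzero multiples of
  \<open>u\<close> or of \<open>v\<close>.\<close>

lemma parallel_nonzero_paths:
  assumes u: "qpath GQ (f (Pc X)) u (f (Pc Y))" "single u 1 \<notin> I (f (Pc X)) (f (Pc Y))"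
    and v: "qpath GQ (f (Pc X)) v (f (Pc Y))" "single v 1 \<notin> I (f (Pc X)) (f (Pc Y))"
    and "u \<noteq> v"
  obtains \<rho> where "minimal_relation I (f (Pc X)) (f (Pc Y)) \<rho>" "u \<in> keys \<rho>" "v \<in> keys \<rho>"
proof -
  let ?x = "f (Pc X)" and ?y = "f (Pc Y)"
  note xy = f_verts[OF XY(1)] f_verts[OF XY(2)]
  obtain h where h: "h \<in> path_span U.Q (Pc X) (Pc Y)" "fmor F (Pc X) (Pc Y) (qco (Pc X) (Pc Y) h) = pcoset I ?x ?y (single u 1)"
    using F_preimage[OF path_span_single[OF u(1)]] .
  obtain h' where h': "h' \<in> path_span U.Q (Pc X) (Pc Y)" "fmor F (Pc X) (Pc Y) (qco (Pc X) (Pc Y) h') = pcoset I ?x ?y (single v 1)"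
    using F_preimage[OF path_span_single[OF v(1)]] .
  have nz: "pmap U.tok h' \<noteq> 0" using F_zero_iff[OF h'] v(2) by simp
  obtain c where c: "qco (Pc X) (Pc Y) h = qco (Pc X) (Pc Y) (single [] c * h')"
    using hom_multiple[OF h(1) h'(1) nz] .
  have "pcoset I ?x ?y (single u 1) = pcoset I ?x ?y (single v c)"
    using F_scale[OF h', of c] c h(2) by (simp add: single_mult_single)
  then have \<rho>: "single u 1 - single v c \<in> I ?x ?y"
    using GQ.pcoset_eq_iff[OF xy] by simp
  have c0: "c \<noteq> 0" using \<rho> u(2) by auto
  define \<rho> where "\<rho> = single u 1 - single v c"
  have look: "lookup \<rho> p = (if p = u then 1 else if p = v then - c else 0)" for p
    using \<open>u \<noteq> v\<close> by (auto simp: \<rho>_def lookup_minus lookup_single when_def)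
  have keys: "keys \<rho> = {u, v}"
    using c0 by (auto simp: in_keys_iff look split: if_splits)
  have vc: "single v (- c) \<notin> I ?x ?y"
  proof
    assume "single v (- c) \<in> I ?x ?y"
    from GQ.ideal_scale[OF xy this, of "- (1 / c)"] show False
      using v(2) c0 by (simp add: single_mult_single)
  qed
  have "minimal_relation I ?x ?y \<rho>"
    unfolding minimal_relation_def keys
  proof (intro conjI allI impI)
    show "\<rho> \<in> I ?x ?y" using \<rho> by (simp add: \<rho>_def)
    show "2 \<le> card {u, v}" using \<open>u \<noteq> v\<close> by simp
    fix K assume "K \<noteq> {} \<and> K \<subset> {u, v}"
    then have "K = {u} \<or> K = {v}" by blast
    then show "(\<Sum>p\<in>K. single p (lookup \<rho> p)) \<notin> I ?x ?y"
      using u(2) vc \<open>u \<noteq> v\<close> by (auto simp: look)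
  qed
  then show thesis using that keys by auto
qed

end

section \<open>Nonzero paths of the Gabriel quiver over steps of the cover\<close>

definition nz_path :: "_ \<Rightarrow> _ \<Rightarrow> _ \<Rightarrow> bool" where
  "nz_path x p y \<longleftrightarrow> qpath GQ x p y \<and> single p 1 \<notin> I x y"

text \<open>The morphism of the step from \<open>X\<close> to \<open>g X\<close> may fail to be
  represented by an arrow of the Gabriel quiver: in degree one it is a full path and may factor as a
  longer one. A nonzero path with the right ends exists in any case and is chosen.\<close>

definition step_path where
  "step_path X = (SOME p. nz_path (f (Pc X)) p (f (Pc (act U 1 X))))"

lemma opath_span: "X \<in> cover_elts E b \<Longrightarrow> single (U.opath X n) c \<in> path_span U.Q (Pc X) (Pc (act U (int n) X))"
  using U.opath_awalk[of X n] by (simp add: path_span_single Pcl_U act_U_closed)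

lemma opath_nonzero:
  "X \<in> cover_elts E b \<Longrightarrow> n \<le> deg U X \<Longrightarrow> c \<noteq> 0 \<Longrightarrow> pmap U.tok (single (U.opath X n) c) \<noteq> (0 :: _ \<Rightarrow>\<^sub>0 'k)"
  by (simp add: pmap_single U.tok_opath single_eq_0)

lemma step_path: "X \<in> cover_elts E b \<Longrightarrow> nz_path (f (Pc X)) (step_path X) (f (Pc (act U 1 X)))"
proof -
  assume X: "X \<in> cover_elts E b"
  let ?Y = "act U 1 X"
  have Y: "?Y \<in> cover_elts E b" using X by (rule act_U_closed)
  let ?x = "f (Pc X)" and ?y = "f (Pc ?Y)"
  let ?h = "single (U.opath X 1) (1 :: 'k)"
  have h: "?h \<in> path_span U.Q (Pc X) (Pc ?Y)" using opath_span[OF X, of 1] by simp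
  obtain u where u: "u \<in> path_span GQ ?x ?y" "fmor F (Pc X) (Pc ?Y) (qco (Pc X) (Pc ?Y) ?h) = pcoset I ?x ?y u"
    using F_image[OF X Y h] .
  have "pmap U.tok ?h \<noteq> 0" using X U.deg_pos[of X] by (intro opath_nonzero) auto
  then have nI: "u \<notin> I ?x ?y" using F_zero_iff[OF X Y h u(2)] by simp
  have "\<exists>p\<in>keys u. single p 1 \<notin> I ?x ?y"
  proof (rule ccontr)
    assume "\<not> ?thesis"
    then have "single p (lookup u p) \<in> I ?x ?y" if "p \<in> keys u" for p
      using that GQ.ideal_scale[OF f_verts[OF X] f_verts[OF Y], of "single p 1" "lookup u p"]
      by (simp add: single_mult_single)
    then have "(\<Sum>p\<in>keys u. single p (lookup u p)) \<in> I ?x ?y"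
      by (intro GQ.ideal_sum[OF f_verts[OF X] f_verts[OF Y]])
    then show False using nI by (simp flip: poly_mapping_sum_singles)
  qed
  then have "\<exists>p. nz_path ?x p ?y"
    using u(1) by (auto simp: nz_path_def path_span_def)
  then show ?thesis
    unfolding step_path_def by (rule someI_ex)
qed

primrec steps_path where
  "steps_path X 0 = []"
| "steps_path X (Suc n) = steps_path X n @ step_path (act U (int n) X)"

lemma steps_path_qpath:
  "X \<in> cover_elts E b \<Longrightarrow> qpath GQ (f (Pc X)) (steps_path X n) (f (Pc (act U (int n) X)))"
proof (induction n)
  case 0
  then show ?case using f_verts[of X] by (simp add: GQ.awalk_Nil_iff act_U_0)
next
  case (Suc n)
  have "qpath GQ (f (Pc (act U (int n) X))) (step_path (act U (int n) X)) (f (Pc (act U 1 (act U (int n) X))))"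
    using step_path[OF act_U_closed[OF Suc.prems]] by (simp add: nz_path_def)
  then show ?case
    using Suc GQ.awalk_appendI by (simp add: act_U_act_U)
qed

text \<open>By one-dimensionality each chosen path corresponds to a nonzero multiple of the arrow
  below it, and functoriality multiplies these scalars. Hence the concatenation is nonzero whenever
  the path along the orbit is.\<close>

lemma F_steps_path:
  assumes X: "X \<in> cover_elts E b"
  shows "\<exists>c. c \<noteq> 0 \<and> fmor F (Pc X) (Pc (act U (int n) X)) (qco (Pc X) (Pc (act U (int n) X)) (single (U.opath X n) c)) =
    pcoset I (f (Pc X)) (f (Pc (act U (int n) X))) (single (steps_path X n) 1)"
proof (induction n)
  case 0
  have "fmor F (Pc X) (Pc X) (idt L.C (Pc X)) = idt GQ.C (f (Pc X))"
    using iso X by (simp add: k_isomorphism_def k_functor_def L_C Ob_Lam_U)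
  then show ?case
    using X by (intro exI[of _ 1]) (simp add: act_U_0 single_Nil_one)
next
  case (Suc n)
  let ?Y = "act U (int n) X"
  let ?Z = "act U 1 ?Y"
  have Y: "?Y \<in> cover_elts E b" and Z: "?Z \<in> cover_elts E b" using X act_U_closed by auto
  have Zeq: "act U (int (Suc n)) X = ?Z" using X by (simp add: act_U_act_U)
  obtain c where c: "c \<noteq> 0" "fmor F (Pc X) (Pc ?Y) (qco (Pc X) (Pc ?Y) (single (U.opath X n) c)) =
      pcoset I (f (Pc X)) (f (Pc ?Y)) (single (steps_path X n) 1)"
    using Suc.IH by blast
  let ?s = "step_path ?Y"
  have s: "qpath GQ (f (Pc ?Y)) ?s (f (Pc ?Z))" "single ?s 1 \<notin> I (f (Pc ?Y)) (f (Pc ?Z))"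
    using step_path[OF Y] by (auto simp: nz_path_def)
  let ?a = "single (U.opath ?Y 1) (1 :: 'k)"
  have a: "?a \<in> path_span U.Q (Pc ?Y) (Pc ?Z)" using opath_span[OF Y, of 1] by simp
  have a0: "pmap U.tok ?a \<noteq> 0" using Y U.deg_pos[of ?Y] by (intro opath_nonzero) auto
  obtain h where h: "h \<in> path_span U.Q (Pc ?Y) (Pc ?Z)"
    "fmor F (Pc ?Y) (Pc ?Z) (qco (Pc ?Y) (Pc ?Z) h) = pcoset I (f (Pc ?Y)) (f (Pc ?Z)) (single ?s 1)"
    using F_preimage[OF Y Z path_span_single[OF s(1)]] .
  obtain c' where c': "qco (Pc ?Y) (Pc ?Z) h = qco (Pc ?Y) (Pc ?Z) (single [] c' * ?a)"
    using hom_multiple[OF Y Z h(1) a a0] .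
  have "pmap U.tok h \<noteq> 0" using F_zero_iff[OF Y Z h] s(2) by simp
  moreover have "pmap U.tok h = pmap U.tok (single [] c' * ?a)"
    using c' L.pcoset_eq_iff_tok[OF _ _ h(1) path_span_scale[OF a, of c']] Y Z by (simp add: Ppart_U)
  ultimately have c'0: "c' \<noteq> 0" by auto
  have h': "single (U.opath ?Y 1) c' \<in> path_span U.Q (Pc ?Y) (Pc ?Z)"
    "fmor F (Pc ?Y) (Pc ?Z) (qco (Pc ?Y) (Pc ?Z) (single (U.opath ?Y 1) c')) = pcoset I (f (Pc ?Y)) (f (Pc ?Z)) (single ?s 1)"
    using h(2) c' opath_span[OF Y, of 1] by (simp_all add: single_mult_single)
  have hn: "single (U.opath X n) c \<in> path_span U.Q (Pc X) (Pc ?Y)"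
    by (rule opath_span[OF X])
  have fun_cmp: "fmor F (Pc X) (Pc ?Z) (cmp L.C (Pc X) (Pc ?Y) (Pc ?Z) v u) =
      cmp GQ.C (f (Pc X)) (f (Pc ?Y)) (f (Pc ?Z)) (fmor F (Pc ?Y) (Pc ?Z) v) (fmor F (Pc X) (Pc ?Y) u)"
    if "u \<in> mor L.C (Pc X) (Pc ?Y)" "v \<in> mor L.C (Pc ?Y) (Pc ?Z)" for u v
    using iso X Y Z that unfolding k_isomorphism_def k_functor_def L_C Ob_Lam_U by blast
  have "fmor F (Pc X) (Pc ?Z) (qco (Pc X) (Pc ?Z) (single (U.opath X n) c * single (U.opath ?Y 1) c')) =
      fmor F (Pc X) (Pc ?Z) (cmp L.C (Pc X) (Pc ?Y) (Pc ?Z)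
        (qco (Pc ?Y) (Pc ?Z) (single (U.opath ?Y 1) c')) (qco (Pc X) (Pc ?Y) (single (U.opath X n) c)))"
    using X Y Z hn h' by (subst L.quot_cmp) (auto simp: Ppart_U)
  also have "\<dots> = cmp GQ.C (f (Pc X)) (f (Pc ?Y)) (f (Pc ?Z))
      (pcoset I (f (Pc ?Y)) (f (Pc ?Z)) (single ?s 1)) (pcoset I (f (Pc X)) (f (Pc ?Y)) (single (steps_path X n) 1))"
    using fun_cmp hn h' c(2) by simp
  also have "\<dots> = pcoset I (f (Pc X)) (f (Pc ?Z)) (single (steps_path X n) 1 * single ?s 1)"
    using steps_path_qpath[OF X, of n] s(1) f_verts[OF X] f_verts[OF Y] f_verts[OF Z]
    by (intro GQ.quot_cmp) (auto intro: path_span_single)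
  finally show ?case
    using c(1) c'0 U.opath_add[of X n 1] X unfolding Zeq
    by (intro exI[of _ "c * c'"]) (simp add: single_mult_single)
qed

lemma steps_path_nz:
  assumes X: "X \<in> cover_elts E b" and n: "n \<le> deg U X"
  shows "nz_path (f (Pc X)) (steps_path X n) (f (Pc (act U (int n) X)))"
proof -
  obtain c where c: "c \<noteq> 0" "fmor F (Pc X) (Pc (act U (int n) X)) (qco (Pc X) (Pc (act U (int n) X)) (single (U.opath X n) c)) =
    pcoset I (f (Pc X)) (f (Pc (act U (int n) X))) (single (steps_path X n) 1)"
    using F_steps_path[OF X] by blast
  show ?thesis
    unfolding nz_path_def
    using F_zero_iff[OF X act_U_closed[OF X] opath_span[OF X] c(2)] opath_nonzero[OF X n c(1)]
      steps_path_qpath[OF X] by simp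
qed

text \<open>Elements of an admissible ideal involve only paths of length at least 2, so an arrow is
  nonzero modulo \<open>I\<close>. Its preimage under \<open>F\<close> is then nonzero as well and
  contains a nonzero path along an orbit with the corresponding ends.\<close>

lemma arrow_nz:
  assumes "a \<in> arcs GQ"
  shows "nz_path (tail GQ a) [a] (head GQ a)"
    and "\<exists>X n. X \<in> cover_elts E b \<and> n \<le> deg U X \<and> tail GQ a = f (Pc X) \<and> head GQ a = f (Pc (act U (int n) X))"
proof -
  let ?x = "tail GQ a" and ?y = "head GQ a"
  have xy: "?x \<in> verts GQ" "?y \<in> verts GQ" using assms by auto
  have q: "qpath GQ ?x [a] ?y" using assms xy by (simp add: GQ.awalk_Cons_iff GQ.awalk_Nil_iff)
  have "single [a] 1 \<notin> I ?x ?y"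
    using admissible xy unfolding admissible_ideal_def by fastforce
  then show nz: "nz_path ?x [a] ?y" using q by (simp add: nz_path_def)
  obtain X Y where XY: "X \<in> cover_elts E b" "?x = f (Pc X)" "Y \<in> cover_elts E b" "?y = f (Pc Y)"
    using f_surj xy by metis
  have q': "qpath GQ (f (Pc X)) [a] (f (Pc Y))" "single [a] 1 \<notin> I (f (Pc X)) (f (Pc Y))"
    using nz XY by (auto simp: nz_path_def)
  obtain h where h: "h \<in> path_span U.Q (Pc X) (Pc Y)"
    "fmor F (Pc X) (Pc Y) (qco (Pc X) (Pc Y) h) = pcoset I (f (Pc X)) (f (Pc Y)) (single [a] 1)"
    using F_preimage[OF XY(1,3) path_span_single[OF q'(1)]] .
  have "pmap U.tok h \<noteq> 0" using F_zero_iff[OF XY(1,3) h] q'(2) by simp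
  then obtain p where "p \<in> keys h" "U.tok p \<noteq> None"
    by (force simp: pmap_def intro!: sum.neutral split: option.splits)
  moreover from this have "qpath U.Q (Pc X) p (Pc Y)" using h(1) by (auto simp: path_span_def)
  ultimately obtain Z n where "Z \<in> cover_elts E b" "n \<le> deg U Z" "Pc X = Pc Z" "Pc Y = Pc (act U (int n) Z)"
    using nonzero_path_U by metis
  then show "\<exists>X n. X \<in> cover_elts E b \<and> n \<le> deg U X \<and> ?x = f (Pc X) \<and> ?y = f (Pc (act U (int n) X))"
    using XY by auto
qed

end

section \<open>Triviality of the fundamental group\<close>

context presentation
begin

text \<open>A tau-step lifts to the empty walk since all elements of a polygon lie over one vertex
  of the Gabriel quiver. A backward step is the inverse of the path chosen at the translate
  \<open>g^(-1) X\<close>.\<close>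

definition step_walk where
  "step_walk X s = (case fst s of
      Gpos \<Rightarrow> map Pos (step_path X)
    | Gneg \<Rightarrow> inv_walk (map Pos (step_path (act U (- 1) X)))
    | Tau \<Rightarrow> [])"

primrec lift_walk where
  "lift_walk X [] = []"
| "lift_walk X (s # v) = step_walk X s @ lift_walk (ext X [s]) v"

lemma step_cases:
  assumes X: "X \<in> cover_elts E b" and s: "is_walk E (tgt X) [s]"
  obtains "fst s = Gpos" "ext X [s] = act U 1 X"
  | "fst s = Gneg" "ext X [s] = act U (- 1) X"
  | "fst s = Tau" "Pc (ext X [s]) = Pc X"
proof -
  obtain \<delta> h where sh: "s = (\<delta>, h)" by (cases s)
  show thesis
  proof (cases \<delta>)
    case Gpos
    then show thesis using that(1) s sh ext_Gpos[OF X] by (simp add: is_step_def)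
  next
    case Gneg
    then show thesis using that(2) s sh ext_Gneg[OF X] by (simp add: is_step_def)
  next
    case Tau
    then have "ext X [s] \<in> Pc X" using s sh X by (simp add: Pc_def del: is_walk.simps)
    then show thesis using that(3) Tau sh Pc_eq[OF X] by simp
  qed
qed

lemma step_walk_qwalk:
  assumes X: "X \<in> cover_elts E b" and s: "is_walk E (tgt X) [s]"
  shows "qwalk GQ (f (Pc X)) (step_walk X s) (f (Pc (ext X [s])))"
  using X s
proof (cases rule: step_cases)
  case 1
  then show ?thesis
    using step_path[OF X] by (simp add: step_walk_def nz_path_def GQ.qwalk_Pos)
next
  case 2
  have "qpath GQ (f (Pc (act U (- 1) X))) (step_path (act U (- 1) X)) (f (Pc X))"
    using step_path[OF act_U_closed[OF X], of "- 1"] X by (simp add: nz_path_def act_U_act_U act_U_0)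
  from GQ.qwalk_inv[OF GQ.qwalk_Pos[OF this]] show ?thesis
    using 2 by (simp add: step_walk_def)
next
  case 3
  then show ?thesis
    using X f_verts[OF X] by (simp add: step_walk_def pre_digraph.awalk_def double_quiver_def pre_digraph.cas.simps)
qed

lemma walk_Cons:
  assumes "X \<in> cover_elts E b" "is_walk E (tgt X) (s # v)"
  shows "is_walk E (tgt X) [s]" "ext X [s] \<in> cover_elts E b" "is_walk E (tgt (ext X [s])) v"
    "ext (ext X [s]) v = ext X (s # v)"
proof -
  show s: "is_walk E (tgt X) [s]" using assms(2) by (auto simp: is_step_def)
  show "ext X [s] \<in> cover_elts E b" using assms(1) s by (rule ext_cover)
  show "is_walk E (tgt (ext X [s])) v" using assms s by simp
  show "ext (ext X [s]) v = ext X (s # v)" using assms s by (subst ext_ext) auto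
qed

lemma lift_walk_qwalk:
  "X \<in> cover_elts E b \<Longrightarrow> is_walk E (tgt X) v \<Longrightarrow> qwalk GQ (f (Pc X)) (lift_walk X v) (f (Pc (ext X v)))"
proof (induction v arbitrary: X)
  case Nil
  then show ?case
    using f_verts[of X] by (simp add: pre_digraph.awalk_def double_quiver_def pre_digraph.cas.simps)
next
  case (Cons s v)
  note w = walk_Cons[OF Cons.prems]
  show ?case
    using GQ.qwalk_append[OF step_walk_qwalk[OF Cons.prems(1) w(1)] Cons.IH[OF w(2,3)]] w(4) by simp
qed

lemma lift_walk_append:
  "X \<in> cover_elts E b \<Longrightarrow> is_walk E (tgt X) (v @ w) \<Longrightarrow>
    lift_walk X (v @ w) = lift_walk X v @ lift_walk (ext X v) w"
proof (induction v arbitrary: X)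
  case (Cons s v)
  have "is_walk E (tgt X) (s # (v @ w))" "is_walk E (tgt X) (s # v)" using Cons.prems(2) by auto
  note w = walk_Cons[OF Cons.prems(1) this(1)] and w' = walk_Cons[OF Cons.prems(1) this(2)]
  show ?case
    using Cons.IH[OF w(2,3)] w'(4) by simp
qed simp

lemma lift_walk_gwalk:
  assumes X: "X \<in> cover_elts E b"
  shows "lift_walk X (gwalk E (int n) (tgt X)) = map Pos (steps_path X n)"
proof (induction n)
  case (Suc n)
  let ?Y = "act U (int n) X"
  have w: "is_walk E (tgt X) (gwalk E (int n) (tgt X) @ [(Gpos, act E (int (Suc n)) (tgt X))])"
    using gwalk_is_walk[of "tgt X" "int (Suc n)"] X by (simp add: gwalk_Suc del: of_nat_Suc)
  show ?case
    using Suc lift_walk_append[OF X w] X by (simp add: gwalk_Suc step_walk_def act_U del: of_nat_Suc)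
qed simp

context
  fixes x N
  assumes x: "x \<in> verts GQ" and N: "subgroup N (quiver_pi1 GQ x)" and rel: "pi1_relators GQ I x \<subseteq> N"
begin

abbreviation "R \<equiv> GQ.walk_rel x N"

lemmas R_cong = GQ.walk_rel_cong[OF x N] and R_refl = GQ.walk_rel_refl[OF x N]
  and R_sym = GQ.walk_rel_sym[OF x N] and R_trans = GQ.walk_rel_trans[OF x N]
  and R_append = GQ.walk_rel_append[OF x N]

text \<open>The prefix \<open>w\<close> is the connecting walk of a relator, and the minimal
  relation comes from \<open>parallel_nonzero_paths\<close>.\<close>

lemma R_parallel:
  assumes w: "qwalk GQ x w y" and y: "y \<in> verts GQ" "z \<in> verts GQ"
    and u: "nz_path y u z" and v: "nz_path y v z"
  shows "R z (w @ map Pos u) (w @ map Pos v)"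
proof (cases "u = v")
  case True
  then show ?thesis
    using u w by (auto simp: nz_path_def intro!: R_refl GQ.qwalk_append GQ.qwalk_Pos)
next
  case False
  obtain X Z where XZ: "X \<in> cover_elts E b" "y = f (Pc X)" "Z \<in> cover_elts E b" "z = f (Pc Z)"
    using f_surj y by metis
  obtain \<rho> where "minimal_relation I y z \<rho>" "u \<in> keys \<rho>" "v \<in> keys \<rho>"
    using parallel_nonzero_paths[OF XZ(1,3), of u v] u v False XZ by (auto simp: nz_path_def)
  then have "walk_class GQ x (w @ map Pos u @ inv_walk (map Pos v) @ inv_walk w) \<in> pi1_relators GQ I x"
    unfolding pi1_relators_def using w y False by blast
  then have "walk_class GQ x ((w @ map Pos u) @ inv_walk (w @ map Pos v)) \<in> N"
    using rel by auto
  moreover have "qwalk GQ x (w @ map Pos u) z" "qwalk GQ x (w @ map Pos v) z"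
    using u v w by (auto simp: nz_path_def intro!: GQ.qwalk_append GQ.qwalk_Pos)
  ultimately show ?thesis by (simp add: GQ.walk_rel_def)
qed

text \<open>
  (h3) is respected because both sides lift to nonzero parallel paths, and these are congruent
  modulo minimal relations as the morphism space has dimension one.
\<close>

lemma lift_walk_homotopic:
  "homotopic E e h v v' \<Longrightarrow> X \<in> cover_elts E b \<Longrightarrow> tgt X = e \<Longrightarrow> qwalk GQ x w (f (Pc X)) \<Longrightarrow>
    R (f (Pc (ext X v))) (w @ lift_walk X v) (w @ lift_walk X v')"
proof (induction arbitrary: X w rule: homotopic.induct)
  case (h_refl e v h)
  then show ?case
    using lift_walk_qwalk[of X v] by (intro R_refl GQ.qwalk_append) auto
next
  case (h_sym e h v v')
  then show ?case
    using R_sym[OF h_sym.IH[OF h_sym.prems]] ext_cong[OF h_sym.prems(1), of h v v'] h_sym.hyps h_sym.prems(2) by simp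
next
  case (h_trans e h u v v')
  then show ?case
    using R_trans[of "f (Pc (ext X u))"] ext_cong[OF h_trans.prems(1), of h u v] by metis
next
  case (h1_neg_pos e)
  have q: "qpath GQ (f (Pc X)) (step_path X) (f (Pc (act U 1 X)))"
    using step_path[OF h1_neg_pos.prems(1)] by (simp add: nz_path_def)
  have "lift_walk X [(Gpos, g e), (Gneg, e)] = map Pos (step_path X) @ inv_walk (map Pos (step_path X))"
    using h1_neg_pos ext_Gpos[of X] by (simp add: step_walk_def act_U_act_U act_U_0)
  moreover have "ext X [(Gpos, g e), (Gneg, e)] = X"
    using ext_cong[OF h1_neg_pos.prems(1) homotopic.h1_neg_pos[of "tgt X" E]] h1_neg_pos by simp
  ultimately show ?case
    using R_cong[OF wc_comp[OF wc_refl[OF h1_neg_pos.prems(3)] GQ.walk_cong_inv[OF GQ.qwalk_Pos[OF q]]]] by simp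
next
  case (h1_pos_neg e)
  let ?Y = "act U (- 1) X"
  have q: "qpath GQ (f (Pc ?Y)) (step_path ?Y) (f (Pc X))"
    using step_path[OF act_U_closed[OF h1_pos_neg.prems(1)], of "- 1"] h1_pos_neg.prems(1)
    by (simp add: nz_path_def act_U_act_U act_U_0)
  have "lift_walk X [(Gneg, act E (- 1) e), (Gpos, e)] = inv_walk (map Pos (step_path ?Y)) @ map Pos (step_path ?Y)"
    using h1_pos_neg ext_Gneg[of X] by (simp add: step_walk_def)
  moreover have "ext X [(Gneg, act E (- 1) e), (Gpos, e)] = X"
    using ext_cong[OF h1_pos_neg.prems(1) homotopic.h1_pos_neg[of "tgt X" E]] h1_pos_neg by simp
  ultimately show ?case
    using R_cong[OF wc_comp[OF wc_refl[OF h1_pos_neg.prems(3)] GQ.walk_cong_inv'[OF GQ.qwalk_Pos[OF q]]]] by simp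
next
  case (h1_tau e)
  then show ?case
    using ext_tau_tgt[of X] by (auto simp: step_walk_def intro: R_refl)
next
  case (h2 e0 e1 e2)
  have "is_walk E (tgt X) [(Tau, e1), (Tau, e2)]" using h2 by (simp add: is_step_def)
  from lift_walk_qwalk[OF h2.prems(1) this] show ?case
    using h2 by (auto simp: step_walk_def intro!: R_refl dest: GQ.qwalk_append)
next
  case (h3 e h)
  let ?d = "deg E e" and ?d' = "deg E h"
  let ?Z = "act U (int ?d) X"
  define Y where "Y = ext X [(Tau, h)]"
  let ?Z' = "act U (int ?d') Y"
  have h: "h \<in> P (tgt X)" using h3 Pcl_props(2)[of h] by simp
  have Y: "Y \<in> cover_elts E b" "tgt Y = h" "Y \<in> Pc X"
    using h h3 by (auto simp: Y_def Pc_def simp del: is_walk.simps)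
  have XY: "Pc Y = Pc X" using Pc_eq[OF h3.prems(1) Y(3)] .
  have d: "deg U X = ?d" "deg U Y = ?d'" using h3 Y by (simp_all add: deg_U)
  have w: "is_walk E (tgt X) (gwalk E (int ?d) (tgt X) @ [(Tau, act E (int ?d') h)])"
    "is_walk E (tgt X) ([(Tau, h)] @ gwalk E (int ?d') h)"
    using homotopic_walks[OF homotopic.h3[OF h3.hyps]] h3.prems(2) by auto
  \<comment> \<open>Axiom (f4) for the cover: the two full paths also end in one vertex, so their
    lifts are parallel.\<close>
  have ZZ: "Pc ?Z' = Pc ?Z"
    using U.f4[of X Y] Y XY h3.prems(1) d by (simp add: Pcl_U act_U_closed)
  have l1: "lift_walk X (gwalk E (int ?d) e @ [(Tau, act E (int ?d') h)]) = map Pos (steps_path X ?d)"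
    using lift_walk_append[OF h3.prems(1) w(1)] lift_walk_gwalk[OF h3.prems(1)] h3.prems(2) by (simp add: step_walk_def)
  have l2: "lift_walk X ([(Tau, h)] @ gwalk E (int ?d') h) = map Pos (steps_path Y ?d')"
    using lift_walk_append[OF h3.prems(1) w(2)] lift_walk_gwalk[OF Y(1)] Y(2) by (simp add: step_walk_def Y_def)
  have end_eq: "ext X (gwalk E (int ?d) e @ [(Tau, act E (int ?d') h)]) = ?Z'"
  proof -
    have "ext X (gwalk E (int ?d) e @ [(Tau, act E (int ?d') h)]) = ext X ([(Tau, h)] @ gwalk E (int ?d') h)"
      using ext_cong[OF h3.prems(1), of "act E (int ?d') h"] homotopic.h3[OF h3.hyps] h3.prems(2) by blast
    also have "\<dots> = ext Y (gwalk E (int ?d') h)"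
      unfolding Y_def using w(2) h3.prems(1) unfolding is_walk_append by (subst ext_ext) auto
    finally show ?thesis using Y by (simp add: act_U)
  qed
  have "R (f (Pc ?Z)) (w @ map Pos (steps_path X ?d)) (w @ map Pos (steps_path Y ?d'))"
  proof (rule R_parallel[OF h3.prems(3)])
    show "nz_path (f (Pc X)) (steps_path X ?d) (f (Pc ?Z))"
      using steps_path_nz[OF h3.prems(1), of ?d] d by simp
    show "nz_path (f (Pc X)) (steps_path Y ?d') (f (Pc ?Z))"
      using steps_path_nz[OF Y(1), of ?d'] d XY ZZ by simp
  qed (use h3.prems(1) act_U_closed in auto)
  then show ?case
    unfolding l1 l2 end_eq ZZ .
next
  case (h4 e h)
  then have "e = h" by (simp add: type_MS)
  have "is_walk E (tgt X) [(Gpos, g e), (Tau, g h)]" using h4 \<open>e = h\<close> by (simp add: is_step_def)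
  from lift_walk_qwalk[OF h4.prems(1) this] show ?case
    using h4 \<open>e = h\<close> ext_tau_tgt[of X] by (auto simp: step_walk_def intro!: R_refl dest: GQ.qwalk_append)
next
  case (h5 e0 e1 v v' e2 u u')
  have w: "is_walk E (tgt X) v" "is_walk E (tgt X) v'" "walk_target (tgt X) v = e1" "walk_target (tgt X) v' = e1"
    "is_walk E e1 u" "is_walk E e1 u'"
    using homotopic_walks[OF h5.hyps(1)] homotopic_walks[OF h5.hyps(2)] h5.prems(2) by auto
  define Y where "Y = ext X v"
  have Y: "Y \<in> cover_elts E b" "tgt Y = e1" using w h5.prems by (simp_all add: Y_def)
  have Y': "ext X v' = Y" using ext_cong[OF h5.prems(1), of e1 v v'] h5 by (simp add: Y_def)
  have l: "lift_walk X (v @ u) = lift_walk X v @ lift_walk Y u" "lift_walk X (v' @ u') = lift_walk X v' @ lift_walk Y u'"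
    using lift_walk_append[OF h5.prems(1)] w Y' by (simp_all add: Y_def)
  have e: "ext X (v @ u) = ext Y u"
    using w h5.prems by (simp add: Y_def)
  have "R (f (Pc Y)) (w @ lift_walk X v) (w @ lift_walk X v')"
    unfolding Y_def by (rule h5.IH(1)[OF h5.prems])
  then have "R (f (Pc (ext Y u))) ((w @ lift_walk X v) @ lift_walk Y u) ((w @ lift_walk X v') @ lift_walk Y u)"
    by (rule R_append) (use lift_walk_qwalk[OF Y(1), of u] w Y in simp)
  \<comment> \<open>The second factor is changed behind the already changed first one; the induction
    hypothesis allows this because the prefix is arbitrary.\<close>
  moreover have "R (f (Pc (ext Y u))) ((w @ lift_walk X v') @ lift_walk Y u) ((w @ lift_walk X v') @ lift_walk Y u')"
    using GQ.qwalk_append[OF h5.prems(3) lift_walk_qwalk[OF h5.prems(1) w(2)]] Y'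
    by (intro h5.IH(2)[OF Y]) simp
  ultimately show ?case
    unfolding l e by (metis R_trans append.assoc)
qed

text \<open>Induction on the last arrow. It is parallel to a nonzero path along an orbit, which may
  start at another element of the polygon reached so far; a tau-step, invisible in the lift, moves
  to that element.\<close>

lemma walk_lifts:
  assumes X0: "X0 \<in> cover_elts E b" "f (Pc X0) = x"
  shows "qwalk GQ x w y \<Longrightarrow>
    \<exists>v. is_walk E (tgt X0) v \<and> f (Pc (ext X0 v)) = y \<and> R y w (lift_walk X0 v)"
proof (induction w arbitrary: y rule: rev_induct)
  case Nil
  then have "y = x" by (simp add: pre_digraph.awalk_def pre_digraph.cas.simps)
  then show ?case
    using X0 R_refl[OF Nil] by (intro exI[of _ "[]"]) simp
next
  case (snoc s w)
  obtain z where z: "qwalk GQ x w z" "qwalk GQ z [s] y"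
    using snoc.prems wf_digraph.awalk_append_iff[OF GQ.wf_double_quiver] by blast
  obtain v where v: "is_walk E (tgt X0) v" "f (Pc (ext X0 v)) = z" "R z w (lift_walk X0 v)"
    using snoc.IH[OF z(1)] by blast
  define Y where "Y = ext X0 v"
  have Y: "Y \<in> cover_elts E b" "f (Pc Y) = z" using v X0 by (simp_all add: Y_def)
  have lq: "qwalk GQ x (lift_walk X0 v) z"
    using lift_walk_qwalk[OF X0(1) v(1)] v(2) X0(2) by simp
  have step: "R y (w @ [s]) (lift_walk X0 v @ [s])"
    by (rule R_append[OF v(3) z(2)])
  \<comment> \<open>Splices a walk \<open>u\<close> starting at some \<open>Z\<close> of the current
    polygon to \<open>v\<close> by a tau-step from \<open>Y\<close> to \<open>Z\<close>.\<close>
  have *: "\<exists>v. is_walk E (tgt X0) v \<and> f (Pc (ext X0 v)) = y \<and> R y (w @ [s]) (lift_walk X0 v)"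
    if Z: "Z \<in> Pc Y" and u: "is_walk E (tgt Z) u" "f (Pc (ext Z u)) = y"
      "R y (lift_walk X0 v @ [s]) (lift_walk X0 v @ lift_walk Z u)" for Z u
  proof -
    obtain h where h: "h \<in> P (tgt Y)" "Z = ext Y [(Tau, h)]" using Z by (auto simp: Pc_def)
    have tau: "is_walk E (tgt Y) [(Tau, h)]" using h(1) Y by (simp del: is_walk.simps)
    have tZ: "tgt Z = h" using h Y by (simp del: is_walk.simps)
    have w1: "is_walk E (tgt X0) (v @ [(Tau, h)])"
      using v(1) tau X0(1) unfolding is_walk_append Y_def by (simp del: is_walk.simps)
    have Z_eq: "Z = ext X0 (v @ [(Tau, h)])"
      unfolding h(2) Y_def using v(1) tau X0(1) by (intro ext_ext) (simp_all add: Y_def del: is_walk.simps)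
    have w2: "is_walk E (tgt X0) ((v @ [(Tau, h)]) @ u)"
      using w1 u(1) tZ by simp
    have e: "ext X0 ((v @ [(Tau, h)]) @ u) = ext Z u"
      unfolding Z_eq using X0(1) w1 u(1) tZ by (intro ext_ext[symmetric]) auto
    have "lift_walk X0 ((v @ [(Tau, h)]) @ u) = lift_walk X0 v @ lift_walk Z u"
      using lift_walk_append[OF X0(1) w2] lift_walk_append[OF X0(1) w1] Z_eq by (simp add: step_walk_def)
    then show ?thesis
      using w2 e u(2) R_trans[OF step u(3)] by (intro exI[of _ "(v @ [(Tau, h)]) @ u"]) simp
  qed
  show ?case
  proof (cases s)
    case (Pos a)
    have a: "a \<in> arcs GQ" "tail GQ a = z" "head GQ a = y"
      using z(2) Pos by (auto simp: pre_digraph.awalk_def pre_digraph.cas.simps double_quiver_def)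
    obtain X n where X: "X \<in> cover_elts E b" "n \<le> deg U X" "z = f (Pc X)" "y = f (Pc (act U (int n) X))"
      using arrow_nz(2)[OF a(1)] a by auto
    have "Pc X = Pc Y" using trans[OF X(3)[symmetric] Y(2)[symmetric]] f_inj[OF X(1) Y(1)] by blast
    then have "X \<in> Pc Y" using Pc_refl[OF X(1)] by simp
    moreover have "R y (lift_walk X0 v @ map Pos [a]) (lift_walk X0 v @ map Pos (steps_path X n))"
      by (rule R_parallel[OF lq]) (use X arrow_nz(1)[OF a(1)] a steps_path_nz[OF X(1,2)] act_U_closed in auto)
    ultimately show ?thesis
      using X Pos lift_walk_gwalk[OF X(1), of n]
      by (intro *[of X "gwalk E (int n) (tgt X)"]) (auto simp: gwalk_is_walk act_U)
  next
    case (Neg a)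
    have a: "a \<in> arcs GQ" "tail GQ a = y" "head GQ a = z"
      using z(2) Neg by (auto simp: pre_digraph.awalk_def pre_digraph.cas.simps double_quiver_def)
    obtain X n where X: "X \<in> cover_elts E b" "n \<le> deg U X" "y = f (Pc X)" "z = f (Pc (act U (int n) X))"
      using arrow_nz(2)[OF a(1)] a by auto
    let ?Z = "act U (int n) X"
    have Z: "?Z \<in> cover_elts E b" using X(1) by (rule act_U_closed)
    have "Pc ?Z = Pc Y" using trans[OF X(4)[symmetric] Y(2)[symmetric]] f_inj[OF Z Y(1)] by blast
    then have "?Z \<in> Pc Y" using Pc_refl[OF Z] by simp
    let ?g = "gwalk E (int n) (tgt X)"
    let ?u = "inv_steps (tgt X) ?g"
    have g: "is_walk E (tgt X) ?g" "walk_target (tgt X) ?g = tgt ?Z"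
      using gwalk_is_walk[of "tgt X" "int n"] X by auto
    have u: "is_walk E (tgt ?Z) ?u" "walk_target (tgt ?Z) ?u = tgt X"
      using inv_steps_walk[OF g(1)] g(2) by auto
    have Zg: "ext X ?g = ?Z" using X by (simp add: act_U)
    have eu: "ext ?Z ?u = X"
    proof -
      have "ext ?Z ?u = ext X (?g @ ?u)"
        unfolding Zg[symmetric] using X(1) g u by (intro ext_ext) (simp_all add: X(1))
      also have "\<dots> = X" using ext_cong[OF X(1) inv_steps_right[OF g(1)]] X(1) by simp
      finally show ?thesis .
    qed
    let ?p = "map Pos (steps_path X n)"
    have p: "qwalk GQ y ?p z" using steps_path_qpath[OF X(1), of n] X by (simp add: GQ.qwalk_Pos)
    have pa: "qwalk GQ y (map Pos [a]) z" using arrow_nz(1)[OF a(1)] a by (intro GQ.qwalk_Pos) (simp add: nz_path_def)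
    have na: "qwalk GQ x (lift_walk X0 v @ [Neg a]) y"
      using GQ.qwalk_append[OF lq] z(2) Neg by simp
    \<comment> \<open>Relators replace paths only in the forward direction, so the backward arrow is
      treated as \<open>a^(-1) ~ a^(-1) a p^(-1) ~ p^(-1)\<close>, in the order of traversal: here
      \<open>a\<close> is exchanged for the parallel path \<open>p\<close> behind
      \<open>a^(-1)\<close>.\<close>
    have 1: "R y (lift_walk X0 v @ [Neg a]) (((lift_walk X0 v @ [Neg a]) @ map Pos [a]) @ inv_walk ?p)"
    proof -
      have "R z ((lift_walk X0 v @ [Neg a]) @ map Pos [a]) ((lift_walk X0 v @ [Neg a]) @ ?p)"
        by (rule R_parallel[OF na]) (use X arrow_nz(1)[OF a(1)] a steps_path_nz[OF X(1,2)] Z in auto)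
      from R_append[OF this GQ.qwalk_inv[OF p]]
      have A: "R y (((lift_walk X0 v @ [Neg a]) @ map Pos [a]) @ inv_walk ?p) ((lift_walk X0 v @ [Neg a]) @ (?p @ inv_walk ?p))"
        by simp
      have B: "R y ((lift_walk X0 v @ [Neg a]) @ (?p @ inv_walk ?p)) ((lift_walk X0 v @ [Neg a]) @ [])"
        by (rule R_cong[OF wc_comp[OF wc_refl[OF na] GQ.walk_cong_inv[OF p]]])
      from R_sym[OF R_trans[OF A B]] show ?thesis by simp
    qed
    have 2: "R y (((lift_walk X0 v @ [Neg a]) @ map Pos [a]) @ inv_walk ?p) (lift_walk X0 v @ inv_walk ?p)"
    proof -
      have "walk_cong GQ z z (inv_walk (map Pos [a]) @ map Pos [a]) []"
        by (rule GQ.walk_cong_inv'[OF pa])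
      from R_append[OF R_cong[OF wc_comp[OF wc_refl[OF lq] this]] GQ.qwalk_inv[OF p]]
      show ?thesis by (simp add: inv_walk_def)
    qed
    \<comment> \<open>The lift of the inverse walk is not computed. Instead the homotopy contracting
      \<open>?g @ ?u\<close> is lifted, which says that \<open>p\<close> followed by the lift of
      \<open>?u\<close> is congruent to the empty walk.\<close>
    have 3: "R y (lift_walk X0 v @ inv_walk ?p) (lift_walk X0 v @ lift_walk ?Z ?u)"
    proof -
      have lu: "qwalk GQ z (lift_walk ?Z ?u) y" using lift_walk_qwalk[OF Z u(1)] eu X by simp
      have ip: "qwalk GQ x (lift_walk X0 v @ inv_walk ?p) y" by (rule GQ.qwalk_append[OF lq GQ.qwalk_inv[OF p]])
      have "R y ((lift_walk X0 v @ inv_walk ?p) @ lift_walk X (?g @ ?u)) ((lift_walk X0 v @ inv_walk ?p) @ lift_walk X [])"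
        using lift_walk_homotopic[OF inv_steps_right[OF g(1)] X(1) refl, of "lift_walk X0 v @ inv_walk ?p"]
          ip X ext_cong[OF X(1) inv_steps_right[OF g(1)]] by simp
      moreover have "lift_walk X (?g @ ?u) = ?p @ lift_walk ?Z ?u"
        using lift_walk_append[OF X(1), of ?g ?u] g u Zg lift_walk_gwalk[OF X(1), of n] by simp
      ultimately have "R y (lift_walk X0 v @ (inv_walk ?p @ ?p) @ lift_walk ?Z ?u) (lift_walk X0 v @ inv_walk ?p)"
        by simp
      moreover have "R y (lift_walk X0 v @ (inv_walk ?p @ ?p) @ lift_walk ?Z ?u) (lift_walk X0 v @ [] @ lift_walk ?Z ?u)"
        by (rule R_cong[OF wc_comp[OF wc_refl[OF lq] wc_comp[OF GQ.walk_cong_inv'[OF p] wc_refl[OF lu]]]])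
      ultimately show ?thesis using R_trans R_sym by (metis append_Nil)
    qed
    show ?thesis
    proof (rule *[OF \<open>?Z \<in> Pc Y\<close> u(1)])
      show "f (Pc (ext ?Z ?u)) = y" using eu X by simp
      show "R y (lift_walk X0 v @ [s]) (lift_walk X0 v @ lift_walk ?Z ?u)"
        using R_trans[OF 1 R_trans[OF 2 3]] Neg by simp
    qed
  qed
qed

text \<open>Vertices are polygons, so the lift of a closed walk returns to the polygon of
  \<open>X0\<close> only, not necessarily to \<open>X0\<close>; every element of that polygon is
  \<open>X0\<close> extended by one tau-step. The equality criterion in the cover turns this into a
  homotopy of \<open>v\<close> with a tau-step.\<close>

lemma closed_walk_in_N:
  assumes w: "qwalk GQ x w x"
  shows "walk_class GQ x w \<in> N"
proof -
  obtain X0 where X0: "X0 \<in> cover_elts E b" "f (Pc X0) = x" using f_surj[OF x] by metis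
  obtain v where v: "is_walk E (tgt X0) v" "f (Pc (ext X0 v)) = x" "R x w (lift_walk X0 v)"
    using walk_lifts[OF X0 w] by blast
  have "Pc (ext X0 v) = Pc X0"
    using v X0 f_inj[of "ext X0 v" X0] by simp
  then have "ext X0 v \<in> Pc X0" using Pc_refl[of "ext X0 v"] X0 v by simp
  then obtain h where h: "h \<in> P (tgt X0)" "ext X0 v = ext X0 [(Tau, h)]" by (auto simp: Pc_def)
  have "homotopic E (tgt X0) (walk_target (tgt X0) v) v [(Tau, h)]"
    using h X0 v ext_eq_iff[OF X0(1) v(1), of "[(Tau, h)]"] by (simp del: is_walk.simps)
  then have "R (f (Pc (ext X0 v))) ([] @ lift_walk X0 v) ([] @ lift_walk X0 [(Tau, h)])"
    by (rule lift_walk_homotopic[OF _ X0(1) refl])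
       (use x X0 in \<open>simp add: pre_digraph.awalk_def double_quiver_def pre_digraph.cas.simps\<close>)
  then have "R x (lift_walk X0 v) []" using v by (simp add: step_walk_def)
  from R_trans[OF v(3) this] show ?thesis
    by (simp add: GQ.walk_rel_def)
qed

end

lemma relators_in_carrier: "x \<in> verts GQ \<Longrightarrow> pi1_relators GQ I x \<subseteq> carrier (quiver_pi1 GQ x)"
proof
  fix W assume x: "x \<in> verts GQ" and "W \<in> pi1_relators GQ I x"
  then obtain \<gamma> u v y z \<rho> where W: "W = walk_class GQ x (\<gamma> @ map Pos v @ inv_walk (map Pos u) @ inv_walk \<gamma>)"
    and g: "qwalk GQ x \<gamma> y" "y \<in> verts GQ" "z \<in> verts GQ" "minimal_relation I y z \<rho>" "u \<in> keys \<rho>" "v \<in> keys \<rho>"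
    unfolding pi1_relators_def by blast
  have "\<rho> \<in> path_span GQ y z" using g(4) GQ.ideal_subset[OF g(2,3)] by (auto simp: minimal_relation_def)
  then have u: "qpath GQ y u z" and v: "qpath GQ y v z" using g(5,6) by (auto simp: path_span_def)
  have "qwalk GQ x (\<gamma> @ map Pos v @ inv_walk (map Pos u) @ inv_walk \<gamma>) x"
    by (rule GQ.qwalk_append[OF g(1) GQ.qwalk_append[OF GQ.qwalk_Pos[OF v]
          GQ.qwalk_append[OF GQ.qwalk_inv[OF GQ.qwalk_Pos[OF u]] GQ.qwalk_inv[OF g(1)]]]])
  then show "W \<in> carrier (quiver_pi1 GQ x)"
    unfolding W by (rule GQ.quiver_pi1_carrierI)
qed

theorem trivial_pi1: "x \<in> verts GQ \<Longrightarrow> trivial_group (pi1 GQ I x)"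
  using closed_walk_in_N relators_in_carrier by (intro GQ.trivial_pi1I)

end

section \<open>Directedness of the Gabriel quiver\<close>

text \<open>The case of the Gabriel quiver in which the radical and its square are both zero: there
  is no arrow.\<close>

lemma dim_quot_trivial:
  fixes V :: "('k::field, 'm) module"
  assumes "vectorspace K V"
  shows "vectorspace.dim K (quot_module (V\<lparr>carrier := {\<zero>\<^bsub>V\<^esub>}\<rparr>) {\<zero>\<^bsub>V\<^esub>}) = 0"
proof -
  interpret vectorspace K V by fact
  let ?W = "quot_module (V\<lparr>carrier := {\<zero>\<^bsub>V\<^esub>}\<rparr>) {\<zero>\<^bsub>V\<^esub>}"
  have c: "carrier ?W = {\<zero>\<^bsub>?W\<^esub>}"
    by (simp add: quot_module_def A_RCOSETS_def' a_r_coset_def')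
  have add: "\<zero>\<^bsub>?W\<^esub> \<oplus>\<^bsub>?W\<^esub> \<zero>\<^bsub>?W\<^esub> = \<zero>\<^bsub>?W\<^esub>"
    by (simp add: quot_module_def set_add_def')
  have smult: "a \<odot>\<^bsub>?W\<^esub> \<zero>\<^bsub>?W\<^esub> = \<zero>\<^bsub>?W\<^esub>" if "a \<in> carrier K" for a
    using that by (simp add: quot_module_def a_r_coset_def')
  interpret W: vectorspace K ?W
    by (rule vs_criteria) (use c add smult in \<open>auto simp: field_axioms\<close>)
  have "W.gen_set {\<zero>\<^bsub>?W\<^esub>}"
    using W.span_is_subset2[of "{\<zero>\<^bsub>?W\<^esub>}"] W.in_own_span[of "{\<zero>\<^bsub>?W\<^esub>}"] c by auto
  then show ?thesis by (rule W.dim0I)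
qed

context bounded_token_cat
begin

text \<open>A nonzero constant term would make the morphism invertible, with inverse
  \<open>v\<close>; then \<open>1 - v u\<close> is 0, which is not invertible, against the
  definition of the radical.\<close>

lemma rad_lookup_Nil:
  assumes xy: "x \<in> verts G" "y \<in> verts G" and f: "f \<in> path_span G x y" and r: "pcoset I x y f \<in> rad C x y"
  shows "lookup f [] = 0"
proof (rule ccontr)
  assume f0: "lookup f [] \<noteq> 0"
  then have "qpath G x [] y" using f by (auto simp: path_span_def in_keys_iff)
  then have "x = y" by (simp add: awalk_Nil_iff)
  then have "iso_mor C x x (pcoset I x x f)"
    using iso_mor_iff[OF xy(1), of f] f f0 by simp
  then obtain v where v: "v \<in> mor C x x" "cmp C x x x v (pcoset I x x f) = idt C x"
    by (auto simp: iso_mor_def simp del: quot_path_category_simps)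
  have "iso_mor C x x (idt C x \<ominus>\<^bsub>Hom C x x\<^esub> cmp C x x x v (pcoset I x x f))"
    using r v(1) \<open>x = y\<close> by (auto simp: rad_def simp del: quot_path_category_simps)
  then have "iso_mor C x x (pcoset I x x 0)"
    using v(2) quot_minus[OF xy(1) xy(1) path_span_one path_span_one] xy by simp
  then show False
    using iso_mor_iff[OF xy(1), of 0] by simp
qed

lemma zero_in_rad:
  assumes xy: "x \<in> verts G" "y \<in> verts G"
  shows "\<zero>\<^bsub>Hom C x y\<^esub> \<in> rad C x y"
proof -
  have "cmp C x y x v (pcoset I x y 0) = pcoset I x x 0" if "v \<in> mor C y x" for v
    using that quot_cmp[OF xy(1,2,1) path_span_zero] by auto
  moreover have "iso_mor C x x (pcoset I x x 1)"
    using iso_mor_iff[OF xy(1) path_span_one[OF xy(1)]] by (simp add: lookup_one_Nil)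
  ultimately show ?thesis
    unfolding quot_zero[OF xy] using quot_minus[OF xy(1) xy(1) path_span_one[OF xy(1)] path_span_zero]
    by (simp add: rad_def)
qed

text \<open>Radical elements have constant term 0, so without nonzero nontrivial paths from
  \<open>x\<close> to \<open>y\<close> the radical vanishes there. Its square vanishes too, as
  constant terms multiply, and the dimension counting the arrows is 0.\<close>

lemma gabriel_arrow_nonzero_path:
  assumes "a \<in> arcs (gabriel_quiver C)"
  shows "\<exists>p. qpath G (tail (gabriel_quiver C) a) p (head (gabriel_quiver C) a) \<and> tok p \<noteq> None \<and> p \<noteq> []"
proof -
  obtain x y i where a: "a = (x, y, i)" by (cases a)
  have xy: "x \<in> verts G" "y \<in> verts G"
    and i: "i < vectorspace.dim class_ring (quot_module ((Hom C x y)\<lparr>carrier := rad C x y\<rparr>) (rad_square C x y))"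
    using assms by (auto simp: a gabriel_quiver_def)
  have "\<exists>p. qpath G x p y \<and> tok p \<noteq> None \<and> p \<noteq> []"
  proof (rule ccontr)
    assume no: "\<not> ?thesis"
    interpret V: vectorspace "class_ring :: 'k ring" "Hom C x y"
      by (rule vectorspace_quot[OF xy])
    have zero: "pcoset I x y f = \<zero>\<^bsub>Hom C x y\<^esub>" if f: "f \<in> path_span G x y" "lookup f [] = 0" for f
    proof -
      have "tok p = None" if "p \<in> keys f" for p
        using f no that by (auto simp: path_span_def in_keys_iff)
      then have "pmap tok f = pmap (\<lambda>_. None) f" by (intro pmap_cong) auto
      then show ?thesis
        using pcoset_zero_iff_tok[OF xy f(1)] by (simp add: pmap_def)
    qed
    have rad: "rad C x y = {\<zero>\<^bsub>Hom C x y\<^esub>}"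
    proof -
      have "u = \<zero>\<^bsub>Hom C x y\<^esub>" if u: "u \<in> rad C x y" for u
      proof -
        obtain f where "f \<in> path_span G x y" "u = pcoset I x y f"
          using u by (auto simp: rad_def)
        then show ?thesis using rad_lookup_Nil[OF xy, of f] u zero[of f] by simp
      qed
      then show ?thesis using zero_in_rad[OF xy] by blast
    qed
    have sq: "rad_square C x y = {\<zero>\<^bsub>Hom C x y\<^esub>}"
    proof -
      let ?S = "{cmp C x z y v u | z u v. z \<in> Ob C \<and> u \<in> rad C x z \<and> v \<in> rad C z y}"
      have "cmp C x z y v u = \<zero>\<^bsub>Hom C x y\<^esub>" if z: "z \<in> verts G" "u \<in> rad C x z" "v \<in> rad C z y" for z u v
      proof -
        obtain f h where fh: "f \<in> path_span G x z" "u = pcoset I x z f" "h \<in> path_span G z y" "v = pcoset I z y h"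
          using z by (auto simp: rad_def)
        then have "lookup (f * h) [] = 0"
          using rad_lookup_Nil[OF xy(1) z(1), of f] z(2) by (simp add: lookup_mult_Nil)
        then show ?thesis
          using zero[OF path_span_mult[OF fh(1,3)]] quot_cmp[OF xy(1) z(1) xy(2) fh(1,3)] fh by simp
      qed
      then have S: "?S \<subseteq> {\<zero>\<^bsub>Hom C x y\<^esub>}" by auto
      have "submodule class_ring {\<zero>\<^bsub>Hom C x y\<^esub>} (Hom C x y)"
        using V.span_is_submodule[of "{}"] V.span_empty by simp
      from V.span_is_subset[OF S this] show ?thesis
        using V.span_zero[of ?S] unfolding rad_square_def by blast
    qed
    show False
      using i dim_quot_trivial[OF V.vectorspace_axioms] unfolding rad sq by simp
  qed
  then show ?thesis by (simp add: a gabriel_quiver_def)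
qed

end

context based_fms_BC_field
begin

lemma gabriel_path_vdeg:
  "qpath (gabriel_quiver Lam_U) x p y \<Longrightarrow> p \<noteq> [] \<Longrightarrow> vdeg x < vdeg y"
proof (induction p arbitrary: x)
  case (Cons a p)
  interpret L: bounded_token_cat U.Q U.tok "fbc_ideal U :: _ \<Rightarrow> _ \<Rightarrow> (_ \<Rightarrow>\<^sub>0 'k) set"
    by (rule U.bounded_token_cat_E[of "cls []"]) (use base in simp)
  let ?G = "gabriel_quiver Lam_U" and ?z = "head (gabriel_quiver Lam_U) a"
  have a: "a \<in> arcs ?G" "tail ?G a = x" "p = [] \<Longrightarrow> ?z = y" "p \<noteq> [] \<Longrightarrow> qpath ?G ?z p y"
    using Cons.prems(1) by (auto simp: pre_digraph.awalk_def pre_digraph.cas.simps gabriel_quiver_def)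
  have "vdeg x < vdeg ?z"
    using L.gabriel_arrow_nonzero_path[of a] a(1,2) vdeg_less unfolding Lambda_def by metis
  then show ?case
    using Cons.IH[of ?z] a(3,4) by fastforce
qed simp

theorem simply_connected_Lam_U:
  assumes "connected_fbc E"
  shows "simply_connected Lam_U"
  unfolding simply_connected_def
proof (intro conjI allI impI ballI)
  show "locally_bounded Lam_U"
    by (rule U.locally_bounded_Lambda[of "cls []"]) (use base in simp)
  show "connected_kcat Lam_U"
    by (rule U.connected_Lambda[OF connected_U, of "cls []"]) (use base in simp)
  show "\<not> (\<exists>x p. p \<noteq> [] \<and> qpath (gabriel_quiver Lam_U) x p x)"
    using gabriel_path_vdeg by blast
  fix I :: "'a steps set lam_ob \<Rightarrow> 'a steps set lam_ob \<Rightarrow>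
      (('a steps set lam_ob \<times> 'a steps set lam_ob \<times> nat) list \<Rightarrow>\<^sub>0 'k) set" and x
  assume I: "admissible_ideal (gabriel_quiver Lam_U) I \<and>
      k_isomorphic Lam_U (quot_kcat (path_category (gabriel_quiver Lam_U)) I)"
    and x: "x \<in> Ob Lam_U"
  then obtain F where "k_isomorphism Lam_U (quot_kcat (path_category (gabriel_quiver Lam_U)) I) F"
    unfolding k_isomorphic_def by blast
  then interpret presentation E b K "gabriel_quiver Lam_U" I F
    by unfold_locales (use I in auto)
  show "trivial_group (pi1 (gabriel_quiver Lam_U) I x)"
    by (rule trivial_pi1) (use x in \<open>simp add: gabriel_quiver_def\<close>)
qed

theorem standard_Lam:
  assumes "connected_fbc E"
  shows "standard TYPE('a steps set lam_ob) TYPE(('k, 'a steps set) lam_mor) Lam"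
  unfolding standard_def
  using locally_bounded_Lambda[OF base] connected_Lambda[OF assms base] simply_connected_Lam_U[OF assms]
    galois_covering_cover_map[OF assms] by blast

end

theorem proposition1p7:
  fixes E :: "'a fbc" and e :: 'a
  assumes "fms_BC E" and "connected_fbc E" and "e \<in> elts E"
  shows "simply_connected
           (Lambda (universal_cover E e) ::
             ('k::field, 'a steps set lam_ob, ('k, 'a steps set) lam_mor) kcat)
         \<and> standard TYPE('a steps set lam_ob) TYPE(('k, 'a steps set) lam_mor)
             (Lambda E :: ('k, 'a lam_ob, ('k, 'a) lam_mor) kcat)"
proof -
  interpret based_fms_BC_field E e "TYPE('k)"
    using assms by (intro based_fms_BC_field.intro based_fms_BC.intro based_fms_BC_axioms.intro)
  show ?thesis
    using simply_connected_Lam_U[OF assms(2)] standard_Lam[OF assms(2)] by simp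
qed

end
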